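(* The property, for a tropical fan, of being div-faithful is $\mathcal T$-stable (in the class of all tropical fans).
   Context: **Fans.** $N$ is a free abelian group of finite rank, $N_{\mathbb R}=N\otimes\mathbb R$. A rational fan $\Sigma$ in $N_{\mathbb R}$ is a non-empty finite collection of strongly convex rational polyhedral cones, closed under taking faces, any two of which meet in a common face; $|\Sigma|$ is its support, $\Sigma_k$ the set of its $k$-dimensional cones, $\underline 0=\{0\}$; facets are maximal cones. For a cone $\sigma$, $N_\sigma=N\cap\mathrm{span}(\sigma)$ and $N^\sigma=N/N_\sigma$. If $\tau$ is a codimension one face of $\sigma$, $\mathfrak n_{\sigma/\tau}\in N_\sigma$ denotes any vector lying on the same side of $\mathrm{span}(\tau)$ as $\sigma$ with $N_\tau+\mathbb Z\,\mathfrak n_{\sigma/\tau}=N_\sigma$, and $e^\tau_\sigma$ is its image in $N^\tau$. The star fan $\Sigma^\sigma$ is the fan in $N^\sigma_{\mathbb R}$ formed by the images $\eta^\sigma$ of the cones $\eta\in\Sigma$ containing $\sigma$. **Tropical fans.** $\mathrm{MW}_p(\Sigma)$ is the group of Minkowski weights: maps $w\colon\Sigma_p\to\mathbb Z$ with $\sum_{\sigma\supset\tau,\,\sigma\in\Sigma_p}w(\sigma)e^\tau_\sigma=0$ in $N^\tau$ for all $\tau\in\Sigma_{p-1}$. A tropical fan $(\Sigma,\omega_\Sigma)$ of dimension $d$ is a rational fan of pure dimension $d$ with an orientation, i.e. an element $\omega_\Sigma\in\mathrm{MW}_d(\Sigma)$ taking only non-zero values. Star fans carry the induced orientation $\omega_{\Sigma^\sigma}(\eta^\sigma)=\omega_\Sigma(\eta)$;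 products carry $\omega(\sigma\times\sigma')=\omega_\Sigma(\sigma)\omega_{\Sigma'}(\sigma')$. Tropical fans are considered up to isomorphism (integral linear isomorphisms of the lattices $N\cap\mathrm{span}|\Sigma|$ matching cones and orientations). **Meromorphic functions, divisors, tropical modifications.** A meromorphic function $f$ on $\Sigma$ is a continuous function $|\Sigma|\to\mathbb R$ whose restriction to each cone $\sigma$ is given by an integral linear form $f_\sigma\in\mathrm{Hom}(N_\sigma,\mathbb Z)$. For $\tau\in\Sigma_{d-1}$, $\mathrm{ord}_\tau(f)=-\sum_{\sigma\supset\tau}\omega_\Sigma(\sigma)f_\sigma(\mathfrak n_{\sigma/\tau})+f_\tau\bigl(\sum_{\sigma\supset\tau}\omega_\Sigma(\sigma)\mathfrak n_{\sigma/\tau}\bigr)$ (sums over $\sigma\in\Sigma_d$), and $\mathrm{div}(f)\in\mathrm{MW}_{d-1}(\Sigma)$ is $\tau\mapsto\mathrm{ord}_\tau(f)$. When not identically zero, $\mathrm{div}(f)$ is identified with the tropical fan $\Delta$ consisting of all $\tau\in\Sigma_{d-1}$ with $\mathrm{ord}_\tau(f)\ne0$ and their faces, oriented by $\mathrm{ord}(f)$; when zero, $\mathrm{div}(f)$ is called trivial and $\Delta=\varnothing$. The tropical modification $\mathrm{TM}_f(\Sigma)$ is the tropical fan in $(N\times\mathbb Z)_{\mathbb R}$ with cones $\sigma_o=\{(x,f(x)):x\in\sigma\}$ for $\sigma\in\Sigma$ and $\delta_\uparrow=\delta_o+\mathbb R_{\ge0}(0,1)$ for $\delta\in\Delta$,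 with orientation $\sigma_o\mapsto\omega_\Sigma(\sigma)$ ($\sigma\in\Sigma_d$), $\delta_\uparrow\mapsto\mathrm{ord}_\delta(f)$ ($\delta\in\Delta_{d-1}$). **Div-faithfulness.** $\Sigma$ is div-faithful at $\eta\in\Sigma$ if every meromorphic function $f$ on the tropical fan $\Sigma^\eta$ with $\mathrm{div}(f)$ trivial is linear on $\Sigma^\eta$, i.e. is the restriction to $|\Sigma^\eta|$ of a linear form on $N^\eta_{\mathbb R}$. $\Sigma$ is div-faithful if it is div-faithful at every $\eta\in\Sigma$. **Blow-ups.** For $\sigma\in\Sigma$ and a rational ray $\rho$ in the relative interior of $\sigma$, the blow-up (stellar subdivision) $\Sigma_{(\rho)}$ is obtained by removing all cones containing $\sigma$ and adding the cones $\tau+\rho$ for $\tau$ a face, not containing $\sigma$, of some $\eta\in\Sigma$ with $\eta\supseteq\sigma$; each facet gets the weight of the facet of $\Sigma$ containing it. $\Sigma$ is then the blow-down of $\Sigma_{(\rho)}$ along $\rho$. **$\mathcal T$-stability.** Let $\mathscr C$ be a class of tropical fans. A subclass $\mathscr S\subseteq\mathscr C$ is $\mathcal T$-stable in $\mathscr C$ if: (i) if $\Sigma,\Sigma'\in\mathscr S$ and $\Sigma\times\Sigma'\in\mathscr C$, then $\Sigma\times\Sigma'\in\mathscr S$; (ii) if $\Sigma\in\mathscr S$, $f$ is meromorphic on $\Sigma$ with $\mathrm{div}(f)$ trivial or in $\mathscr S$, and $\mathrm{TM}_f(\Sigma)\in\mathscr C$, then $\mathrm{TM}_f(\Sigma)\in\mathscr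 S$; (iii) if $\Sigma\in\mathscr C$, $\sigma\in\Sigma$, $\rho$ is a rational ray in the relative interior of $\sigma$, $\Sigma^\sigma\in\mathscr S$ and $\Sigma_{(\rho)}\in\mathscr C$, then $\Sigma\in\mathscr S\Leftrightarrow\Sigma_{(\rho)}\in\mathscr S$. A property is $\mathcal T$-stable in $\mathscr C$ if the subclass of elements of $\mathscr C$ having it is; "$\mathcal T$-stable" alone means in the class of all tropical fans. *)

theory Defs
  imports "HOL-Analysis.Analysis" "HOL-Analysis.Finite_Function_Topology"
begin

section \<open>Rational fans\<close>

text \<open>
  A free abelian group of finite rank is realised as the integer span \<open>N\<close> of a finite linearly
  independent subset of some real vector space, so that \<open>N\<^sub>\<real> = span N\<close>; the ambient space may be
  larger than \<open>span N\<close>.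
\<close>

definition is_lattice :: "'a::real_vector set \<Rightarrow> bool" where
  "is_lattice N \<longleftrightarrow> (\<exists>B. finite B \<and> independent B \<and>
     N = range (\<lambda>c :: 'a \<Rightarrow> int. \<Sum>b\<in>B. of_int (c b) *\<^sub>R b))"

definition rational_cone :: "'a::real_vector set \<Rightarrow> 'a set \<Rightarrow> bool" where
  "rational_cone N \<sigma> \<longleftrightarrow> (\<exists>F. finite F \<and> F \<subseteq> N \<and> \<sigma> = convex_cone hull F) \<and>
     (\<forall>x\<in>\<sigma>. - x \<in> \<sigma> \<longrightarrow> x = 0)"

text \<open>The library's \<^term>\<open>(face_of)\<close> admits the empty face, which is not a face of a cone.\<close>

definition cone_face :: "'a::real_vector set \<Rightarrow> 'a set \<Rightarrow> bool" where
  "cone_face \<tau> \<sigma> \<longleftrightarrow> \<tau> face_of \<sigma> \<and> \<tau> \<noteq> {}"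

definition rational_fan :: "'a::real_vector set \<Rightarrow> 'a set set \<Rightarrow> bool" where
  "rational_fan N \<Sigma> \<longleftrightarrow> is_lattice N \<and> finite \<Sigma> \<and> \<Sigma> \<noteq> {} \<and>
     (\<forall>\<sigma>\<in>\<Sigma>. rational_cone N \<sigma>) \<and>
     (\<forall>\<sigma>\<in>\<Sigma>. \<forall>\<tau>. cone_face \<tau> \<sigma> \<longrightarrow> \<tau> \<in> \<Sigma>) \<and>
     (\<forall>\<sigma>\<in>\<Sigma>. \<forall>\<tau>\<in>\<Sigma>. cone_face (\<sigma> \<inter> \<tau>) \<sigma> \<and> cone_face (\<sigma> \<inter> \<tau>) \<tau>)"

text \<open>
  \<open>\<sigma> + span \<tau>\<close> is the closed half-space of \<open>span \<sigma>\<close> bounded by \<open>span \<tau>\<close> and containing \<open>\<sigma>\<close>; the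
  generation condition keeps \<open>v\<close> off \<open>span \<tau>\<close>.
\<close>

definition is_normal_vec :: "'a::real_vector set \<Rightarrow> 'a set \<Rightarrow> 'a set \<Rightarrow> 'a \<Rightarrow> bool" where
  "is_normal_vec N \<sigma> \<tau> v \<longleftrightarrow> v \<in> N \<inter> span \<sigma> \<and>
     (\<exists>x\<in>\<sigma>. \<exists>y\<in>span \<tau>. v = x + y) \<and>
     {u + of_int k *\<^sub>R v | u k. u \<in> N \<inter> span \<tau>} = N \<inter> span \<sigma>"

definition normal_vec :: "'a::real_vector set \<Rightarrow> 'a set \<Rightarrow> 'a set \<Rightarrow> 'a" where
  "normal_vec N \<sigma> \<tau> = (SOME v. is_normal_vec N \<sigma> \<tau> v)"

definition k_cones :: "'a::real_vector set set \<Rightarrow> nat \<Rightarrow> 'a set set" where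
  "k_cones \<Sigma> k = {\<sigma> \<in> \<Sigma>. dim \<sigma> = k}"

text \<open>
  Weights are total functions on sets; only the values on \<open>k_cones \<Sigma> p\<close> matter.
  A sum of classes \<open>e\<^sup>\<tau>\<^sub>\<sigma>\<close> vanishes in \<open>N/N\<^sub>\<tau>\<close> iff the sum of representatives lies in \<open>N\<^sub>\<tau>\<close>.
\<close>

definition minkowski_weights :: "'a::real_vector set \<Rightarrow> 'a set set \<Rightarrow> nat \<Rightarrow> ('a set \<Rightarrow> int) set" where
  "minkowski_weights N \<Sigma> p = {w. \<forall>\<tau>\<in>\<Sigma>. dim \<tau> + 1 = p \<longrightarrow>
     (\<Sum>\<sigma>\<in>{\<sigma> \<in> k_cones \<Sigma> p. \<tau> \<subseteq> \<sigma>}. of_int (w \<sigma>) *\<^sub>R normal_vec N \<sigma> \<tau>) \<in> N \<inter> span \<tau>}"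


section \<open>Tropical fans\<close>

record 'a tfan =
  tf_lattice :: "'a set"
  tf_cones :: "'a set set"
  tf_orient :: "'a set \<Rightarrow> int"

definition support :: "'a tfan \<Rightarrow> 'a set" where
  "support X = \<Union> (tf_cones X)"

definition facets :: "'a tfan \<Rightarrow> 'a set set" where
  "facets X = {\<sigma> \<in> tf_cones X. \<forall>\<tau>\<in>tf_cones X. \<sigma> \<subseteq> \<tau> \<longrightarrow> \<tau> = \<sigma>}"

definition fan_dim :: "'a::real_vector tfan \<Rightarrow> nat" where
  "fan_dim X = Max (dim ` tf_cones X)"

definition tropical_fan :: "'a::real_vector tfan \<Rightarrow> bool" where
  "tropical_fan X \<longleftrightarrow> rational_fan (tf_lattice X) (tf_cones X) \<and>
     (\<forall>\<sigma>\<in>facets X. dim \<sigma> = fan_dim X) \<and>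
     tf_orient X \<in> minkowski_weights (tf_lattice X) (tf_cones X) (fan_dim X) \<and>
     (\<forall>\<sigma>\<in>facets X. tf_orient X \<sigma> \<noteq> 0)"

text \<open>
  A linear isomorphism of \<open>span |\<Sigma>|\<close> is given here as the restriction of a linear map between the
  ambient spaces; every linear map on a subspace has such an extension.
\<close>

definition tfan_iso :: "'a::real_vector tfan \<Rightarrow> 'b::real_vector tfan \<Rightarrow> bool" (infix "\<cong>\<^sub>T" 50) where
  "X \<cong>\<^sub>T Y \<longleftrightarrow> (\<exists>\<phi>. linear \<phi> \<and>
     bij_betw \<phi> (tf_lattice X \<inter> span (support X)) (tf_lattice Y \<inter> span (support Y)) \<and>
     (\<lambda>\<sigma>. \<phi> ` \<sigma>) ` tf_cones X = tf_cones Y \<and>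
     (\<forall>\<sigma>\<in>facets X. tf_orient Y (\<phi> ` \<sigma>) = tf_orient X \<sigma>))"

text \<open>
  The quotient by a subspace \<open>W\<close> is realised inside the same ambient space, through a linear map
  with kernel \<open>W\<close>. Any two choices have canonically isomorphic images, so the image of \<open>N\<close> under
  \<open>quot_map (span \<sigma>)\<close> is a model of \<open>N/N\<^sub>\<sigma>\<close>, with realification \<open>N\<^sub>\<real>/span \<sigma>\<close>.
\<close>

definition quot_map :: "'a::real_vector set \<Rightarrow> 'a \<Rightarrow> 'a" where
  "quot_map W = (SOME \<pi>. linear \<pi> \<and> {x. \<pi> x = 0} = W)"

definition star_fan :: "'a::real_vector tfan \<Rightarrow> 'a set \<Rightarrow> 'a tfan" where
  "star_fan X \<sigma> = (let \<pi> = quot_map (span \<sigma>) in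
     \<lparr> tf_lattice = \<pi> ` tf_lattice X,
       tf_cones = {\<pi> ` \<eta> | \<eta>. \<eta> \<in> tf_cones X \<and> \<sigma> \<subseteq> \<eta>},
       tf_orient = (\<lambda>\<kappa>. tf_orient X (THE \<eta>. \<eta> \<in> tf_cones X \<and> \<sigma> \<subseteq> \<eta> \<and> \<pi> ` \<eta> = \<kappa>)) \<rparr>)"

text \<open>Factors are recovered from a product of (non-empty) cones by projection.\<close>

definition prod_fan :: "'a tfan \<Rightarrow> 'b tfan \<Rightarrow> ('a \<times> 'b) tfan" where
  "prod_fan X Y =
     \<lparr> tf_lattice = tf_lattice X \<times> tf_lattice Y,
       tf_cones = {\<sigma> \<times> \<sigma>' | \<sigma> \<sigma>'. \<sigma> \<in> tf_cones X \<and> \<sigma>' \<in> tf_cones Y},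
       tf_orient = (\<lambda>\<kappa>. tf_orient X (fst ` \<kappa>) * tf_orient Y (snd ` \<kappa>)) \<rparr>"


section \<open>Meromorphic functions, divisors, tropical modifications\<close>

text \<open>Functions on \<open>|\<Sigma>|\<close> are total functions of which only the restriction to \<open>|\<Sigma>|\<close> matters.\<close>

definition meromorphic :: "'a::real_normed_vector tfan \<Rightarrow> ('a \<Rightarrow> real) \<Rightarrow> bool" where
  "meromorphic X f \<longleftrightarrow> continuous_on (support X) f \<and>
     (\<forall>\<sigma>\<in>tf_cones X. \<exists>l. linear l \<and> l ` (tf_lattice X \<inter> span \<sigma>) \<subseteq> \<int> \<and> (\<forall>x\<in>\<sigma>. f x = l x))"

text \<open>The linear form \<open>f\<^sub>\<sigma>\<close>; its values are determined on \<open>span \<sigma>\<close>, and only used there.\<close>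

definition cone_form :: "('a::real_vector \<Rightarrow> real) \<Rightarrow> 'a set \<Rightarrow> 'a \<Rightarrow> real" where
  "cone_form f \<sigma> = (SOME l. linear l \<and> (\<forall>x\<in>\<sigma>. f x = l x))"

text \<open>The real number under the floor is an integer when \<open>f\<close> is meromorphic.\<close>

definition ord_at :: "'a::real_vector tfan \<Rightarrow> ('a \<Rightarrow> real) \<Rightarrow> 'a set \<Rightarrow> int" where
  "ord_at X f \<tau> =
     (let S = {\<sigma> \<in> k_cones (tf_cones X) (fan_dim X). \<tau> \<subseteq> \<sigma>};
          n = (\<lambda>\<sigma>. normal_vec (tf_lattice X) \<sigma> \<tau>);
          \<omega> = tf_orient X
      in \<lfloor>- (\<Sum>\<sigma>\<in>S. of_int (\<omega> \<sigma>) * cone_form f \<sigma> (n \<sigma>))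
          + cone_form f \<tau> (\<Sum>\<sigma>\<in>S. of_int (\<omega> \<sigma>) *\<^sub>R n \<sigma>)\<rfloor>)"

definition div_trivial :: "'a::real_vector tfan \<Rightarrow> ('a \<Rightarrow> real) \<Rightarrow> bool" where
  "div_trivial X f \<longleftrightarrow> (\<forall>\<tau>\<in>tf_cones X. dim \<tau> + 1 = fan_dim X \<longrightarrow> ord_at X f \<tau> = 0)"

definition div_cones :: "'a::real_vector tfan \<Rightarrow> ('a \<Rightarrow> real) \<Rightarrow> 'a set set" where
  "div_cones X f = {\<delta>. \<exists>\<tau>\<in>tf_cones X. dim \<tau> + 1 = fan_dim X \<and> ord_at X f \<tau> \<noteq> 0 \<and> cone_face \<delta> \<tau>}"

definition div_fan :: "'a::real_vector tfan \<Rightarrow> ('a \<Rightarrow> real) \<Rightarrow> 'a tfan" where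
  "div_fan X f =
     \<lparr> tf_lattice = tf_lattice X, tf_cones = div_cones X f, tf_orient = ord_at X f \<rparr>"

definition graph_cone :: "('a \<Rightarrow> real) \<Rightarrow> 'a set \<Rightarrow> ('a \<times> real) set" where
  "graph_cone f \<sigma> = (\<lambda>x. (x, f x)) ` \<sigma>"

definition up_cone :: "('a \<Rightarrow> real) \<Rightarrow> 'a set \<Rightarrow> ('a \<times> real) set" where
  "up_cone f \<delta> = {(x, f x + t) | x t. x \<in> \<delta> \<and> t \<ge> 0}"

text \<open>The first projection maps both \<open>\<sigma>\<^sub>o\<close> to \<open>\<sigma>\<close> and \<open>\<delta>\<^sub>\<up>\<close> to \<open>\<delta>\<close>.\<close>

definition trop_mod :: "'a::real_vector tfan \<Rightarrow> ('a \<Rightarrow> real) \<Rightarrow> ('a \<times> real) tfan" where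
  "trop_mod X f =
     \<lparr> tf_lattice = tf_lattice X \<times> \<int>,
       tf_cones = graph_cone f ` tf_cones X \<union> up_cone f ` div_cones X f,
       tf_orient = (\<lambda>\<kappa>. if \<kappa> \<in> up_cone f ` div_cones X f then ord_at X f (fst ` \<kappa>)
                        else tf_orient X (fst ` \<kappa>)) \<rparr>"


section \<open>Div-faithfulness\<close>

definition linear_on_fan :: "'a::real_vector tfan \<Rightarrow> ('a \<Rightarrow> real) \<Rightarrow> bool" where
  "linear_on_fan X f \<longleftrightarrow> (\<exists>l. linear l \<and> (\<forall>x\<in>support X. f x = l x))"

definition div_faithful_at :: "'a::real_normed_vector tfan \<Rightarrow> 'a set \<Rightarrow> bool" where
  "div_faithful_at X \<eta> \<longleftrightarrow>
     (\<forall>f. meromorphic (star_fan X \<eta>) f \<and> div_trivial (star_fan X \<eta>) f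
        \<longrightarrow> linear_on_fan (star_fan X \<eta>) f)"

definition div_faithful :: "'a::real_normed_vector tfan \<Rightarrow> bool" where
  "div_faithful X \<longleftrightarrow> (\<forall>\<eta>\<in>tf_cones X. div_faithful_at X \<eta>)"


section \<open>Blow-ups\<close>

definition rational_ray_in :: "'a::real_normed_vector set \<Rightarrow> 'a set \<Rightarrow> 'a set \<Rightarrow> bool" where
  "rational_ray_in N \<sigma> \<rho> \<longleftrightarrow>
     (\<exists>v\<in>N. v \<noteq> 0 \<and> v \<in> rel_interior \<sigma> \<and> \<rho> = {t *\<^sub>R v | t. t \<ge> 0})"

definition blow_up :: "'a::real_vector tfan \<Rightarrow> 'a set \<Rightarrow> 'a set \<Rightarrow> 'a tfan" where
  "blow_up X \<sigma> \<rho> =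
     \<lparr> tf_lattice = tf_lattice X,
       tf_cones = {\<eta> \<in> tf_cones X. \<not> \<sigma> \<subseteq> \<eta>} \<union>
         {{x + y | x y. x \<in> \<tau> \<and> y \<in> \<rho>} | \<tau>.
            \<exists>\<eta>\<in>tf_cones X. \<sigma> \<subseteq> \<eta> \<and> cone_face \<tau> \<eta> \<and> \<not> \<sigma> \<subseteq> \<tau>},
       tf_orient = (\<lambda>\<kappa>. tf_orient X (THE \<eta>. \<eta> \<in> facets X \<and> \<kappa> \<subseteq> \<eta>)) \<rparr>"


section \<open>Tropical stability\<close>

text \<open>
  Every tropical fan, in whatever ambient space, is isomorphic to one in the space of finitely
  supported real sequences. A class of tropical fans up to isomorphism is therefore an
  isomorphism-closed set of tropical fans in that space, and membership of a fan living in another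
  ambient space (such as a product) means that it is a tropical fan with an isomorphic copy in the class.
\<close>

type_synonym ambient = "nat \<Rightarrow>\<^sub>0 real"

definition tfan_class :: "ambient tfan set \<Rightarrow> bool" where
  "tfan_class C \<longleftrightarrow> (\<forall>X\<in>C. tropical_fan X) \<and>
     (\<forall>X\<in>C. \<forall>Y :: ambient tfan. tropical_fan Y \<and> X \<cong>\<^sub>T Y \<longrightarrow> Y \<in> C)"

definition in_class :: "'b::real_vector tfan \<Rightarrow> ambient tfan set \<Rightarrow> bool" (infix "\<in>\<^sub>T" 50) where
  "X \<in>\<^sub>T C \<longleftrightarrow> tropical_fan X \<and> (\<exists>Y\<in>C. Y \<cong>\<^sub>T X)"

definition T_stable :: "ambient tfan set \<Rightarrow> ambient tfan set \<Rightarrow> bool" where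
  "T_stable C S \<longleftrightarrow> tfan_class C \<and> tfan_class S \<and> S \<subseteq> C \<and>
     (\<forall>X\<in>S. \<forall>Y\<in>S. prod_fan X Y \<in>\<^sub>T C \<longrightarrow> prod_fan X Y \<in>\<^sub>T S) \<and>
     (\<forall>X\<in>S. \<forall>f. meromorphic X f \<and> (div_trivial X f \<or> div_fan X f \<in>\<^sub>T S) \<and> trop_mod X f \<in>\<^sub>T C
        \<longrightarrow> trop_mod X f \<in>\<^sub>T S) \<and>
     (\<forall>X\<in>C. \<forall>\<sigma>\<in>tf_cones X. \<forall>\<rho>. rational_ray_in (tf_lattice X) \<sigma> \<rho> \<and>
        star_fan X \<sigma> \<in>\<^sub>T S \<and> blow_up X \<sigma> \<rho> \<in>\<^sub>T C
        \<longrightarrow> (X \<in>\<^sub>T S \<longleftrightarrow> blow_up X \<sigma> \<rho> \<in>\<^sub>T S))"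

definition T_stable_property_in :: "ambient tfan set \<Rightarrow> (ambient tfan \<Rightarrow> bool) \<Rightarrow> bool" where
  "T_stable_property_in C P \<longleftrightarrow> T_stable C {X \<in> C. P X}"

definition T_stable_property :: "(ambient tfan \<Rightarrow> bool) \<Rightarrow> bool" where
  "T_stable_property P \<longleftrightarrow> T_stable_property_in {X. tropical_fan X} P"

end

theory Submission
  imports Defs
begin

text \<open>
  Div-faithfulness is a local condition along the support: it holds iff at every point \<open>p\<close> of
  \<open>|\<Sigma>|\<close>, a function that is integral linear on each cone through \<open>p\<close> and balanced at each wall
  through \<open>p\<close> is given by one linear form on all of these cones. This is stated without quotients.

  For a product, \<open>f (x, y) = f (x, 0) + f (0, y)\<close> follows by working in one factor at a time.
  On a modification of \<open>\<Sigma>\<close> along \<open>f\<close>, all upper cones through a point share the vertical ray there,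
  so a balanced function has one vertical slope on them; after subtracting the slope times the height
  it descends to a balanced function on \<open>\<Sigma>\<close>. Off the graph of \<open>f\<close> the modification is locally a
  product of the divisor with a line.

  For subdivisions, a function that is balanced on the finer fan is given by the same form on both sides
  of any wall interior to a coarse facet, so crossing these walls along a generic segment shows that
  its derivative at \<open>p\<close> is a balanced function on the coarse cones through \<open>p\<close>. Hence the local
  condition depends on the support and the weights only.
\<close>

section \<open>Linear algebra\<close>

text \<open>Points replace cones because they survive the operations: a modification or a
  subdivision has cones that do not match those of the given fan, but a point of the support selects
  the cones through it in both. A point in general position in \<open>\<eta>\<close> selects exactly
  the star of \<open>\<eta>\<close>. To pass from these cones to the quotient, a function must first
  be made to vanish on \<open>\<eta>\<close>, and it must stay integral: this needs an integral form
  on \<open>\<eta>\<close> to extend to the whole lattice, hence the lattice generators built below.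
  Orders are defined through chosen normal vectors, chosen forms and a floor, so balancing is
  restated for all choices at once. The fine cones through \<open>p\<close> fill the coarse ones
  only near \<open>p\<close>; the derivative at \<open>p\<close> is what extends a function from the
  former to the latter. The ambient space may have infinite dimension, so dimension counts,
  closedness of cones and continuity of forms are all argued inside the span of a finite
  set.\<close>

lemma finite_basis_of:
  fixes V :: "'a::real_vector set"
  assumes "finite F" "V \<subseteq> span F"
  obtains B where "B \<subseteq> V" "independent B" "finite B" "span B = span V" "card B = dim V"
proof -
  obtain B where B: "B \<subseteq> V" "independent B" "V \<subseteq> span B" "card B = dim V"
    using basis_exists by blast
  have "finite B"
    using independent_span_bound[OF assms(1) B(2)] B(1) assms(2) by blast
  moreover have "span B = span V"
    using B by (metis span_mono span_span subset_antisym)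
  ultimately show ?thesis using that B by blast
qed

text \<open>For a set of infinite dimension \<open>dim\<close> is a mere default value, so it is
  monotone only inside a finitely spanned space; \<open>F\<close> provides one.\<close>

lemma dim_le_finite_span:
  fixes S :: "'a::real_vector set"
  assumes "finite F" "T \<subseteq> span F" "S \<subseteq> span T"
  shows "dim S \<le> dim T"
proof -
  obtain B where B: "finite B" "span B = span T" "card B = dim T"
    using finite_basis_of[OF assms(1,2)] by metis
  then show ?thesis using assms(3) dim_le_card[of S B] by simp
qed

lemma dim_insert_notin:
  fixes S :: "'a::real_vector set"
  assumes "finite F" "S \<subseteq> span F" "v \<notin> span S"
  shows "dim (insert v S) = dim S + 1"
proof -
  obtain B where B: "B \<subseteq> S" "independent B" "finite B" "span B = span S" "card B = dim S"
    using finite_basis_of[OF assms(1,2)] by metis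
  have "v \<notin> span B" using B assms by simp
  then have "independent (insert v B)" "v \<notin> B"
    using B(2) independent_insertI span_base by auto
  moreover have "span (insert v S) = span (insert v B)"
    using B(4) by (simp add: span_insert)
  ultimately show ?thesis
    using B dim_eq_card[of "insert v B" "insert v S"] by simp
qed

lemma span_eq_if_dim_le:
  fixes S :: "'a::real_vector set"
  assumes "finite F" "T \<subseteq> span F" "S \<subseteq> span T" "dim T \<le> dim S"
  shows "span S = span T"
proof (rule ccontr)
  assume "span S \<noteq> span T"
  then obtain v where v: "v \<in> T" "v \<notin> span S"
    by (metis assms(3) span_eq subsetI)
  have "S \<subseteq> span F" using assms(2,3) span_mono span_span by (metis subset_trans)
  then have "dim (insert v S) = dim S + 1" using dim_insert_notin assms(1) v by blast
  moreover have "dim (insert v S) \<le> dim T"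
    using dim_le_finite_span[OF assms(1,2), of "insert v S"] assms(3) v span_base by auto
  ultimately show False using assms(4) by simp
qed

text \<open>A linear section \<open>s\<close> of \<open>\<pi>\<close> over its range gives the
  factor as \<open>m\<close> after \<open>s\<close>; the choice of \<open>s\<close> only moves
  arguments inside the kernel, where \<open>m\<close> vanishes. This is how forms descend to a
  quotient.\<close>

lemma linear_factor_kernel:
  fixes \<pi> :: "'a::real_vector \<Rightarrow> 'b::real_vector" and m :: "'a \<Rightarrow> 'c::real_vector"
  assumes "linear \<pi>" "linear m" "\<And>x. \<pi> x = 0 \<Longrightarrow> m x = 0"
  obtains l where "linear l" "\<And>x. l (\<pi> x) = m x"
proof -
  obtain s where s: "linear s" "\<forall>y\<in>\<pi> ` UNIV. \<pi> (s y) = y"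
    using linear_exists_right_inverse_on[OF assms(1), of UNIV] by auto
  have "m (s (\<pi> x)) = m x" for x
  proof -
    have "\<pi> (s (\<pi> x) - x) = 0" using s assms(1) by (simp add: linear_diff)
    then have "m (s (\<pi> x) - x) = 0" using assms(3) by blast
    then show ?thesis using assms(2) by (simp add: linear_diff)
  qed
  moreover have "linear (\<lambda>y. m (s y))"
    using linear_compose[OF s(1) assms(2)] by (simp add: o_def)
  ultimately show ?thesis using that by blast
qed

lemma linear_cmult: "linear h \<Longrightarrow> linear (\<lambda>x. c * h x :: real)"
  by (rule linearI) (simp_all add: linear_add linear_scale algebra_simps)

text \<open>Extending a basis of \<open>span S\<close> by \<open>u\<close> makes \<open>u\<close> a
  basis vector, and \<open>c\<close> is its coordinate functional. It reads off the position of a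
  vector modulo \<open>span S\<close>.\<close>

lemma linear_coordinate:
  fixes u :: "'a::real_vector"
  assumes "u \<notin> span S"
  obtains c :: "'a \<Rightarrow> real" where "linear c" "\<And>x. x \<in> span S \<Longrightarrow> c x = 0" "c u = 1"
proof -
  obtain B where B: "B \<subseteq> S" "independent B" "S \<subseteq> span B"
    by (meson maximal_independent_subset)
  have sp: "span B = span S" using B by (metis span_mono span_span subset_antisym)
  have ind: "independent (insert u B)" using assms sp B independent_insertI by blast
  obtain c where c: "linear c" "\<forall>x\<in>insert u B. c x = (if x = u then 1 else 0 :: real)"
    using linear_independent_extend[OF ind, of "\<lambda>x. if x = u then 1 else 0 :: real"] by auto
  have "c x = 0" if "x \<in> span S" for x
  proof -
    have "\<And>b. b \<in> B \<Longrightarrow> c b = 0" using c assms sp span_base by fastforce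
    then show ?thesis using linear_eq_0_on_span[OF c(1), of B x] that sp by blast
  qed
  then show ?thesis using that c by auto
qed

text \<open>The identity minus a projection onto \<open>span W\<close> has exactly this kernel. It
  justifies the choice made in \<open>quot_map\<close>, also in infinite dimension.\<close>

lemma quot_map_ex: "\<exists>\<pi> :: 'a::real_vector \<Rightarrow> 'a. linear \<pi> \<and> {x. \<pi> x = 0} = span W"
proof -
  obtain B where B: "B \<subseteq> W" "independent B" "W \<subseteq> span B"
    by (meson maximal_independent_subset)
  have sp: "span B = span W" using B by (metis span_mono span_span subset_antisym)
  obtain p :: "'a \<Rightarrow> 'a" where p: "linear p" "\<forall>x\<in>span B. p x = x" "range p \<subseteq> span B"
    using linear_independent_extend_subspace[OF B(2), of "\<lambda>x. x"] linear_eq_on[OF _ linear_ident]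
    by (metis image_ident order_refl)
  have "x - p x = 0 \<longleftrightarrow> x \<in> span W" for x
    using p sp by auto
  then show ?thesis
    using linear_compose_sub[OF linear_ident p(1)] by blast
qed

text \<open>Finitely many subspaces cover a convex cone only if one of them contains it. If
  \<open>x\<close> avoids all earlier subspaces but lies in \<open>W\<close>, and \<open>y\<close>
  in the cone is outside \<open>W\<close>, then \<open>x + t *\<^sub>R y\<close> with
  \<open>t > 0\<close> leaves \<open>W\<close> and meets each earlier subspace for at most one
  \<open>t\<close>.\<close>

lemma generic_point:
  fixes C :: "'a::real_vector set"
  assumes "convex_cone C" "finite \<W>" "\<And>W. W \<in> \<W> \<Longrightarrow> subspace W" "\<And>W. W \<in> \<W> \<Longrightarrow> \<not> C \<subseteq> W"
  obtains x where "x \<in> C" "\<And>W. W \<in> \<W> \<Longrightarrow> x \<notin> W"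
proof -
  have "\<exists>x\<in>C. \<forall>W\<in>\<W>. x \<notin> W" using assms(2-4)
  proof (induction \<W> rule: finite_induct)
    case empty
    then show ?case using convex_cone_nonempty[OF assms(1)] by auto
  next
    case (insert W \<W>)
    from insert.IH insert.prems obtain x where x: "x \<in> C" "\<forall>W\<in>\<W>. x \<notin> W" by blast
    obtain y where y: "y \<in> C" "y \<notin> W" using insert.prems(2)[of W] by auto
    show ?case
    proof (cases "x \<in> W")
      case False
      then show ?thesis using x by blast
    next
      case True
      have fin: "finite (\<Union>V\<in>\<W>. {t::real. x + t *\<^sub>R y \<in> V})"
      proof (rule finite_UN_I[OF insert(1)])
        fix V assume V: "V \<in> \<W>"
        then have sV: "subspace V" and xV: "x \<notin> V" using insert.prems(1) x by simp_all
        have "t = s" if that: "x + t *\<^sub>R y \<in> V" "x + s *\<^sub>R y \<in> V" for t s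
        proof (rule ccontr)
          assume ne: "t \<noteq> s"
          have "(t - s) *\<^sub>R y \<in> V" using subspace_diff[OF sV that] by (simp add: algebra_simps)
          then have "(1 / (t - s)) *\<^sub>R ((t - s) *\<^sub>R y) \<in> V" using subspace_scale[OF sV] by blast
          then have "y \<in> V" using ne by simp
          then have "t *\<^sub>R y \<in> V" by (rule subspace_scale[OF sV])
          then show False using subspace_diff[OF sV that(1), of "t *\<^sub>R y"] xV by simp
        qed
        then have uniq: "t = s" if "t \<in> {t. x + t *\<^sub>R y \<in> V}" "s \<in> {t. x + t *\<^sub>R y \<in> V}" for t s
          using that by blast
        show "finite {t. x + t *\<^sub>R y \<in> V}"
        proof (cases "{t. x + t *\<^sub>R y \<in> V} = {}")
          case False
          then obtain s where "s \<in> {t. x + t *\<^sub>R y \<in> V}" by blast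
          then have "{t. x + t *\<^sub>R y \<in> V} \<subseteq> {s}" using uniq by blast
          then show ?thesis by (rule finite_subset) simp
        qed (simp only: finite.emptyI)
      qed
      have "infinite {0<..<(1::real)}" by simp
      then have "\<not> {0<..<(1::real)} \<subseteq> (\<Union>V\<in>\<W>. {t::real. x + t *\<^sub>R y \<in> V})"
        using finite_subset[OF _ fin] by blast
      then obtain t where t: "t > 0" "t \<notin> (\<Union>V\<in>\<W>. {t::real. x + t *\<^sub>R y \<in> V})"
        unfolding subset_iff greaterThanLessThan_iff by blast
      have "x + t *\<^sub>R y \<in> C" using x y t assms(1) by (simp add: convex_cone_add convex_cone_scaleR)
      moreover have "x + t *\<^sub>R y \<notin> W"
      proof
        assume "x + t *\<^sub>R y \<in> W"
        then have "t *\<^sub>R y \<in> W" using insert.prems(1)[of W] True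
          by (metis add_diff_cancel_left' insertI1 subspace_diff)
        then have "(1/t) *\<^sub>R (t *\<^sub>R y) \<in> W" using insert.prems(1)[of W] subspace_scale by blast
        then show False using y t by simp
      qed
      ultimately show ?thesis using t by blast
    qed
  qed
  then show ?thesis using that by blast
qed

section \<open>Cones and their faces\<close>

lemma cone_face_subset: "cone_face \<tau> \<sigma> \<Longrightarrow> \<tau> \<subseteq> \<sigma>"
  by (simp add: cone_face_def face_of_def)

text \<open>A nonzero point \<open>t\<close> of the face lies strictly between \<open>0\<close> and
  any multiple \<open>c *\<^sub>R t\<close> with \<open>c > 1\<close>, so extremality puts both ends
  into the face; convexity then supplies the smaller multiples.\<close>

lemma cone_face_convex_cone:
  assumes "convex_cone \<sigma>" "cone_face \<tau> \<sigma>"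
  shows "convex_cone \<tau>"
proof -
  have f: "\<tau> \<subseteq> \<sigma>" "convex \<tau>" "\<tau> \<noteq> {}"
    and seg: "\<And>a b x. \<lbrakk>a\<in>\<sigma>; b\<in>\<sigma>; x\<in>\<tau>; x \<in> open_segment a b\<rbrakk> \<Longrightarrow> a \<in> \<tau> \<and> b \<in> \<tau>"
    using assms(2) unfolding cone_face_def face_of_def by blast+
  have sc: "0 \<in> \<tau> \<and> c *\<^sub>R t \<in> \<tau>" if "t \<in> \<tau>" "c > 1" for t and c :: real
  proof (cases "t = 0")
    case False
    have "t = (1 - 1/c) *\<^sub>R 0 + (1/c) *\<^sub>R (c *\<^sub>R t)" using that by simp
    then have "t \<in> open_segment 0 (c *\<^sub>R t)"
      unfolding in_segment using that False by (intro conjI exI[of _ "1/c"]) auto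
    then show ?thesis
      using seg[of 0 "c *\<^sub>R t" t] that f(1) assms(1) convex_cone_contains_0 convex_cone_scaleR[of \<sigma> c t]
      by auto
  qed (use that in auto)
  obtain t0 where "t0 \<in> \<tau>" using f by blast
  then have 0: "0 \<in> \<tau>" using sc[of t0 2] by simp
  have sc': "c *\<^sub>R t \<in> \<tau>" if "t \<in> \<tau>" "c \<ge> 0" for t and c :: real
  proof (cases "c > 1")
    case False
    then show ?thesis using convexD_alt[OF f(2) 0 that(1), of c] that by simp
  qed (use sc that in blast)
  show ?thesis
    unfolding convex_cone_def conic_def using f sc' by auto
qed

text \<open>The sum \<open>x + y\<close> is the midpoint of \<open>2 *\<^sub>R x\<close> and
  \<open>2 *\<^sub>R y\<close>, which turns the segment condition of \<open>face_of\<close> into an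
  additive one. For \<open>x = y\<close> the open segment is empty and halving is used
  instead.\<close>

lemma cone_faceD:
  assumes "convex_cone \<sigma>" "cone_face \<tau> \<sigma>" "x \<in> \<sigma>" "y \<in> \<sigma>" "x + y \<in> \<tau>"
  shows "x \<in> \<tau>"
proof -
  have c: "convex_cone \<tau>" by (rule cone_face_convex_cone[OF assms(1,2)])
  have seg: "\<And>a b x. \<lbrakk>a\<in>\<sigma>; b\<in>\<sigma>; x\<in>\<tau>; x \<in> open_segment a b\<rbrakk> \<Longrightarrow> a \<in> \<tau> \<and> b \<in> \<tau>"
    using assms(2) unfolding cone_face_def face_of_def by blast
  have half: "z \<in> \<tau>" if "2 *\<^sub>R z \<in> \<tau>" for z
    using convex_cone_scaleR[OF c, of "1/2", OF _ that] by simp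
  show ?thesis
  proof (cases "x = y")
    case True
    then show ?thesis using assms half[of x] by (simp add: scaleR_2)
  next
    case False
    have "x + y = (1 - 1/2) *\<^sub>R (2 *\<^sub>R x) + (1/2::real) *\<^sub>R (2 *\<^sub>R y)" by simp
    then have "x + y \<in> open_segment (2 *\<^sub>R x) (2 *\<^sub>R y)"
      unfolding in_segment using False by (intro conjI exI[of _ "1/2"]) auto
    then have "2 *\<^sub>R x \<in> \<tau>"
      using seg[of "2 *\<^sub>R x" "2 *\<^sub>R y" "x + y"] assms convex_cone_scaleR[OF assms(1), of 2] by simp
    then show ?thesis using half by blast
  qed
qed

text \<open>A point of an open segment is the sum of the two rescaled ends, both in the cone, so the
  additive condition gives back the segment condition.\<close>

lemma cone_faceI:
  assumes "convex_cone \<sigma>" "convex_cone \<tau>" "\<tau> \<subseteq> \<sigma>"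
    and "\<And>x y. x \<in> \<sigma> \<Longrightarrow> y \<in> \<sigma> \<Longrightarrow> x + y \<in> \<tau> \<Longrightarrow> x \<in> \<tau>"
  shows "cone_face \<tau> \<sigma>"
proof -
  have "a \<in> \<tau> \<and> b \<in> \<tau>" if ab: "a \<in> \<sigma>" "b \<in> \<sigma>" "x \<in> \<tau>" "x \<in> open_segment a b" for a b x
  proof -
    obtain u where u: "0 < u" "u < 1" "x = (1 - u) *\<^sub>R a + u *\<^sub>R b"
      using ab(4) by (auto simp: in_segment)
    have m: "(1 - u) *\<^sub>R a \<in> \<sigma>" "u *\<^sub>R b \<in> \<sigma>"
      using u ab assms(1) by (simp_all add: convex_cone_scaleR)
    have 1: "(1 - u) *\<^sub>R a \<in> \<tau>" using assms(4)[OF m] u ab by simp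
    have 2: "u *\<^sub>R b \<in> \<tau>" using assms(4)[OF m(2,1)] u ab by (simp add: add.commute)
    show ?thesis
      using convex_cone_scaleR[OF assms(2), of "1/(1-u)", OF _ 1]
        convex_cone_scaleR[OF assms(2), of "1/u", OF _ 2] u by simp
  qed
  then show ?thesis
    unfolding cone_face_def face_of_def using assms(2,3) unfolding convex_cone_def by blast
qed

text \<open>The differences of elements form a subspace containing the cone. Writing a vector of the
  span in this way lets the subtracted part be moved to the other side, which is how statements
  about spans become statements about cones.\<close>

lemma span_convex_cone:
  assumes "convex_cone C" "x \<in> span C"
  obtains a b where "a \<in> C" "b \<in> C" "x = a - b"
proof -
  have "subspace {a - b |a b. a \<in> C \<and> b \<in> C}"
  proof (rule subspaceI)
    show "0 \<in> {a - b |a b. a \<in> C \<and> b \<in> C}"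
      using convex_cone_contains_0[OF assms(1)] by (metis (mono_tags, lifting) diff_self mem_Collect_eq)
  next
    fix x y assume "x \<in> {a - b |a b. a \<in> C \<and> b \<in> C}" "y \<in> {a - b |a b. a \<in> C \<and> b \<in> C}"
    then obtain a b c d where *: "x = a - b" "y = c - d" "a \<in> C" "b \<in> C" "c \<in> C" "d \<in> C" by blast
    have "x + y = (a + c) - (b + d)" using * by simp
    moreover have "a + c \<in> C" "b + d \<in> C"
      using convex_cone_add[OF assms(1)] * by blast+
    ultimately show "x + y \<in> {a - b |a b. a \<in> C \<and> b \<in> C}" by blast
  next
    fix r :: real and x assume "x \<in> {a - b |a b. a \<in> C \<and> b \<in> C}"
    then obtain a b where ab: "x = a - b" "a \<in> C" "b \<in> C" by blast
    show "r *\<^sub>R x \<in> {a - b |a b. a \<in> C \<and> b \<in> C}"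
    proof (cases "r \<ge> 0")
      case True
      then have "r *\<^sub>R a \<in> C" "r *\<^sub>R b \<in> C"
        using ab convex_cone_scaleR[OF assms(1)] by blast+
      moreover have "r *\<^sub>R x = r *\<^sub>R a - r *\<^sub>R b" unfolding ab(1) by (simp add: scaleR_diff_right)
      ultimately show ?thesis by blast
    next
      case False
      then have "(-r) *\<^sub>R a \<in> C" "(-r) *\<^sub>R b \<in> C"
        using ab convex_cone_scaleR[OF assms(1), of "-r"] by simp_all
      moreover have "r *\<^sub>R x = (-r) *\<^sub>R b - (-r) *\<^sub>R a" unfolding ab(1) by (simp add: scaleR_diff_right)
      ultimately show ?thesis by blast
    qed
  qed
  moreover have "C \<subseteq> {a - b |a b. a \<in> C \<and> b \<in> C}"
  proof
    fix x assume "x \<in> C"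
    then have "x = x - 0" "x \<in> C" "0 \<in> C" using convex_cone_contains_0[OF assms(1)] by auto
    then show "x \<in> {a - b |a b. a \<in> C \<and> b \<in> C}" by blast
  qed
  ultimately have "span C \<subseteq> {a - b |a b. a \<in> C \<and> b \<in> C}" using span_minimal by blast
  then show ?thesis using assms(2) that by blast
qed

text \<open>Writing \<open>x = a - b\<close> with \<open>a\<close> and \<open>b\<close> in the face
  makes \<open>x + b\<close> an element of the face, and faces are closed under taking
  summands.\<close>

lemma cone_face_Int_span:
  assumes "convex_cone \<sigma>" "cone_face \<tau> \<sigma>" "x \<in> \<sigma>" "x \<in> span \<tau>"
  shows "x \<in> \<tau>"
proof -
  obtain a b where "a \<in> \<tau>" "b \<in> \<tau>" "x = a - b"
    using span_convex_cone[OF cone_face_convex_cone[OF assms(1,2)] assms(4)] by blast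
  then show ?thesis using cone_faceD[OF assms(1,2,3), of b] cone_face_subset[OF assms(2)] by auto
qed

lemma cone_face_eq_if_span:
  assumes "convex_cone \<sigma>" "cone_face \<tau> \<sigma>" "\<sigma> \<subseteq> span \<tau>"
  shows "\<tau> = \<sigma>"
  using cone_face_Int_span[OF assms(1,2)] assms(3) cone_face_subset[OF assms(2)] by blast

lemma span_convex_cone_hull: "span (convex_cone hull F) = span F"
proof
  have "convex_cone hull F \<subseteq> span F"
    by (rule hull_minimal[of F "span F" convex_cone, OF span_superset convex_cone_span])
  then show "span (convex_cone hull F) \<subseteq> span F" by (simp add: span_minimal)
  show "span F \<subseteq> span (convex_cone hull F)" by (simp add: hull_subset span_mono)
qed

lemma convex_cone_hull_insert:
  "convex_cone hull (insert g F) = {y + t *\<^sub>R g | y t. y \<in> convex_cone hull F \<and> 0 \<le> t}"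
proof
  let ?R = "{y + t *\<^sub>R g | y t. y \<in> convex_cone hull F \<and> 0 \<le> t}"
  have gF: "insert g F \<subseteq> ?R"
  proof -
    have "g = 0 + 1 *\<^sub>R g" by simp
    then have "g \<in> ?R" using convex_cone_hull_contains_0[of F] by (metis (mono_tags, lifting) mem_Collect_eq zero_le_one)
    moreover have "F \<subseteq> ?R"
    proof
      fix x assume "x \<in> F"
      then have "x \<in> convex_cone hull F" "x = x + 0 *\<^sub>R g" by (simp_all add: hull_inc)
      then show "x \<in> ?R" by blast
    qed
    ultimately show ?thesis by simp
  qed
  have zero: "0 \<in> ?R"
  proof -
    have "0 = 0 + 0 *\<^sub>R g" by simp
    then show ?thesis using convex_cone_hull_contains_0[of F] by blast
  qed
  have add: "x + y \<in> ?R" if xy: "x \<in> ?R" "y \<in> ?R" for x y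
  proof -
    obtain a s b t where *: "x = a + s *\<^sub>R g" "y = b + t *\<^sub>R g" "a \<in> convex_cone hull F"
      "b \<in> convex_cone hull F" "0 \<le> s" "0 \<le> t" using xy by blast
    have "x + y = (a + b) + (s + t) *\<^sub>R g" using * by (simp add: algebra_simps)
    moreover have "a + b \<in> convex_cone hull F" "0 \<le> s + t"
      using * by (simp_all add: convex_cone_hull_add)
    ultimately show ?thesis by blast
  qed
  have sc: "c *\<^sub>R x \<in> ?R" if x: "x \<in> ?R" and c: "0 \<le> c" for x c
  proof -
    obtain a s where *: "x = a + s *\<^sub>R g" "a \<in> convex_cone hull F" "0 \<le> s" using x by blast
    have "c *\<^sub>R x = c *\<^sub>R a + (c * s) *\<^sub>R g" using * by (simp add: algebra_simps)
    moreover have "c *\<^sub>R a \<in> convex_cone hull F" "0 \<le> c * s"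
      using * c by (simp_all add: convex_cone_hull_mul)
    ultimately show ?thesis by blast
  qed
  have "convex_cone ?R"
    by (rule convex_cone_iff[THEN iffD2]) (intro conjI ballI allI impI zero add sc)
  then show "convex_cone hull (insert g F) \<subseteq> ?R" by (rule hull_minimal[where S = convex_cone, OF gF])
  show "?R \<subseteq> convex_cone hull (insert g F)"
  proof
    fix x assume "x \<in> ?R"
    then obtain y t where yt: "y \<in> convex_cone hull F" "0 \<le> t" and x: "x = y + t *\<^sub>R g" by blast
    have "y \<in> convex_cone hull (insert g F)" using yt(1) hull_mono[of F "insert g F"] by blast
    moreover have "t *\<^sub>R g \<in> convex_cone hull (insert g F)"
      using yt(2) by (simp add: convex_cone_hull_mul hull_inc)
    ultimately show "x \<in> convex_cone hull (insert g F)" unfolding x by (rule convex_cone_hull_add)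
  qed
qed

text \<open>Minkowski--Weyl, by Fourier--Motzkin elimination of the generators.\<close>

lemma convex_cone_hull_halfspaces:
  fixes F :: "'a::real_vector set"
  assumes "finite F"
  shows "\<exists>H. finite H \<and> (\<forall>h\<in>H. linear (h :: 'a \<Rightarrow> real)) \<and>
     convex_cone hull F = {x \<in> span F. \<forall>h\<in>H. 0 \<le> h x}"
  using assms
proof (induction F rule: finite_induct)
  case empty
  then show ?case by (intro exI[of _ "{}"]) auto
next
  case (insert g F)
  then obtain H where H: "finite H" "\<forall>h\<in>H. linear (h :: 'a \<Rightarrow> real)"
    "convex_cone hull F = {x \<in> span F. \<forall>h\<in>H. 0 \<le> h x}" by blast
  have mem: "x \<in> convex_cone hull (insert g F) \<longleftrightarrow>
      (\<exists>t\<ge>0. x - t *\<^sub>R g \<in> span F \<and> (\<forall>h\<in>H. t * h g \<le> h x))" for x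
  proof -
    have "x \<in> convex_cone hull (insert g F) \<longleftrightarrow> (\<exists>t\<ge>0. x - t *\<^sub>R g \<in> convex_cone hull F)"
      unfolding convex_cone_hull_insert by (auto simp: algebra_simps)
        (metis add.commute diff_add_cancel)
    also have "\<dots> \<longleftrightarrow> (\<exists>t\<ge>0. x - t *\<^sub>R g \<in> span F \<and> (\<forall>h\<in>H. t * h g \<le> h x))"
      using H(2) unfolding H(3) by (auto simp: linear_diff linear_scale)
    finally show ?thesis .
  qed
  show ?case
  proof (cases "g \<in> span F")
    case True
    \<comment> \<open>Each \<open>h\<close> bounds \<open>t\<close> by
      \<open>t * h g \<le> h x\<close>: from above if \<open>h g > 0\<close>, from below if
      \<open>h g < 0\<close>. A nonnegative solution exists iff the upper bounds are nonnegative,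
      the conditions with \<open>h g = 0\<close> hold, and each upper bound dominates each lower
      one; \<open>K\<close> states this without division.\<close>
    define K where "K = {h\<in>H. h g \<ge> 0} \<union>
      (\<lambda>(h,k) x. h g * k x - k g * h x) ` ({h\<in>H. h g > 0} \<times> {k\<in>H. k g < 0})"
    have fin: "finite K" using H(1) by (auto simp: K_def)
    have lin: "\<forall>h\<in>K. linear h"
      using H(2) by (auto simp: K_def intro!: linear_compose_sub linear_cmult)
    have sp: "x - t *\<^sub>R g \<in> span F \<longleftrightarrow> x \<in> span F" for x t
      using True by (metis diff_add_cancel span_add span_diff span_scale)
    have "(\<exists>t\<ge>0. \<forall>h\<in>H. t * h g \<le> h x) \<longleftrightarrow> (\<forall>h\<in>K. 0 \<le> h x)" for x
    proof
      assume "\<exists>t\<ge>0. \<forall>h\<in>H. t * h g \<le> h x"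
      then obtain t where t: "t \<ge> 0" "\<forall>h\<in>H. t * h g \<le> h x" by blast
      have "0 \<le> h x" if "h \<in> H" "h g \<ge> 0" for h
        using t that by (metis mult_nonneg_nonneg order_trans)
      moreover have "0 \<le> h g * k x - k g * h x" if "h \<in> H" "k \<in> H" "h g > 0" "k g < 0" for h k
      proof -
        have "h g * (t * k g) \<le> h g * k x" using t that by (intro mult_left_mono) auto
        moreover have "k g * h x \<le> k g * (t * h g)" using t that by (intro mult_left_mono_neg) auto
        ultimately show ?thesis by (simp add: algebra_simps)
      qed
      ultimately show "\<forall>h\<in>K. 0 \<le> h x" by (auto simp: K_def)
    next
      assume K: "\<forall>h\<in>K. 0 \<le> h x"
      \<comment> \<open>The lower bounds on \<open>t\<close>, with \<open>0\<close> for the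
        condition \<open>0 \<le> t\<close>; their maximum is the solution.\<close>
      define T where "T = insert 0 ((\<lambda>k. k x / k g) ` {k\<in>H. k g < 0})"
      have T: "finite T" "T \<noteq> {}" using H(1) by (auto simp: T_def)
      have "Max T * h g \<le> h x" if h: "h \<in> H" for h
      proof -
        consider "h g > 0" | "h g = 0" | "h g < 0" by linarith
        then show ?thesis
        proof cases
          case 1
          have "s \<le> h x / h g" if "s \<in> T" for s
          proof -
            from that consider "s = 0" | k where "k \<in> H" "k g < 0" "s = k x / k g"
              by (auto simp: T_def)
            then show ?thesis
            proof cases
              case 1
              then show ?thesis using K h \<open>h g > 0\<close> by (simp add: K_def)
            next
              case (2 k)
              have "(\<lambda>x. h g * k x - k g * h x) \<in> K"
                unfolding K_def using 2 h \<open>h g > 0\<close> by (intro UnI2 image_eqI[of _ _ "(h, k)"]) auto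
              with K have "0 \<le> (\<lambda>x. h g * k x - k g * h x) x" by (rule bspec)
              then have "0 \<le> h g * k x - k g * h x" .
              moreover have "k x = s * k g" using 2 by simp
              ultimately have "k g * (h x - s * h g) \<le> 0" by (simp add: algebra_simps)
              then have "s * h g \<le> h x" using \<open>k g < 0\<close> by (simp add: mult_le_0_iff)
              then show ?thesis using \<open>h g > 0\<close> by (simp add: pos_le_divide_eq)
            qed
          qed
          then show ?thesis using T 1 by (simp add: pos_le_divide_eq)
        next
          case 2
          then show ?thesis using K h by (simp add: K_def)
        next
          case 3
          then have "h x / h g \<le> Max T" using T h by (auto simp: T_def)
          then show ?thesis using 3 by (simp add: divide_simps)
        qed
      qed
      moreover have "Max T \<ge> 0" using T by (auto simp: T_def)
      ultimately show "\<exists>t\<ge>0. \<forall>h\<in>H. t * h g \<le> h x" by blast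
    qed
    then have "convex_cone hull (insert g F) = {x \<in> span (insert g F). \<forall>h\<in>K. 0 \<le> h x}"
      unfolding set_eq_iff mem sp by (auto simp: span_redundant[OF True])
    then show ?thesis using fin lin by (intro exI[of _ K]) auto
  next
    case False
    obtain c where c: "linear c" "\<And>x. x \<in> span F \<Longrightarrow> c x = 0" "c g = (1::real)"
      using linear_coordinate[OF False] by blast
    \<comment> \<open>Outside \<open>span F\<close> the coefficient of \<open>g\<close> is forced to
      be \<open>c x\<close>, so it is substituted instead of eliminated.\<close>
    define K where "K = insert c ((\<lambda>h x. h x - h g * c x) ` H)"
    have "finite K" using H(1) by (simp add: K_def)
    moreover have "\<forall>h\<in>K. linear h"
      using H(2) c(1) by (auto simp: K_def intro!: linear_compose_sub linear_cmult)
    moreover have "x \<in> convex_cone hull (insert g F) \<longleftrightarrow> x \<in> span (insert g F) \<and> (\<forall>h\<in>K. 0 \<le> h x)" for x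
    proof -
      have 1: "t = c x" if "x - t *\<^sub>R g \<in> span F" for t
        using c(2)[OF that] c(1,3) by (simp add: linear_diff linear_scale)
      have 2: "x \<in> span (insert g F) \<longleftrightarrow> x - c x *\<^sub>R g \<in> span F"
        unfolding span_insert using 1 by auto
      have 3: "(\<forall>h\<in>K. 0 \<le> h x) \<longleftrightarrow> 0 \<le> c x \<and> (\<forall>h\<in>H. c x * h g \<le> h x)"
        unfolding K_def by (simp add: mult.commute)
      show ?thesis unfolding mem 2 3 using 1 by metis
    qed
    ultimately show ?thesis by (intro exI[of _ K] conjI set_eqI) simp_all
  qed
qed

text \<open>A single vector completing \<open>\<tau>\<close> is easier to transport along linear
  maps and sums than a dimension count; for sets of finite dimension the two agree by
  \<open>codim1_iff_dim\<close>.\<close>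

definition codim1 :: "'a::real_vector set \<Rightarrow> 'a set \<Rightarrow> bool" where
  "codim1 \<tau> \<sigma> \<longleftrightarrow> \<tau> \<subseteq> \<sigma> \<and> (\<exists>v\<in>\<sigma>. v \<notin> span \<tau> \<and> \<sigma> \<subseteq> span (insert v \<tau>))"

lemma codim1_iff_dim:
  fixes \<sigma> :: "'a::real_vector set"
  assumes "finite F" "\<sigma> \<subseteq> span F" "\<tau> \<subseteq> \<sigma>"
  shows "codim1 \<tau> \<sigma> \<longleftrightarrow> dim \<sigma> = dim \<tau> + 1"
proof
  assume "codim1 \<tau> \<sigma>"
  then obtain v where v: "v \<in> \<sigma>" "v \<notin> span \<tau>" "\<sigma> \<subseteq> span (insert v \<tau>)"
    unfolding codim1_def by blast
  have "insert v \<tau> \<subseteq> span \<sigma>" using v(1) assms(3) span_superset[of \<sigma>] by blast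
  then have "span \<sigma> = span (insert v \<tau>)" using v(3) by (simp add: span_eq)
  then have "dim \<sigma> = dim (insert v \<tau>)" by (rule span_eq_dim)
  also have "\<dots> = dim \<tau> + 1"
    using dim_insert_notin[OF assms(1) _ v(2)] assms(2,3) by blast
  finally show "dim \<sigma> = dim \<tau> + 1" .
next
  assume d: "dim \<sigma> = dim \<tau> + 1"
  have "\<not> \<sigma> \<subseteq> span \<tau>"
  proof
    assume "\<sigma> \<subseteq> span \<tau>"
    then have "dim \<sigma> \<le> dim \<tau>"
      using dim_le_finite_span[OF assms(1), of \<tau> \<sigma>] assms(2,3) by blast
    then show False using d by simp
  qed
  then obtain v where v: "v \<in> \<sigma>" "v \<notin> span \<tau>" by blast
  have "\<tau> \<subseteq> span F" using assms(2,3) by blast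
  then have "dim \<sigma> \<le> dim (insert v \<tau>)"
    using dim_insert_notin[OF assms(1) _ v(2)] d by simp
  moreover have "insert v \<tau> \<subseteq> span \<sigma>" using v(1) assms(3) span_superset[of \<sigma>] by blast
  ultimately have "span (insert v \<tau>) = span \<sigma>"
    using span_eq_if_dim_le[OF assms(1,2)] by blast
  then have "\<sigma> \<subseteq> span (insert v \<tau>)" using span_superset[of \<sigma>] by simp
  then show "codim1 \<tau> \<sigma>" unfolding codim1_def using assms(3) v by blast
qed

text \<open>Modulo \<open>span \<tau>\<close> everything in \<open>span \<sigma>\<close> is a
  multiple of the distinguished vector \<open>w\<close>, and \<open>v\<close> is a nonzero multiple
  of it, so \<open>v\<close> can take its place.\<close>

lemma codim1_decomp:
  assumes "codim1 \<tau> \<sigma>" "v \<in> span \<sigma>" "v \<notin> span \<tau>" "x \<in> span \<sigma>"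
  obtains a where "x - a *\<^sub>R v \<in> span \<tau>"
proof -
  obtain w where w: "w \<in> \<sigma>" "w \<notin> span \<tau>" "\<sigma> \<subseteq> span (insert w \<tau>)"
    using assms(1) unfolding codim1_def by blast
  have sub: "span \<sigma> \<subseteq> span (insert w \<tau>)" using w(3) by (simp add: span_minimal)
  obtain a where a: "v - a *\<^sub>R w \<in> span \<tau>" using assms(2) sub unfolding span_insert by blast
  obtain b where b: "x - b *\<^sub>R w \<in> span \<tau>" using assms(4) sub unfolding span_insert by blast
  have "a \<noteq> 0" using a assms(3) by auto
  have "(x - b *\<^sub>R w) - (b / a) *\<^sub>R (v - a *\<^sub>R w) \<in> span \<tau>"
    by (rule span_diff[OF b span_scale[OF a]])
  moreover have "(x - b *\<^sub>R w) - (b / a) *\<^sub>R (v - a *\<^sub>R w) = x - (b / a) *\<^sub>R v"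
    using \<open>a \<noteq> 0\<close> by (simp add: algebra_simps)
  ultimately show ?thesis using that by simp
qed

lemma codim1_span:
  assumes "codim1 \<tau> \<sigma>" "v \<in> span \<sigma>" "v \<notin> span \<tau>"
  shows "span \<sigma> = span (insert v \<tau>)"
proof
  show "span \<sigma> \<subseteq> span (insert v \<tau>)"
  proof
    fix x assume "x \<in> span \<sigma>"
    then obtain a where "x - a *\<^sub>R v \<in> span \<tau>" using codim1_decomp[OF assms] by blast
    then show "x \<in> span (insert v \<tau>)" unfolding span_insert by blast
  qed
  have "\<tau> \<subseteq> span \<sigma>" using assms(1) span_superset[of \<sigma>] unfolding codim1_def by blast
  then show "span (insert v \<tau>) \<subseteq> span \<sigma>" using assms(2) by (intro span_minimal) auto
qed

text \<open>A cone lies on one side of the span of its face. If \<open>a\<close> were negative, then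
  \<open>(- a) *\<^sub>R x\<close> and \<open>y + l\<close> would be elements of
  \<open>\<sigma>\<close> with sum \<open>k\<close> in \<open>\<tau>\<close>, forcing
  \<open>x\<close> into \<open>span \<tau>\<close>.\<close>

lemma cone_face_same_side:
  assumes "convex_cone \<sigma>" "cone_face \<tau> \<sigma>" "x \<in> \<sigma>" "x \<notin> span \<tau>" "y \<in> \<sigma>" "y - a *\<^sub>R x \<in> span \<tau>"
  shows "0 \<le> a"
proof (rule ccontr)
  assume "\<not> 0 \<le> a"
  obtain k l where k: "k \<in> \<tau>" "l \<in> \<tau>" "y - a *\<^sub>R x = k - l"
    using span_convex_cone[OF cone_face_convex_cone[OF assms(1,2)] assms(6)] by blast
  have 1: "(- a) *\<^sub>R x \<in> \<sigma>" using \<open>\<not> 0 \<le> a\<close> assms(1,3) by (intro convex_cone_scaleR) auto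
  have 2: "y + l \<in> \<sigma>"
    using assms(1,5) k(2) cone_face_subset[OF assms(2)] by (blast intro: convex_cone_add)
  have "(- a) *\<^sub>R x + (y + l) = k" using k(3) by (simp add: algebra_simps)
  then have "(- a) *\<^sub>R x \<in> \<tau>" using cone_faceD[OF assms(1,2) 1 2] k(1) by simp
  then have "(- 1 / a) *\<^sub>R ((- a) *\<^sub>R x) \<in> span \<tau>" by (intro span_scale span_base)
  then show False using assms(4) \<open>\<not> 0 \<le> a\<close> by simp
qed

section \<open>Lattices\<close>

lemma is_lattice_zero:
  assumes "is_lattice N"
  shows "0 \<in> N"
proof -
  obtain B where B: "N = range (\<lambda>c :: _ \<Rightarrow> int. \<Sum>b\<in>B. of_int (c b) *\<^sub>R b)"
    using assms unfolding is_lattice_def by blast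
  show ?thesis unfolding B by (rule range_eqI[of _ _ "\<lambda>_. 0"]) simp
qed

lemma is_lattice_add:
  assumes "is_lattice N" "x \<in> N" "y \<in> N"
  shows "x + y \<in> N"
proof -
  obtain B where B: "N = range (\<lambda>c :: _ \<Rightarrow> int. \<Sum>b\<in>B. of_int (c b) *\<^sub>R b)"
    using assms(1) unfolding is_lattice_def by blast
  obtain c d where "x = (\<Sum>b\<in>B. of_int (c b) *\<^sub>R b)" "y = (\<Sum>b\<in>B. of_int (d b) *\<^sub>R b)"
    using assms(2,3) unfolding B by blast
  then have "x + y = (\<Sum>b\<in>B. of_int (c b + d b) *\<^sub>R b)"
    by (simp add: sum.distrib scaleR_left_distrib)
  then show ?thesis unfolding B by (intro range_eqI[of _ _ "\<lambda>b. c b + d b"])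
qed

lemma is_lattice_scale:
  assumes "is_lattice N" "x \<in> N"
  shows "of_int k *\<^sub>R x \<in> N"
proof -
  obtain B where B: "N = range (\<lambda>c :: _ \<Rightarrow> int. \<Sum>b\<in>B. of_int (c b) *\<^sub>R b)"
    using assms(1) unfolding is_lattice_def by blast
  obtain c where "x = (\<Sum>b\<in>B. of_int (c b) *\<^sub>R b)"
    using assms(2) unfolding B by blast
  then have "of_int k *\<^sub>R x = (\<Sum>b\<in>B. of_int (k * c b) *\<^sub>R b)"
    by (simp add: scaleR_sum_right)
  then show ?thesis unfolding B by (intro range_eqI[of _ _ "\<lambda>b. k * c b"])
qed

lemma is_lattice_diff: "is_lattice N \<Longrightarrow> x \<in> N \<Longrightarrow> y \<in> N \<Longrightarrow> x - y \<in> N"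
  using is_lattice_add[of N x "-y"] is_lattice_scale[of N y "-1"] by simp

lemma is_lattice_sum:
  assumes "is_lattice N" "\<And>i. i \<in> I \<Longrightarrow> x i \<in> N"
  shows "(\<Sum>i\<in>I. x i) \<in> N"
  using assms(2)
  by (induction I rule: infinite_finite_induct)
    (simp_all add: is_lattice_zero[OF assms(1)] is_lattice_add[OF assms(1)])

text \<open>In a lattice basis the coordinates of a lattice point are integers, and for a
  combination of \<open>U\<close> with coefficients between 0 and 1 they are bounded by the sums of
  the absolute coordinates of \<open>U\<close>. This is the discreteness of the lattice in the form
  used below.\<close>

lemma is_lattice_finite_box:
  assumes "is_lattice N" "finite U"
  shows "finite {x \<in> N. \<exists>t. (\<forall>u\<in>U. 0 \<le> t u \<and> t u \<le> 1) \<and> x = (\<Sum>u\<in>U. t u *\<^sub>R u)}" (is "finite ?Q")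
proof -
  obtain B where B: "finite B" "independent B" "N = range (\<lambda>c :: _ \<Rightarrow> int. \<Sum>b\<in>B. of_int (c b) *\<^sub>R b)"
    using assms(1) unfolding is_lattice_def by blast
  have "\<exists>c. linear c \<and> (\<forall>b'\<in>B. c b' = (if b' = b then 1 else 0 :: real))" for b
    by (rule linear_independent_extend[OF B(2)])
  then obtain c where c: "\<And>b. b \<in> B \<Longrightarrow> linear (c b)"
    "\<And>b b'. b \<in> B \<Longrightarrow> b' \<in> B \<Longrightarrow> c b b' = (if b' = b then 1 else 0 :: real)"
    by metis
  define M where "M = (\<lambda>b. \<lceil>\<Sum>u\<in>U. \<bar>c b u\<bar>\<rceil>)"
  have "?Q \<subseteq> (\<lambda>k :: _ \<Rightarrow> int. \<Sum>b\<in>B. of_int (k b) *\<^sub>R b) ` (PiE B (\<lambda>b. {- M b .. M b}))"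
  proof
    fix x assume "x \<in> ?Q"
    then obtain t where x: "x \<in> N" and t: "\<And>u. u \<in> U \<Longrightarrow> 0 \<le> t u \<and> t u \<le> 1" "x = (\<Sum>u\<in>U. t u *\<^sub>R u)"
      by blast
    obtain k :: "_ \<Rightarrow> int" where k: "x = (\<Sum>b\<in>B. of_int (k b) *\<^sub>R b)" using x unfolding B(3) by blast
    have "k b \<in> {- M b .. M b}" if b: "b \<in> B" for b
    proof -
      have "c b x = (\<Sum>b'\<in>B. of_int (k b') * c b b')"
        unfolding k using c(1)[OF b] by (simp add: linear_sum linear_scale)
      also have "\<dots> = (\<Sum>b'\<in>B. if b' = b then of_int (k b') else 0)"
        using c(2)[OF b] by (intro sum.cong) auto
      also have "\<dots> = of_int (k b)" using b B(1) by simp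
      finally have 1: "c b x = of_int (k b)" .
      have "c b x = (\<Sum>u\<in>U. t u * c b u)"
        unfolding t(2) using c(1)[OF b] by (simp add: linear_sum linear_scale)
      then have "\<bar>c b x\<bar> \<le> (\<Sum>u\<in>U. \<bar>t u * c b u\<bar>)" by simp
      also have "\<dots> \<le> (\<Sum>u\<in>U. \<bar>c b u\<bar>)"
      proof (rule sum_mono)
        fix u assume "u \<in> U"
        then have "\<bar>t u\<bar> \<le> 1" using t(1) by force
        then show "\<bar>t u * c b u\<bar> \<le> \<bar>c b u\<bar>" by (simp add: abs_mult mult_left_le_one_le)
      qed
      finally have "\<bar>of_int (k b)\<bar> \<le> (of_int (M b) :: real)"
        unfolding 1 M_def by (meson le_of_int_ceiling order_trans)
      then show ?thesis by simp linarith
    qed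
    then have 1: "restrict k B \<in> PiE B (\<lambda>b. {- M b .. M b})" by simp
    have 2: "x = (\<Sum>b\<in>B. of_int (restrict k B b) *\<^sub>R b)" unfolding k by (intro sum.cong) auto
    show "x \<in> (\<lambda>k :: _ \<Rightarrow> int. \<Sum>b\<in>B. of_int (k b) *\<^sub>R b) ` (PiE B (\<lambda>b. {- M b .. M b}))"
      using 1 2 by (intro image_eqI[where x = "restrict k B"])
  qed
  moreover have "finite (PiE B (\<lambda>b. {- M b .. M b}))" using B(1) by (intro finite_PiE) auto
  ultimately show ?thesis by (meson finite_imageI finite_subset)
qed

text \<open>The coordinate along \<open>u\<close> takes a least positive value on the lattice points
  of \<open>span (insert u F)\<close>, because its values in (0,1] are all taken in a bounded box. A
  lattice point \<open>v\<close> with that value generates the infinite cyclic group of these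
  lattice points modulo \<open>span F\<close>, on the side of \<open>u\<close>.\<close>

lemma is_lattice_generator:
  assumes N: "is_lattice N" and F: "finite F" "F \<subseteq> N" and u: "u \<in> N" "u \<notin> span F"
  obtains v a where "v \<in> N" "0 < a" "v - a *\<^sub>R u \<in> span F"
    "\<And>x. x \<in> N \<Longrightarrow> x \<in> span (insert u F) \<Longrightarrow> \<exists>k::int. x - of_int k *\<^sub>R v \<in> span F"
proof -
  obtain B where B: "B \<subseteq> F" "finite B" "span B = span F"
    using finite_basis_of[OF F(1) span_superset] by metis
  obtain c where c: "linear c" "\<And>x. x \<in> span F \<Longrightarrow> c x = 0" "c u = (1::real)"
    using linear_coordinate[OF u(2)] by blast
  have dec: "x - c x *\<^sub>R u \<in> span F" if x: "x \<in> span (insert u F)" for x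
  proof -
    obtain k where k: "x - k *\<^sub>R u \<in> span F" using x unfolding span_insert by blast
    then have "c x = k" using c(2)[OF k] c(1,3) by (simp add: linear_diff linear_scale)
    then show ?thesis using k by simp
  qed
  \<comment> \<open>Values above \<open>1\<close> may be cut off since \<open>u\<close> itself has
    coordinate \<open>1\<close>.\<close>
  define P where "P = {c x | x. x \<in> N \<and> x \<in> span (insert u F) \<and> 0 < c x \<and> c x \<le> 1}"
  define Q where "Q = {x \<in> N. \<exists>t. (\<forall>w\<in>insert u B. 0 \<le> t w \<and> t w \<le> 1) \<and> x = (\<Sum>w\<in>insert u B. t w *\<^sub>R w)}"
  have uB: "u \<notin> B" using u(2) B span_base by blast
  have "P \<subseteq> c ` Q"
  proof
    fix y assume "y \<in> P"
    then obtain x where x: "y = c x" "x \<in> N" "x \<in> span (insert u F)" "0 < c x" "c x \<le> 1"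
      unfolding P_def by blast
    have "x - c x *\<^sub>R u \<in> span B" using dec[OF x(3)] B(3) by simp
    then obtain r where r: "x - c x *\<^sub>R u = (\<Sum>b\<in>B. r b *\<^sub>R b)"
      unfolding span_finite[OF B(2)] by blast
    \<comment> \<open>Subtracting integer parts along \<open>B\<close>, a lattice vector of
      \<open>span F\<close>, moves \<open>x\<close> into the box without changing
      \<open>c\<close>.\<close>
    define x' where "x' = x - (\<Sum>b\<in>B. of_int \<lfloor>r b\<rfloor> *\<^sub>R b)"
    have "(\<Sum>b\<in>B. of_int \<lfloor>r b\<rfloor> *\<^sub>R b) \<in> N"
      using B(1) F(2) N by (intro is_lattice_sum is_lattice_scale) auto
    then have "x' \<in> N" unfolding x'_def using N x(2) by (intro is_lattice_diff)
    have x'eq: "x' = c x *\<^sub>R u + (\<Sum>b\<in>B. frac (r b) *\<^sub>R b)"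
    proof -
      have "(\<Sum>b\<in>B. frac (r b) *\<^sub>R b) = (\<Sum>b\<in>B. r b *\<^sub>R b) - (\<Sum>b\<in>B. of_int \<lfloor>r b\<rfloor> *\<^sub>R b)"
        by (simp add: frac_def scaleR_diff_left sum_subtractf)
      then show ?thesis unfolding x'_def by (simp flip: r)
    qed
    have "c x' = c x"
    proof -
      have "(\<Sum>b\<in>B. of_int \<lfloor>r b\<rfloor> *\<^sub>R b) \<in> span F"
        using B(1) by (intro span_sum span_scale span_base) auto
      then show ?thesis unfolding x'_def using c(1,2) by (simp add: linear_diff)
    qed
    moreover have "x' \<in> Q"
    proof -
      define t where "t = (\<lambda>w. if w = u then c x else frac (r w))"
      have "(\<Sum>w\<in>insert u B. t w *\<^sub>R w) = t u *\<^sub>R u + (\<Sum>w\<in>B. t w *\<^sub>R w)"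
        using uB B(2) by simp
      also have "(\<Sum>w\<in>B. t w *\<^sub>R w) = (\<Sum>b\<in>B. frac (r b) *\<^sub>R b)"
        using uB by (intro sum.cong) (auto simp: t_def)
      finally have "x' = (\<Sum>w\<in>insert u B. t w *\<^sub>R w)" unfolding x'eq by (simp add: t_def)
      moreover have "\<forall>w\<in>insert u B. 0 \<le> t w \<and> t w \<le> 1"
        using x(4,5) by (simp add: t_def frac_ge_0 frac_lt_1 less_imp_le)
      ultimately show ?thesis unfolding Q_def using \<open>x' \<in> N\<close> by blast
    qed
    ultimately show "y \<in> c ` Q" using x(1) by (metis imageI)
  qed
  moreover have "finite Q" unfolding Q_def using is_lattice_finite_box[OF N] B(2) by blast
  ultimately have finP: "finite P" using finite_subset by blast
  have "1 \<in> P" unfolding P_def using u(1) c(3) by (auto intro!: exI[of _ u] span_base)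
  define g where "g = Min P"
  have "g \<in> P" "g \<le> 1" using finP \<open>1 \<in> P\<close> unfolding g_def by (auto intro: Min_in Min_le)
  then obtain v where v: "v \<in> N" "v \<in> span (insert u F)" "c v = g" "0 < g"
    unfolding P_def by blast
  have "v - g *\<^sub>R u \<in> span F" using dec[OF v(2)] v(3) by simp
  moreover have "\<exists>k::int. x - of_int k *\<^sub>R v \<in> span F" if x: "x \<in> N" "x \<in> span (insert u F)" for x
  proof -
    \<comment> \<open>Division with remainder: the remainder has a coordinate in [0,g), hence
      \<open>0\<close> by minimality of \<open>g\<close>.\<close>
    define k where "k = \<lfloor>c x / g\<rfloor>"
    define y where "y = x - of_int k *\<^sub>R v"
    have y: "y \<in> N" "y \<in> span (insert u F)"
      unfolding y_def using x v N by (auto intro: is_lattice_diff is_lattice_scale span_diff span_scale)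
    have cy: "c y = c x - of_int k * g" unfolding y_def using c(1) v(3) by (simp add: linear_diff linear_scale)
    have "of_int k \<le> c x / g" "c x / g < of_int k + 1" unfolding k_def by linarith+
    then have "0 \<le> c y" "c y < g" unfolding cy using v(4) by (simp_all add: field_simps)
    moreover have "\<not> 0 < c y"
    proof
      assume "0 < c y"
      then have "c y \<in> P" unfolding P_def using y \<open>c y < g\<close> \<open>g \<le> 1\<close> by auto
      then have "g \<le> c y" unfolding g_def using finP by simp
      then show False using \<open>c y < g\<close> by simp
    qed
    ultimately have "c y = 0" by simp
    then have "y \<in> span F" using dec[OF y(2)] by simp
    then show ?thesis unfolding y_def by blast
  qed
  ultimately show ?thesis using that v by blast
qed

text \<open>Each generator outside the span reached so far adds one basis vector, the generator of
  the new rank-one quotient, so integer coordinates extend one at a time. The set \<open>F\<close>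
  itself may generate only a sublattice of finite index.\<close>

lemma is_lattice_Int_span_basis:
  assumes N: "is_lattice N" and F: "finite F" "F \<subseteq> N"
  obtains B where "finite B" "independent B" "B \<subseteq> N" "span B = span F"
    "\<And>x. x \<in> N \<Longrightarrow> x \<in> span F \<Longrightarrow> \<exists>z :: _ \<Rightarrow> int. x = (\<Sum>b\<in>B. of_int (z b) *\<^sub>R b)"
proof -
  have "\<exists>B. finite B \<and> independent B \<and> B \<subseteq> N \<and> span B = span F \<and>
    (\<forall>x \<in> N. x \<in> span F \<longrightarrow> (\<exists>z :: _ \<Rightarrow> int. x = (\<Sum>b\<in>B. of_int (z b) *\<^sub>R b)))"
    using F
  proof (induction F rule: finite_induct)
    case empty
    show ?case by (rule exI[of _ "{}"]) (simp add: independent_empty)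
  next
    case (insert u F)
    then obtain B where B: "finite B" "independent B" "B \<subseteq> N" "span B = span F"
      "\<And>x. x \<in> N \<Longrightarrow> x \<in> span F \<Longrightarrow> \<exists>z :: _ \<Rightarrow> int. x = (\<Sum>b\<in>B. of_int (z b) *\<^sub>R b)"
      by auto
    show ?case
    proof (cases "u \<in> span F")
      case True
      then have "span (insert u F) = span F" by (rule span_redundant)
      then show ?thesis using B by (intro exI[of _ B]) auto
    next
      case False
      obtain v a where v: "v \<in> N" "0 < a" "v - a *\<^sub>R u \<in> span F"
        "\<And>x. x \<in> N \<Longrightarrow> x \<in> span (insert u F) \<Longrightarrow> \<exists>k::int. x - of_int k *\<^sub>R v \<in> span F"
        using is_lattice_generator[OF N insert(1) _ _ False] insert.prems by blast
      have vF: "v \<notin> span F"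
      proof
        assume "v \<in> span F"
        then have "v - (v - a *\<^sub>R u) \<in> span F" using v(3) by (rule span_diff)
        then have "a *\<^sub>R u \<in> span F" by simp
        then have "(1/a) *\<^sub>R (a *\<^sub>R u) \<in> span F" by (rule span_scale)
        then show False using v(2) False by simp
      qed
      then have vB: "v \<notin> B" using B(4) span_base by blast
      have "v \<in> span (insert u F)" using v(3) unfolding span_insert by blast
      moreover have "u \<in> span (insert v B)"
      proof -
        have "(1/a) *\<^sub>R (a *\<^sub>R u - v) \<in> span F"
          using span_neg[OF v(3)] by (intro span_scale) simp
        then have "u - (1/a) *\<^sub>R v \<in> span F" using v(2) by (simp add: algebra_simps)
        then show ?thesis unfolding span_insert B(4) by blast
      qed
      moreover have "B \<subseteq> span (insert u F)" "F \<subseteq> span (insert v B)"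
        using B(4) span_superset[of B] span_superset[of F] span_mono[of F "insert u F"] span_mono[of B "insert v B"]
        by blast+
      ultimately have sp: "span (insert v B) = span (insert u F)"
        by (simp add: span_eq)
      have "\<exists>z :: _ \<Rightarrow> int. x = (\<Sum>b\<in>insert v B. of_int (z b) *\<^sub>R b)" if x: "x \<in> N" "x \<in> span (insert u F)" for x
      proof -
        obtain k where k: "x - of_int k *\<^sub>R v \<in> span F" using v(4)[OF x] by blast
        then obtain z :: "_ \<Rightarrow> int" where z: "x - of_int k *\<^sub>R v = (\<Sum>b\<in>B. of_int (z b) *\<^sub>R b)"
          using B(5)[OF is_lattice_diff[OF N x(1) is_lattice_scale[OF N v(1)]] k] by blast
        have "(\<Sum>b\<in>insert v B. of_int ((z(v := k)) b) *\<^sub>R b) = of_int k *\<^sub>R v + (\<Sum>b\<in>B. of_int ((z(v := k)) b) *\<^sub>R b)"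
          using vB B(1) by simp
        also have "(\<Sum>b\<in>B. of_int ((z(v := k)) b) *\<^sub>R b) = (\<Sum>b\<in>B. of_int (z b) *\<^sub>R b)"
          using vB by (intro sum.cong) auto
        also have "of_int k *\<^sub>R v + \<dots> = x" using z by (simp flip: z)
        finally show ?thesis by (intro exI[of _ "z(v := k)"]) simp
      qed
      moreover have "independent (insert v B)" using vF B(2,4) independent_insertI by blast
      ultimately show ?thesis using B(1,3) v(1) sp by (intro exI[of _ "insert v B"]) simp
    qed
  qed
  then show ?thesis using that by blast
qed

text \<open>The lattice points in \<open>span F\<close> form a saturated sublattice, so a lattice
  vector outside adds a free summand of rank one, on which the form can be prescribed at will;
  finitely many steps reach all of \<open>N\<close>.\<close>

lemma integral_form_extend:
  assumes N: "is_lattice N" and F: "finite F" "F \<subseteq> N"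
    and l: "linear l" "l ` (N \<inter> span F) \<subseteq> (\<int> :: real set)"
  obtains L where "linear L" "\<And>x. x \<in> span F \<Longrightarrow> L x = l x" "L ` N \<subseteq> \<int>"
proof -
  have step: "\<exists>L. linear L \<and> (\<forall>x\<in>span F. L x = l x) \<and> L ` (N \<inter> span (G \<union> F)) \<subseteq> \<int>"
    if "finite G" "G \<subseteq> N" for G
    using that
  proof (induction G rule: finite_induct)
    case empty
    then show ?case using l by auto
  next
    case (insert u G)
    then obtain L where L: "linear L" "\<And>x. x \<in> span F \<Longrightarrow> L x = l x" "L ` (N \<inter> span (G \<union> F)) \<subseteq> \<int>"
      by auto
    show ?case
    proof (cases "u \<in> span (G \<union> F)")
      case True
      then have "span (insert u G \<union> F) = span (G \<union> F)" by (simp add: span_redundant)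
      then show ?thesis using L by (intro exI[of _ L]) simp
    next
      case False
      obtain v a where v: "v \<in> N" "0 < a" "v - a *\<^sub>R u \<in> span (G \<union> F)"
        "\<And>x. x \<in> N \<Longrightarrow> x \<in> span (insert u (G \<union> F)) \<Longrightarrow> \<exists>k::int. x - of_int k *\<^sub>R v \<in> span (G \<union> F)"
        using is_lattice_generator[OF N _ _ _ False] insert.prems insert(1) F by blast
      obtain c where c: "linear c" "\<And>x. x \<in> span (G \<union> F) \<Longrightarrow> c x = 0" "c u = (1::real)"
        using linear_coordinate[OF False] by blast
      have cv: "c v = a" using c(2)[OF v(3)] c(1,3) by (simp add: linear_diff linear_scale)
      \<comment> \<open>Normalised by \<open>L' v = 0\<close> on the new generator; since
        \<open>c\<close> vanishes on the old span, nothing changes there.\<close>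
      define L' where "L' = (\<lambda>x. L x - (L v / a) * c x)"
      have lin: "linear L'" unfolding L'_def by (intro linear_compose_sub L(1) linear_cmult c(1))
      have same: "L' x = L x" if "x \<in> span (G \<union> F)" for x using c(2)[OF that] by (simp add: L'_def)
      have "L' v = 0" using cv v(2) by (simp add: L'_def)
      have "L' x \<in> \<int>" if x: "x \<in> N" "x \<in> span (insert u (G \<union> F))" for x
      proof -
        obtain k :: int where k: "x - of_int k *\<^sub>R v \<in> span (G \<union> F)" using v(4)[OF x] by blast
        have "L' x = L' (x - of_int k *\<^sub>R v)"
          using lin \<open>L' v = 0\<close> by (simp add: linear_diff linear_scale)
        also have "\<dots> = L (x - of_int k *\<^sub>R v)" using same[OF k] .
        also have "\<dots> \<in> \<int>"
          using L(3) k is_lattice_diff[OF N x(1) is_lattice_scale[OF N v(1)]] by blast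
        finally show ?thesis .
      qed
      moreover have "L' x = l x" if "x \<in> span F" for x
        using same[of x] L(2)[OF that] that span_mono[of F "G \<union> F"] by auto
      ultimately show ?thesis using lin by (intro exI[of _ L']) auto
    qed
  qed
  obtain B where B: "finite B" "N = range (\<lambda>c :: _ \<Rightarrow> int. \<Sum>b\<in>B. of_int (c b) *\<^sub>R b)"
    using N unfolding is_lattice_def by blast
  have "B \<subseteq> N"
  proof
    fix b assume "b \<in> B"
    have "(\<Sum>b'\<in>B. of_int (if b' = b then 1 else 0) *\<^sub>R b') = (\<Sum>b'\<in>B. if b' = b then b' else 0)"
      by (intro sum.cong) auto
    then have "b = (\<Sum>b'\<in>B. of_int (if b' = b then 1 else 0) *\<^sub>R b')"
      using B(1) \<open>b \<in> B\<close> by simp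
    then show "b \<in> N" unfolding B(2) by (rule range_eqI[of _ _ "\<lambda>b'. if b' = b then 1 else 0"])
  qed
  moreover have "N \<subseteq> span (B \<union> F)"
  proof
    fix x assume "x \<in> N"
    then obtain c :: "_ \<Rightarrow> int" where "x = (\<Sum>b\<in>B. of_int (c b) *\<^sub>R b)" unfolding B(2) by blast
    then show "x \<in> span (B \<union> F)" by (simp add: span_sum span_scale span_base)
  qed
  ultimately show ?thesis using step[OF B(1)] that
    by (metis (no_types, lifting) Int_absorb2)
qed

section \<open>Normal vectors\<close>

lemma rational_cone_convex: "rational_cone N \<sigma> \<Longrightarrow> convex_cone \<sigma>"
  unfolding rational_cone_def by (auto simp: convex_cone_convex_cone_hull)

lemma rational_cone_zero: "rational_cone N \<sigma> \<Longrightarrow> 0 \<in> \<sigma>"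
  using rational_cone_convex convex_cone_contains_0 by blast

lemma rational_coneE:
  assumes "rational_cone N \<sigma>"
  obtains F where "finite F" "F \<subseteq> N" "F \<subseteq> \<sigma>" "\<sigma> = convex_cone hull F" "span \<sigma> = span F"
  using assms unfolding rational_cone_def by (metis hull_subset span_convex_cone_hull)

text \<open>Rationality provides a lattice vector \<open>u\<close> of \<open>\<sigma>\<close>
  outside \<open>span \<tau>\<close>. The generator \<open>v\<close> on its side differs from the
  positive multiple \<open>a *\<^sub>R u\<close> by a vector of \<open>span \<tau>\<close>, which is
  the side condition.\<close>

lemma normal_vec_ex:
  assumes N: "is_lattice N" and c: "rational_cone N \<sigma>" "rational_cone N \<tau>" and cd: "codim1 \<tau> \<sigma>"
  shows "\<exists>v. is_normal_vec N \<sigma> \<tau> v"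
proof -
  obtain F where F: "finite F" "F \<subseteq> N" "span \<tau> = span F" using rational_coneE[OF c(2)] by metis
  obtain G where G: "finite G" "G \<subseteq> N" "G \<subseteq> \<sigma>" "\<sigma> = convex_cone hull G" "span \<sigma> = span G"
    using rational_coneE[OF c(1)] by metis
  obtain w where w: "w \<in> \<sigma>" "w \<notin> span \<tau>" using cd unfolding codim1_def by blast
  have "\<not> G \<subseteq> span \<tau>"
  proof
    assume "G \<subseteq> span \<tau>"
    then have "span \<sigma> \<subseteq> span \<tau>" unfolding G(5) by (simp add: span_minimal)
    then show False using w span_base by blast
  qed
  then obtain u where u: "u \<in> G" "u \<notin> span \<tau>" by blast
  obtain v a where v: "v \<in> N" "0 < a" "v - a *\<^sub>R u \<in> span F"
    "\<And>x. x \<in> N \<Longrightarrow> x \<in> span (insert u F) \<Longrightarrow> \<exists>k::int. x - of_int k *\<^sub>R v \<in> span F"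
    using is_lattice_generator[OF N F(1,2), of u] u F(3) G(2) by blast
  have us: "u \<in> \<sigma>" "u \<in> span \<sigma>" using u(1) G(3) span_base by blast+
  have ts: "span \<tau> \<subseteq> span \<sigma>" using cd unfolding codim1_def by (simp add: span_mono)
  have vs: "v \<in> span \<sigma>"
  proof -
    have "v = (v - a *\<^sub>R u) + a *\<^sub>R u" by simp
    then show ?thesis using v(3) F(3) ts us(2) span_add span_scale by (metis subsetD)
  qed
  have "x \<in> span (insert u F)" if "x \<in> span \<sigma>" for x
    using codim1_decomp[OF cd us(2) u(2) that] unfolding span_insert F(3) by blast
  then have gen: "\<exists>k::int. x - of_int k *\<^sub>R v \<in> span \<tau>" if "x \<in> N" "x \<in> span \<sigma>" for x
    using v(4) that F(3) by simp
  have "{w + of_int k *\<^sub>R v | w k. w \<in> N \<inter> span \<tau>} = N \<inter> span \<sigma>"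
  proof (intro equalityI subsetI)
    fix x assume "x \<in> {w + of_int k *\<^sub>R v | w k. w \<in> N \<inter> span \<tau>}"
    then obtain w k where "x = w + of_int k *\<^sub>R v" "w \<in> N" "w \<in> span \<tau>" by blast
    then show "x \<in> N \<inter> span \<sigma>"
      using N v(1) vs ts is_lattice_add is_lattice_scale span_add span_scale by (metis IntI subsetD)
  next
    fix x assume x: "x \<in> N \<inter> span \<sigma>"
    then obtain k :: int where k: "x - of_int k *\<^sub>R v \<in> span \<tau>" using gen by blast
    have "x - of_int k *\<^sub>R v \<in> N" using x N v(1) by (intro is_lattice_diff is_lattice_scale) auto
    moreover have "x = (x - of_int k *\<^sub>R v) + of_int k *\<^sub>R v" by simp
    ultimately show "x \<in> {w + of_int k *\<^sub>R v | w k. w \<in> N \<inter> span \<tau>}" using k by blast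
  qed
  moreover have "\<exists>x\<in>\<sigma>. \<exists>y\<in>span \<tau>. v = x + y"
  proof (intro bexI)
    show "v = a *\<^sub>R u + (v - a *\<^sub>R u)" by simp
    show "v - a *\<^sub>R u \<in> span \<tau>" using v(3) F(3) by simp
    show "a *\<^sub>R u \<in> \<sigma>" using v(2) us(1) rational_cone_convex[OF c(1)] by (simp add: convex_cone_scaleR)
  qed
  ultimately show ?thesis unfolding is_normal_vec_def using v(1) vs by blast
qed

text \<open>A vector of \<open>span \<tau>\<close> would generate only lattice vectors in
  \<open>span \<tau>\<close>, and among the lattice vectors of \<open>span \<sigma>\<close> are the
  generators of \<open>\<sigma>\<close>.\<close>

lemma normal_vec_notin:
  assumes "is_normal_vec N \<sigma> \<tau> v" "rational_cone N \<sigma>" "\<not> \<sigma> \<subseteq> span \<tau>"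
  shows "v \<notin> span \<tau>"
proof
  assume v: "v \<in> span \<tau>"
  obtain G where G: "finite G" "G \<subseteq> N" "G \<subseteq> \<sigma>" "\<sigma> = convex_cone hull G" "span \<sigma> = span G"
    using rational_coneE[OF assms(2)] by metis
  have eq: "{u + of_int k *\<^sub>R v | u k. u \<in> N \<inter> span \<tau>} = N \<inter> span \<sigma>"
    using assms(1) unfolding is_normal_vec_def by blast
  have "{u + of_int k *\<^sub>R v | u k. u \<in> N \<inter> span \<tau>} \<subseteq> span \<tau>"
    using v by (auto intro: span_add span_scale)
  then have "G \<subseteq> span \<tau>" unfolding eq using G(2,3) span_superset[of \<sigma>] by blast
  then have "span \<sigma> \<subseteq> span \<tau>" unfolding G(5) by (simp add: span_minimal)
  then show False using assms(3) span_superset by blast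
qed

text \<open>Both vectors generate the same infinite cyclic quotient, so each is plus or minus the
  other modulo \<open>span \<tau>\<close>. The minus sign would make a sum of two elements of
  \<open>\<sigma>\<close> lie in \<open>\<tau>\<close>, and then \<open>v\<close> in
  \<open>span \<tau>\<close>.\<close>

lemma normal_vec_diff:
  assumes v: "is_normal_vec N \<sigma> \<tau> v" "v \<notin> span \<tau>" and v': "is_normal_vec N \<sigma> \<tau> v'" "v' \<notin> span \<tau>"
    and f: "convex_cone \<sigma>" "cone_face \<tau> \<sigma>"
  shows "v' - v \<in> span \<tau>"
proof -
  have "v' \<in> {u + of_int k *\<^sub>R v | u k. u \<in> N \<inter> span \<tau>}"
    using v(1) v'(1) unfolding is_normal_vec_def by simp
  then obtain u and k :: int where u: "v' = u + of_int k *\<^sub>R v" "u \<in> span \<tau>" by blast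
  have "v \<in> {u + of_int k *\<^sub>R v' | u k. u \<in> N \<inter> span \<tau>}"
    using v(1) v'(1) unfolding is_normal_vec_def by simp
  then obtain u' and k' :: int where u': "v = u' + of_int k' *\<^sub>R v'" "u' \<in> span \<tau>" by blast
  have "k * k' = 1"
  proof (rule ccontr)
    assume ne: "k * k' \<noteq> 1"
    define r where "r = (1 - of_int k * of_int k' :: real)"
    have "r \<noteq> 0" using ne unfolding r_def by (metis of_int_1 of_int_eq_iff of_int_mult right_minus_eq)
    have "u + of_int k *\<^sub>R u' \<in> span \<tau>" using u(2) u'(2) by (intro span_add span_scale)
    moreover have "u + of_int k *\<^sub>R u' = r *\<^sub>R v'"
    proof -
      have "v' = u + of_int k *\<^sub>R (u' + of_int k' *\<^sub>R v')" using u(1) u'(1) by simp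
      then show ?thesis unfolding r_def by (simp add: algebra_simps)
    qed
    ultimately have "r *\<^sub>R v' \<in> span \<tau>" by simp
    then have "(1/r) *\<^sub>R (r *\<^sub>R v') \<in> span \<tau>" by (rule span_scale)
    then show False using v'(2) \<open>r \<noteq> 0\<close> by simp
  qed
  then consider "k = 1" | "k = -1" using zmult_eq_1_iff by blast
  then show ?thesis
  proof cases
    case 1
    then show ?thesis using u by simp
  next
    case 2
    obtain x y where x: "x \<in> \<sigma>" "y \<in> span \<tau>" "v = x + y" using v(1) unfolding is_normal_vec_def by blast
    obtain x' y' where x': "x' \<in> \<sigma>" "y' \<in> span \<tau>" "v' = x' + y'" using v'(1) unfolding is_normal_vec_def by blast
    have "x + x' = u - y - y'" using 2 u(1) x(3) x'(3) by (simp add: algebra_simps)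
    then have "x + x' \<in> span \<tau>" using u(2) x(2) x'(2) by (simp add: span_diff)
    then have "x + x' \<in> \<tau>" using cone_face_Int_span[OF f] x x' f(1) by (simp add: convex_cone_add)
    then have "x \<in> \<tau>" using cone_faceD[OF f] x x' by blast
    then have "v \<in> span \<tau>" using x by (simp add: span_add span_base)
    then show ?thesis using v(2) by simp
  qed
qed

section \<open>Local div-faithfulness\<close>

lemma tropical_fan_lattice: "tropical_fan X \<Longrightarrow> is_lattice (tf_lattice X)"
  and tropical_fan_finite: "tropical_fan X \<Longrightarrow> finite (tf_cones X)"
  and tropical_fan_cone: "tropical_fan X \<Longrightarrow> \<sigma> \<in> tf_cones X \<Longrightarrow> rational_cone (tf_lattice X) \<sigma>"
  and tropical_fan_face: "tropical_fan X \<Longrightarrow> \<sigma> \<in> tf_cones X \<Longrightarrow> cone_face \<tau> \<sigma> \<Longrightarrow> \<tau> \<in> tf_cones X"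
  and tropical_fan_Int: "tropical_fan X \<Longrightarrow> \<sigma> \<in> tf_cones X \<Longrightarrow> \<tau> \<in> tf_cones X \<Longrightarrow> cone_face (\<sigma> \<inter> \<tau>) \<sigma>"
  and tropical_fan_orient: "tropical_fan X \<Longrightarrow> \<sigma> \<in> facets X \<Longrightarrow> tf_orient X \<sigma> \<noteq> 0"
  and tropical_fan_dim: "tropical_fan X \<Longrightarrow> \<sigma> \<in> facets X \<Longrightarrow> dim \<sigma> = fan_dim X"
  and tropical_fan_nonempty: "tropical_fan X \<Longrightarrow> tf_cones X \<noteq> {}"
  unfolding tropical_fan_def rational_fan_def by blast+

lemma tropical_fan_convex: "tropical_fan X \<Longrightarrow> \<sigma> \<in> tf_cones X \<Longrightarrow> convex_cone \<sigma>"
  using tropical_fan_cone rational_cone_convex by blast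

lemma tropical_fan_zero: "tropical_fan X \<Longrightarrow> \<sigma> \<in> tf_cones X \<Longrightarrow> 0 \<in> \<sigma>"
  using tropical_fan_cone rational_cone_zero by blast

lemma tropical_fan_subset_face:
  "tropical_fan X \<Longrightarrow> \<sigma> \<in> tf_cones X \<Longrightarrow> \<tau> \<in> tf_cones X \<Longrightarrow> \<tau> \<subseteq> \<sigma> \<Longrightarrow> cone_face \<tau> \<sigma>"
  using tropical_fan_Int[of X \<sigma> \<tau>] by (simp add: Int_absorb1)

lemma tropical_fan_Int_cone:
  "tropical_fan X \<Longrightarrow> \<sigma> \<in> tf_cones X \<Longrightarrow> \<tau> \<in> tf_cones X \<Longrightarrow> \<sigma> \<inter> \<tau> \<in> tf_cones X"
  using tropical_fan_Int tropical_fan_face by blast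

lemma tropical_fan_finite_span:
  assumes "tropical_fan X" "\<sigma> \<in> tf_cones X"
  obtains F where "finite F" "\<sigma> \<subseteq> span F"
  using rational_coneE[OF tropical_fan_cone[OF assms]] by (metis span_superset)

lemma tropical_fan_eq_if_span:
  assumes "tropical_fan X" "\<sigma> \<in> tf_cones X" "\<tau> \<in> tf_cones X" "\<tau> \<subseteq> \<sigma>" "\<sigma> \<subseteq> span \<tau>"
  shows "\<tau> = \<sigma>"
  using cone_face_eq_if_span tropical_fan_convex tropical_fan_subset_face assms by blast

lemma tropical_fan_dim_mono:
  assumes "tropical_fan X" "\<sigma> \<in> tf_cones X" "\<tau> \<subseteq> span \<sigma>"
  shows "dim \<tau> \<le> dim \<sigma>"
proof -
  obtain F where "finite F" "\<sigma> \<subseteq> span F" using tropical_fan_finite_span[OF assms(1,2)] by blast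
  then show ?thesis using dim_le_finite_span assms(3) by blast
qed

lemma tropical_fan_span_eq_if_dim:
  assumes "tropical_fan X" "\<sigma> \<in> tf_cones X" "\<tau> \<subseteq> span \<sigma>" "dim \<sigma> \<le> dim \<tau>"
  shows "span \<tau> = span \<sigma>"
proof -
  obtain F where "finite F" "\<sigma> \<subseteq> span F" using tropical_fan_finite_span[OF assms(1,2)] by blast
  then show ?thesis using span_eq_if_dim_le assms(3,4) by blast
qed

lemma tropical_fan_eq_if_dim:
  assumes "tropical_fan X" "\<sigma> \<in> tf_cones X" "\<tau> \<in> tf_cones X" "\<tau> \<subseteq> \<sigma>" "dim \<sigma> \<le> dim \<tau>"
  shows "\<tau> = \<sigma>"
proof -
  have "\<tau> \<subseteq> span \<sigma>" using assms(4) span_superset by blast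
  then have "span \<tau> = span \<sigma>" using tropical_fan_span_eq_if_dim[OF assms(1,2) _ assms(5)] by blast
  then have "\<sigma> \<subseteq> span \<tau>" using span_superset[of \<sigma>] by simp
  then show ?thesis using tropical_fan_eq_if_span[OF assms(1-4)] by blast
qed

lemma facets_subset: "\<sigma> \<in> facets X \<Longrightarrow> \<sigma> \<in> tf_cones X"
  unfolding facets_def by blast

lemma facets_maximal: "\<sigma> \<in> facets X \<Longrightarrow> \<tau> \<in> tf_cones X \<Longrightarrow> \<sigma> \<subseteq> \<tau> \<Longrightarrow> \<tau> = \<sigma>"
  unfolding facets_def by blast

lemma facet_above:
  assumes "tropical_fan X" "\<sigma> \<in> tf_cones X"
  obtains F where "F \<in> facets X" "\<sigma> \<subseteq> F"
proof -
  obtain F where F: "F \<in> tf_cones X" "\<sigma> \<subseteq> F" "\<forall>\<tau>\<in>tf_cones X. F \<subseteq> \<tau> \<longrightarrow> F = \<tau>"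
    using finite_has_maximal2[OF tropical_fan_finite[OF assms(1)] assms(2)] by blast
  then show ?thesis using that[of F] unfolding facets_def by blast
qed

lemma k_cones_fan_dim:
  assumes "tropical_fan X"
  shows "k_cones (tf_cones X) (fan_dim X) = facets X"
proof (intro equalityI subsetI)
  fix \<sigma> assume "\<sigma> \<in> k_cones (tf_cones X) (fan_dim X)"
  then have s: "\<sigma> \<in> tf_cones X" "dim \<sigma> = fan_dim X" unfolding k_cones_def by auto
  obtain F where F: "F \<in> facets X" "\<sigma> \<subseteq> F" using facet_above[OF assms s(1)] by blast
  then have "dim F \<le> dim \<sigma>" using tropical_fan_dim[OF assms] s by simp
  then have "\<sigma> = F" using tropical_fan_eq_if_dim[OF assms facets_subset[OF F(1)] s(1) F(2)] by blast
  then show "\<sigma> \<in> facets X" using F by simp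
next
  fix \<sigma> assume "\<sigma> \<in> facets X"
  then show "\<sigma> \<in> k_cones (tf_cones X) (fan_dim X)"
    using facets_subset tropical_fan_dim[OF assms] unfolding k_cones_def by blast
qed

section \<open>Walls and the balancing condition\<close>

definition walls :: "'a::real_vector tfan \<Rightarrow> 'a set set" where
  "walls X = {\<tau> \<in> tf_cones X. dim \<tau> + 1 = fan_dim X}"

definition wall_facets :: "'a tfan \<Rightarrow> 'a set \<Rightarrow> 'a set set" where
  "wall_facets X \<tau> = {\<sigma> \<in> facets X. \<tau> \<subseteq> \<sigma>}"

lemma walls_subset: "\<tau> \<in> walls X \<Longrightarrow> \<tau> \<in> tf_cones X"
  unfolding walls_def by blast

lemma wall_facetsD:
  assumes "\<sigma> \<in> wall_facets X \<tau>"
  shows "\<sigma> \<in> facets X" "\<sigma> \<in> tf_cones X" "\<tau> \<subseteq> \<sigma>"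
  using assms facets_subset unfolding wall_facets_def by auto

lemma finite_wall_facets: "tropical_fan X \<Longrightarrow> finite (wall_facets X \<tau>)"
  by (rule finite_subset[OF _ tropical_fan_finite[of X]]) (use wall_facetsD in auto)

lemma wall_iff_codim1:
  assumes "tropical_fan X" "\<sigma> \<in> facets X" "\<tau> \<in> tf_cones X" "\<tau> \<subseteq> \<sigma>"
  shows "\<tau> \<in> walls X \<longleftrightarrow> codim1 \<tau> \<sigma>"
proof -
  obtain F where "finite F" "\<sigma> \<subseteq> span F"
    using tropical_fan_finite_span[OF assms(1) facets_subset[OF assms(2)]] by blast
  then have "codim1 \<tau> \<sigma> \<longleftrightarrow> dim \<sigma> = dim \<tau> + 1" using codim1_iff_dim assms(4) by blast
  then show ?thesis using tropical_fan_dim[OF assms(1,2)] assms(3) unfolding walls_def by auto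
qed

lemma wall_codim1:
  assumes "tropical_fan X" "\<tau> \<in> walls X" "\<sigma> \<in> wall_facets X \<tau>"
  shows "codim1 \<tau> \<sigma>" "\<not> \<sigma> \<subseteq> span \<tau>"
  using wall_iff_codim1[OF assms(1) wall_facetsD(1)[OF assms(3)] walls_subset[OF assms(2)] wall_facetsD(3)[OF assms(3)]]
    assms(2) unfolding codim1_def by auto

lemma wall_normal_ex:
  assumes "tropical_fan X" "\<tau> \<in> walls X" "\<sigma> \<in> wall_facets X \<tau>"
  shows "\<exists>v. is_normal_vec (tf_lattice X) \<sigma> \<tau> v"
  using normal_vec_ex[OF tropical_fan_lattice[OF assms(1)] tropical_fan_cone[OF assms(1)]
      tropical_fan_cone[OF assms(1)] wall_codim1(1)[OF assms]]
    wall_facetsD(2)[OF assms(3)] walls_subset[OF assms(2)] by blast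

lemma wall_normal_notin:
  assumes "tropical_fan X" "\<tau> \<in> walls X" "\<sigma> \<in> wall_facets X \<tau>" "is_normal_vec (tf_lattice X) \<sigma> \<tau> v"
  shows "v \<notin> span \<tau>"
  using normal_vec_notin[OF assms(4) tropical_fan_cone[OF assms(1) wall_facetsD(2)[OF assms(3)]] wall_codim1(2)[OF assms(1-3)]] .

lemma wall_normal_diff:
  assumes "tropical_fan X" "\<tau> \<in> walls X" "\<sigma> \<in> wall_facets X \<tau>"
    "is_normal_vec (tf_lattice X) \<sigma> \<tau> v" "is_normal_vec (tf_lattice X) \<sigma> \<tau> w"
  shows "w - v \<in> span \<tau>"
proof -
  note s = wall_facetsD[OF assms(3)]
  show ?thesis
    using normal_vec_diff[OF assms(4) wall_normal_notin[OF assms(1-4)] assms(5) wall_normal_notin[OF assms(1-3,5)]]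
      tropical_fan_convex[OF assms(1) s(2)] tropical_fan_subset_face[OF assms(1) s(2) walls_subset[OF assms(2)] s(3)]
    by blast
qed

text \<open>Two choices of normal vectors differ by elements of \<open>span \<tau>\<close>, so the
  condition of \<open>minkowski_weights\<close>, made for \<open>normal_vec\<close>, holds modulo
  \<open>span \<tau>\<close> for every choice.\<close>

lemma wall_balance:
  assumes "tropical_fan X" "\<tau> \<in> walls X" "\<And>\<sigma>. \<sigma> \<in> wall_facets X \<tau> \<Longrightarrow> is_normal_vec (tf_lattice X) \<sigma> \<tau> (n \<sigma>)"
  shows "(\<Sum>\<sigma>\<in>wall_facets X \<tau>. of_int (tf_orient X \<sigma>) *\<^sub>R n \<sigma>) \<in> span \<tau>"
proof -
  let ?m = "\<lambda>\<sigma>. normal_vec (tf_lattice X) \<sigma> \<tau>"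
  have m: "is_normal_vec (tf_lattice X) \<sigma> \<tau> (?m \<sigma>)" if "\<sigma> \<in> wall_facets X \<tau>" for \<sigma>
    unfolding normal_vec_def by (rule someI_ex[OF wall_normal_ex[OF assms(1,2) that]])
  have "tf_orient X \<in> minkowski_weights (tf_lattice X) (tf_cones X) (fan_dim X)"
    using assms(1) unfolding tropical_fan_def by blast
  then have b: "(\<Sum>\<sigma>\<in>wall_facets X \<tau>. of_int (tf_orient X \<sigma>) *\<^sub>R ?m \<sigma>) \<in> span \<tau>"
    using assms(2) unfolding minkowski_weights_def walls_def k_cones_fan_dim[OF assms(1)] wall_facets_def by blast
  have "(\<Sum>\<sigma>\<in>wall_facets X \<tau>. of_int (tf_orient X \<sigma>) *\<^sub>R (n \<sigma> - ?m \<sigma>)) \<in> span \<tau>"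
    using wall_normal_diff[OF assms(1,2) _ m assms(3)] by (intro span_sum span_scale) blast
  from span_add[OF b this] show ?thesis
    by (simp flip: sum.distrib scaleR_add_right)
qed

section \<open>The local condition at a point\<close>

definition integral_linear_on :: "'a::real_vector set \<Rightarrow> 'a set \<Rightarrow> ('a \<Rightarrow> real) \<Rightarrow> bool" where
  "integral_linear_on N \<sigma> f \<longleftrightarrow>
     (\<exists>l. linear l \<and> l ` (N \<inter> span \<sigma>) \<subseteq> \<int> \<and> (\<forall>x\<in>\<sigma>. f x = l x))"

text \<open>
  This is \<^term>\<open>ord_at X f \<tau> = 0\<close>, freed from the choices of normal vectors and of the linear forms.
  Subtracting \<open>L\<close> makes each summand depend on the class of the normal vector modulo \<open>span \<tau>\<close> only.
\<close>

definition balanced_at :: "'a::real_vector tfan \<Rightarrow> ('a \<Rightarrow> real) \<Rightarrow> 'a set \<Rightarrow> bool" where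
  "balanced_at X f \<tau> \<longleftrightarrow> (\<forall>n l L.
     (\<forall>\<sigma>\<in>wall_facets X \<tau>. is_normal_vec (tf_lattice X) \<sigma> \<tau> (n \<sigma>) \<and> linear (l \<sigma>) \<and> (\<forall>x\<in>\<sigma>. f x = l \<sigma> x)) \<longrightarrow>
     linear L \<longrightarrow> (\<forall>x\<in>\<tau>. f x = L x) \<longrightarrow>
     (\<Sum>\<sigma>\<in>wall_facets X \<tau>. of_int (tf_orient X \<sigma>) * (l \<sigma> (n \<sigma>) - L (n \<sigma>))) = 0)"

text \<open>Only the cones through \<open>p\<close> count, but each as a whole: modulo the span of
  the smallest one they are the star fan there. Continuity is left to
  \<open>continuous_on_piecewise_linear\<close>, and \<open>m\<close> carries no integrality, as in
  \<open>linear_on_fan\<close>.\<close>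

definition div_faithful_near :: "'a::real_vector tfan \<Rightarrow> 'a \<Rightarrow> bool" where
  "div_faithful_near X p \<longleftrightarrow> (\<forall>f.
     (\<forall>\<sigma>\<in>tf_cones X. p \<in> \<sigma> \<longrightarrow> integral_linear_on (tf_lattice X) \<sigma> f) \<longrightarrow>
     (\<forall>\<tau>\<in>walls X. p \<in> \<tau> \<longrightarrow> balanced_at X f \<tau>) \<longrightarrow>
     (\<exists>m. linear m \<and> (\<forall>\<sigma>\<in>tf_cones X. p \<in> \<sigma> \<longrightarrow> (\<forall>x\<in>\<sigma>. f x = m x))))"

lemma linear_eq_on_span: "linear l \<Longrightarrow> linear m \<Longrightarrow> (\<And>x. x \<in> S \<Longrightarrow> l x = m x) \<Longrightarrow> x \<in> span S \<Longrightarrow> l x = m x"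
  for l m :: "'a::real_vector \<Rightarrow> 'b::real_vector"
  using linear_eq_on by blast

lemma balanced_atD:
  assumes "balanced_at X f \<tau>"
    "\<And>\<sigma>. \<sigma> \<in> wall_facets X \<tau> \<Longrightarrow> is_normal_vec (tf_lattice X) \<sigma> \<tau> (n \<sigma>)"
    "\<And>\<sigma>. \<sigma> \<in> wall_facets X \<tau> \<Longrightarrow> linear (l \<sigma>)"
    "\<And>\<sigma> x. \<sigma> \<in> wall_facets X \<tau> \<Longrightarrow> x \<in> \<sigma> \<Longrightarrow> f x = l \<sigma> x"
    "linear L" "\<And>x. x \<in> \<tau> \<Longrightarrow> f x = L x"
  shows "(\<Sum>\<sigma>\<in>wall_facets X \<tau>. of_int (tf_orient X \<sigma>) * (l \<sigma> (n \<sigma>) - L (n \<sigma>))) = 0"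
  using assms unfolding balanced_at_def by blast

text \<open>One choice decides. Replacing \<open>n\<close> moves it inside
  \<open>span \<tau>\<close>, where the forms agree; replacing \<open>L\<close> changes the sum by
  the value of \<open>L - L'\<close> at the weighted sum of the normal vectors, which lies in
  \<open>span \<tau>\<close> because the fan is balanced, and there \<open>L\<close> and
  \<open>L'\<close> agree.\<close>

lemma balanced_atI:
  assumes X: "tropical_fan X" and \<tau>: "\<tau> \<in> walls X"
    and n: "\<And>\<sigma>. \<sigma> \<in> wall_facets X \<tau> \<Longrightarrow> is_normal_vec (tf_lattice X) \<sigma> \<tau> (n \<sigma>)"
    and l: "\<And>\<sigma>. \<sigma> \<in> wall_facets X \<tau> \<Longrightarrow> linear (l \<sigma>)"
      "\<And>\<sigma> x. \<sigma> \<in> wall_facets X \<tau> \<Longrightarrow> x \<in> \<sigma> \<Longrightarrow> f x = l \<sigma> x"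
    and L: "linear L" "\<And>x. x \<in> \<tau> \<Longrightarrow> f x = L x"
    and s: "(\<Sum>\<sigma>\<in>wall_facets X \<tau>. of_int (tf_orient X \<sigma>) * (l \<sigma> (n \<sigma>) - L (n \<sigma>))) = 0"
  shows "balanced_at X f \<tau>"
  unfolding balanced_at_def
proof (intro allI impI)
  fix n' l' L'
  assume nl: "\<forall>\<sigma>\<in>wall_facets X \<tau>. is_normal_vec (tf_lattice X) \<sigma> \<tau> (n' \<sigma>) \<and> linear (l' \<sigma>) \<and> (\<forall>x\<in>\<sigma>. f x = l' \<sigma> x)"
    and L': "linear L'" "\<forall>x\<in>\<tau>. f x = L' x"
  let ?\<omega> = "\<lambda>\<sigma>. real_of_int (tf_orient X \<sigma>)"
  have LL: "L x = L' x" if "x \<in> span \<tau>" for x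
    using linear_eq_on_span[OF L(1) L'(1) _ that] L(2) L'(2) by auto
  have 1: "l' \<sigma> (n' \<sigma>) - L' (n' \<sigma>) = (l \<sigma> (n \<sigma>) - L (n \<sigma>)) + (L (n \<sigma>) - L' (n \<sigma>))"
    if \<sigma>: "\<sigma> \<in> wall_facets X \<tau>" for \<sigma>
  proof -
    have d: "n' \<sigma> - n \<sigma> \<in> span \<tau>" using wall_normal_diff[OF X \<tau> \<sigma> n[OF \<sigma>]] nl \<sigma> by blast
    have ll: "l' \<sigma> x = l \<sigma> x" if "x \<in> span \<sigma>" for x
      using linear_eq_on_span[of "l' \<sigma>" "l \<sigma>", OF _ l(1)[OF \<sigma>] _ that] l(2)[OF \<sigma>] nl \<sigma> by auto
    have "n' \<sigma> \<in> span \<sigma>" using nl \<sigma> unfolding is_normal_vec_def by blast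
    then have "l' \<sigma> (n' \<sigma>) = l \<sigma> (n' \<sigma>)" by (rule ll)
    moreover have "l \<sigma> (n' \<sigma> - n \<sigma>) = L' (n' \<sigma> - n \<sigma>)"
      using linear_eq_on_span[OF l(1)[OF \<sigma>] L'(1) _ d] l(2)[OF \<sigma>] L'(2) wall_facetsD(3)[OF \<sigma>] by (metis subsetD)
    ultimately show ?thesis using l(1)[OF \<sigma>] L'(1) by (simp add: linear_diff)
  qed
  have "(\<Sum>\<sigma>\<in>wall_facets X \<tau>. ?\<omega> \<sigma> * (l' \<sigma> (n' \<sigma>) - L' (n' \<sigma>)))
     = (\<Sum>\<sigma>\<in>wall_facets X \<tau>. ?\<omega> \<sigma> * (l \<sigma> (n \<sigma>) - L (n \<sigma>))) + (\<Sum>\<sigma>\<in>wall_facets X \<tau>. ?\<omega> \<sigma> * (L (n \<sigma>) - L' (n \<sigma>)))"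
    unfolding sum.distrib[symmetric] by (intro sum.cong refl) (simp only: 1 distrib_left)
  also have "(\<Sum>\<sigma>\<in>wall_facets X \<tau>. ?\<omega> \<sigma> * (L (n \<sigma>) - L' (n \<sigma>)))
     = L (\<Sum>\<sigma>\<in>wall_facets X \<tau>. ?\<omega> \<sigma> *\<^sub>R n \<sigma>) - L' (\<Sum>\<sigma>\<in>wall_facets X \<tau>. ?\<omega> \<sigma> *\<^sub>R n \<sigma>)"
    using L(1) L'(1) by (simp add: linear_sum linear_scale right_diff_distrib sum_subtractf)
  also have "\<dots> = 0" using LL[OF wall_balance[OF X \<tau> n]] by simp
  finally show "(\<Sum>\<sigma>\<in>wall_facets X \<tau>. ?\<omega> \<sigma> * (l' \<sigma> (n' \<sigma>) - L' (n' \<sigma>))) = 0" using s by simp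
qed

lemma fan_minimal_cone:
  assumes X: "tropical_fan X" and p: "p \<in> support X"
  obtains \<eta> where "\<eta> \<in> tf_cones X" "\<And>\<zeta>. \<zeta> \<in> tf_cones X \<Longrightarrow> p \<in> \<zeta> \<longleftrightarrow> \<eta> \<subseteq> \<zeta>"
proof -
  obtain \<sigma> where \<sigma>: "\<sigma> \<in> {\<zeta> \<in> tf_cones X. p \<in> \<zeta>}" using p unfolding support_def by blast
  have "finite {\<zeta> \<in> tf_cones X. p \<in> \<zeta>}" using tropical_fan_finite[OF X] by simp
  from finite_has_minimal2[OF this \<sigma>] obtain \<eta> where \<eta>: "\<eta> \<in> tf_cones X" "p \<in> \<eta>"
    "\<And>\<zeta>. \<zeta> \<in> tf_cones X \<Longrightarrow> p \<in> \<zeta> \<Longrightarrow> \<zeta> \<subseteq> \<eta> \<Longrightarrow> \<eta> = \<zeta>" by auto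
  have "\<eta> \<subseteq> \<zeta>" if "\<zeta> \<in> tf_cones X" "p \<in> \<zeta>" for \<zeta>
    using \<eta>(3)[OF tropical_fan_Int_cone[OF X \<eta>(1) that(1)]] \<eta>(2) that(2) by blast
  then show ?thesis using that \<eta>(1,2) by blast
qed

text \<open>A point of \<open>\<eta>\<close> off the spans of all smaller cones inside
  \<open>\<eta>\<close> lies in no cone that meets \<open>\<eta>\<close> properly. So every cone is
  the smallest one through some point, which lets conditions at cones be tested at points.\<close>

lemma fan_generic_point:
  assumes X: "tropical_fan X" and \<eta>: "\<eta> \<in> tf_cones X"
  obtains p where "p \<in> \<eta>" "\<And>\<zeta>. \<zeta> \<in> tf_cones X \<Longrightarrow> p \<in> \<zeta> \<longleftrightarrow> \<eta> \<subseteq> \<zeta>"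
proof -
  define \<W> where "\<W> = span ` {\<zeta> \<in> tf_cones X. \<zeta> \<subseteq> \<eta> \<and> \<zeta> \<noteq> \<eta>}"
  have "finite \<W>" using tropical_fan_finite[OF X] unfolding \<W>_def by simp
  moreover have "\<not> \<eta> \<subseteq> W" if "W \<in> \<W>" for W
    using tropical_fan_eq_if_span[OF X \<eta>] that unfolding \<W>_def by blast
  ultimately obtain p where p: "p \<in> \<eta>" "\<And>W. W \<in> \<W> \<Longrightarrow> p \<notin> W"
    using generic_point[OF tropical_fan_convex[OF X \<eta>], of \<W>] unfolding \<W>_def by blast
  have "\<eta> \<subseteq> \<zeta>" if "\<zeta> \<in> tf_cones X" "p \<in> \<zeta>" for \<zeta>
  proof (rule ccontr)
    assume "\<not> \<eta> \<subseteq> \<zeta>"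
    then have "span (\<eta> \<inter> \<zeta>) \<in> \<W>"
      using tropical_fan_Int_cone[OF X \<eta> that(1)] unfolding \<W>_def by blast
    then show False using p that(2) span_base by blast
  qed
  then show ?thesis using that p(1) by blast
qed

section \<open>Finitely generated cones in normed spaces\<close>

text \<open>Half of an induction on \<open>B\<close>: bounded forms make the coordinates of a
  convergent sequence Cauchy, so its limit stays in the span. The other half,
  \<open>linear_bounded_on_finite_span\<close>, uses closedness for \<open>B\<close> to bound forms
  for one vector more.\<close>

lemma closed_span_if_bounded_forms:
  fixes B :: "'a::real_normed_vector set"
  assumes B: "finite B" "independent B"
    and bd: "\<And>l :: 'a \<Rightarrow> real. linear l \<Longrightarrow> \<exists>M. \<forall>x\<in>span B. \<bar>l x\<bar> \<le> M * norm x"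
  shows "closed (span B)"
  unfolding closed_sequential_limits
proof (intro allI impI, elim conjE)
  fix x :: "nat \<Rightarrow> 'a" and y assume x: "\<forall>n. x n \<in> span B" and lim: "x \<longlonglongrightarrow> y"
  have "\<exists>c. linear c \<and> (\<forall>b'\<in>B. c b' = (if b' = b then 1 else 0 :: real))" for b
    by (rule linear_independent_extend[OF B(2)])
  then obtain c where c: "\<And>b. linear (c b)"
    "\<And>b b'. b' \<in> B \<Longrightarrow> c b b' = (if b' = b then 1 else 0 :: real)"
    by metis
  have coords: "z = (\<Sum>b\<in>B. c b z *\<^sub>R b)" if z: "z \<in> span B" for z
  proof -
    have lin: "linear (\<lambda>z. \<Sum>b\<in>B. c b z *\<^sub>R b)"
      by (rule linearI)
        (simp_all add: linear_add[OF c(1)] linear_scale[OF c(1)] scaleR_left_distrib sum.distrib scaleR_sum_right)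
    have "(\<Sum>b\<in>B. c b z *\<^sub>R b) = z" if "z \<in> B" for z
    proof -
      have "(\<Sum>b\<in>B. c b z *\<^sub>R b) = (\<Sum>b\<in>B. if b = z then b else 0)"
        using c(2)[OF that] by (intro sum.cong) auto
      then show ?thesis using that B(1) by simp
    qed
    then show ?thesis using linear_eq_on_span[OF linear_ident lin _ z] by simp
  qed
  have "convergent (\<lambda>n. c b (x n))" for b
  proof -
    obtain M where M: "\<And>z. z \<in> span B \<Longrightarrow> \<bar>c b z\<bar> \<le> M * norm z" using bd[OF c(1)] by blast
    have "Cauchy (\<lambda>n. c b (x n))"
    proof (rule metric_CauchyI)
      fix e :: real assume "e > 0"
      define K where "K = max M 1"
      have K: "K > 0" "M \<le> K" unfolding K_def by auto
      have "Cauchy x" using lim LIMSEQ_imp_Cauchy by blast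
      then obtain n0 where n0: "\<And>m n. m \<ge> n0 \<Longrightarrow> n \<ge> n0 \<Longrightarrow> dist (x m) (x n) < e / K"
        using metric_CauchyD[of x "e / K"] \<open>e > 0\<close> K by auto
      have "dist (c b (x m)) (c b (x n)) < e" if "m \<ge> n0" "n \<ge> n0" for m n
      proof -
        have "dist (c b (x m)) (c b (x n)) = \<bar>c b (x m - x n)\<bar>"
          by (simp add: dist_real_def linear_diff[OF c(1)])
        also have "\<dots> \<le> M * norm (x m - x n)" using x by (intro M span_diff) auto
        also have "\<dots> \<le> K * norm (x m - x n)" using K by (intro mult_right_mono) auto
        also have "\<dots> < K * (e / K)" using n0[OF that] K by (intro mult_strict_left_mono) (auto simp: dist_norm)
        also have "\<dots> = e" using K by simp
        finally show ?thesis .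
      qed
      then show "\<exists>M. \<forall>m\<ge>M. \<forall>n\<ge>M. dist (c b (x m)) (c b (x n)) < e" by blast
    qed
    then show ?thesis by (simp add: Cauchy_convergent_iff)
  qed
  then have "\<exists>d. (\<lambda>n. c b (x n)) \<longlonglongrightarrow> d" for b unfolding convergent_def by blast
  then obtain d where d: "\<And>b. (\<lambda>n. c b (x n)) \<longlonglongrightarrow> d b" by metis
  have "(\<lambda>n. \<Sum>b\<in>B. c b (x n) *\<^sub>R b) \<longlonglongrightarrow> (\<Sum>b\<in>B. d b *\<^sub>R b)"
    by (intro tendsto_sum tendsto_scaleR d tendsto_const)
  moreover have "(\<lambda>n. \<Sum>b\<in>B. c b (x n) *\<^sub>R b) = x" using coords x by (intro ext) metis
  ultimately have "y = (\<Sum>b\<in>B. d b *\<^sub>R b)" using lim LIMSEQ_unique by metis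
  then show "y \<in> span B" by (simp add: span_sum span_scale span_base)
qed

lemma linear_bounded_on_finite_span:
  fixes B :: "'a::real_normed_vector set" and l :: "'a \<Rightarrow> real"
  assumes "finite B" "independent B" "linear l"
  shows "\<exists>M. \<forall>x\<in>span B. \<bar>l x\<bar> \<le> M * norm x"
  using assms
proof (induction B arbitrary: l rule: finite_induct)
  case empty
  then show ?case by (simp add: linear_0)
next
  case (insert b B)
  have indB: "independent B" and bB: "b \<notin> span B"
    using insert.prems(1) insert.hyps(2) independent_insert[of b B] by auto
  have "closed (span B)"
    by (rule closed_span_if_bounded_forms[OF insert.hyps(1) indB insert.IH[OF indB]])
  then have "open (- span B)" by (rule open_Compl)
  moreover have "b \<in> - span B" using bB by simp
  \<comment> \<open>A lower bound \<open>\<delta>\<close> for the distance of \<open>b\<close> from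
    the closed span bounds the coefficient of \<open>b\<close> in any \<open>x\<close> by
    \<open>norm x / \<delta>\<close>.\<close>
  ultimately obtain \<delta> where \<delta>: "\<delta> > 0" "ball b \<delta> \<subseteq> - span B" by (meson openE)
  obtain M0 where M0: "\<And>x. x \<in> span B \<Longrightarrow> \<bar>l x\<bar> \<le> M0 * norm x"
    using insert.IH[OF indB insert.prems(2)] by blast
  define M where "M = max M0 0"
  have M: "\<bar>l x\<bar> \<le> M * norm x" "0 \<le> M" if "x \<in> span B" for x
  proof -
    have "M0 * norm x \<le> M * norm x" unfolding M_def by (intro mult_right_mono) auto
    then show "\<bar>l x\<bar> \<le> M * norm x" using M0[OF that] by simp
  qed (simp add: M_def)
  have M_nonneg: "0 \<le> M" by (simp add: M_def)
  have "\<bar>l x\<bar> \<le> (M + (M * norm b + \<bar>l b\<bar>) / \<delta>) * norm x" if x: "x \<in> span (insert b B)" for x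
  proof -
    obtain k where k: "x - k *\<^sub>R b \<in> span B" using x unfolding span_insert by blast
    define y where "y = x - k *\<^sub>R b"
    have ky: "\<bar>k\<bar> * \<delta> \<le> norm x"
    proof (cases "k = 0")
      case False
      have "(- (1 / k)) *\<^sub>R y \<in> span B" using k unfolding y_def by (rule span_scale)
      then have "\<delta> \<le> dist b ((- (1 / k)) *\<^sub>R y)" using \<delta>(2) by (meson ComplD mem_ball not_le subsetD)
      also have "\<dots> = norm ((1 / k) *\<^sub>R x)" unfolding dist_norm y_def using False by (simp add: algebra_simps)
      also have "\<dots> = norm x / \<bar>k\<bar>" by simp
      finally show ?thesis using False by (simp add: field_simps)
    qed simp
    have "l x = l y + k * l b"
      unfolding y_def using insert.prems(2) by (simp add: linear_diff linear_scale)
    then have "\<bar>l x\<bar> \<le> \<bar>l y\<bar> + \<bar>k\<bar> * \<bar>l b\<bar>" by (metis abs_mult abs_triangle_ineq)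
    also have "\<bar>l y\<bar> \<le> M * norm y" using M(1)[of y] k unfolding y_def by blast
    also have "norm y \<le> norm x + \<bar>k\<bar> * norm b" unfolding y_def by (metis norm_scaleR norm_triangle_ineq4)
    finally have "\<bar>l x\<bar> \<le> M * (norm x + \<bar>k\<bar> * norm b) + \<bar>k\<bar> * \<bar>l b\<bar>"
      using M_nonneg by (simp add: mult_left_mono)
    also have "\<dots> = M * norm x + \<bar>k\<bar> * (M * norm b + \<bar>l b\<bar>)" by (simp add: algebra_simps)
    also have "\<dots> \<le> M * norm x + norm x / \<delta> * (M * norm b + \<bar>l b\<bar>)"
      using ky \<delta>(1) M_nonneg by (intro add_left_mono mult_right_mono) (auto simp: field_simps)
    also have "\<dots> = (M + (M * norm b + \<bar>l b\<bar>) / \<delta>) * norm x" by (simp add: algebra_simps add_divide_distrib)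
    finally show ?thesis .
  qed
  then show ?case by blast
qed

lemma
  fixes F :: "'a::real_normed_vector set"
  assumes "finite F"
  shows closed_finite_span: "closed (span F)"
    and linear_continuous_on_finite_span: "linear (l :: 'a \<Rightarrow> real) \<Longrightarrow> continuous_on (span F) l"
proof -
  obtain B where B: "finite B" "independent B" "span B = span F"
    using finite_basis_of[OF assms span_superset] by metis
  show "closed (span F)"
    using closed_span_if_bounded_forms[OF B(1,2)] linear_bounded_on_finite_span[OF B(1,2)] B(3) by metis
  assume l: "linear l"
  obtain M0 where M0: "\<And>x. x \<in> span F \<Longrightarrow> \<bar>l x\<bar> \<le> M0 * norm x"
    using linear_bounded_on_finite_span[OF B(1,2) l] B(3) by auto
  define M where "M = max M0 1"
  have M: "\<bar>l x\<bar> \<le> M * norm x" if "x \<in> span F" for x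
  proof -
    have "M0 * norm x \<le> M * norm x" unfolding M_def by (intro mult_right_mono) auto
    then show "\<bar>l x\<bar> \<le> M * norm x" using M0[OF that] by simp
  qed
  have "M > 0" by (simp add: M_def)
  show "continuous_on (span F) l"
  proof (rule continuous_onI)
    fix x and e :: real assume x: "x \<in> span F" "e > 0"
    have "dist (l x') (l x) \<le> e" if x': "x' \<in> span F" "dist x' x < e / M" for x'
    proof -
      have "dist (l x') (l x) = \<bar>l (x' - x)\<bar>" by (simp add: dist_real_def linear_diff[OF l])
      also have "\<dots> \<le> M * norm (x' - x)" using x x' by (intro M span_diff)
      also have "\<dots> \<le> M * (e / M)" using x'(2) \<open>M > 0\<close> by (intro mult_left_mono) (auto simp: dist_norm)
      finally show ?thesis using \<open>M > 0\<close> by simp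
    qed
    then show "\<exists>d>0. \<forall>x'\<in>span F. dist x' x < d \<longrightarrow> dist (l x') (l x) \<le> e"
      using x(2) \<open>M > 0\<close> by (intro exI[of _ "e / M"]) simp
  qed
qed

text \<open>Inside a finite span, which is closed, the cone is cut out by finitely many half-spaces
  whose forms are continuous there.\<close>

lemma closed_convex_cone_hull_finite:
  fixes F :: "'a::real_normed_vector set"
  assumes "finite F"
  shows "closed (convex_cone hull F)"
proof -
  obtain H where H: "finite H" "\<forall>h\<in>H. linear (h :: 'a \<Rightarrow> real)"
    "convex_cone hull F = {x \<in> span F. \<forall>h\<in>H. 0 \<le> h x}"
    using convex_cone_hull_halfspaces[OF assms] by blast
  have "closed (span F \<inter> h -` {0..})" if "h \<in> H" for h
    using continuous_closed_preimage[OF linear_continuous_on_finite_span[OF assms] closed_finite_span[OF assms] closed_atLeast]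
      H(2) that by blast
  then have "closed (span F \<inter> (\<Inter>h\<in>H. span F \<inter> h -` {0..}))"
    by (intro closed_Int closed_finite_span assms closed_INT) blast
  moreover have "convex_cone hull F = span F \<inter> (\<Inter>h\<in>H. span F \<inter> h -` {0..})"
    unfolding H(3) by auto
  ultimately show ?thesis by simp
qed

text \<open>Pasting over finitely many closed sets. It supplies the continuity required by
  \<open>meromorphic\<close> for a function built cone by cone.\<close>

lemma continuous_on_piecewise_linear:
  fixes g :: "'a::real_normed_vector \<Rightarrow> real"
  assumes "finite \<Sigma>"
    and "\<And>\<sigma>. \<sigma> \<in> \<Sigma> \<Longrightarrow> \<exists>F. finite F \<and> \<sigma> = convex_cone hull F"
    and "\<And>\<sigma>. \<sigma> \<in> \<Sigma> \<Longrightarrow> \<exists>l. linear l \<and> (\<forall>x\<in>\<sigma>. g x = l x)"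
  shows "continuous_on (\<Union>\<Sigma>) g"
proof -
  have "continuous_on (\<Union>\<sigma>\<in>\<Sigma>. \<sigma>) g"
  proof (rule continuous_on_closed_Union[OF assms(1)])
    fix \<sigma> assume \<sigma>: "\<sigma> \<in> \<Sigma>"
    obtain F where F: "finite F" "\<sigma> = convex_cone hull F" using assms(2)[OF \<sigma>] by blast
    show "closed \<sigma>" using closed_convex_cone_hull_finite F by blast
    obtain l where l: "linear l" "\<And>x. x \<in> \<sigma> \<Longrightarrow> g x = l x" using assms(3)[OF \<sigma>] by blast
    have "\<sigma> \<subseteq> span F" unfolding F(2) using span_superset[of "convex_cone hull F"] span_convex_cone_hull by blast
    then have "continuous_on \<sigma> l"
      using linear_continuous_on_finite_span[OF F(1) l(1)] continuous_on_subset by blast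
    then show "continuous_on \<sigma> g" using l(2) by (simp cong: continuous_on_cong)
  qed
  then show ?thesis by simp
qed

section \<open>Star fans\<close>

text \<open>Rank and nullity for a set whose span contains the kernel: starting from generators of
  the kernel, a new vector raises both dimensions or neither.\<close>

lemma dim_linear_image_kernel:
  fixes \<pi> :: "'a::real_vector \<Rightarrow> 'b::real_vector"
  assumes \<pi>: "linear \<pi>" "\<And>x. \<pi> x = 0 \<longleftrightarrow> x \<in> span K" and F: "finite F" "S \<subseteq> span F" and K: "K \<subseteq> S"
  shows "dim (\<pi> ` S) + dim K = dim S"
proof -
  obtain E where E: "E \<subseteq> S" "finite E" "span E = span S"
    using finite_basis_of[OF F] by metis
  obtain A where A: "A \<subseteq> K" "finite A" "span A = span K"
    using finite_basis_of[OF F(1), of K] F(2) K by (metis subset_trans)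
  have step: "dim (\<pi> ` (D \<union> A)) + dim A = dim (D \<union> A)" if "finite D" for D
    using that
  proof (induction D rule: finite_induct)
    case empty
    have "\<pi> ` A \<subseteq> {0}" using \<pi>(2) A(3) span_base by blast
    then have "\<pi> ` A \<subseteq> span {}" by simp
    then have "dim (\<pi> ` A) \<le> card ({} :: 'b set)" by (intro dim_le_card) auto
    then show ?case by simp
  next
    case (insert v D)
    have fin: "finite (D \<union> A)" "finite (\<pi> ` (D \<union> A))" using insert A by auto
    show ?case
    proof (cases "v \<in> span (D \<union> A)")
      case True
      then have "\<pi> v \<in> span (\<pi> ` (D \<union> A))" using \<pi>(1) by (simp add: linear_span_image)
      then have "span (\<pi> ` (insert v D \<union> A)) = span (\<pi> ` (D \<union> A))" by (simp add: span_redundant)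
      then have "dim (\<pi> ` (insert v D \<union> A)) = dim (\<pi> ` (D \<union> A))" by (rule span_eq_dim)
      moreover have "span (insert v D \<union> A) = span (D \<union> A)" using True by (simp add: span_redundant)
      then have "dim (insert v D \<union> A) = dim (D \<union> A)" by (rule span_eq_dim)
      ultimately show ?thesis using insert.IH by simp
    next
      case False
      have "\<pi> v \<notin> span (\<pi> ` (D \<union> A))"
      proof
        assume "\<pi> v \<in> span (\<pi> ` (D \<union> A))"
        then obtain s where s: "s \<in> span (D \<union> A)" "\<pi> v = \<pi> s" using \<pi>(1) by (auto simp: linear_span_image)
        then have "\<pi> (v - s) = 0" using \<pi>(1) by (simp add: linear_diff)
        then have "v - s \<in> span (D \<union> A)" using \<pi>(2) A(3) span_mono[of A "D \<union> A"] by blast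
        then have "(v - s) + s \<in> span (D \<union> A)" using s(1) by (rule span_add)
        then show False using False by simp
      qed
      then have "dim (insert (\<pi> v) (\<pi> ` (D \<union> A))) = dim (\<pi> ` (D \<union> A)) + 1"
        using dim_insert_notin[OF fin(2) span_superset] by blast
      moreover have "dim (insert v (D \<union> A)) = dim (D \<union> A) + 1"
        using dim_insert_notin[OF fin(1) span_superset False] .
      ultimately show ?thesis using insert.IH by simp
    qed
  qed
  have "span (E \<union> A) = span S"
  proof
    show "span (E \<union> A) \<subseteq> span S" using E(1) A(1) K by (intro span_mono) blast
    show "span S \<subseteq> span (E \<union> A)" unfolding E(3)[symmetric] by (intro span_mono) blast
  qed
  then have "dim (E \<union> A) = dim S" "dim (\<pi> ` (E \<union> A)) = dim (\<pi> ` S)"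
    using \<pi>(1) by (auto intro!: span_eq_dim simp: linear_span_image)
  moreover have "dim A = dim K" using A(3) by (rule span_eq_dim)
  ultimately show ?thesis using step[OF E(2)] by simp
qed

lemma normal_vec_notin_iff:
  assumes "is_normal_vec N \<sigma> \<tau> v" "v \<notin> span \<tau>" "is_normal_vec N \<sigma> \<tau> w"
  shows "w \<notin> span \<tau>"
proof
  assume w: "w \<in> span \<tau>"
  have "v \<in> {u + of_int k *\<^sub>R w | u k. u \<in> N \<inter> span \<tau>}"
    using assms(1,3) unfolding is_normal_vec_def by simp
  then obtain u and k :: int where "v = u + of_int k *\<^sub>R w" "u \<in> span \<tau>" by blast
  then have "v \<in> span \<tau>" using w by (simp add: span_add span_scale)
  then show False using assms(2) by simp
qed

text \<open>The hypotheses are the facts about one wall that the formula uses, in place of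
  \<open>tropical_fan Y\<close>: it will be applied to star fans, for which these facts are
  established directly. The floor disappears because the forms are integral on the lattice and the
  weighted sum \<open>M\<close> is a lattice vector.\<close>

lemma real_ord_at:
  fixes Y :: "'a::real_vector tfan"
  defines "S \<equiv> \<lambda>\<tau>. {\<sigma> \<in> k_cones (tf_cones Y) (fan_dim Y). \<tau> \<subseteq> \<sigma>}"
  assumes fin: "finite (S \<tau>)"
    and comb: "\<And>m (z :: 'a set \<Rightarrow> int). (\<And>\<sigma>. \<sigma> \<in> S \<tau> \<Longrightarrow> m \<sigma> \<in> tf_lattice Y) \<Longrightarrow> (\<Sum>\<sigma>\<in>S \<tau>. of_int (z \<sigma>) *\<^sub>R m \<sigma>) \<in> tf_lattice Y"
    and n: "\<And>\<sigma>. \<sigma> \<in> S \<tau> \<Longrightarrow> is_normal_vec (tf_lattice Y) \<sigma> \<tau> (n \<sigma>)" "\<And>\<sigma>. \<sigma> \<in> S \<tau> \<Longrightarrow> n \<sigma> \<notin> span \<tau>"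
    and face: "\<And>\<sigma>. \<sigma> \<in> S \<tau> \<Longrightarrow> convex_cone \<sigma>" "\<And>\<sigma>. \<sigma> \<in> S \<tau> \<Longrightarrow> cone_face \<tau> \<sigma>"
    and bal: "(\<Sum>\<sigma>\<in>S \<tau>. of_int (tf_orient Y \<sigma>) *\<^sub>R n \<sigma>) \<in> span \<tau>"
    and l: "\<And>\<sigma>. \<sigma> \<in> S \<tau> \<Longrightarrow> linear (l \<sigma>)" "\<And>\<sigma>. \<sigma> \<in> S \<tau> \<Longrightarrow> l \<sigma> ` (tf_lattice Y \<inter> span \<sigma>) \<subseteq> \<int>"
      "\<And>\<sigma> x. \<sigma> \<in> S \<tau> \<Longrightarrow> x \<in> \<sigma> \<Longrightarrow> g x = l \<sigma> x"
    and L: "linear L" "L ` (tf_lattice Y \<inter> span \<tau>) \<subseteq> \<int>" "\<And>x. x \<in> \<tau> \<Longrightarrow> g x = L x"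
  shows "of_int (ord_at Y g \<tau>) = - (\<Sum>\<sigma>\<in>S \<tau>. of_int (tf_orient Y \<sigma>) * (l \<sigma> (n \<sigma>) - L (n \<sigma>)))"
proof -
  let ?\<omega> = "tf_orient Y"
  define m where "m = (\<lambda>\<sigma>. normal_vec (tf_lattice Y) \<sigma> \<tau>)"
  have m: "is_normal_vec (tf_lattice Y) \<sigma> \<tau> (m \<sigma>)" if "\<sigma> \<in> S \<tau>" for \<sigma>
    unfolding m_def normal_vec_def by (rule someI[of _ "n \<sigma>"]) (rule n(1)[OF that])
  have mN: "m \<sigma> \<in> tf_lattice Y" "m \<sigma> \<in> span \<sigma>" if "\<sigma> \<in> S \<tau>" for \<sigma>
    using m[OF that] unfolding is_normal_vec_def by blast+
  have d: "m \<sigma> - n \<sigma> \<in> span \<tau>" if "\<sigma> \<in> S \<tau>" for \<sigma>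
    using normal_vec_diff[OF n[OF that] m[OF that] normal_vec_notin_iff[OF n[OF that] m[OF that]] face[OF that]] .
  have form: "cone_form g \<kappa> x = k x"
    if "linear k" "\<And>x. x \<in> \<kappa> \<Longrightarrow> g x = k x" "x \<in> span \<kappa>" for \<kappa> k x
  proof -
    have "linear (cone_form g \<kappa>) \<and> (\<forall>x\<in>\<kappa>. g x = cone_form g \<kappa> x)"
      unfolding cone_form_def by (rule someI[of _ k]) (use that in blast)
    then show ?thesis using linear_eq_on_span[of "cone_form g \<kappa>" k, OF _ that(1) _ that(3)] that(2) by auto
  qed
  define M where "M = (\<Sum>\<sigma>\<in>S \<tau>. of_int (?\<omega> \<sigma>) *\<^sub>R m \<sigma>)"
  have "(\<Sum>\<sigma>\<in>S \<tau>. of_int (?\<omega> \<sigma>) *\<^sub>R (m \<sigma> - n \<sigma>)) \<in> span \<tau>"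
    using d by (intro span_sum span_scale) blast
  from span_add[OF bal this] have M: "M \<in> span \<tau>"
    unfolding M_def by (simp flip: sum.distrib scaleR_add_right)
  have MN: "M \<in> tf_lattice Y" unfolding M_def using mN(1) by (rule comb)
  define r where "r = - (\<Sum>\<sigma>\<in>S \<tau>. of_int (?\<omega> \<sigma>) * l \<sigma> (m \<sigma>)) + L M"
  have "ord_at Y g \<tau> = \<lfloor>- (\<Sum>\<sigma>\<in>S \<tau>. of_int (?\<omega> \<sigma>) * cone_form g \<sigma> (m \<sigma>)) + cone_form g \<tau> M\<rfloor>"
    unfolding ord_at_def Let_def m_def M_def S_def ..
  also have "cone_form g \<tau> M = L M" using form[OF L(1,3) M] .
  also have "(\<Sum>\<sigma>\<in>S \<tau>. of_int (?\<omega> \<sigma>) * cone_form g \<sigma> (m \<sigma>)) = (\<Sum>\<sigma>\<in>S \<tau>. of_int (?\<omega> \<sigma>) * l \<sigma> (m \<sigma>))"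
    using form[OF l(1,3) mN(2)] by (intro sum.cong) auto
  finally have o: "ord_at Y g \<tau> = \<lfloor>r\<rfloor>" unfolding r_def .
  have "L M \<in> \<int>" using L(2) M MN by blast
  moreover have "(\<Sum>\<sigma>\<in>S \<tau>. of_int (?\<omega> \<sigma>) * l \<sigma> (m \<sigma>)) \<in> \<int>"
    using l(2) mN by (intro Ints_sum Ints_mult Ints_of_int) blast
  ultimately have "r \<in> \<int>" unfolding r_def by (intro Ints_add Ints_minus)
  then have "of_int (ord_at Y g \<tau>) = r" unfolding o by (metis Ints_cases of_int_floor_cancel)
  also have "r = - (\<Sum>\<sigma>\<in>S \<tau>. of_int (?\<omega> \<sigma>) * (l \<sigma> (m \<sigma>) - L (m \<sigma>)))"
    unfolding r_def M_def using L(1) by (simp add: linear_sum linear_scale right_diff_distrib sum_subtractf)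
  also have "(\<Sum>\<sigma>\<in>S \<tau>. of_int (?\<omega> \<sigma>) * (l \<sigma> (m \<sigma>) - L (m \<sigma>)))
      = (\<Sum>\<sigma>\<in>S \<tau>. of_int (?\<omega> \<sigma>) * (l \<sigma> (n \<sigma>) - L (n \<sigma>)))"
  proof (intro sum.cong refl)
    fix \<sigma> assume \<sigma>: "\<sigma> \<in> S \<tau>"
    have "l \<sigma> (m \<sigma> - n \<sigma>) = L (m \<sigma> - n \<sigma>)"
      using linear_eq_on_span[OF l(1)[OF \<sigma>] L(1) _ d[OF \<sigma>]] l(3)[OF \<sigma>] L(3) cone_face_subset[OF face(2)[OF \<sigma>]]
      by (metis subsetD)
    then have "l \<sigma> (m \<sigma>) - L (m \<sigma>) = l \<sigma> (n \<sigma>) - L (n \<sigma>)"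
      using l(1)[OF \<sigma>] L(1) by (simp add: linear_diff)
    then show "of_int (?\<omega> \<sigma>) * (l \<sigma> (m \<sigma>) - L (m \<sigma>)) = of_int (?\<omega> \<sigma>) * (l \<sigma> (n \<sigma>) - L (n \<sigma>))"
      by (simp only:)
  qed
  finally show ?thesis .
qed

section \<open>The star fan of a cone and the cones around it\<close>

locale fan_star =
  fixes X :: "'a::real_normed_vector tfan" and \<eta> :: "'a set"
  assumes X: "tropical_fan X" and \<eta>: "\<eta> \<in> tf_cones X"
begin

abbreviation "\<pi> \<equiv> quot_map (span \<eta>)"
abbreviation "N \<equiv> tf_lattice X"
abbreviation "Y \<equiv> star_fan X \<eta>"

definition "St = {\<zeta> \<in> tf_cones X. \<eta> \<subseteq> \<zeta>}"

lemma quot: "linear \<pi>" and ker: "\<pi> x = 0 \<longleftrightarrow> x \<in> span \<eta>"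
proof -
  have "linear \<pi> \<and> {x. \<pi> x = 0} = span \<eta>"
    unfolding quot_map_def by (rule someI_ex[OF quot_map_ex])
  then show "linear \<pi>" "\<pi> x = 0 \<longleftrightarrow> x \<in> span \<eta>" by auto
qed

lemma StD: "\<zeta> \<in> St \<Longrightarrow> \<zeta> \<in> tf_cones X" "\<zeta> \<in> St \<Longrightarrow> \<eta> \<subseteq> \<zeta>"
  unfolding St_def by auto

lemma star_lattice: "tf_lattice Y = \<pi> ` N"
  and star_cones: "tf_cones Y = (`) \<pi> ` St"
  unfolding star_fan_def Let_def St_def by auto

text \<open>Points with the same image differ by a vector of \<open>span \<eta>\<close>, a
  difference of two elements of \<open>\<eta>\<close>. Adding these elements stays inside the cones
  of the star and produces a common point of both cones.\<close>

lemma star_lift: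
  assumes "\<zeta> \<in> St" "\<zeta>' \<in> St" "x \<in> \<zeta>" "x' \<in> \<zeta>'" "\<pi> x = \<pi> x'"
  obtains e e' where "e \<in> \<eta>" "e' \<in> \<eta>" "x + e = x' + e'" "x + e \<in> \<zeta>" "x + e \<in> \<zeta>'"
proof -
  have "\<pi> (x' - x) = 0" using quot assms(5) by (simp add: linear_diff)
  then have "x' - x \<in> span \<eta>" using ker by blast
  then obtain e e' where e: "e \<in> \<eta>" "e' \<in> \<eta>" "x' - x = e - e'"
    using span_convex_cone[OF tropical_fan_convex[OF X \<eta>]] by blast
  have eq: "x + e = x' + e'" using e(3) by (simp add: algebra_simps)
  have "x + e \<in> \<zeta>" using convex_cone_add[OF tropical_fan_convex[OF X]] StD assms e by blast
  moreover have "x' + e' \<in> \<zeta>'" using convex_cone_add[OF tropical_fan_convex[OF X]] StD assms e by blast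
  ultimately show ?thesis using that[OF e(1,2) eq] eq by simp
qed

text \<open>A point of \<open>\<zeta>\<close> whose image lies in that of \<open>\<zeta>'\<close>
  enters \<open>\<zeta> \<inter> \<zeta>'\<close> after adding some \<open>e\<close> in
  \<open>\<eta>\<close>; the intersection is a face of \<open>\<zeta>\<close>, so it contained the
  point already.\<close>

lemma star_subset_iff:
  assumes "\<zeta> \<in> St" "\<zeta>' \<in> St"
  shows "\<pi> ` \<zeta> \<subseteq> \<pi> ` \<zeta>' \<longleftrightarrow> \<zeta> \<subseteq> \<zeta>'"
proof
  assume sub: "\<pi> ` \<zeta> \<subseteq> \<pi> ` \<zeta>'"
  show "\<zeta> \<subseteq> \<zeta>'"
  proof
    fix x assume x: "x \<in> \<zeta>"
    then obtain x' where x': "x' \<in> \<zeta>'" "\<pi> x = \<pi> x'" using sub by blast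
    obtain e e' where e: "e \<in> \<eta>" "x + e \<in> \<zeta>" "x + e \<in> \<zeta>'"
      using star_lift[OF assms x x'] by blast
    have "x \<in> \<zeta> \<inter> \<zeta>'"
      using cone_faceD[OF tropical_fan_convex[OF X StD(1)[OF assms(1)]]
          tropical_fan_Int[OF X StD(1)[OF assms(1)] StD(1)[OF assms(2)]] x, of e] StD(2)[OF assms(1)] e by blast
    then show "x \<in> \<zeta>'" by blast
  qed
qed blast

lemma star_inj: "inj_on ((`) \<pi>) St"
  by (rule inj_onI) (metis star_subset_iff order_refl subset_antisym)

lemma star_orient: "\<zeta> \<in> St \<Longrightarrow> tf_orient Y (\<pi> ` \<zeta>) = tf_orient X \<zeta>"
proof -
  assume \<zeta>: "\<zeta> \<in> St"
  have "(THE \<xi>. \<xi> \<in> tf_cones X \<and> \<eta> \<subseteq> \<xi> \<and> \<pi> ` \<xi> = \<pi> ` \<zeta>) = \<zeta>"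
  proof (rule the_equality)
    fix \<xi> assume "\<xi> \<in> tf_cones X \<and> \<eta> \<subseteq> \<xi> \<and> \<pi> ` \<xi> = \<pi> ` \<zeta>"
    then show "\<xi> = \<zeta>" using inj_onD[OF star_inj, of \<xi> \<zeta>] \<zeta> unfolding St_def by blast
  qed (use StD \<zeta> in blast)
  then show ?thesis unfolding star_fan_def Let_def by simp
qed

lemma span_eta_subset: "\<zeta> \<in> St \<Longrightarrow> span \<eta> \<subseteq> span \<zeta>"
  using StD(2) span_mono by blast

lemma star_lattice_span:
  assumes "\<zeta> \<in> St"
  shows "\<pi> ` N \<inter> span (\<pi> ` \<zeta>) = \<pi> ` (N \<inter> span \<zeta>)"
proof (intro equalityI subsetI)
  fix y assume "y \<in> \<pi> ` N \<inter> span (\<pi> ` \<zeta>)"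
  then obtain x s where x: "x \<in> N" "y = \<pi> x" "s \<in> span \<zeta>" "y = \<pi> s"
    using quot by (auto simp: linear_span_image)
  then have "\<pi> (x - s) = 0" using quot by (simp add: linear_diff)
  then have "x - s \<in> span \<zeta>" using ker span_eta_subset[OF assms] by blast
  then have "x - s + s \<in> span \<zeta>" using x(3) by (rule span_add)
  then show "y \<in> \<pi> ` (N \<inter> span \<zeta>)" using x by auto
next
  fix y assume "y \<in> \<pi> ` (N \<inter> span \<zeta>)"
  then show "y \<in> \<pi> ` N \<inter> span (\<pi> ` \<zeta>)" using quot by (auto simp: linear_span_image)
qed

lemma star_dim: "\<zeta> \<in> St \<Longrightarrow> dim (\<pi> ` \<zeta>) + dim \<eta> = dim \<zeta>"
  using dim_linear_image_kernel[OF quot ker] tropical_fan_finite_span[OF X] StD by metis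

lemma star_fan_dim: "fan_dim Y + dim \<eta> = fan_dim X"
proof -
  obtain F where F: "F \<in> facets X" "\<eta> \<subseteq> F" using facet_above[OF X \<eta>] by blast
  then have FS: "F \<in> St" using facets_subset unfolding St_def by blast
  have "fan_dim Y = dim (\<pi> ` F)"
    unfolding fan_dim_def
  proof (rule Max_eqI)
    have "finite St" using tropical_fan_finite[OF X] unfolding St_def by simp
    then show "finite (dim ` tf_cones Y)" unfolding star_cones by blast
    show "dim (\<pi> ` F) \<in> dim ` tf_cones Y" unfolding star_cones using FS by blast
    fix y assume "y \<in> dim ` tf_cones Y"
    then obtain \<zeta> where \<zeta>: "\<zeta> \<in> St" "y = dim (\<pi> ` \<zeta>)" unfolding star_cones by blast
    obtain G where G: "G \<in> facets X" "\<zeta> \<subseteq> G" using facet_above[OF X StD(1)[OF \<zeta>(1)]] by blast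
    have "dim \<zeta> \<le> dim G"
      using tropical_fan_dim_mono[OF X facets_subset[OF G(1)]] G(2) span_superset[of G] by blast
    then have "dim \<zeta> \<le> dim F" using tropical_fan_dim[OF X] G(1) F(1) by simp
    then show "y \<le> dim (\<pi> ` F)" using star_dim[OF \<zeta>(1)] star_dim[OF FS] \<zeta>(2) by simp
  qed
  then show ?thesis using star_dim[OF FS] tropical_fan_dim[OF X F(1)] by simp
qed

lemma star_wall: "\<tau> \<in> St \<Longrightarrow> dim (\<pi> ` \<tau>) + 1 = fan_dim Y \<longleftrightarrow> \<tau> \<in> walls X"
  using star_dim[of \<tau>] star_fan_dim StD(1)[of \<tau>] unfolding walls_def by auto

lemma star_wall_facets:
  assumes "\<tau> \<in> St"
  shows "{\<kappa> \<in> k_cones (tf_cones Y) (fan_dim Y). \<pi> ` \<tau> \<subseteq> \<kappa>} = (`) \<pi> ` wall_facets X \<tau>"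
    and "wall_facets X \<tau> \<subseteq> St"
proof -
  show sub: "wall_facets X \<tau> \<subseteq> St" using wall_facetsD StD(2)[OF assms] unfolding St_def by blast
  have dm: "dim (\<pi> ` \<zeta>) = fan_dim Y \<longleftrightarrow> \<zeta> \<in> facets X" if "\<zeta> \<in> St" for \<zeta>
  proof -
    have "dim (\<pi> ` \<zeta>) = fan_dim Y \<longleftrightarrow> dim \<zeta> = fan_dim X"
      using star_dim[OF that] star_fan_dim by linarith
    then show ?thesis
      unfolding k_cones_fan_dim[OF X, symmetric] k_cones_def using StD(1)[OF that] by simp
  qed
  show "{\<kappa> \<in> k_cones (tf_cones Y) (fan_dim Y). \<pi> ` \<tau> \<subseteq> \<kappa>} = (`) \<pi> ` wall_facets X \<tau>"
  proof (intro equalityI subsetI)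
    fix \<kappa> assume "\<kappa> \<in> {\<kappa> \<in> k_cones (tf_cones Y) (fan_dim Y). \<pi> ` \<tau> \<subseteq> \<kappa>}"
    then have "\<kappa> \<in> (`) \<pi> ` St" and k: "dim \<kappa> = fan_dim Y" "\<pi> ` \<tau> \<subseteq> \<kappa>"
      unfolding k_cones_def star_cones by simp_all
    then obtain \<zeta> where \<zeta>: "\<zeta> \<in> St" "\<kappa> = \<pi> ` \<zeta>" by blast
    have "\<zeta> \<in> facets X" "\<tau> \<subseteq> \<zeta>"
      using dm[OF \<zeta>(1)] star_subset_iff[OF assms \<zeta>(1)] k \<zeta>(2) by simp_all
    then show "\<kappa> \<in> (`) \<pi> ` wall_facets X \<tau>"
      using \<zeta>(2) unfolding wall_facets_def by blast
  next
    fix \<kappa> assume "\<kappa> \<in> (`) \<pi> ` wall_facets X \<tau>"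
    then obtain \<zeta> where \<zeta>: "\<zeta> \<in> wall_facets X \<tau>" "\<kappa> = \<pi> ` \<zeta>" by blast
    have zS: "\<zeta> \<in> St" using sub \<zeta>(1) by blast
    have "dim \<kappa> = fan_dim Y" using dm[OF zS] wall_facetsD(1)[OF \<zeta>(1)] \<zeta>(2) by simp
    moreover have "\<pi> ` \<tau> \<subseteq> \<kappa>" unfolding \<zeta>(2) by (rule image_mono[OF wall_facetsD(3)[OF \<zeta>(1)]])
    moreover have "\<kappa> \<in> (`) \<pi> ` St" using zS \<zeta>(2) by blast
    ultimately show "\<kappa> \<in> {\<kappa> \<in> k_cones (tf_cones Y) (fan_dim Y). \<pi> ` \<tau> \<subseteq> \<kappa>}"
      unfolding k_cones_def star_cones by simp
  qed
qed

lemma star_normal: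
  assumes "\<tau> \<in> St" "\<zeta> \<in> St" "is_normal_vec N \<zeta> \<tau> v"
  shows "is_normal_vec (\<pi> ` N) (\<pi> ` \<zeta>) (\<pi> ` \<tau>) (\<pi> v)"
proof -
  have v: "v \<in> N \<inter> span \<zeta>" "{u + of_int k *\<^sub>R v | u k. u \<in> N \<inter> span \<tau>} = N \<inter> span \<zeta>"
    using assms(3) unfolding is_normal_vec_def by blast+
  obtain x y where xy: "x \<in> \<zeta>" "y \<in> span \<tau>" "v = x + y" using assms(3) unfolding is_normal_vec_def by blast
  have "\<pi> v = \<pi> x + \<pi> y" using xy(3) quot by (simp add: linear_add)
  moreover have "\<pi> y \<in> span (\<pi> ` \<tau>)" using xy(2) quot by (simp add: linear_span_image)
  ultimately have 1: "\<exists>x\<in>\<pi> ` \<zeta>. \<exists>y\<in>span (\<pi> ` \<tau>). \<pi> v = x + y" using xy(1) by blast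
  have "{u + of_int k *\<^sub>R \<pi> v | u k. u \<in> \<pi> ` (N \<inter> span \<tau>)} = \<pi> ` {u + of_int k *\<^sub>R v | u k. u \<in> N \<inter> span \<tau>}"
  proof (intro equalityI subsetI)
    fix z assume "z \<in> {u + of_int k *\<^sub>R \<pi> v | u k. u \<in> \<pi> ` (N \<inter> span \<tau>)}"
    then obtain u k where u: "z = \<pi> u + of_int k *\<^sub>R \<pi> v" "u \<in> N \<inter> span \<tau>" by blast
    then have "z = \<pi> (u + of_int k *\<^sub>R v)" using quot by (simp add: linear_add linear_scale)
    then show "z \<in> \<pi> ` {u + of_int k *\<^sub>R v | u k. u \<in> N \<inter> span \<tau>}" using u(2) by blast
  next
    fix z assume "z \<in> \<pi> ` {u + of_int k *\<^sub>R v | u k. u \<in> N \<inter> span \<tau>}"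
    then obtain u k where u: "z = \<pi> (u + of_int k *\<^sub>R v)" "u \<in> N \<inter> span \<tau>" by blast
    then have "z = \<pi> u + of_int k *\<^sub>R \<pi> v" using quot by (simp add: linear_add linear_scale)
    then show "z \<in> {u + of_int k *\<^sub>R \<pi> v | u k. u \<in> \<pi> ` (N \<inter> span \<tau>)}" using u(2) by blast
  qed
  then have 2: "{u + of_int k *\<^sub>R \<pi> v | u k. u \<in> \<pi> ` (N \<inter> span \<tau>)} = \<pi> ` (N \<inter> span \<zeta>)"
    unfolding v(2) .
  show ?thesis
    unfolding is_normal_vec_def star_lattice_span[OF assms(1)] star_lattice_span[OF assms(2)]
    by (intro conjI 1 2 imageI v(1))
qed

lemma star_face:
  assumes "\<tau> \<in> St" "\<zeta> \<in> St" "\<tau> \<subseteq> \<zeta>"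
  shows "convex_cone (\<pi> ` \<zeta>)" "cone_face (\<pi> ` \<tau>) (\<pi> ` \<zeta>)"
proof -
  note cc = tropical_fan_convex[OF X]
  have c: "convex_cone (\<pi> ` \<zeta>)" if "\<zeta> \<in> St" for \<zeta>
    using cc[OF StD(1)[OF that]] quot convex_cone_linear_image by blast
  show "convex_cone (\<pi> ` \<zeta>)" using c assms by blast
  show "cone_face (\<pi> ` \<tau>) (\<pi> ` \<zeta>)"
  proof (rule cone_faceI[OF c[OF assms(2)] c[OF assms(1)]])
    show "\<pi> ` \<tau> \<subseteq> \<pi> ` \<zeta>" using assms(3) by blast
    fix a b assume "a \<in> \<pi> ` \<zeta>" "b \<in> \<pi> ` \<zeta>" "a + b \<in> \<pi> ` \<tau>"
    then obtain x y t where xy: "a = \<pi> x" "x \<in> \<zeta>" "b = \<pi> y" "y \<in> \<zeta>" "a + b = \<pi> t" "t \<in> \<tau>" by blast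
    then have "\<pi> (x + y) = \<pi> t" using quot by (simp add: linear_add)
    moreover have "x + y \<in> \<zeta>" using convex_cone_add[OF cc[OF StD(1)[OF assms(2)]]] xy by blast
    ultimately obtain e where e: "e \<in> \<eta>" "x + y + e \<in> \<tau>"
      using star_lift[OF assms(2,1), of "x + y" t] xy(6) by metis
    have "y + e \<in> \<zeta>" using convex_cone_add[OF cc[OF StD(1)[OF assms(2)]]] xy e StD(2)[OF assms(2)] by blast
    then have "x \<in> \<tau>"
      using cone_faceD[OF cc[OF StD(1)[OF assms(2)]] tropical_fan_subset_face[OF X StD(1)[OF assms(2)] StD(1)[OF assms(1)] assms(3)] xy(2), of "y + e"]
        e(2) by (simp add: add.assoc)
    then show "a \<in> \<pi> ` \<tau>" using xy by blast
  qed
qed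

text \<open>Expresses an order on the quotient through normal vectors of \<open>X\<close>, so that
  it can be compared with \<open>balanced_at\<close>. The cones around the wall correspond by
  \<open>star_inj\<close>, and normal vectors map to normal vectors.\<close>

lemma star_ord:
  assumes \<tau>: "\<tau> \<in> St" "\<tau> \<in> walls X"
    and n: "\<And>\<sigma>. \<sigma> \<in> wall_facets X \<tau> \<Longrightarrow> is_normal_vec N \<sigma> \<tau> (n \<sigma>)"
    and l: "\<And>\<sigma>. \<sigma> \<in> wall_facets X \<tau> \<Longrightarrow> linear (l \<sigma>)"
      "\<And>\<sigma>. \<sigma> \<in> wall_facets X \<tau> \<Longrightarrow> l \<sigma> ` (\<pi> ` N \<inter> span (\<pi> ` \<sigma>)) \<subseteq> \<int>"
      "\<And>\<sigma> x. \<sigma> \<in> wall_facets X \<tau> \<Longrightarrow> x \<in> \<sigma> \<Longrightarrow> g (\<pi> x) = l \<sigma> (\<pi> x)"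
    and L: "linear L" "L ` (\<pi> ` N \<inter> span (\<pi> ` \<tau>)) \<subseteq> \<int>" "\<And>x. x \<in> \<tau> \<Longrightarrow> g (\<pi> x) = L (\<pi> x)"
  shows "of_int (ord_at Y g (\<pi> ` \<tau>)) =
    - (\<Sum>\<sigma>\<in>wall_facets X \<tau>. of_int (tf_orient X \<sigma>) * (l \<sigma> (\<pi> (n \<sigma>)) - L (\<pi> (n \<sigma>))))"
proof -
  let ?W = "wall_facets X \<tau>"
  note W = star_wall_facets(1)[OF \<tau>(1)]
  note WS = star_wall_facets(2)[OF \<tau>(1)]
  define i where "i = inv_into St ((`) \<pi>)"
  have i: "i (\<pi> ` \<sigma>) = \<sigma>" if "\<sigma> \<in> ?W" for \<sigma>
    unfolding i_def using inv_into_f_f[OF star_inj] WS that by blast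
  have inj: "inj_on ((`) \<pi>) ?W" using star_inj WS inj_on_subset by blast
  have orient: "tf_orient Y (\<pi> ` \<sigma>) = tf_orient X \<sigma>" if "\<sigma> \<in> ?W" for \<sigma>
    using star_orient that WS by blast
  have "of_int (ord_at Y g (\<pi> ` \<tau>)) =
    - (\<Sum>\<kappa>\<in>(`) \<pi> ` ?W. of_int (tf_orient Y \<kappa>) * (l (i \<kappa>) (\<pi> (n (i \<kappa>))) - L (\<pi> (n (i \<kappa>)))))"
    unfolding W[symmetric]
  proof (rule real_ord_at[of Y "\<pi> ` \<tau>" "\<lambda>\<kappa>. \<pi> (n (i \<kappa>))" "\<lambda>\<kappa>. l (i \<kappa>)" g L], unfold W star_lattice)
    show "finite ((`) \<pi> ` ?W)" using finite_wall_facets[OF X] by blast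
  next
    fix m and z :: "'a set \<Rightarrow> int" assume m: "\<And>\<kappa>. \<kappa> \<in> (`) \<pi> ` ?W \<Longrightarrow> m \<kappa> \<in> \<pi> ` N"
    then have "\<forall>\<kappa>\<in>(`) \<pi> ` ?W. \<exists>x. x \<in> N \<and> m \<kappa> = \<pi> x" by blast
    then obtain x where x: "\<forall>\<kappa>\<in>(`) \<pi> ` ?W. x \<kappa> \<in> N \<and> m \<kappa> = \<pi> (x \<kappa>)" using bchoice by metis
    have "(\<Sum>\<kappa>\<in>(`) \<pi> ` ?W. of_int (z \<kappa>) *\<^sub>R m \<kappa>) = (\<Sum>\<kappa>\<in>(`) \<pi> ` ?W. of_int (z \<kappa>) *\<^sub>R \<pi> (x \<kappa>))"
      using x by (intro sum.cong refl arg_cong2[where f = scaleR]) blast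
    also have "\<dots> = \<pi> (\<Sum>\<kappa>\<in>(`) \<pi> ` ?W. of_int (z \<kappa>) *\<^sub>R x \<kappa>)"
      using quot by (simp add: linear_sum linear_scale)
    finally have "(\<Sum>\<kappa>\<in>(`) \<pi> ` ?W. of_int (z \<kappa>) *\<^sub>R m \<kappa>) = \<pi> (\<Sum>\<kappa>\<in>(`) \<pi> ` ?W. of_int (z \<kappa>) *\<^sub>R x \<kappa>)" .
    moreover have "(\<Sum>\<kappa>\<in>(`) \<pi> ` ?W. of_int (z \<kappa>) *\<^sub>R x \<kappa>) \<in> N"
      using x tropical_fan_lattice[OF X] by (intro is_lattice_sum is_lattice_scale) blast+
    ultimately show "(\<Sum>\<kappa>\<in>(`) \<pi> ` ?W. of_int (z \<kappa>) *\<^sub>R m \<kappa>) \<in> \<pi> ` N" by blast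
  next
    fix \<kappa> assume "\<kappa> \<in> (`) \<pi> ` ?W"
    then obtain \<sigma> where \<sigma>: "\<sigma> \<in> ?W" "\<kappa> = \<pi> ` \<sigma>" by blast
    have \<sigma>S: "\<sigma> \<in> St" using \<sigma> WS by blast
    show "is_normal_vec (\<pi> ` N) \<kappa> (\<pi> ` \<tau>) (\<pi> (n (i \<kappa>)))"
      using star_normal[OF \<tau>(1) \<sigma>S n[OF \<sigma>(1)]] \<sigma>(2) i[OF \<sigma>(1)] by simp
    have "n \<sigma> \<notin> span \<tau>" using wall_normal_notin[OF X \<tau>(2) \<sigma>(1) n[OF \<sigma>(1)]] .
    moreover have "n \<sigma> \<in> span \<tau>" if "\<pi> (n \<sigma>) \<in> span (\<pi> ` \<tau>)"
    proof -
      obtain s where s: "s \<in> span \<tau>" "\<pi> (n \<sigma>) = \<pi> s" using \<open>\<pi> (n \<sigma>) \<in> span (\<pi> ` \<tau>)\<close> quot by (auto simp: linear_span_image)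
      then have "\<pi> (n \<sigma> - s) = 0" using quot by (simp add: linear_diff)
      then have "n \<sigma> - s \<in> span \<tau>" using ker span_eta_subset[OF \<tau>(1)] by blast
      then have "n \<sigma> - s + s \<in> span \<tau>" using s(1) by (rule span_add)
      then show ?thesis by simp
    qed
    ultimately show "\<pi> (n (i \<kappa>)) \<notin> span (\<pi> ` \<tau>)" using \<sigma>(2) i[OF \<sigma>(1)] by auto
    show "convex_cone \<kappa>" "cone_face (\<pi> ` \<tau>) \<kappa>"
      using star_face[OF \<tau>(1) \<sigma>S wall_facetsD(3)[OF \<sigma>(1)]] \<sigma>(2) by blast+
    show "linear (l (i \<kappa>))" "l (i \<kappa>) ` (\<pi> ` N \<inter> span \<kappa>) \<subseteq> \<int>"
      using l(1,2)[OF \<sigma>(1)] \<sigma>(2) i[OF \<sigma>(1)] by simp_all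
    show "g x = l (i \<kappa>) x" if "x \<in> \<kappa>" for x
      using l(3)[OF \<sigma>(1)] \<sigma>(2) i[OF \<sigma>(1)] that by auto
  next
    have "(\<Sum>\<kappa>\<in>(`) \<pi> ` ?W. of_int (tf_orient Y \<kappa>) *\<^sub>R \<pi> (n (i \<kappa>)))
      = (\<Sum>\<sigma>\<in>?W. of_int (tf_orient X \<sigma>) *\<^sub>R \<pi> (n \<sigma>))"
      unfolding sum.reindex[OF inj] using i orient by (intro sum.cong) auto
    also have "\<dots> = \<pi> (\<Sum>\<sigma>\<in>?W. of_int (tf_orient X \<sigma>) *\<^sub>R n \<sigma>)"
      using quot by (simp add: linear_sum linear_scale)
    finally show "(\<Sum>\<kappa>\<in>(`) \<pi> ` ?W. of_int (tf_orient Y \<kappa>) *\<^sub>R \<pi> (n (i \<kappa>))) \<in> span (\<pi> ` \<tau>)"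
      using wall_balance[OF X \<tau>(2) n] quot by (simp add: linear_span_image)
  next
    show "linear L" "L ` (\<pi> ` N \<inter> span (\<pi> ` \<tau>)) \<subseteq> \<int>" using L by blast+
    show "g x = L x" if "x \<in> \<pi> ` \<tau>" for x using L(3) that by blast
  qed
  also have "(\<Sum>\<kappa>\<in>(`) \<pi> ` ?W. of_int (tf_orient Y \<kappa>) * (l (i \<kappa>) (\<pi> (n (i \<kappa>))) - L (\<pi> (n (i \<kappa>)))))
    = (\<Sum>\<sigma>\<in>?W. of_int (tf_orient X \<sigma>) * (l \<sigma> (\<pi> (n \<sigma>)) - L (\<pi> (n \<sigma>))))"
    unfolding sum.reindex[OF inj] using i orient by (intro sum.cong) auto
  finally show ?thesis .
qed

text \<open>Composition with \<open>\<pi>\<close> turns a function on the star into one on the cones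
  through \<open>p\<close>. The form found for it vanishes on \<open>\<eta>\<close>, because all of
  \<open>\<eta>\<close> is sent to \<open>0\<close>, and therefore descends again.\<close>

lemma div_faithful_at_if_near:
  assumes p: "\<And>\<zeta>. \<zeta> \<in> tf_cones X \<Longrightarrow> p \<in> \<zeta> \<longleftrightarrow> \<eta> \<subseteq> \<zeta>" and near: "div_faithful_near X p"
  shows "div_faithful_at X \<eta>"
  unfolding div_faithful_at_def
proof (intro allI impI, elim conjE)
  fix g assume g: "meromorphic Y g" "div_trivial Y g"
  have pS: "\<zeta> \<in> St \<longleftrightarrow> \<zeta> \<in> tf_cones X \<and> p \<in> \<zeta>" for \<zeta> unfolding St_def using p by blast
  have "\<exists>l. linear l \<and> l ` (\<pi> ` N \<inter> span (\<pi> ` \<zeta>)) \<subseteq> \<int> \<and> (\<forall>x\<in>\<zeta>. g (\<pi> x) = l (\<pi> x))" if "\<zeta> \<in> St" for \<zeta>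
  proof -
    have c: "\<pi> ` \<zeta> \<in> tf_cones Y" unfolding star_cones by (rule imageI[OF that])
    have "\<forall>\<kappa>\<in>tf_cones Y. \<exists>l. linear l \<and> l ` (tf_lattice Y \<inter> span \<kappa>) \<subseteq> \<int> \<and> (\<forall>y\<in>\<kappa>. g y = l y)"
      using g(1) unfolding meromorphic_def by (rule conjunct2)
    from bspec[OF this c] show ?thesis unfolding star_lattice ball_simps .
  qed
  then have "\<forall>\<zeta>\<in>St. \<exists>l. linear l \<and> l ` (\<pi> ` N \<inter> span (\<pi> ` \<zeta>)) \<subseteq> \<int> \<and> (\<forall>x\<in>\<zeta>. g (\<pi> x) = l (\<pi> x))" by blast
  from bchoice[OF this] obtain l where
    l': "\<forall>\<zeta>\<in>St. linear (l \<zeta>) \<and> l \<zeta> ` (\<pi> ` N \<inter> span (\<pi> ` \<zeta>)) \<subseteq> \<int> \<and> (\<forall>x\<in>\<zeta>. g (\<pi> x) = l \<zeta> (\<pi> x))" ..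
  then have l: "\<And>\<zeta>. \<zeta> \<in> St \<Longrightarrow> linear (l \<zeta>)" "\<And>\<zeta>. \<zeta> \<in> St \<Longrightarrow> l \<zeta> ` (\<pi> ` N \<inter> span (\<pi> ` \<zeta>)) \<subseteq> \<int>"
    "\<And>\<zeta> x. \<zeta> \<in> St \<Longrightarrow> x \<in> \<zeta> \<Longrightarrow> g (\<pi> x) = l \<zeta> (\<pi> x)" by blast+
  define f where "f = (\<lambda>x. g (\<pi> x))"
  have lin: "linear (\<lambda>x. l \<zeta> (\<pi> x))" if "\<zeta> \<in> St" for \<zeta>
    using linear_compose[OF quot l(1)[OF that]] by (simp add: o_def)
  have "integral_linear_on N \<zeta> f" if "\<zeta> \<in> St" for \<zeta>
    unfolding integral_linear_on_def
  proof (intro exI conjI ballI)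
    show "linear (\<lambda>x. l \<zeta> (\<pi> x))" by (rule lin[OF that])
    show "(\<lambda>x. l \<zeta> (\<pi> x)) ` (N \<inter> span \<zeta>) \<subseteq> \<int>"
      using l(2)[OF that] unfolding star_lattice_span[OF that] by blast
    show "f x = l \<zeta> (\<pi> x)" if "x \<in> \<zeta>" for x unfolding f_def using l(3) \<open>\<zeta> \<in> St\<close> that by blast
  qed
  moreover have "balanced_at X f \<tau>" if \<tau>: "\<tau> \<in> walls X" "p \<in> \<tau>" for \<tau>
  proof -
    have \<tau>S: "\<tau> \<in> St" using pS \<tau> walls_subset by blast
    note WS = star_wall_facets(2)[OF \<tau>S]
    have "\<forall>\<sigma>\<in>wall_facets X \<tau>. \<exists>v. is_normal_vec N \<sigma> \<tau> v" using wall_normal_ex[OF X \<tau>(1)] by blast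
    from bchoice[OF this] obtain n where n: "\<And>\<sigma>. \<sigma> \<in> wall_facets X \<tau> \<Longrightarrow> is_normal_vec N \<sigma> \<tau> (n \<sigma>)" by blast
    have "\<pi> ` \<tau> \<in> tf_cones Y" unfolding star_cones using \<tau>S by blast
    then have o: "ord_at Y g (\<pi> ` \<tau>) = 0"
      using g(2) star_wall[OF \<tau>S] \<tau>(1) unfolding div_trivial_def by blast
    show ?thesis
    proof (rule balanced_atI[OF X \<tau>(1) n, where l = "\<lambda>\<sigma> x. l \<sigma> (\<pi> x)" and L = "\<lambda>x. l \<tau> (\<pi> x)"])
      show "(\<Sum>\<sigma>\<in>wall_facets X \<tau>. of_int (tf_orient X \<sigma>) * (l \<sigma> (\<pi> (n \<sigma>)) - l \<tau> (\<pi> (n \<sigma>)))) = 0"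
        using star_ord[OF \<tau>S \<tau>(1) n l(1) l(2) l(3) l(1)[OF \<tau>S] l(2)[OF \<tau>S] l(3)[OF \<tau>S]] WS o by auto
    qed (use lin l(3) \<tau>S WS in \<open>auto simp: f_def\<close>)
  qed
  ultimately obtain m where m: "linear m" "\<And>\<zeta> x. \<zeta> \<in> St \<Longrightarrow> x \<in> \<zeta> \<Longrightarrow> f x = m x"
    using near pS unfolding div_faithful_near_def by metis
  have \<eta>S: "\<eta> \<in> St" unfolding St_def using \<eta> by blast
  have m0: "m e = 0" if "e \<in> \<eta>" for e
  proof -
    have "\<pi> e = 0" using ker that span_base by blast
    then have "f e = l \<eta> 0" unfolding f_def using l(3)[OF \<eta>S that] by simp
    then show ?thesis using m(2)[OF \<eta>S that] l(1)[OF \<eta>S] by (simp add: linear_0)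
  qed
  have "m x = 0" if "\<pi> x = 0" for x
    using linear_eq_0_on_span[OF m(1), of \<eta> x] m0 ker that by blast
  from linear_factor_kernel[OF quot m(1) this] obtain k where k: "linear k" "\<And>x. k (\<pi> x) = m x" by blast
  show "linear_on_fan Y g"
    unfolding linear_on_fan_def support_def star_cones
    using k m(2) unfolding f_def by auto
qed

text \<open>A function on the cones through \<open>p\<close> may vary along \<open>\<eta>\<close>.
  Subtracting a form \<open>L0\<close> that agrees with it on \<open>\<eta>\<close> makes it
  descend, and choosing \<open>L0\<close> integral on the whole lattice keeps the result integral;
  being linear, \<open>L0\<close> does not affect the orders.\<close>

lemma near_if_div_faithful_at:
  assumes p: "\<And>\<zeta>. \<zeta> \<in> tf_cones X \<Longrightarrow> p \<in> \<zeta> \<longleftrightarrow> \<eta> \<subseteq> \<zeta>" and at: "div_faithful_at X \<eta>"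
  shows "div_faithful_near X p"
  unfolding div_faithful_near_def
proof (intro allI impI)
  fix f assume f: "\<forall>\<sigma>\<in>tf_cones X. p \<in> \<sigma> \<longrightarrow> integral_linear_on N \<sigma> f"
    and bal: "\<forall>\<tau>\<in>walls X. p \<in> \<tau> \<longrightarrow> balanced_at X f \<tau>"
  have pS: "\<zeta> \<in> St \<longleftrightarrow> \<zeta> \<in> tf_cones X \<and> p \<in> \<zeta>" for \<zeta> unfolding St_def using p by blast
  have "\<forall>\<zeta>\<in>St. \<exists>l. linear l \<and> l ` (N \<inter> span \<zeta>) \<subseteq> \<int> \<and> (\<forall>x\<in>\<zeta>. f x = l x)"
    using f pS unfolding integral_linear_on_def by blast
  from bchoice[OF this] obtain l where
    l': "\<forall>\<zeta>\<in>St. linear (l \<zeta>) \<and> l \<zeta> ` (N \<inter> span \<zeta>) \<subseteq> \<int> \<and> (\<forall>x\<in>\<zeta>. f x = l \<zeta> x)" ..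
  then have l: "\<And>\<zeta>. \<zeta> \<in> St \<Longrightarrow> linear (l \<zeta>)" "\<And>\<zeta>. \<zeta> \<in> St \<Longrightarrow> l \<zeta> ` (N \<inter> span \<zeta>) \<subseteq> \<int>"
    "\<And>\<zeta> x. \<zeta> \<in> St \<Longrightarrow> x \<in> \<zeta> \<Longrightarrow> f x = l \<zeta> x" by blast+
  have \<eta>S: "\<eta> \<in> St" unfolding St_def using \<eta> by blast
  obtain F where F: "finite F" "F \<subseteq> N" "span \<eta> = span F"
    using rational_coneE[OF tropical_fan_cone[OF X \<eta>]] by metis
  obtain L0 where L0: "linear L0" "\<And>x. x \<in> span \<eta> \<Longrightarrow> L0 x = l \<eta> x" "L0 ` N \<subseteq> \<int>"
    using integral_form_extend[OF tropical_fan_lattice[OF X] F(1,2) l(1)[OF \<eta>S]] l(2)[OF \<eta>S] F(3) by metis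
  have L0f: "L0 e = f e" if "e \<in> \<eta>" for e using L0(2) l(3)[OF \<eta>S that] span_base[OF that] by simp
  have "\<exists>k. linear k \<and> (\<forall>x. k (\<pi> x) = l \<zeta> x - L0 x)" if \<zeta>: "\<zeta> \<in> St" for \<zeta>
  proof -
    have lin: "linear (\<lambda>x. l \<zeta> x - L0 x)" by (intro linear_compose_sub l(1) \<zeta> L0(1))
    have "l \<zeta> x - L0 x = 0" if "\<pi> x = 0" for x
    proof -
      have x: "x \<in> span \<eta>" using ker that by blast
      have "l \<zeta> x = L0 x"
      proof (rule linear_eq_on_span[OF l(1)[OF \<zeta>] L0(1) _ x])
        fix e assume e: "e \<in> \<eta>"
        then have "e \<in> \<zeta>" using StD(2)[OF \<zeta>] by blast
        then show "l \<zeta> e = L0 e" using l(3)[OF \<zeta>] L0f[OF e] by simp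
      qed
      then show ?thesis by simp
    qed
    from linear_factor_kernel[OF quot lin this] show ?thesis by blast
  qed
  then have "\<forall>\<zeta>\<in>St. \<exists>k. linear k \<and> (\<forall>x. k (\<pi> x) = l \<zeta> x - L0 x)" by blast
  from bchoice[OF this] obtain k where "\<forall>\<zeta>\<in>St. linear (k \<zeta>) \<and> (\<forall>x. k \<zeta> (\<pi> x) = l \<zeta> x - L0 x)" ..
  then have k: "\<And>\<zeta>. \<zeta> \<in> St \<Longrightarrow> linear (k \<zeta>)" "\<And>\<zeta> x. \<zeta> \<in> St \<Longrightarrow> k \<zeta> (\<pi> x) = l \<zeta> x - L0 x" by blast+
  \<comment> \<open>Some cone over \<open>y\<close> is chosen; \<open>star_lift\<close> shows below
    that the value does not depend on it.\<close>
  define g where "g = (\<lambda>y. k (SOME \<zeta>. \<zeta> \<in> St \<and> y \<in> \<pi> ` \<zeta>) y)"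
  have g: "g (\<pi> x) = f x - L0 x" if \<zeta>: "\<zeta> \<in> St" and x: "x \<in> \<zeta>" for \<zeta> x
  proof -
    define \<zeta>' where "\<zeta>' = (SOME \<zeta>'. \<zeta>' \<in> St \<and> \<pi> x \<in> \<pi> ` \<zeta>')"
    have "\<zeta>' \<in> St \<and> \<pi> x \<in> \<pi> ` \<zeta>'" unfolding \<zeta>'_def by (rule someI[of _ \<zeta>]) (use \<zeta> x in blast)
    then obtain x' where x': "\<zeta>' \<in> St" "x' \<in> \<zeta>'" "\<pi> x = \<pi> x'" by blast
    obtain e e' where e: "e \<in> \<eta>" "e' \<in> \<eta>" "x + e = x' + e'" "x + e \<in> \<zeta>" "x + e \<in> \<zeta>'"
      using star_lift[OF \<zeta> x'(1) x x'(2,3)] by blast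
    have "e \<in> \<zeta>" "e' \<in> \<zeta>'" using e StD(2) \<zeta> x'(1) by blast+
    then have "f (x + e) = f x + f e"
      using l(3)[OF \<zeta> x] l(3)[OF \<zeta> e(4)] l(3)[OF \<zeta>, of e] l(1)[OF \<zeta>] by (simp add: linear_add)
    moreover have "f (x' + e') = f x' + f e'"
    proof -
      have "x' + e' \<in> \<zeta>'" using e(3,5) by simp
      then show ?thesis
        using l(3)[OF x'(1,2)] l(3)[OF x'(1), of "x' + e'"] l(3)[OF x'(1) \<open>e' \<in> \<zeta>'\<close>] l(1)[OF x'(1)]
        by (simp add: linear_add)
    qed
    ultimately have fa: "f (x + e) = f x + f e" "f (x' + e') = f x' + f e'" .
    have "L0 (x + e) = L0 x + f e" "L0 (x' + e') = L0 x' + f e'"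
      using L0(1) L0f e(1,2) by (simp_all add: linear_add)
    then have "f x - L0 x = f x' - L0 x'" using fa e(3) by simp
    moreover have "g (\<pi> x) = k \<zeta>' (\<pi> x')" unfolding g_def \<zeta>'_def[symmetric] using x'(3) by simp
    ultimately show ?thesis using k(2)[OF x'(1)] l(3)[OF x'(1,2)] by simp
  qed
  have gk: "g (\<pi> x) = k \<zeta> (\<pi> x)" if "\<zeta> \<in> St" "x \<in> \<zeta>" for \<zeta> x
    using g[OF that] k(2)[OF that(1)] l(3)[OF that] by simp
  have kint: "k \<zeta> ` (\<pi> ` N \<inter> span (\<pi> ` \<zeta>)) \<subseteq> \<int>" if \<zeta>: "\<zeta> \<in> St" for \<zeta>
  proof
    fix y assume "y \<in> k \<zeta> ` (\<pi> ` N \<inter> span (\<pi> ` \<zeta>))"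
    then obtain x where x: "x \<in> N" "x \<in> span \<zeta>" "y = k \<zeta> (\<pi> x)" unfolding star_lattice_span[OF \<zeta>] by blast
    have "l \<zeta> x \<in> \<int>" "L0 x \<in> \<int>" using l(2)[OF \<zeta>] L0(3) x by blast+
    then show "y \<in> \<int>" using x(3) k(2)[OF \<zeta>] by simp
  qed
  have "meromorphic Y g"
    unfolding meromorphic_def
  proof
    show "continuous_on (support Y) g"
      unfolding support_def
    proof (rule continuous_on_piecewise_linear)
      show "finite (tf_cones Y)" unfolding star_cones St_def using tropical_fan_finite[OF X] by simp
      fix \<kappa> assume "\<kappa> \<in> tf_cones Y"
      then obtain \<zeta> where \<zeta>: "\<zeta> \<in> St" "\<kappa> = \<pi> ` \<zeta>" unfolding star_cones by blast
      obtain G where G: "finite G" "\<zeta> = convex_cone hull G"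
        using rational_coneE[OF tropical_fan_cone[OF X StD(1)[OF \<zeta>(1)]]] by metis
      then have "\<kappa> = convex_cone hull (\<pi> ` G)" using \<zeta>(2) convex_cone_hull_linear_image[OF quot] by metis
      then show "\<exists>F. finite F \<and> \<kappa> = convex_cone hull F" using G(1) by blast
      show "\<exists>l. linear l \<and> (\<forall>x\<in>\<kappa>. g x = l x)" using k(1) gk \<zeta> by blast
    qed
    show "\<forall>\<sigma>\<in>tf_cones Y. \<exists>l. linear l \<and> l ` (tf_lattice Y \<inter> span \<sigma>) \<subseteq> \<int> \<and> (\<forall>x\<in>\<sigma>. g x = l x)"
      unfolding star_cones star_lattice using k(1) kint gk by blast
  qed
  moreover have "div_trivial Y g"
    unfolding div_trivial_def
  proof (intro ballI impI)
    fix \<kappa> assume \<kappa>: "\<kappa> \<in> tf_cones Y" "dim \<kappa> + 1 = fan_dim Y"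
    then obtain \<tau> where \<tau>: "\<tau> \<in> St" "\<kappa> = \<pi> ` \<tau>" unfolding star_cones by blast
    have w: "\<tau> \<in> walls X" using star_wall[OF \<tau>(1)] \<kappa>(2) \<tau>(2) by blast
    note WS = star_wall_facets(2)[OF \<tau>(1)]
    have WS': "\<sigma> \<in> St" if "\<sigma> \<in> wall_facets X \<tau>" for \<sigma> using WS that by blast
    have "\<forall>\<sigma>\<in>wall_facets X \<tau>. \<exists>v. is_normal_vec N \<sigma> \<tau> v" using wall_normal_ex[OF X w] by blast
    from bchoice[OF this] obtain n where n: "\<And>\<sigma>. \<sigma> \<in> wall_facets X \<tau> \<Longrightarrow> is_normal_vec N \<sigma> \<tau> (n \<sigma>)" by blast
    have "balanced_at X f \<tau>" using bal w \<tau>(1) pS by blast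
    from balanced_atD[OF this n l(1)[OF WS'] l(3)[OF WS'] l(1)[OF \<tau>(1)] l(3)[OF \<tau>(1)]]
    have "(\<Sum>\<sigma>\<in>wall_facets X \<tau>. of_int (tf_orient X \<sigma>) * (l \<sigma> (n \<sigma>) - l \<tau> (n \<sigma>))) = 0" by simp
    moreover have "real_of_int (ord_at Y g (\<pi> ` \<tau>)) =
      - (\<Sum>\<sigma>\<in>wall_facets X \<tau>. of_int (tf_orient X \<sigma>) * (k \<sigma> (\<pi> (n \<sigma>)) - k \<tau> (\<pi> (n \<sigma>))))"
      by (rule star_ord[OF \<tau>(1) w n k(1)[OF WS'] kint[OF WS'] gk[OF WS'] k(1)[OF \<tau>(1)] kint[OF \<tau>(1)] gk[OF \<tau>(1)]])
    moreover have "(\<Sum>\<sigma>\<in>wall_facets X \<tau>. of_int (tf_orient X \<sigma>) * (k \<sigma> (\<pi> (n \<sigma>)) - k \<tau> (\<pi> (n \<sigma>))))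
      = (\<Sum>\<sigma>\<in>wall_facets X \<tau>. of_int (tf_orient X \<sigma>) * (l \<sigma> (n \<sigma>) - l \<tau> (n \<sigma>)))"
      using k(2) WS' \<tau>(1) by (intro sum.cong) auto
    ultimately show "ord_at Y g \<kappa> = 0" unfolding \<tau>(2) by simp
  qed
  ultimately have "linear_on_fan Y g" using at unfolding div_faithful_at_def by blast
  then obtain m where m: "linear m" "\<And>y. y \<in> support Y \<Longrightarrow> g y = m y" unfolding linear_on_fan_def by blast
  have "f x = m (\<pi> x) + L0 x" if "\<zeta> \<in> St" "x \<in> \<zeta>" for \<zeta> x
  proof -
    have "\<pi> x \<in> support Y" unfolding support_def star_cones using that by blast
    then show ?thesis using m(2) g[OF that] by simp
  qed
  moreover have "linear (\<lambda>x. m (\<pi> x) + L0 x)"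
    using linear_compose_add[OF linear_compose[OF quot m(1)] L0(1)] by (simp add: o_def)
  ultimately show "\<exists>m. linear m \<and> (\<forall>\<sigma>\<in>tf_cones X. p \<in> \<sigma> \<longrightarrow> (\<forall>x\<in>\<sigma>. f x = m x))"
    using pS by blast
qed

end

lemma div_faithful_iff_near:
  fixes X :: "'a::real_normed_vector tfan"
  assumes X: "tropical_fan X"
  shows "div_faithful X \<longleftrightarrow> (\<forall>p\<in>support X. div_faithful_near X p)"
proof
  assume df: "div_faithful X"
  show "\<forall>p\<in>support X. div_faithful_near X p"
  proof
    fix p assume "p \<in> support X"
    then obtain \<eta> where e: "\<eta> \<in> tf_cones X" "\<And>\<zeta>. \<zeta> \<in> tf_cones X \<Longrightarrow> p \<in> \<zeta> \<longleftrightarrow> \<eta> \<subseteq> \<zeta>"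
      using fan_minimal_cone[OF X] by blast
    interpret fan_star X \<eta> using X e(1) by unfold_locales
    show "div_faithful_near X p"
      using near_if_div_faithful_at[OF e(2)] df e(1) unfolding div_faithful_def by blast
  qed
next
  assume near: "\<forall>p\<in>support X. div_faithful_near X p"
  show "div_faithful X"
    unfolding div_faithful_def
  proof
    fix \<eta> assume e: "\<eta> \<in> tf_cones X"
    obtain p where p: "p \<in> \<eta>" "\<And>\<zeta>. \<zeta> \<in> tf_cones X \<Longrightarrow> p \<in> \<zeta> \<longleftrightarrow> \<eta> \<subseteq> \<zeta>"
      using fan_generic_point[OF X e] by blast
    interpret fan_star X \<eta> using X e by unfold_locales
    have "p \<in> support X" unfolding support_def using p(1) e by blast
    then show "div_faithful_at X \<eta>" using div_faithful_at_if_near[OF p(2)] near by blast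
  qed
qed

section \<open>Comparing balancing conditions\<close>

text \<open>One pattern serves all constructions: \<open>R\<close> is \<open>{0}\<close> for
  isomorphisms and graphs, the vertical ray for upper cones, and a facet of the other factor for
  products. Modulo \<open>span B\<close>, which contains \<open>R\<close>, a vector \<open>z\<close>
  of \<open>span A\<close> is the lift of \<open>p z\<close>, so \<open>p\<close> and
  \<open>\<iota>\<close> identify the two quotients.\<close>

lemma
  fixes \<iota> :: "'a::real_vector \<Rightarrow> 'b::real_vector" and p :: "'b \<Rightarrow> 'a"
  assumes A: "A = {\<iota> x + r | x r. x \<in> \<sigma> \<and> r \<in> R}" and B: "B = {\<iota> x + r | x r. x \<in> \<tau> \<and> r \<in> R}"
    and \<iota>: "linear \<iota>" and p: "linear p" "\<And>x. x \<in> span \<sigma> \<Longrightarrow> p (\<iota> x) = x" "\<And>r. r \<in> R \<Longrightarrow> p r = 0"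
    and \<tau>: "\<tau> \<subseteq> \<sigma>" "0 \<in> \<tau>" and R: "0 \<in> R"
  shows codim1_sum: "codim1 \<tau> \<sigma> \<Longrightarrow> codim1 B A"
    and is_normal_vec_sum: "\<lbrakk>is_normal_vec N \<sigma> \<tau> n; is_lattice M; p ` (M \<inter> span A) \<subseteq> N; \<iota> ` (N \<inter> span \<sigma>) \<subseteq> M\<rbrakk>
      \<Longrightarrow> is_normal_vec M A B (\<iota> n)"
proof -
  define J where "J = (\<lambda>\<sigma>. {\<iota> x + r | x r. x \<in> \<sigma> \<and> r \<in> R})"
  have AB: "A = J \<sigma>" "B = J \<tau>" unfolding J_def by (fact A, fact B)
  have J\<iota>: "\<iota> x \<in> J \<rho>" if "x \<in> \<rho>" for x \<rho>
    unfolding J_def using that R by force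
  have JR: "r \<in> J \<tau>" if "r \<in> R" for r
    unfolding J_def using that \<tau>(2) linear_0[OF \<iota>] by force
  have J\<iota>_span: "\<iota> x \<in> span (J \<rho>)" if "x \<in> span \<rho>" for x \<rho>
  proof -
    have "\<iota> x \<in> span (\<iota> ` \<rho>)" using that \<iota> by (simp add: linear_span_image)
    moreover have "\<iota> ` \<rho> \<subseteq> J \<rho>" using J\<iota> by blast
    ultimately show ?thesis using span_mono by blast
  qed
  have p_span: "p z \<in> span \<rho>" if "z \<in> span (J \<rho>)" "\<rho> \<subseteq> \<sigma>" for z \<rho>
  proof -
    have "p ` J \<rho> \<subseteq> \<rho>"
    proof
      fix y assume "y \<in> p ` J \<rho>"
      then obtain x r where x: "y = p (\<iota> x + r)" "x \<in> \<rho>" "r \<in> R" unfolding J_def by blast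
      then have "y = x" using p(1,3) p(2)[of x] that(2) span_base[of x \<sigma>] by (auto simp: linear_add)
      then show "y \<in> \<rho>" using x by simp
    qed
    then have "span (p ` J \<rho>) \<subseteq> span \<rho>" by (rule span_mono)
    then show ?thesis using that(1) p(1) by (auto simp: linear_span_image)
  qed
  \<comment> \<open>The map \<open>z - \<iota> (p z)\<close> sends \<open>\<iota> x + r\<close> to
    \<open>r\<close>, and \<open>R\<close> lies in \<open>J \<tau>\<close> because \<open>0\<close>
    lies in \<open>\<tau>\<close>.\<close>
  have rest: "z - \<iota> (p z) \<in> span (J \<tau>)" if "z \<in> span (J \<sigma>)" for z
  proof -
    have lin: "linear (\<lambda>z. z - \<iota> (p z))"
      using linear_compose_sub[OF linear_ident linear_compose[OF p(1) \<iota>]] by (simp add: o_def)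
    have "(\<lambda>z. z - \<iota> (p z)) ` J \<sigma> \<subseteq> R"
    proof
      fix y assume "y \<in> (\<lambda>z. z - \<iota> (p z)) ` J \<sigma>"
      then obtain x r where x: "y = (\<iota> x + r) - \<iota> (p (\<iota> x + r))" "x \<in> \<sigma>" "r \<in> R" unfolding J_def by blast
      then have "p (\<iota> x + r) = x" using p(1,3) p(2)[of x] span_base[of x \<sigma>] by (auto simp: linear_add)
      then show "y \<in> R" using x by simp
    qed
    then have "(\<lambda>z. z - \<iota> (p z)) ` J \<sigma> \<subseteq> J \<tau>" using JR by blast
    then have "span ((\<lambda>z. z - \<iota> (p z)) ` J \<sigma>) \<subseteq> span (J \<tau>)" by (rule span_mono)
    then show ?thesis using that linear_span_image[OF lin] by blast
  qed
  have J\<tau>\<sigma>: "span (J \<tau>) \<subseteq> span (J \<sigma>)" using \<tau>(1) unfolding J_def by (intro span_mono) blast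
  show "codim1 B A" if cd: "codim1 \<tau> \<sigma>"
  proof -
    obtain v where v: "v \<in> \<sigma>" "v \<notin> span \<tau>" "\<sigma> \<subseteq> span (insert v \<tau>)" using cd unfolding codim1_def by blast
    have pv: "p (\<iota> v) = v" using p(2) v(1) span_base by blast
    have "\<iota> v \<notin> span (J \<tau>)" using p_span[OF _ \<tau>(1)] pv v(2) by metis
    moreover have "J \<sigma> \<subseteq> span (insert (\<iota> v) (J \<tau>))"
    proof
      fix z assume z: "z \<in> J \<sigma>"
      then have "p z \<in> span \<sigma>" using p_span span_base by blast
      moreover have "span \<sigma> \<subseteq> span (insert v \<tau>)" using v(3) by (simp add: span_minimal)
      ultimately obtain k where k: "p z - k *\<^sub>R v \<in> span \<tau>" unfolding span_insert by blast
      have "(z - \<iota> (p z)) + \<iota> (p z - k *\<^sub>R v) \<in> span (J \<tau>)"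
        using rest[OF span_base[OF z]] J\<iota>_span[OF k] by (rule span_add)
      then have "z - k *\<^sub>R \<iota> v \<in> span (J \<tau>)" using \<iota> by (simp add: linear_diff linear_scale)
      then show "z \<in> span (insert (\<iota> v) (J \<tau>))" unfolding span_insert by blast
    qed
    moreover have "J \<tau> \<subseteq> J \<sigma>" using \<tau>(1) unfolding J_def by blast
    ultimately show ?thesis unfolding AB codim1_def using J\<iota>[OF v(1)] by blast
  qed
  show "is_normal_vec M A B (\<iota> n)"
    if n: "is_normal_vec N \<sigma> \<tau> n" and M: "is_lattice M" "p ` (M \<inter> span A) \<subseteq> N" "\<iota> ` (N \<inter> span \<sigma>) \<subseteq> M"
  proof -
    note M = M(1) M(2)[unfolded AB] M(3)
    have n1: "n \<in> N" "n \<in> span \<sigma>" "{u + of_int k *\<^sub>R n | u k. u \<in> N \<inter> span \<tau>} = N \<inter> span \<sigma>"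
      using n unfolding is_normal_vec_def by blast+
    obtain x y where xy: "x \<in> \<sigma>" "y \<in> span \<tau>" "n = x + y" using n unfolding is_normal_vec_def by blast
    have \<iota>n: "\<iota> n \<in> M" "\<iota> n \<in> span (J \<sigma>)" using n1(1,2) M(3) J\<iota>_span by blast+
    have "\<iota> n = \<iota> x + \<iota> y" using xy(3) \<iota> by (simp add: linear_add)
    then have "\<exists>x\<in>J \<sigma>. \<exists>y\<in>span (J \<tau>). \<iota> n = x + y" using J\<iota>[OF xy(1)] J\<iota>_span[OF xy(2)] by blast
    moreover have "{u + of_int k *\<^sub>R \<iota> n | u k. u \<in> M \<inter> span (J \<tau>)} = M \<inter> span (J \<sigma>)"
    proof (intro equalityI subsetI)
      fix z assume "z \<in> {u + of_int k *\<^sub>R \<iota> n | u k. u \<in> M \<inter> span (J \<tau>)}"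
      then obtain u k where u: "z = u + of_int k *\<^sub>R \<iota> n" "u \<in> M" "u \<in> span (J \<tau>)" by blast
      have "z \<in> M" unfolding u(1) using M(1) u(2) \<iota>n(1) by (intro is_lattice_add is_lattice_scale)
      moreover have "z \<in> span (J \<sigma>)" unfolding u(1) using u(3) J\<tau>\<sigma> \<iota>n(2) by (intro span_add span_scale) auto
      ultimately show "z \<in> M \<inter> span (J \<sigma>)" by blast
    next
      fix z assume z: "z \<in> M \<inter> span (J \<sigma>)"
      then have "p z \<in> N \<inter> span \<sigma>" using M(2) p_span[of z \<sigma>] by blast
      then obtain u and k :: int where u: "p z = u + of_int k *\<^sub>R n" "u \<in> span \<tau>" unfolding n1(3)[symmetric] by blast
      have "(z - \<iota> (p z)) + \<iota> u \<in> span (J \<tau>)" using rest J\<iota>_span[OF u(2)] z span_add by blast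
      moreover have "(z - \<iota> (p z)) + \<iota> u = z - of_int k *\<^sub>R \<iota> n"
        using u(1) \<iota> by (simp add: linear_add linear_scale)
      ultimately have "z - of_int k *\<^sub>R \<iota> n \<in> span (J \<tau>)" by simp
      moreover have "z - of_int k *\<^sub>R \<iota> n \<in> M" using M(1) z \<iota>n(1) by (intro is_lattice_diff is_lattice_scale) auto
      moreover have "z = (z - of_int k *\<^sub>R \<iota> n) + of_int k *\<^sub>R \<iota> n" by simp
      ultimately show "z \<in> {u + of_int k *\<^sub>R \<iota> n | u k. u \<in> M \<inter> span (J \<tau>)}" by blast
    qed
    ultimately show ?thesis unfolding AB is_normal_vec_def using \<iota>n by blast
  qed
qed

text \<open>
  \<open>J\<close> embeds the facets around the wall \<open>\<tau>\<close> of \<open>X\<close> into those around the wall \<open>\<kappa>\<close> of \<open>Y\<close>; the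
  remaining facets around \<open>\<kappa>\<close> contribute nothing.
\<close>

lemma balanced_at_pullback:
  fixes J :: "'a::real_vector set \<Rightarrow> 'b::real_vector set" and c :: int
  assumes X: "tropical_fan X" "\<tau> \<in> walls X" and Y: "tropical_fan Y" and bal: "balanced_at Y g \<kappa>"
    and J: "inj_on J (wall_facets X \<tau>)" "J ` wall_facets X \<tau> \<subseteq> wall_facets Y \<kappa>"
    and orient: "\<And>\<sigma>. \<sigma> \<in> wall_facets X \<tau> \<Longrightarrow> tf_orient Y (J \<sigma>) = c * tf_orient X \<sigma>" "c \<noteq> 0"
    and normal: "\<And>\<sigma>. \<sigma> \<in> wall_facets X \<tau> \<Longrightarrow> is_normal_vec (tf_lattice X) \<sigma> \<tau> (n \<sigma>)"
      "\<And>\<sigma>. \<sigma> \<in> wall_facets X \<tau> \<Longrightarrow> is_normal_vec (tf_lattice Y) (J \<sigma>) \<kappa> (n' \<sigma>)"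
    and rest: "\<And>\<rho>. \<rho> \<in> wall_facets Y \<kappa> \<Longrightarrow> \<rho> \<notin> J ` wall_facets X \<tau> \<Longrightarrow>
      is_normal_vec (tf_lattice Y) \<rho> \<kappa> (m \<rho>) \<and> l' \<rho> (m \<rho>) = L' (m \<rho>)"
    and forms: "\<And>\<sigma>. \<sigma> \<in> wall_facets X \<tau> \<Longrightarrow> linear (l \<sigma>)"
      "\<And>\<sigma> x. \<sigma> \<in> wall_facets X \<tau> \<Longrightarrow> x \<in> \<sigma> \<Longrightarrow> f x = l \<sigma> x"
      "linear L" "\<And>x. x \<in> \<tau> \<Longrightarrow> f x = L x"
    and forms': "\<And>\<rho>. \<rho> \<in> wall_facets Y \<kappa> \<Longrightarrow> linear (l' \<rho>)"
      "\<And>\<rho> y. \<rho> \<in> wall_facets Y \<kappa> \<Longrightarrow> y \<in> \<rho> \<Longrightarrow> g y = l' \<rho> y"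
      "linear L'" "\<And>y. y \<in> \<kappa> \<Longrightarrow> g y = L' y"
    and compare: "\<And>\<sigma>. \<sigma> \<in> wall_facets X \<tau> \<Longrightarrow> l' (J \<sigma>) (n' \<sigma>) - L' (n' \<sigma>) = l \<sigma> (n \<sigma>) - L (n \<sigma>)"
  shows "balanced_at X f \<tau>"
proof -
  let ?W = "wall_facets X \<tau>" and ?V = "wall_facets Y \<kappa>"
  define i where "i = inv_into ?W J"
  have i: "i (J \<sigma>) = \<sigma>" if "\<sigma> \<in> ?W" for \<sigma> unfolding i_def using inv_into_f_f[OF J(1) that] .
  \<comment> \<open>Normal vectors for all facets around \<open>\<kappa>\<close>: the transported
    ones on the image of \<open>J\<close>, and elsewhere those along which \<open>l'\<close> and
    \<open>L'\<close> agree.\<close>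
  define k where "k = (\<lambda>\<rho>. if \<rho> \<in> J ` ?W then n' (i \<rho>) else m \<rho>)"
  have kJ: "k (J \<sigma>) = n' \<sigma>" if "\<sigma> \<in> ?W" for \<sigma> unfolding k_def using i[OF that] that by simp
  have k: "is_normal_vec (tf_lattice Y) \<rho> \<kappa> (k \<rho>)" if \<rho>: "\<rho> \<in> ?V" for \<rho>
  proof (cases "\<rho> \<in> J ` ?W")
    case True
    then obtain \<sigma> where \<sigma>: "\<sigma> \<in> ?W" "\<rho> = J \<sigma>" by blast
    show ?thesis unfolding \<sigma>(2) kJ[OF \<sigma>(1)] by (rule normal(2)[OF \<sigma>(1)])
  next
    case False
    then have "k \<rho> = m \<rho>" unfolding k_def by simp
    then show ?thesis using rest[OF \<rho> False] by simp
  qed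
  define G where "G = (\<lambda>\<rho>. of_int (tf_orient Y \<rho>) * (l' \<rho> (k \<rho>) - L' (k \<rho>)))"
  have "(\<Sum>\<rho>\<in>?V. G \<rho>) = 0"
    unfolding G_def by (rule balanced_atD[OF bal k forms'])
  moreover have "(\<Sum>\<rho>\<in>J ` ?W. G \<rho>) = (\<Sum>\<rho>\<in>?V. G \<rho>)"
  proof (rule sum.mono_neutral_left[OF finite_wall_facets[OF Y] J(2)], rule ballI)
    fix \<rho> assume \<rho>: "\<rho> \<in> ?V - J ` ?W"
    then have "k \<rho> = m \<rho>" unfolding k_def by simp
    then show "G \<rho> = 0" unfolding G_def using rest[of \<rho>] \<rho> by simp
  qed
  moreover have "(\<Sum>\<rho>\<in>J ` ?W. G \<rho>) = (\<Sum>\<sigma>\<in>?W. of_int c * (of_int (tf_orient X \<sigma>) * (l \<sigma> (n \<sigma>) - L (n \<sigma>))))"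
    unfolding sum.reindex[OF J(1)] G_def
  proof (intro sum.cong refl)
    fix \<sigma> assume \<sigma>: "\<sigma> \<in> ?W"
    show "((\<lambda>\<rho>. of_int (tf_orient Y \<rho>) * (l' \<rho> (k \<rho>) - L' (k \<rho>))) \<circ> J) \<sigma> = of_int c * (of_int (tf_orient X \<sigma>) * (l \<sigma> (n \<sigma>) - L (n \<sigma>)))"
      unfolding o_def kJ[OF \<sigma>] orient(1)[OF \<sigma>] compare[OF \<sigma>] by simp
  qed
  ultimately have "of_int c * (\<Sum>\<sigma>\<in>?W. of_int (tf_orient X \<sigma>) * (l \<sigma> (n \<sigma>) - L (n \<sigma>))) = 0"
    by (simp add: sum_distrib_left)
  then have z: "(\<Sum>\<sigma>\<in>?W. of_int (tf_orient X \<sigma>) * (l \<sigma> (n \<sigma>) - L (n \<sigma>))) = 0" using orient(2) by simp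
  show ?thesis by (rule balanced_atI[OF X, where n = n and l = l and L = L]) (fact normal(1) forms z)+
qed

lemma wall_normals:
  assumes "tropical_fan X" "\<tau> \<in> walls X"
  obtains n where "\<And>\<sigma>. \<sigma> \<in> wall_facets X \<tau> \<Longrightarrow> is_normal_vec (tf_lattice X) \<sigma> \<tau> (n \<sigma>)"
proof -
  have "\<forall>\<sigma>\<in>wall_facets X \<tau>. \<exists>v. is_normal_vec (tf_lattice X) \<sigma> \<tau> v" using wall_normal_ex[OF assms] by blast
  from bchoice[OF this] show ?thesis using that by blast
qed

lemma integral_linear_forms:
  assumes "\<And>\<sigma>. \<sigma> \<in> S \<Longrightarrow> integral_linear_on N \<sigma> f"
  obtains l where "\<And>\<sigma>. \<sigma> \<in> S \<Longrightarrow> linear (l \<sigma>)" "\<And>\<sigma>. \<sigma> \<in> S \<Longrightarrow> l \<sigma> ` (N \<inter> span \<sigma>) \<subseteq> \<int>"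
    "\<And>\<sigma> x. \<sigma> \<in> S \<Longrightarrow> x \<in> \<sigma> \<Longrightarrow> f x = l \<sigma> x"
proof -
  have "\<forall>\<sigma>\<in>S. \<exists>l. linear l \<and> l ` (N \<inter> span \<sigma>) \<subseteq> \<int> \<and> (\<forall>x\<in>\<sigma>. f x = l x)"
    using assms unfolding integral_linear_on_def by blast
  from bchoice[OF this] show ?thesis using that by blast
qed

section \<open>Isomorphisms\<close>

lemma span_support_lattice:
  assumes "tropical_fan X"
  obtains G where "finite G" "G \<subseteq> tf_lattice X" "span (support X) = span G"
proof -
  have "\<forall>\<sigma>\<in>tf_cones X. \<exists>F. finite F \<and> F \<subseteq> tf_lattice X \<and> span \<sigma> = span F"
    using rational_coneE[OF tropical_fan_cone[OF assms]] by metis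
  from bchoice[OF this] obtain F where F: "\<forall>\<sigma>\<in>tf_cones X. finite (F \<sigma>) \<and> F \<sigma> \<subseteq> tf_lattice X \<and> span \<sigma> = span (F \<sigma>)" ..
  define G where "G = (\<Union>\<sigma>\<in>tf_cones X. F \<sigma>)"
  have "G \<subseteq> span (support X)"
  proof
    fix x assume "x \<in> G"
    then obtain \<sigma> where "\<sigma> \<in> tf_cones X" "x \<in> span \<sigma>" unfolding G_def using F span_base by blast
    moreover then have "span \<sigma> \<subseteq> span (support X)" unfolding support_def by (intro span_mono) blast
    ultimately show "x \<in> span (support X)" by blast
  qed
  moreover have "support X \<subseteq> span G"
  proof
    fix x assume "x \<in> support X"
    then obtain \<sigma> where \<sigma>: "\<sigma> \<in> tf_cones X" "x \<in> \<sigma>" unfolding support_def by blast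
    then have "x \<in> span (F \<sigma>)" using F span_base by blast
    moreover have "span (F \<sigma>) \<subseteq> span G" unfolding G_def using \<sigma>(1) by (intro span_mono) blast
    ultimately show "x \<in> span G" by blast
  qed
  ultimately have "span (support X) = span G" by (simp add: span_eq)
  moreover have "finite G" "G \<subseteq> tf_lattice X" unfolding G_def using F tropical_fan_finite[OF assms] by auto
  ultimately show ?thesis using that by blast
qed

text \<open>
  A bijection of lattices need not be injective on their real spans a priori; here it is, because its
  inverse also extends linearly, along a basis of the target lattice.
\<close>

lemma tfan_iso_inverse:
  assumes X: "tropical_fan X" and Y: "tropical_fan Y" and \<phi>: "linear \<phi>"
    and bij: "bij_betw \<phi> (tf_lattice X \<inter> span (support X)) (tf_lattice Y \<inter> span (support Y))"
  obtains \<psi> where "linear \<psi>" "\<And>x. x \<in> span (support X) \<Longrightarrow> \<psi> (\<phi> x) = x"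
    "\<And>y. y \<in> span (support Y) \<Longrightarrow> \<phi> (\<psi> y) = y"
proof -
  let ?N = "tf_lattice X \<inter> span (support X)" and ?M = "tf_lattice Y \<inter> span (support Y)"
  obtain G where G: "finite G" "G \<subseteq> tf_lattice X" "span (support X) = span G" using span_support_lattice[OF X] by blast
  obtain H where H: "finite H" "H \<subseteq> tf_lattice Y" "span (support Y) = span H" using span_support_lattice[OF Y] by blast
  obtain B where B: "finite B" "independent B" "B \<subseteq> tf_lattice Y" "span B = span H"
    "\<And>x. x \<in> tf_lattice Y \<Longrightarrow> x \<in> span H \<Longrightarrow> \<exists>z :: _ \<Rightarrow> int. x = (\<Sum>b\<in>B. of_int (z b) *\<^sub>R b)"
    using is_lattice_Int_span_basis[OF tropical_fan_lattice[OF Y] H(1,2)] by blast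
  have BM: "B \<subseteq> ?M" using B(3,4) H(3) span_superset[of B] by auto
  define h where "h = inv_into ?N \<phi>"
  have h: "h y \<in> ?N" "\<phi> (h y) = y" if "y \<in> ?M" for y
    using bij that unfolding h_def bij_betw_def by (metis inv_into_into, metis f_inv_into_f)
  have h\<phi>: "h (\<phi> x) = x" if "x \<in> ?N" for x
    using bij that unfolding h_def bij_betw_def by simp
  obtain \<psi> where \<psi>: "linear \<psi>" "\<forall>b\<in>B. \<psi> b = h b" using linear_independent_extend[OF B(2)] by blast
  \<comment> \<open>On the lattice, \<open>\<psi> y\<close> is a lattice point of \<open>X\<close>
    with image \<open>y\<close>, so injectivity of \<open>\<phi>\<close> there identifies it with
    \<open>h y\<close>.\<close>
  have \<psi>h: "\<psi> y = h y" if y: "y \<in> ?M" for y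
  proof -
    obtain z :: "_ \<Rightarrow> int" where z: "y = (\<Sum>b\<in>B. of_int (z b) *\<^sub>R b)" using B(5) y H(3) by auto
    have e: "\<psi> y = (\<Sum>b\<in>B. of_int (z b) *\<^sub>R h b)"
      unfolding z using \<psi> by (simp add: linear_sum linear_scale)
    have "\<phi> (\<psi> y) = (\<Sum>b\<in>B. of_int (z b) *\<^sub>R \<phi> (h b))" unfolding e using \<phi> by (simp add: linear_sum linear_scale)
    also have "\<dots> = y" unfolding z using h(2) BM by (intro sum.cong arg_cong2[where f = scaleR] refl) blast
    finally have "\<phi> (\<psi> y) = y" .
    moreover have "\<psi> y \<in> ?N"
    proof
      show "\<psi> y \<in> tf_lattice X"
        unfolding e using h(1) BM tropical_fan_lattice[OF X] by (intro is_lattice_sum is_lattice_scale) blast+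
      show "\<psi> y \<in> span (support X)"
        unfolding e using h(1) BM by (intro span_sum span_scale) blast
    qed
    ultimately show ?thesis using h\<phi> by metis
  qed
  have 1: "\<psi> (\<phi> x) = x" if "x \<in> span (support X)" for x
  proof -
    have "linear (\<lambda>x. \<psi> (\<phi> x))" using linear_compose[OF \<phi> \<psi>(1)] by (simp add: o_def)
    moreover have "\<psi> (\<phi> g) = g" if "g \<in> G" for g
    proof -
      have g: "g \<in> ?N" using that G(2,3) span_superset[of G] by auto
      then have "\<phi> g \<in> ?M" using bij bij_betwE by blast
      then show ?thesis using \<psi>h h\<phi>[OF g] by simp
    qed
    ultimately show ?thesis using linear_eq_on_span[of "\<lambda>x. \<psi> (\<phi> x)" "\<lambda>x. x", OF _ linear_ident] that G(3) by metis
  qed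
  have 2: "\<phi> (\<psi> y) = y" if "y \<in> span (support Y)" for y
  proof -
    have "linear (\<lambda>y. \<phi> (\<psi> y))" using linear_compose[OF \<psi>(1) \<phi>] by (simp add: o_def)
    moreover have "\<phi> (\<psi> g) = g" if "g \<in> B" for g using \<psi>h h(2) BM that by (metis subsetD)
    ultimately show ?thesis
      using linear_eq_on_span[of "\<lambda>y. \<phi> (\<psi> y)" "\<lambda>x. x", OF _ linear_ident] that H(3) B(4) by metis
  qed
  show ?thesis using that \<psi>(1) 1 2 by blast
qed

text \<open>The inverse \<open>\<psi>\<close> is carried along as a total linear map, which makes
  the notion symmetric: one implication and \<open>flip\<close> then give both.\<close>

locale fan_iso =
  fixes X :: "'a::real_vector tfan" and Y :: "'b::real_vector tfan" and \<phi> :: "'a \<Rightarrow> 'b" and \<psi> :: "'b \<Rightarrow> 'a"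
  assumes X: "tropical_fan X" and Y: "tropical_fan Y" and \<phi>: "linear \<phi>" and \<psi>: "linear \<psi>"
    and \<psi>\<phi>: "\<And>x. x \<in> span (support X) \<Longrightarrow> \<psi> (\<phi> x) = x" and \<phi>\<psi>: "\<And>y. y \<in> span (support Y) \<Longrightarrow> \<phi> (\<psi> y) = y"
    and lattice: "bij_betw \<phi> (tf_lattice X \<inter> span (support X)) (tf_lattice Y \<inter> span (support Y))"
    and cones: "(`) \<phi> ` tf_cones X = tf_cones Y"
    and orient: "\<And>\<sigma>. \<sigma> \<in> facets X \<Longrightarrow> tf_orient Y (\<phi> ` \<sigma>) = tf_orient X \<sigma>"
begin

lemma cone_support: "\<sigma> \<in> tf_cones X \<Longrightarrow> \<sigma> \<subseteq> span (support X)"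
  unfolding support_def using span_superset[of "\<Union> (tf_cones X)"] by blast

lemma image_back: "\<psi> ` \<phi> ` \<sigma> = \<sigma>" if "\<sigma> \<in> tf_cones X"
proof -
  have "\<psi> ` \<phi> ` \<sigma> = (\<lambda>x. x) ` \<sigma>"
    unfolding image_image using \<psi>\<phi> cone_support[OF that] by (intro image_cong refl) blast
  then show ?thesis by simp
qed

lemma image_subset_iff: "\<sigma> \<in> tf_cones X \<Longrightarrow> \<tau> \<in> tf_cones X \<Longrightarrow> \<phi> ` \<sigma> \<subseteq> \<phi> ` \<tau> \<longleftrightarrow> \<sigma> \<subseteq> \<tau>"
  using image_back by (metis image_mono)

lemma image_cone: "\<sigma> \<in> tf_cones X \<Longrightarrow> \<phi> ` \<sigma> \<in> tf_cones Y"
  unfolding cones[symmetric] by (rule imageI)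

lemma image_coneE:
  assumes "\<kappa> \<in> tf_cones Y"
  obtains \<sigma> where "\<sigma> \<in> tf_cones X" "\<kappa> = \<phi> ` \<sigma>"
  using assms unfolding cones[symmetric] by (rule imageE)

lemma facets_image: "facets Y = (`) \<phi> ` facets X"
proof (intro equalityI subsetI)
  fix \<kappa> assume k: "\<kappa> \<in> facets Y"
  obtain \<sigma> where \<sigma>: "\<sigma> \<in> tf_cones X" "\<kappa> = \<phi> ` \<sigma>" using image_coneE[OF facets_subset[OF k]] .
  have "\<tau> = \<sigma>" if \<tau>: "\<tau> \<in> tf_cones X" "\<sigma> \<subseteq> \<tau>" for \<tau>
  proof -
    have "\<phi> ` \<tau> = \<phi> ` \<sigma>"
      using facets_maximal[OF k image_cone[OF \<tau>(1)]] image_mono[OF \<tau>(2)] \<sigma>(2) by metis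
    then show ?thesis using image_back[OF \<tau>(1)] image_back[OF \<sigma>(1)] by metis
  qed
  then have "\<sigma> \<in> facets X" using \<sigma>(1) unfolding facets_def by simp
  then show "\<kappa> \<in> (`) \<phi> ` facets X" unfolding \<sigma>(2) by (rule imageI)
next
  fix \<kappa> assume "\<kappa> \<in> (`) \<phi> ` facets X"
  then obtain \<sigma> where \<sigma>: "\<sigma> \<in> facets X" "\<kappa> = \<phi> ` \<sigma>" by (rule imageE)
  have "\<rho> = \<kappa>" if \<rho>: "\<rho> \<in> tf_cones Y" "\<kappa> \<subseteq> \<rho>" for \<rho>
  proof -
    obtain \<tau> where \<tau>: "\<tau> \<in> tf_cones X" "\<rho> = \<phi> ` \<tau>" using image_coneE[OF \<rho>(1)] .
    have "\<sigma> \<subseteq> \<tau>" using image_subset_iff[OF facets_subset[OF \<sigma>(1)] \<tau>(1)] \<rho>(2) \<sigma>(2) \<tau>(2) by simp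
    then show ?thesis using facets_maximal[OF \<sigma>(1) \<tau>(1)] \<sigma>(2) \<tau>(2) by simp
  qed
  then show "\<kappa> \<in> facets Y"
    using image_cone[OF facets_subset[OF \<sigma>(1)]] \<sigma>(2) unfolding facets_def by simp
qed

lemma flip: "fan_iso Y X \<psi> \<phi>"
proof (rule fan_iso.intro; (fact X Y \<phi> \<psi> \<psi>\<phi> \<phi>\<psi>)?)
  show "bij_betw \<psi> (tf_lattice Y \<inter> span (support Y)) (tf_lattice X \<inter> span (support X))"
  proof (rule bij_betw_byWitness[where f' = \<phi>])
    show "\<phi> ` (tf_lattice X \<inter> span (support X)) \<subseteq> tf_lattice Y \<inter> span (support Y)"
      using lattice by (simp add: bij_betw_def)
    show "\<psi> ` (tf_lattice Y \<inter> span (support Y)) \<subseteq> tf_lattice X \<inter> span (support X)"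
      unfolding bij_betw_imp_surj_on[OF lattice, symmetric] image_image using \<psi>\<phi> by auto
  qed (use \<psi>\<phi> \<phi>\<psi> in auto)
  show "(`) \<psi> ` tf_cones Y = tf_cones X"
  proof -
    have "(`) \<psi> ` (`) \<phi> ` tf_cones X = (\<lambda>\<sigma>. \<sigma>) ` tf_cones X"
      unfolding image_image[of "(`) \<psi>"] by (intro image_cong refl image_back)
    then show ?thesis unfolding cones by simp
  qed
  fix \<kappa> assume "\<kappa> \<in> facets Y"
  then obtain \<sigma> where \<sigma>: "\<sigma> \<in> facets X" "\<kappa> = \<phi> ` \<sigma>" unfolding facets_image by (rule imageE)
  show "tf_orient X (\<psi> ` \<kappa>) = tf_orient Y \<kappa>"
    unfolding \<sigma>(2) image_back[OF facets_subset[OF \<sigma>(1)]] orient[OF \<sigma>(1)] ..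
qed

lemma near_image:
  assumes p: "p \<in> support X" and near: "div_faithful_near X p"
  shows "div_faithful_near Y (\<phi> p)"
  unfolding div_faithful_near_def
proof (intro allI impI)
  fix f assume f: "\<forall>\<kappa>\<in>tf_cones Y. \<phi> p \<in> \<kappa> \<longrightarrow> integral_linear_on (tf_lattice Y) \<kappa> f"
    and bal: "\<forall>\<kappa>\<in>walls Y. \<phi> p \<in> \<kappa> \<longrightarrow> balanced_at Y f \<kappa>"
  obtain l where l: "\<And>\<kappa>. \<kappa> \<in> {\<kappa> \<in> tf_cones Y. \<phi> p \<in> \<kappa>} \<Longrightarrow> linear (l \<kappa>)"
    "\<And>\<kappa>. \<kappa> \<in> {\<kappa> \<in> tf_cones Y. \<phi> p \<in> \<kappa>} \<Longrightarrow> l \<kappa> ` (tf_lattice Y \<inter> span \<kappa>) \<subseteq> \<int>"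
    "\<And>\<kappa> x. \<kappa> \<in> {\<kappa> \<in> tf_cones Y. \<phi> p \<in> \<kappa>} \<Longrightarrow> x \<in> \<kappa> \<Longrightarrow> f x = l \<kappa> x"
    using integral_linear_forms[of "{\<kappa> \<in> tf_cones Y. \<phi> p \<in> \<kappa>}" "tf_lattice Y" f] f by auto
  have S: "\<phi> ` \<sigma> \<in> {\<kappa> \<in> tf_cones Y. \<phi> p \<in> \<kappa>}" if "\<sigma> \<in> tf_cones X" "p \<in> \<sigma>" for \<sigma>
    using image_cone[OF that(1)] that(2) by simp
  define h where "h = (\<lambda>x. f (\<phi> x))"
  have lin: "linear (\<lambda>x. l (\<phi> ` \<sigma>) (\<phi> x))" if "\<sigma> \<in> tf_cones X" "p \<in> \<sigma>" for \<sigma>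
    using linear_compose[OF \<phi> l(1)[OF S[OF that]]] by (simp add: o_def)
  have span_sub: "span \<sigma> \<subseteq> span (support X)" if "\<sigma> \<in> tf_cones X" for \<sigma>
    using cone_support[OF that] by (simp add: span_minimal)
  have lat: "\<phi> ` (tf_lattice X \<inter> span \<sigma>) \<subseteq> tf_lattice Y \<inter> span (\<phi> ` \<sigma>)" if \<sigma>: "\<sigma> \<in> tf_cones X" for \<sigma>
    using lattice span_sub[OF \<sigma>] linear_span_image[OF \<phi>, of \<sigma>] unfolding bij_betw_def by blast
  have "integral_linear_on (tf_lattice X) \<sigma> h" if \<sigma>: "\<sigma> \<in> tf_cones X" "p \<in> \<sigma>" for \<sigma>
    unfolding integral_linear_on_def
  proof (intro exI conjI ballI)
    show "linear (\<lambda>x. l (\<phi> ` \<sigma>) (\<phi> x))" by (rule lin[OF \<sigma>])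
    show "(\<lambda>x. l (\<phi> ` \<sigma>) (\<phi> x)) ` (tf_lattice X \<inter> span \<sigma>) \<subseteq> \<int>"
      using lat[OF \<sigma>(1)] l(2)[OF S[OF \<sigma>]] by blast
    show "h x = l (\<phi> ` \<sigma>) (\<phi> x)" if "x \<in> \<sigma>" for x unfolding h_def using l(3)[OF S[OF \<sigma>]] that by blast
  qed
  moreover have "balanced_at X h \<tau>" if \<tau>: "\<tau> \<in> walls X" "p \<in> \<tau>" for \<tau>
  proof -
    have \<tau>c: "\<tau> \<in> tf_cones X" using \<tau> walls_subset by blast
    have sum: "\<phi> ` \<sigma> = {\<phi> x + r | x r. x \<in> \<sigma> \<and> r \<in> {0}}" for \<sigma> by auto
    obtain F where F: "F \<in> facets X" "\<tau> \<subseteq> F" using facet_above[OF X \<tau>c] by blast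
    have W: "\<sigma> \<in> tf_cones X" "p \<in> \<sigma>" if "\<sigma> \<in> wall_facets X \<tau>" for \<sigma> using wall_facetsD[OF that] \<tau>(2) by auto
    have "codim1 (\<phi> ` \<tau>) (\<phi> ` F)"
    proof (rule codim1_sum[OF sum sum, where p = \<psi>])
      show "\<psi> (\<phi> x) = x" if "x \<in> span F" for x using \<psi>\<phi> span_sub facets_subset F(1) that by blast
      show "codim1 \<tau> F" using wall_iff_codim1[OF X F(1) \<tau>c F(2)] \<tau>(1) by blast
    qed (use \<phi> \<psi> F tropical_fan_zero[OF X \<tau>c] in \<open>simp_all add: linear_0\<close>)
    then have wall: "\<phi> ` \<tau> \<in> walls Y"
      using wall_iff_codim1[OF Y _ image_cone[OF \<tau>c] image_mono[OF F(2)]] facets_image F(1) by simp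
    have WY: "wall_facets Y (\<phi> ` \<tau>) = (`) \<phi> ` wall_facets X \<tau>"
    proof (intro equalityI subsetI)
      fix \<kappa> assume "\<kappa> \<in> wall_facets Y (\<phi> ` \<tau>)"
      then have "\<kappa> \<in> (`) \<phi> ` facets X" and sub: "\<phi> ` \<tau> \<subseteq> \<kappa>" unfolding wall_facets_def facets_image by simp_all
      then obtain \<sigma> where \<sigma>: "\<sigma> \<in> facets X" "\<kappa> = \<phi> ` \<sigma>" by (elim imageE)
      have "\<tau> \<subseteq> \<sigma>" using image_subset_iff[OF \<tau>c facets_subset[OF \<sigma>(1)]] sub \<sigma>(2) by simp
      then show "\<kappa> \<in> (`) \<phi> ` wall_facets X \<tau>" using \<sigma> unfolding wall_facets_def by simp
    next
      fix \<kappa> assume "\<kappa> \<in> (`) \<phi> ` wall_facets X \<tau>"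
      then obtain \<sigma> where \<sigma>: "\<sigma> \<in> wall_facets X \<tau>" "\<kappa> = \<phi> ` \<sigma>" by (rule imageE)
      then show "\<kappa> \<in> wall_facets Y (\<phi> ` \<tau>)"
        using wall_facetsD[OF \<sigma>(1)] unfolding wall_facets_def facets_image by (simp add: image_mono)
    qed
    have \<kappa>S: "\<kappa> \<in> {\<kappa> \<in> tf_cones Y. \<phi> p \<in> \<kappa>}" if "\<kappa> \<in> wall_facets Y (\<phi> ` \<tau>)" for \<kappa>
      using wall_facetsD(2,3)[OF that] \<tau>(2) by blast
    obtain n where n: "\<And>\<sigma>. \<sigma> \<in> wall_facets X \<tau> \<Longrightarrow> is_normal_vec (tf_lattice X) \<sigma> \<tau> (n \<sigma>)"
      using wall_normals[OF X \<tau>(1)] by blast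
    have nY: "is_normal_vec (tf_lattice Y) (\<phi> ` \<sigma>) (\<phi> ` \<tau>) (\<phi> (n \<sigma>))" if \<sigma>: "\<sigma> \<in> wall_facets X \<tau>" for \<sigma>
    proof (rule is_normal_vec_sum[OF sum sum, where p = \<psi>, OF _ _ _ _ _ _ _ n[OF \<sigma>]])
      note s = W[OF \<sigma>]
      show "\<psi> (\<phi> x) = x" if "x \<in> span \<sigma>" for x using \<psi>\<phi> span_sub s(1) that by blast
      show "\<psi> ` (tf_lattice Y \<inter> span (\<phi> ` \<sigma>)) \<subseteq> tf_lattice X"
      proof
        fix x assume "x \<in> \<psi> ` (tf_lattice Y \<inter> span (\<phi> ` \<sigma>))"
        then obtain y where y: "x = \<psi> y" "y \<in> tf_lattice Y" "y \<in> span (\<phi> ` \<sigma>)" by blast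
        have "\<phi> ` \<sigma> \<subseteq> support Y" using image_cone[OF s(1)] unfolding support_def by blast
        then have "y \<in> tf_lattice Y \<inter> span (support Y)" using y(2,3) span_mono by blast
        then obtain z where "z \<in> tf_lattice X \<inter> span (support X)" "y = \<phi> z"
          using lattice unfolding bij_betw_def by blast
        then show "x \<in> tf_lattice X" using y(1) \<psi>\<phi> by simp
      qed
      show "\<phi> ` (tf_lattice X \<inter> span \<sigma>) \<subseteq> tf_lattice Y" using lat[OF s(1)] by blast
    qed (use \<phi> \<psi> wall_facetsD[OF \<sigma>] tropical_fan_zero[OF X \<tau>c] tropical_fan_lattice[OF Y] in \<open>simp_all add: linear_0\<close>)
    show ?thesis
    proof (rule balanced_at_pullback[OF X \<tau>(1) Y, of f "\<phi> ` \<tau>" "(`) \<phi>" 1 n "\<lambda>\<sigma>. \<phi> (n \<sigma>)" _ l "l (\<phi> ` \<tau>)"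
          "\<lambda>\<sigma> x. l (\<phi> ` \<sigma>) (\<phi> x)" h "\<lambda>x. l (\<phi> ` \<tau>) (\<phi> x)"])
      show "balanced_at Y f (\<phi> ` \<tau>)" using bal wall \<tau>(2) by blast
      show "inj_on ((`) \<phi>) (wall_facets X \<tau>)" by (rule inj_onI) (metis image_back W(1))
      show "tf_orient Y (\<phi> ` \<sigma>) = 1 * tf_orient X \<sigma>" if "\<sigma> \<in> wall_facets X \<tau>" for \<sigma>
        using orient wall_facetsD(1)[OF that] by simp
      show "h x = l (\<phi> ` \<sigma>) (\<phi> x)" if "\<sigma> \<in> wall_facets X \<tau>" "x \<in> \<sigma>" for \<sigma> x
        unfolding h_def using l(3)[OF S[OF W[OF that(1)]]] that(2) by blast
      show "h x = l (\<phi> ` \<tau>) (\<phi> x)" if "x \<in> \<tau>" for x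
        unfolding h_def using l(3)[OF S[OF \<tau>c \<tau>(2)]] that by blast
      show "linear (\<lambda>x. l (\<phi> ` \<sigma>) (\<phi> x))" if "\<sigma> \<in> wall_facets X \<tau>" for \<sigma> using lin[OF W[OF that]] .
      show "linear (\<lambda>x. l (\<phi> ` \<tau>) (\<phi> x))" using lin[OF \<tau>c \<tau>(2)] .
      show "linear (l \<rho>)" if "\<rho> \<in> wall_facets Y (\<phi> ` \<tau>)" for \<rho> using l(1)[OF \<kappa>S[OF that]] .
      show "f y = l \<rho> y" if "\<rho> \<in> wall_facets Y (\<phi> ` \<tau>)" "y \<in> \<rho>" for \<rho> y using l(3)[OF \<kappa>S[OF that(1)] that(2)] .
      show "linear (l (\<phi> ` \<tau>))" using l(1)[OF S[OF \<tau>c \<tau>(2)]] .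
      show "f y = l (\<phi> ` \<tau>) y" if "y \<in> \<phi> ` \<tau>" for y using l(3)[OF S[OF \<tau>c \<tau>(2)] that] .
    qed (use WY n nY in simp_all)
  qed
  ultimately obtain m where m: "linear m" "\<forall>\<sigma>\<in>tf_cones X. p \<in> \<sigma> \<longrightarrow> (\<forall>x\<in>\<sigma>. h x = m x)"
    using near unfolding div_faithful_near_def by blast
  have "f y = m (\<psi> y)" if \<kappa>: "\<kappa> \<in> tf_cones Y" "\<phi> p \<in> \<kappa>" "y \<in> \<kappa>" for \<kappa> y
  proof -
    obtain \<sigma> where \<sigma>: "\<sigma> \<in> tf_cones X" "\<kappa> = \<phi> ` \<sigma>" using image_coneE[OF \<kappa>(1)] .
    have "p \<in> \<sigma>"
    proof -
      have "\<psi> (\<phi> p) \<in> \<psi> ` \<phi> ` \<sigma>" using \<kappa>(2) \<sigma>(2) by blast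
      then show ?thesis using image_back[OF \<sigma>(1)] \<psi>\<phi> p span_base by metis
    qed
    obtain x where x: "x \<in> \<sigma>" "y = \<phi> x" using \<kappa>(3) \<sigma>(2) by blast
    have "\<psi> y = x" using \<psi>\<phi> cone_support[OF \<sigma>(1)] x by blast
    moreover have "h x = m x" using m(2) \<sigma>(1) \<open>p \<in> \<sigma>\<close> x(1) by blast
    ultimately show ?thesis using x(2) unfolding h_def by simp
  qed
  moreover have "linear (\<lambda>y. m (\<psi> y))" using linear_compose[OF \<psi> m(1)] by (simp add: o_def)
  ultimately show "\<exists>m. linear m \<and> (\<forall>\<sigma>\<in>tf_cones Y. \<phi> p \<in> \<sigma> \<longrightarrow> (\<forall>x\<in>\<sigma>. f x = m x))"
    by (intro exI[of _ "\<lambda>y. m (\<psi> y)"] conjI ballI impI)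
qed

end

lemma tfan_iso_fan_iso:
  assumes "tropical_fan X" "tropical_fan Y" "X \<cong>\<^sub>T Y"
  obtains \<phi> \<psi> where "fan_iso X Y \<phi> \<psi>"
proof -
  obtain \<phi> where \<phi>: "linear \<phi>" "bij_betw \<phi> (tf_lattice X \<inter> span (support X)) (tf_lattice Y \<inter> span (support Y))"
    "(`) \<phi> ` tf_cones X = tf_cones Y" "\<forall>\<sigma>\<in>facets X. tf_orient Y (\<phi> ` \<sigma>) = tf_orient X \<sigma>"
    using assms(3) unfolding tfan_iso_def by blast
  obtain \<psi> where \<psi>: "linear \<psi>" "\<And>x. x \<in> span (support X) \<Longrightarrow> \<psi> (\<phi> x) = x" "\<And>y. y \<in> span (support Y) \<Longrightarrow> \<phi> (\<psi> y) = y"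
    using tfan_iso_inverse[OF assms(1,2) \<phi>(1,2)] by blast
  have "fan_iso X Y \<phi> \<psi>"
    by (intro fan_iso.intro assms(1,2) \<phi>(1-3) \<psi> \<phi>(4)[rule_format])
  then show ?thesis by (rule that)
qed

lemma div_faithful_tfan_iso:
  fixes X :: "'a::real_normed_vector tfan" and Y :: "'b::real_normed_vector tfan"
  assumes "tropical_fan X" "tropical_fan Y" "X \<cong>\<^sub>T Y"
  shows "div_faithful X \<longleftrightarrow> div_faithful Y"
proof -
  obtain \<phi> \<psi> where iso: "fan_iso X Y \<phi> \<psi>" using tfan_iso_fan_iso[OF assms] by blast
  have *: "div_faithful B" if iso: "fan_iso A B \<phi> \<psi>" and A: "div_faithful A"
    for A :: "'c::real_normed_vector tfan" and B :: "'d::real_normed_vector tfan" and \<phi> \<psi>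
  proof -
    interpret fan_iso A B \<phi> \<psi> by (rule iso)
    have "div_faithful_near B q" if "q \<in> support B" for q
    proof -
      obtain \<kappa> where \<kappa>: "\<kappa> \<in> tf_cones B" "q \<in> \<kappa>" using \<open>q \<in> support B\<close> unfolding support_def by blast
      obtain \<sigma> where "\<sigma> \<in> tf_cones A" "\<kappa> = \<phi> ` \<sigma>" using image_coneE[OF \<kappa>(1)] .
      with \<kappa>(2) obtain p where "\<sigma> \<in> tf_cones A" "p \<in> \<sigma>" "q = \<phi> p" by blast
      then show ?thesis
        using near_image[of p] A unfolding div_faithful_iff_near[OF X] support_def by blast
    qed
    then show ?thesis unfolding div_faithful_iff_near[OF Y] by blast
  qed
  from iso have "fan_iso Y X \<psi> \<phi>" by (rule fan_iso.flip)
  then show ?thesis using *[OF iso] *[of Y X \<psi> \<phi>] by blast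
qed

section \<open>Products\<close>

text \<open>Since the cones \<open>J \<sigma> R\<close> share the summand \<open>R\<close>, the
  facets around \<open>J \<tau> R\<close> are again of this form and carry the weights of
  \<open>X\<close> times one constant \<open>c\<close>; restricting \<open>f\<close> along
  \<open>\<iota>\<close> therefore keeps it balanced. It is applied to each factor of a product in
  turn.\<close>

lemma near_slice:
  fixes \<iota> :: "'a::real_vector \<Rightarrow> 'c::real_vector" and pr :: "'c \<Rightarrow> 'a" and c :: int
  defines "J \<equiv> \<lambda>\<sigma> R. {\<iota> x + r | x r. x \<in> \<sigma> \<and> r \<in> R}"
  assumes X: "tropical_fan X" and Z: "tropical_fan Z"
    and \<iota>: "linear \<iota>" "\<iota> ` tf_lattice X \<subseteq> tf_lattice Z"
    and pr: "linear pr" "pr ` tf_lattice Z \<subseteq> tf_lattice X" "\<And>x. pr (\<iota> x) = x" "\<And>r. r \<in> R \<Longrightarrow> pr r = 0"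
    and R: "0 \<in> R" "b \<in> R"
    and J: "\<And>\<sigma>. \<sigma> \<in> tf_cones X \<Longrightarrow> J \<sigma> R \<in> tf_cones Z" "\<And>\<sigma>. \<sigma> \<in> facets X \<Longrightarrow> J \<sigma> R \<in> facets Z"
      "\<And>\<tau> \<kappa>. \<lbrakk>\<tau> \<in> tf_cones X; \<kappa> \<in> facets Z; J \<tau> R \<subseteq> \<kappa>\<rbrakk> \<Longrightarrow> \<exists>\<sigma>\<in>facets X. \<kappa> = J \<sigma> R"
    and orient: "\<And>\<sigma>. \<sigma> \<in> facets X \<Longrightarrow> tf_orient Z (J \<sigma> R) = c * tf_orient X \<sigma>" "c \<noteq> 0"
    and near: "div_faithful_near X a"
    and f: "\<And>\<kappa>. \<kappa> \<in> tf_cones Z \<Longrightarrow> \<iota> a + b \<in> \<kappa> \<Longrightarrow> integral_linear_on (tf_lattice Z) \<kappa> f"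
    and bal: "\<And>\<kappa>. \<kappa> \<in> walls Z \<Longrightarrow> \<iota> a + b \<in> \<kappa> \<Longrightarrow> balanced_at Z f \<kappa>"
  obtains m where "linear m" "\<And>\<sigma> x. \<sigma> \<in> tf_cones X \<Longrightarrow> a \<in> \<sigma> \<Longrightarrow> x \<in> \<sigma> \<Longrightarrow> f (\<iota> x) = m x"
proof -
  let ?q = "\<iota> a + b"
  have Jeq: "J \<sigma> R = {\<iota> x + r | x r. x \<in> \<sigma> \<and> r \<in> R}" for \<sigma> unfolding J_def ..
  obtain l where l: "\<And>\<kappa>. \<kappa> \<in> {\<kappa> \<in> tf_cones Z. ?q \<in> \<kappa>} \<Longrightarrow> linear (l \<kappa>)"
    "\<And>\<kappa>. \<kappa> \<in> {\<kappa> \<in> tf_cones Z. ?q \<in> \<kappa>} \<Longrightarrow> l \<kappa> ` (tf_lattice Z \<inter> span \<kappa>) \<subseteq> \<int>"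
    "\<And>\<kappa> x. \<kappa> \<in> {\<kappa> \<in> tf_cones Z. ?q \<in> \<kappa>} \<Longrightarrow> x \<in> \<kappa> \<Longrightarrow> f x = l \<kappa> x"
    using integral_linear_forms[of "{\<kappa> \<in> tf_cones Z. ?q \<in> \<kappa>}" "tf_lattice Z" f] f by auto
  have S: "J \<sigma> R \<in> {\<kappa> \<in> tf_cones Z. ?q \<in> \<kappa>}" if "\<sigma> \<in> tf_cones X" "a \<in> \<sigma>" for \<sigma>
    using J(1)[OF that(1)] that(2) R(2) unfolding J_def by blast
  have \<iota>J: "\<iota> x \<in> J \<sigma> R" if "x \<in> \<sigma>" for x \<sigma> unfolding J_def using that R(1) by force
  have \<iota>_span: "\<iota> x \<in> span (J \<sigma> R)" if "x \<in> span \<sigma>" for x \<sigma>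
  proof -
    have "\<iota> x \<in> span (\<iota> ` \<sigma>)" using that \<iota>(1) by (simp add: linear_span_image)
    moreover have "\<iota> ` \<sigma> \<subseteq> J \<sigma> R" using \<iota>J by blast
    ultimately show ?thesis using span_mono by blast
  qed
  have pJ: "pr ` J \<sigma> R = \<sigma>" for \<sigma>
  proof
    show "pr ` J \<sigma> R \<subseteq> \<sigma>" unfolding J_def using pr by (auto simp: linear_add)
    show "\<sigma> \<subseteq> pr ` J \<sigma> R"
    proof
      fix x assume "x \<in> \<sigma>"
      then have "pr (\<iota> x) \<in> pr ` J \<sigma> R" using \<iota>J by blast
      then show "x \<in> pr ` J \<sigma> R" using pr(3) by simp
    qed
  qed
  have J_subset: "J \<tau> R \<subseteq> J \<sigma> R \<longleftrightarrow> \<tau> \<subseteq> \<sigma>" for \<tau> \<sigma>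
  proof
    assume "J \<tau> R \<subseteq> J \<sigma> R"
    then show "\<tau> \<subseteq> \<sigma>" using pJ image_mono by metis
  qed (auto simp: J_def)
  define h where "h = (\<lambda>x. f (\<iota> x))"
  have lin: "linear (\<lambda>x. l (J \<sigma> R) (\<iota> x))" if "\<sigma> \<in> tf_cones X" "a \<in> \<sigma>" for \<sigma>
    using linear_compose[OF \<iota>(1) l(1)[OF S[OF that]]] by (simp add: o_def)
  have hl: "h x = l (J \<sigma> R) (\<iota> x)" if "\<sigma> \<in> tf_cones X" "a \<in> \<sigma>" "x \<in> \<sigma>" for \<sigma> x
    unfolding h_def using l(3)[OF S[OF that(1,2)] \<iota>J[OF that(3)]] .
  have "integral_linear_on (tf_lattice X) \<sigma> h" if \<sigma>: "\<sigma> \<in> tf_cones X" "a \<in> \<sigma>" for \<sigma>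
    unfolding integral_linear_on_def
  proof (intro exI conjI ballI)
    show "linear (\<lambda>x. l (J \<sigma> R) (\<iota> x))" by (rule lin[OF \<sigma>])
    have "\<iota> ` (tf_lattice X \<inter> span \<sigma>) \<subseteq> tf_lattice Z \<inter> span (J \<sigma> R)" using \<iota>(2) \<iota>_span by blast
    then show "(\<lambda>x. l (J \<sigma> R) (\<iota> x)) ` (tf_lattice X \<inter> span \<sigma>) \<subseteq> \<int>" using l(2)[OF S[OF \<sigma>]] by blast
  qed (rule hl[OF \<sigma>])
  moreover have "balanced_at X h \<tau>" if \<tau>: "\<tau> \<in> walls X" "a \<in> \<tau>" for \<tau>
  proof -
    have \<tau>c: "\<tau> \<in> tf_cones X" using \<tau> walls_subset by blast
    have W: "\<sigma> \<in> tf_cones X" "a \<in> \<sigma>" if "\<sigma> \<in> wall_facets X \<tau>" for \<sigma> using wall_facetsD[OF that] \<tau>(2) by auto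
    obtain F where F: "F \<in> facets X" "\<tau> \<subseteq> F" using facet_above[OF X \<tau>c] by blast
    have "codim1 (J \<tau> R) (J F R)"
    proof (rule codim1_sum[OF Jeq Jeq \<iota>(1) pr(1) pr(3,4) F(2) tropical_fan_zero[OF X \<tau>c] R(1)])
      show "codim1 \<tau> F" using wall_iff_codim1[OF X F(1) \<tau>c F(2)] \<tau>(1) by blast
    qed
    then have wall: "J \<tau> R \<in> walls Z"
      using wall_iff_codim1[OF Z J(2)[OF F(1)] J(1)[OF \<tau>c]] J_subset F(2) by blast
    have WZ: "wall_facets Z (J \<tau> R) = (\<lambda>\<sigma>. J \<sigma> R) ` wall_facets X \<tau>"
    proof (intro equalityI subsetI)
      fix \<kappa> assume "\<kappa> \<in> wall_facets Z (J \<tau> R)"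
      then obtain \<sigma> where "\<sigma> \<in> facets X" "\<kappa> = J \<sigma> R" "J \<tau> R \<subseteq> \<kappa>"
        using J(3)[OF \<tau>c] unfolding wall_facets_def by blast
      then show "\<kappa> \<in> (\<lambda>\<sigma>. J \<sigma> R) ` wall_facets X \<tau>" using J_subset unfolding wall_facets_def by blast
    next
      fix \<kappa> assume "\<kappa> \<in> (\<lambda>\<sigma>. J \<sigma> R) ` wall_facets X \<tau>"
      then obtain \<sigma> where \<sigma>: "\<sigma> \<in> facets X" "\<tau> \<subseteq> \<sigma>" "\<kappa> = J \<sigma> R" unfolding wall_facets_def by blast
      then show "\<kappa> \<in> wall_facets Z (J \<tau> R)" using J(2)[OF \<sigma>(1)] J_subset unfolding wall_facets_def by simp
    qed
    have \<kappa>S: "\<kappa> \<in> {\<kappa> \<in> tf_cones Z. ?q \<in> \<kappa>}" if "\<kappa> \<in> wall_facets Z (J \<tau> R)" for \<kappa>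
      using wall_facetsD(2,3)[OF that] S[OF \<tau>c \<tau>(2)] by blast
    obtain n where n: "\<And>\<sigma>. \<sigma> \<in> wall_facets X \<tau> \<Longrightarrow> is_normal_vec (tf_lattice X) \<sigma> \<tau> (n \<sigma>)"
      using wall_normals[OF X \<tau>(1)] by blast
    have nZ: "is_normal_vec (tf_lattice Z) (J \<sigma> R) (J \<tau> R) (\<iota> (n \<sigma>))" if \<sigma>: "\<sigma> \<in> wall_facets X \<tau>" for \<sigma>
    proof (rule is_normal_vec_sum[OF Jeq Jeq \<iota>(1) pr(1) pr(3,4) wall_facetsD(3)[OF \<sigma>] tropical_fan_zero[OF X \<tau>c] R(1) n[OF \<sigma>]
          tropical_fan_lattice[OF Z]])
      show "pr ` (tf_lattice Z \<inter> span (J \<sigma> R)) \<subseteq> tf_lattice X" using pr(2) by blast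
      show "\<iota> ` (tf_lattice X \<inter> span \<sigma>) \<subseteq> tf_lattice Z" using \<iota>(2) by blast
    qed
    show ?thesis
    proof (rule balanced_at_pullback[OF X \<tau>(1) Z, of f "J \<tau> R" "\<lambda>\<sigma>. J \<sigma> R" c n "\<lambda>\<sigma>. \<iota> (n \<sigma>)" _ l "l (J \<tau> R)"
          "\<lambda>\<sigma> x. l (J \<sigma> R) (\<iota> x)" h "\<lambda>x. l (J \<tau> R) (\<iota> x)"])
      show "balanced_at Z f (J \<tau> R)" using bal wall S[OF \<tau>c \<tau>(2)] by blast
      show "inj_on (\<lambda>\<sigma>. J \<sigma> R) (wall_facets X \<tau>)" by (rule inj_onI) (metis pJ)
      show "tf_orient Z (J \<sigma> R) = c * tf_orient X \<sigma>" if "\<sigma> \<in> wall_facets X \<tau>" for \<sigma>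
        using orient(1) wall_facetsD(1)[OF that] by simp
      show "c \<noteq> 0" by (rule orient(2))
      show "h x = l (J \<sigma> R) (\<iota> x)" if "\<sigma> \<in> wall_facets X \<tau>" "x \<in> \<sigma>" for \<sigma> x using hl[OF W[OF that(1)] that(2)] .
      show "h x = l (J \<tau> R) (\<iota> x)" if "x \<in> \<tau>" for x using hl[OF \<tau>c \<tau>(2) that] .
      show "linear (\<lambda>x. l (J \<sigma> R) (\<iota> x))" if "\<sigma> \<in> wall_facets X \<tau>" for \<sigma> using lin[OF W[OF that]] .
      show "linear (\<lambda>x. l (J \<tau> R) (\<iota> x))" using lin[OF \<tau>c \<tau>(2)] .
      show "linear (l \<rho>)" if "\<rho> \<in> wall_facets Z (J \<tau> R)" for \<rho> using l(1)[OF \<kappa>S[OF that]] .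
      show "f y = l \<rho> y" if "\<rho> \<in> wall_facets Z (J \<tau> R)" "y \<in> \<rho>" for \<rho> y using l(3)[OF \<kappa>S[OF that(1)] that(2)] .
      show "linear (l (J \<tau> R))" using l(1)[OF S[OF \<tau>c \<tau>(2)]] .
      show "f y = l (J \<tau> R) y" if "y \<in> J \<tau> R" for y using l(3)[OF S[OF \<tau>c \<tau>(2)] that] .
    qed (use WZ n nZ in simp_all)
  qed
  ultimately obtain m where "linear m" "\<forall>\<sigma>\<in>tf_cones X. a \<in> \<sigma> \<longrightarrow> (\<forall>x\<in>\<sigma>. h x = m x)"
    using near unfolding div_faithful_near_def by blast
  then show ?thesis using that unfolding h_def by blast
qed

lemma prod_fan_cones: "tf_cones (prod_fan X Y) = {\<sigma> \<times> \<sigma>' | \<sigma> \<sigma>'. \<sigma> \<in> tf_cones X \<and> \<sigma>' \<in> tf_cones Y}"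
  and prod_fan_lattice: "tf_lattice (prod_fan X Y) = tf_lattice X \<times> tf_lattice Y"
  unfolding prod_fan_def by simp_all

lemma prod_fan_facets:
  assumes X: "tropical_fan X" and Y: "tropical_fan Y"
  shows "facets (prod_fan X Y) = {\<sigma> \<times> \<sigma>' | \<sigma> \<sigma>'. \<sigma> \<in> facets X \<and> \<sigma>' \<in> facets Y}"
proof (intro equalityI subsetI)
  fix \<kappa> assume k: "\<kappa> \<in> facets (prod_fan X Y)"
  then obtain \<sigma> \<sigma>' where \<sigma>: "\<kappa> = \<sigma> \<times> \<sigma>'" "\<sigma> \<in> tf_cones X" "\<sigma>' \<in> tf_cones Y"
    using facets_subset[OF k] unfolding prod_fan_cones by blast
  obtain F where F: "F \<in> facets X" "\<sigma> \<subseteq> F" using facet_above[OF X \<sigma>(2)] by blast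
  obtain F' where F': "F' \<in> facets Y" "\<sigma>' \<subseteq> F'" using facet_above[OF Y \<sigma>(3)] by blast
  have "F \<times> F' \<in> tf_cones (prod_fan X Y)"
    unfolding prod_fan_cones using facets_subset[OF F(1)] facets_subset[OF F'(1)] by blast
  moreover have "\<kappa> \<subseteq> F \<times> F'" unfolding \<sigma>(1) using F(2) F'(2) by (rule Sigma_mono)
  ultimately have "F \<times> F' = \<kappa>" by (rule facets_maximal[OF k])
  then show "\<kappa> \<in> {\<sigma> \<times> \<sigma>' | \<sigma> \<sigma>'. \<sigma> \<in> facets X \<and> \<sigma>' \<in> facets Y}" using F(1) F'(1) by blast
next
  fix \<kappa> assume "\<kappa> \<in> {\<sigma> \<times> \<sigma>' | \<sigma> \<sigma>'. \<sigma> \<in> facets X \<and> \<sigma>' \<in> facets Y}"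
  then obtain \<sigma> \<sigma>' where \<sigma>: "\<kappa> = \<sigma> \<times> \<sigma>'" "\<sigma> \<in> facets X" "\<sigma>' \<in> facets Y" by blast
  have "\<rho> = \<kappa>" if \<rho>: "\<rho> \<in> tf_cones (prod_fan X Y)" "\<kappa> \<subseteq> \<rho>" for \<rho>
  proof -
    obtain \<tau> \<tau>' where \<tau>: "\<rho> = \<tau> \<times> \<tau>'" "\<tau> \<in> tf_cones X" "\<tau>' \<in> tf_cones Y"
      using \<rho>(1) unfolding prod_fan_cones by blast
    have "0 \<in> \<sigma>" "0 \<in> \<sigma>'"
      using tropical_fan_zero[OF X facets_subset[OF \<sigma>(2)]] tropical_fan_zero[OF Y facets_subset[OF \<sigma>(3)]] .
    then have "\<sigma> \<subseteq> \<tau>" "\<sigma>' \<subseteq> \<tau>'" using \<rho>(2) unfolding \<sigma>(1) \<tau>(1) times_subset_iff by auto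
    then show ?thesis using facets_maximal[OF \<sigma>(2) \<tau>(2)] facets_maximal[OF \<sigma>(3) \<tau>(3)] \<sigma>(1) \<tau>(1) by simp
  qed
  moreover have "\<kappa> \<in> tf_cones (prod_fan X Y)"
    unfolding prod_fan_cones using \<sigma>(1) facets_subset[OF \<sigma>(2)] facets_subset[OF \<sigma>(3)] by blast
  ultimately show "\<kappa> \<in> facets (prod_fan X Y)" unfolding facets_def by blast
qed

lemma near_prod:
  fixes X :: "'a::real_vector tfan" and Y :: "'b::real_vector tfan"
  assumes X: "tropical_fan X" and Y: "tropical_fan Y" and P: "tropical_fan (prod_fan X Y)"
    and a: "a \<in> support X" "div_faithful_near X a" and b: "b \<in> support Y" "div_faithful_near Y b"
  shows "div_faithful_near (prod_fan X Y) (a, b)"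
  unfolding div_faithful_near_def
proof (intro allI impI)
  let ?P = "prod_fan X Y"
  fix f assume f: "\<forall>\<kappa>\<in>tf_cones ?P. (a, b) \<in> \<kappa> \<longrightarrow> integral_linear_on (tf_lattice ?P) \<kappa> f"
    and bal: "\<forall>\<kappa>\<in>walls ?P. (a, b) \<in> \<kappa> \<longrightarrow> balanced_at ?P f \<kappa>"
  obtain \<sigma>0 where \<sigma>0: "\<sigma>0 \<in> tf_cones X" "a \<in> \<sigma>0" using a(1) unfolding support_def by blast
  \<comment> \<open>Facets through \<open>a\<close> and, below, \<open>b\<close>: each serves as the
    fixed factor while the other variable moves.\<close>
  obtain \<alpha> where \<alpha>: "\<alpha> \<in> facets X" "a \<in> \<alpha>" using facet_above[OF X \<sigma>0(1)] \<sigma>0(2) by blast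
  obtain \<sigma>1 where \<sigma>1: "\<sigma>1 \<in> tf_cones Y" "b \<in> \<sigma>1" using b(1) unfolding support_def by blast
  obtain \<beta> where \<beta>: "\<beta> \<in> facets Y" "b \<in> \<beta>" using facet_above[OF Y \<sigma>1(1)] \<sigma>1(2) by blast
  note c\<alpha> = facets_subset[OF \<alpha>(1)] and c\<beta> = facets_subset[OF \<beta>(1)]
  note z\<alpha> = tropical_fan_zero[OF X c\<alpha>] and z\<beta> = tropical_fan_zero[OF Y c\<beta>]
  have J1: "{(x, 0) + r | x r. x \<in> \<sigma> \<and> r \<in> {0} \<times> \<beta>} = \<sigma> \<times> \<beta>" for \<sigma> :: "'a set"
    by force
  have J2: "{(0, y) + r | y r. y \<in> \<sigma> \<and> r \<in> \<alpha> \<times> {0}} = \<alpha> \<times> \<sigma>" for \<sigma> :: "'b set"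
    by force
  have orient: "tf_orient ?P (\<sigma> \<times> \<sigma>') = tf_orient X \<sigma> * tf_orient Y \<sigma>'" if "\<sigma> \<in> tf_cones X" "\<sigma>' \<in> tf_cones Y" for \<sigma> \<sigma>'
  proof -
    have "0 \<in> \<sigma>" "0 \<in> \<sigma>'" using tropical_fan_zero[OF X that(1)] tropical_fan_zero[OF Y that(2)] .
    then have "fst ` (\<sigma> \<times> \<sigma>') = \<sigma>" "snd ` (\<sigma> \<times> \<sigma>') = \<sigma>'" by auto
    then show ?thesis unfolding prod_fan_def by simp
  qed
  obtain m1 where m1: "linear m1" "\<And>\<sigma> x. \<sigma> \<in> tf_cones X \<Longrightarrow> a \<in> \<sigma> \<Longrightarrow> x \<in> \<sigma> \<Longrightarrow> f (x, 0) = m1 x"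
  proof (rule near_slice[of X ?P "\<lambda>x. (x, 0)" fst "{0} \<times> \<beta>" "(0, b)" "tf_orient Y \<beta>" a f, OF X P, unfolded J1])
    show "linear (\<lambda>x :: 'a. (x, 0 :: 'b))" by (rule linearI) simp_all
    show "(\<lambda>x. (x, 0)) ` tf_lattice X \<subseteq> tf_lattice ?P"
      unfolding prod_fan_lattice using is_lattice_zero[OF tropical_fan_lattice[OF Y]] by blast
    show "linear (fst :: 'a \<times> 'b \<Rightarrow> 'a)" by (rule linear_fst)
    show "fst ` tf_lattice ?P \<subseteq> tf_lattice X" unfolding prod_fan_lattice by auto
    show "\<sigma> \<times> \<beta> \<in> tf_cones ?P" if "\<sigma> \<in> tf_cones X" for \<sigma>
      unfolding prod_fan_cones using that c\<beta> by blast
    show "\<sigma> \<times> \<beta> \<in> facets ?P" if "\<sigma> \<in> facets X" for \<sigma>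
      unfolding prod_fan_facets[OF X Y] using that \<beta>(1) by blast
    show "\<exists>\<sigma>\<in>facets X. \<kappa> = \<sigma> \<times> \<beta>" if \<kappa>: "\<tau> \<in> tf_cones X" "\<kappa> \<in> facets ?P" "\<tau> \<times> \<beta> \<subseteq> \<kappa>" for \<tau> \<kappa>
    proof -
      obtain \<sigma> \<sigma>' where \<sigma>: "\<kappa> = \<sigma> \<times> \<sigma>'" "\<sigma> \<in> facets X" "\<sigma>' \<in> facets Y"
        using \<kappa>(2) unfolding prod_fan_facets[OF X Y] by blast
      have "\<beta> \<subseteq> \<sigma>'" using \<kappa>(3) tropical_fan_zero[OF X \<kappa>(1)] z\<beta> unfolding \<sigma>(1) times_subset_iff by auto
      then have "\<sigma>' = \<beta>" using facets_maximal[OF \<beta>(1) facets_subset[OF \<sigma>(3)]] by blast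
      then show ?thesis using \<sigma>(1,2) by blast
    qed
    show "tf_orient ?P (\<sigma> \<times> \<beta>) = tf_orient Y \<beta> * tf_orient X \<sigma>" if "\<sigma> \<in> facets X" for \<sigma>
      using orient[OF facets_subset[OF that] c\<beta>] by simp
    show "tf_orient Y \<beta> \<noteq> 0" by (rule tropical_fan_orient[OF Y \<beta>(1)])
    show "thesis" if "linear m" "\<And>\<sigma> x. \<sigma> \<in> tf_cones X \<Longrightarrow> a \<in> \<sigma> \<Longrightarrow> x \<in> \<sigma> \<Longrightarrow> f (x, 0) = m x" for m
      using that by (rule \<open>\<And>m1. \<lbrakk>linear m1; \<And>\<sigma> x. \<lbrakk>\<sigma> \<in> tf_cones X; a \<in> \<sigma>; x \<in> \<sigma>\<rbrakk> \<Longrightarrow> f (x, 0) = m1 x\<rbrakk> \<Longrightarrow> thesis\<close>)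
    show "0 \<in> {0} \<times> \<beta>" "(0, b) \<in> {0} \<times> \<beta>" using z\<beta> \<beta>(2) by (simp_all add: zero_prod_def)
    show "div_faithful_near X a" by (rule a(2))
  qed (use f bal in auto)
  obtain m2 where m2: "linear m2" "\<And>\<sigma> y. \<sigma> \<in> tf_cones Y \<Longrightarrow> b \<in> \<sigma> \<Longrightarrow> y \<in> \<sigma> \<Longrightarrow> f (0, y) = m2 y"
  proof (rule near_slice[of Y ?P "\<lambda>y. (0, y)" snd "\<alpha> \<times> {0}" "(a, 0)" "tf_orient X \<alpha>" b f, OF Y P, unfolded J2])
    show "linear (\<lambda>y :: 'b. (0 :: 'a, y))" by (rule linearI) simp_all
    show "(\<lambda>y. (0, y)) ` tf_lattice Y \<subseteq> tf_lattice ?P"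
      unfolding prod_fan_lattice using is_lattice_zero[OF tropical_fan_lattice[OF X]] by blast
    show "linear (snd :: 'a \<times> 'b \<Rightarrow> 'b)" by (rule linear_snd)
    show "snd ` tf_lattice ?P \<subseteq> tf_lattice Y" unfolding prod_fan_lattice by auto
    show "\<alpha> \<times> \<sigma> \<in> tf_cones ?P" if "\<sigma> \<in> tf_cones Y" for \<sigma>
      unfolding prod_fan_cones using that c\<alpha> by blast
    show "\<alpha> \<times> \<sigma> \<in> facets ?P" if "\<sigma> \<in> facets Y" for \<sigma>
      unfolding prod_fan_facets[OF X Y] using that \<alpha>(1) by blast
    show "\<exists>\<sigma>\<in>facets Y. \<kappa> = \<alpha> \<times> \<sigma>" if \<kappa>: "\<tau> \<in> tf_cones Y" "\<kappa> \<in> facets ?P" "\<alpha> \<times> \<tau> \<subseteq> \<kappa>" for \<tau> \<kappa>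
    proof -
      obtain \<sigma> \<sigma>' where \<sigma>: "\<kappa> = \<sigma> \<times> \<sigma>'" "\<sigma> \<in> facets X" "\<sigma>' \<in> facets Y"
        using \<kappa>(2) unfolding prod_fan_facets[OF X Y] by blast
      have "\<alpha> \<subseteq> \<sigma>" using \<kappa>(3) tropical_fan_zero[OF Y \<kappa>(1)] z\<alpha> unfolding \<sigma>(1) times_subset_iff by auto
      then have "\<sigma> = \<alpha>" using facets_maximal[OF \<alpha>(1) facets_subset[OF \<sigma>(2)]] by blast
      then show ?thesis using \<sigma>(1,3) by blast
    qed
    show "tf_orient ?P (\<alpha> \<times> \<sigma>) = tf_orient X \<alpha> * tf_orient Y \<sigma>" if "\<sigma> \<in> facets Y" for \<sigma>
      using orient[OF c\<alpha> facets_subset[OF that]] .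
    show "tf_orient X \<alpha> \<noteq> 0" by (rule tropical_fan_orient[OF X \<alpha>(1)])
    show "thesis" if "linear m" "\<And>\<sigma> y. \<sigma> \<in> tf_cones Y \<Longrightarrow> b \<in> \<sigma> \<Longrightarrow> y \<in> \<sigma> \<Longrightarrow> f (0, y) = m y" for m
      using that by (rule \<open>\<And>m2. \<lbrakk>linear m2; \<And>\<sigma> y. \<lbrakk>\<sigma> \<in> tf_cones Y; b \<in> \<sigma>; y \<in> \<sigma>\<rbrakk> \<Longrightarrow> f (0, y) = m2 y\<rbrakk> \<Longrightarrow> thesis\<close>)
    show "0 \<in> \<alpha> \<times> {0}" "(a, 0) \<in> \<alpha> \<times> {0}" using z\<alpha> \<alpha>(2) by (simp_all add: zero_prod_def)
    show "div_faithful_near Y b" by (rule b(2))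
  qed (use f bal in auto)
  have "f (x, y) = m1 x + m2 y" if \<kappa>: "\<kappa> \<in> tf_cones ?P" "(a, b) \<in> \<kappa>" "(x, y) \<in> \<kappa>" for \<kappa> x y
  proof -
    obtain \<sigma> \<sigma>' where \<sigma>: "\<kappa> = \<sigma> \<times> \<sigma>'" "\<sigma> \<in> tf_cones X" "\<sigma>' \<in> tf_cones Y"
      using \<kappa>(1) unfolding prod_fan_cones by blast
    have xy: "x \<in> \<sigma>" "a \<in> \<sigma>" "y \<in> \<sigma>'" "b \<in> \<sigma>'" using \<kappa> \<sigma>(1) by auto
    obtain k where k: "linear k" "\<forall>z\<in>\<kappa>. f z = k z" using f \<kappa>(1,2) unfolding integral_linear_on_def by blast
    have "(x, 0) \<in> \<kappa>" "(0, y) \<in> \<kappa>"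
      using xy tropical_fan_zero[OF X \<sigma>(2)] tropical_fan_zero[OF Y \<sigma>(3)] unfolding \<sigma>(1) by blast+
    then have "f (x, y) = f (x, 0) + f (0, y)"
      using k \<kappa>(3) linear_add[OF k(1), of "(x, 0)" "(0, y)"] by simp
    then show ?thesis using m1(2)[OF \<sigma>(2) xy(2,1)] m2(2)[OF \<sigma>(3) xy(4,3)] by simp
  qed
  moreover have "linear (\<lambda>z. m1 (fst z) + m2 (snd z))"
    using linear_compose_add[OF linear_compose[OF linear_fst m1(1)] linear_compose[OF linear_snd m2(1)]]
    by (simp add: o_def)
  ultimately show "\<exists>m. linear m \<and> (\<forall>\<kappa>\<in>tf_cones ?P. (a, b) \<in> \<kappa> \<longrightarrow> (\<forall>z\<in>\<kappa>. f z = m z))"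
    by (intro exI[of _ "\<lambda>z. m1 (fst z) + m2 (snd z)"]) auto
qed

lemma div_faithful_prod:
  fixes X :: "'a::real_normed_vector tfan" and Y :: "'b::real_normed_vector tfan"
  assumes "tropical_fan X" "tropical_fan Y" "tropical_fan (prod_fan X Y)" "div_faithful X" "div_faithful Y"
  shows "div_faithful (prod_fan X Y)"
  unfolding div_faithful_iff_near[OF assms(3)]
proof
  fix p assume "p \<in> support (prod_fan X Y)"
  then obtain a b where ab: "p = (a, b)" "a \<in> support X" "b \<in> support Y"
    unfolding support_def prod_fan_cones by blast
  have "div_faithful_near X a" using assms(4) ab(2) unfolding div_faithful_iff_near[OF assms(1)] by blast
  moreover have "div_faithful_near Y b" using assms(5) ab(3) unfolding div_faithful_iff_near[OF assms(2)] by blast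
  ultimately show "div_faithful_near (prod_fan X Y) p" unfolding ab(1) using near_prod[OF assms(1-3)] ab(2,3) by blast
qed

section \<open>Tropical modifications\<close>

lemma linear_Pair: "linear l \<Longrightarrow> linear (\<lambda>x. (x, l x))"
  for l :: "'a::real_vector \<Rightarrow> 'b::real_vector"
  by (rule linearI) (simp_all add: linear_add linear_scale)

lemma linear_affine_coord:
  assumes "linear (k :: 'a::real_vector \<Rightarrow> real)"
  shows "linear (\<lambda>z. k (fst z) + c * snd z)"
  by (rule linearI) (simp_all add: linear_add[OF assms] linear_scale[OF assms] algebra_simps)

lemma is_normal_vec_ray:
  assumes "is_lattice M" "\<tau> \<subseteq> span \<sigma>" "v \<in> M" "v \<in> \<sigma>" "v \<notin> span \<tau>"
    and "\<And>x. x \<in> M \<Longrightarrow> x \<in> span \<sigma> \<Longrightarrow> \<exists>k::int. x - of_int k *\<^sub>R v \<in> span \<tau>"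
  shows "is_normal_vec M \<sigma> \<tau> v"
proof -
  have \<tau>: "span \<tau> \<subseteq> span \<sigma>" using assms(2) by (simp add: span_minimal)
  have v: "v \<in> span \<sigma>" using assms(4) span_base by blast
  have "{u + of_int k *\<^sub>R v | u k. u \<in> M \<inter> span \<tau>} = M \<inter> span \<sigma>"
  proof (intro equalityI subsetI)
    fix z assume "z \<in> {u + of_int k *\<^sub>R v | u k. u \<in> M \<inter> span \<tau>}"
    then obtain u k where u: "z = u + of_int k *\<^sub>R v" "u \<in> M" "u \<in> span \<tau>" by blast
    have "z \<in> M" unfolding u(1) using assms(1,3) u(2) by (intro is_lattice_add is_lattice_scale)
    moreover have "z \<in> span \<sigma>" unfolding u(1) using u(3) \<tau> v by (intro span_add span_scale) auto
    ultimately show "z \<in> M \<inter> span \<sigma>" by blast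
  next
    fix z assume z: "z \<in> M \<inter> span \<sigma>"
    then obtain k :: int where k: "z - of_int k *\<^sub>R v \<in> span \<tau>" using assms(6) by blast
    have "z - of_int k *\<^sub>R v \<in> M" using assms(1,3) z by (intro is_lattice_diff is_lattice_scale) auto
    moreover have "z = (z - of_int k *\<^sub>R v) + of_int k *\<^sub>R v" by simp
    ultimately show "z \<in> {u + of_int k *\<^sub>R v | u k. u \<in> M \<inter> span \<tau>}" using k by blast
  qed
  moreover have "\<exists>x\<in>\<sigma>. \<exists>y\<in>span \<tau>. v = x + y"
    using assms(4) by (intro bexI[of _ v] bexI[of _ 0]) (simp_all add: span_zero)
  ultimately show ?thesis unfolding is_normal_vec_def using assms(3) v by blast
qed

lemma image_eq_sum_zero: "g ` S = {g x + r | x r. x \<in> S \<and> r \<in> {0}}" for g :: "'a \<Rightarrow> 'b::monoid_add"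
  by auto

locale fan_modification =
  fixes X :: "'a::real_normed_vector tfan" and f :: "'a \<Rightarrow> real"
  assumes X: "tropical_fan X" and f: "meromorphic X f" and T: "tropical_fan (trop_mod X f)"
begin

abbreviation "T \<equiv> trop_mod X f"
abbreviation "D \<equiv> div_fan X f"
abbreviation "N \<equiv> tf_lattice X"

text \<open>The facets of the divisor, whichever the sign of the order. They have dimension one less
  than \<open>X\<close>, so the upper cones over them are facets of the modification.\<close>

definition "poles = {\<tau> \<in> walls X. ord_at X f \<tau> \<noteq> 0}"

lemma T_lattice: "tf_lattice T = N \<times> \<int>"
  and T_cones: "tf_cones T = graph_cone f ` tf_cones X \<union> up_cone f ` div_cones X f"
  and D_lattice: "tf_lattice D = N"
  and D_cones: "tf_cones D = div_cones X f"
  and D_orient: "tf_orient D = ord_at X f"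
  unfolding trop_mod_def div_fan_def by simp_all

lemma div_cones_poles: "\<delta> \<in> div_cones X f \<longleftrightarrow> (\<exists>\<tau>\<in>poles. cone_face \<delta> \<tau>)"
  unfolding div_cones_def poles_def walls_def by blast

lemma polesD: "\<tau> \<in> poles \<Longrightarrow> \<tau> \<in> walls X" "\<tau> \<in> poles \<Longrightarrow> \<tau> \<in> tf_cones X" "\<tau> \<in> poles \<Longrightarrow> \<tau> \<in> div_cones X f"
proof -
  assume t: "\<tau> \<in> poles"
  then show w: "\<tau> \<in> walls X" unfolding poles_def by blast
  then show c: "\<tau> \<in> tf_cones X" by (rule walls_subset)
  have "cone_face \<tau> \<tau>" by (rule tropical_fan_subset_face[OF X c c order_refl])
  then show "\<tau> \<in> div_cones X f" using t div_cones_poles by blast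
qed

lemma div_cone: "\<delta> \<in> div_cones X f \<Longrightarrow> \<delta> \<in> tf_cones X"
  using div_cones_poles tropical_fan_face[OF X polesD(2)] by blast

lemma div_cone_below_pole:
  assumes "\<delta> \<in> div_cones X f"
  obtains \<tau> where "\<tau> \<in> poles" "\<delta> \<subseteq> \<tau>"
  using assms div_cones_poles cone_face_subset by blast

lemma pole_maximal: "\<tau> = \<tau>'" if "\<tau> \<in> poles" "\<tau>' \<in> poles" "\<tau> \<subseteq> \<tau>'"
proof (rule tropical_fan_eq_if_dim[OF X polesD(2)[OF that(2)] polesD(2)[OF that(1)] that(3)])
  show "dim \<tau>' \<le> dim \<tau>" using polesD(1)[OF that(1)] polesD(1)[OF that(2)] unfolding walls_def by simp
qed

lemma facet_not_below_pole: "F \<in> facets X \<Longrightarrow> \<tau> \<in> poles \<Longrightarrow> \<not> F \<subseteq> \<tau>"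
proof
  assume F: "F \<in> facets X" and \<tau>: "\<tau> \<in> poles" and sub: "F \<subseteq> \<tau>"
  have "\<tau> = F" using facets_maximal[OF F polesD(2)[OF \<tau>] sub] .
  then show False using tropical_fan_dim[OF X F] polesD(1)[OF \<tau>] unfolding walls_def by simp
qed

lemma mem_graph: "(x, s) \<in> graph_cone f \<sigma> \<longleftrightarrow> x \<in> \<sigma> \<and> s = f x"
  unfolding graph_cone_def by auto

lemma mem_up: "(x, s) \<in> up_cone f \<delta> \<longleftrightarrow> x \<in> \<delta> \<and> f x \<le> s"
  unfolding up_cone_def by (auto intro!: exI[of _ "s - f x"])

lemma graph_subset: "graph_cone f \<sigma> \<subseteq> graph_cone f \<sigma>' \<longleftrightarrow> \<sigma> \<subseteq> \<sigma>'"
  unfolding graph_cone_def by auto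

lemma graph_up_subset: "graph_cone f \<sigma> \<subseteq> up_cone f \<delta> \<longleftrightarrow> \<sigma> \<subseteq> \<delta>"
proof -
  have "(x, f x) \<in> up_cone f \<delta> \<longleftrightarrow> x \<in> \<delta>" for x unfolding mem_up by simp
  then show ?thesis unfolding graph_cone_def by blast
qed

lemma up_subset: "up_cone f \<delta> \<subseteq> up_cone f \<delta>' \<longleftrightarrow> \<delta> \<subseteq> \<delta>'"
proof
  assume sub: "up_cone f \<delta> \<subseteq> up_cone f \<delta>'"
  show "\<delta> \<subseteq> \<delta>'"
  proof
    fix x assume "x \<in> \<delta>"
    then have "(x, f x) \<in> up_cone f \<delta>'" using sub mem_up[of x "f x" \<delta>] by auto
    then show "x \<in> \<delta>'" unfolding mem_up by blast
  qed
qed (auto simp: up_cone_def)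

lemma up_not_graph: "\<delta> \<noteq> {} \<Longrightarrow> \<not> up_cone f \<delta> \<subseteq> graph_cone f \<sigma>"
proof
  assume "\<delta> \<noteq> {}" and sub: "up_cone f \<delta> \<subseteq> graph_cone f \<sigma>"
  then obtain x where "x \<in> \<delta>" by blast
  then have "(x, f x + 1) \<in> graph_cone f \<sigma>" using sub mem_up[of x "f x + 1" \<delta>] by auto
  then show False unfolding mem_graph by simp
qed

lemma zero_mem: "\<sigma> \<in> tf_cones X \<Longrightarrow> 0 \<in> \<sigma>"
  by (rule tropical_fan_zero[OF X])

lemma inj_graph: "inj (graph_cone f)" and inj_up: "inj (up_cone f)"
  by (rule injI, metis graph_subset order_refl subset_antisym) (rule injI, metis up_subset order_refl subset_antisym)

lemma fst_graph: "fst ` graph_cone f \<sigma> = \<sigma>"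
  unfolding graph_cone_def by (simp add: image_image)

lemma fst_up: "fst ` up_cone f \<delta> = \<delta>"
proof
  show "fst ` up_cone f \<delta> \<subseteq> \<delta>" unfolding up_cone_def by auto
  show "\<delta> \<subseteq> fst ` up_cone f \<delta>"
  proof
    fix x assume "x \<in> \<delta>"
    then have "(x, f x) \<in> up_cone f \<delta>" unfolding mem_up by simp
    then show "x \<in> fst ` up_cone f \<delta>" by force
  qed
qed

lemma up_neq_graph: "\<delta> \<in> div_cones X f \<Longrightarrow> up_cone f \<delta> \<noteq> graph_cone f \<sigma>"
  using up_not_graph[of \<delta> \<sigma>] zero_mem[OF div_cone] by blast

lemma orient_graph: "tf_orient T (graph_cone f \<sigma>) = tf_orient X \<sigma>"
  and orient_up: "\<delta> \<in> div_cones X f \<Longrightarrow> tf_orient T (up_cone f \<delta>) = ord_at X f \<delta>"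
proof -
  have "graph_cone f \<sigma> \<notin> up_cone f ` div_cones X f" using up_neq_graph by (metis imageE)
  then show "tf_orient T (graph_cone f \<sigma>) = tf_orient X \<sigma>" unfolding trop_mod_def by (simp add: fst_graph)
  assume "\<delta> \<in> div_cones X f"
  then show "tf_orient T (up_cone f \<delta>) = ord_at X f \<delta>" unfolding trop_mod_def by (simp add: fst_up)
qed

lemma T_coneE:
  assumes "\<kappa> \<in> tf_cones T"
  obtains \<sigma> where "\<sigma> \<in> tf_cones X" "\<kappa> = graph_cone f \<sigma>" | \<delta> where "\<delta> \<in> div_cones X f" "\<kappa> = up_cone f \<delta>"
  using assms unfolding T_cones by (elim UnE imageE) blast+

lemma graph_mem_T: "\<sigma> \<in> tf_cones X \<Longrightarrow> graph_cone f \<sigma> \<in> tf_cones T"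
  and up_mem_T: "\<delta> \<in> div_cones X f \<Longrightarrow> up_cone f \<delta> \<in> tf_cones T"
  unfolding T_cones by simp_all

text \<open>A facet of \<open>X\<close> is never contained in a pole, for dimension reasons, and an
  upper cone is never contained in a graph. So the graphs of facets and the upper cones over poles
  stay maximal, and every cone lies in one of them.\<close>

lemma facets_T: "facets T = graph_cone f ` facets X \<union> up_cone f ` poles"
proof (intro equalityI subsetI)
  fix \<kappa> assume k: "\<kappa> \<in> facets T"
  from facets_subset[OF k] show "\<kappa> \<in> graph_cone f ` facets X \<union> up_cone f ` poles"
  proof (cases rule: T_coneE)
    case (1 \<sigma>)
    obtain F where F: "F \<in> facets X" "\<sigma> \<subseteq> F" using facet_above[OF X 1(1)] by blast
    have "graph_cone f F = \<kappa>"
      using facets_maximal[OF k graph_mem_T[OF facets_subset[OF F(1)]]] graph_subset F(2) 1(2) by simp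
    then show ?thesis using F(1) by blast
  next
    case (2 \<delta>)
    obtain \<tau> where \<tau>: "\<tau> \<in> poles" "\<delta> \<subseteq> \<tau>" using div_cone_below_pole[OF 2(1)] .
    have "up_cone f \<tau> = \<kappa>"
      using facets_maximal[OF k up_mem_T[OF polesD(3)[OF \<tau>(1)]]] up_subset \<tau>(2) 2(2) by simp
    then show ?thesis using \<tau>(1) by blast
  qed
next
  fix \<kappa> assume "\<kappa> \<in> graph_cone f ` facets X \<union> up_cone f ` poles"
  then consider F where "F \<in> facets X" "\<kappa> = graph_cone f F" | \<tau> where "\<tau> \<in> poles" "\<kappa> = up_cone f \<tau>" by blast
  then show "\<kappa> \<in> facets T"
  proof cases
    case (1 F)
    have "\<rho> = \<kappa>" if \<rho>: "\<rho> \<in> tf_cones T" "\<kappa> \<subseteq> \<rho>" for \<rho>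
      using \<rho>(1)
    proof (cases rule: T_coneE)
      case (1 \<sigma>)
      then have "F \<subseteq> \<sigma>" using \<rho>(2) \<open>\<kappa> = graph_cone f F\<close> graph_subset by simp
      then show ?thesis using facets_maximal[OF \<open>F \<in> facets X\<close> 1(1)] 1(2) \<open>\<kappa> = graph_cone f F\<close> by simp
    next
      case (2 \<delta>)
      then have "F \<subseteq> \<delta>" using \<rho>(2) \<open>\<kappa> = graph_cone f F\<close> graph_up_subset by simp
      moreover obtain \<tau> where "\<tau> \<in> poles" "\<delta> \<subseteq> \<tau>" using div_cone_below_pole[OF 2(1)] .
      ultimately show ?thesis using facet_not_below_pole[OF \<open>F \<in> facets X\<close>] by blast
    qed
    then show ?thesis using graph_mem_T[OF facets_subset[OF 1(1)]] 1(2) unfolding facets_def by simp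
  next
    case (2 \<tau>)
    have "\<rho> = \<kappa>" if \<rho>: "\<rho> \<in> tf_cones T" "\<kappa> \<subseteq> \<rho>" for \<rho>
      using \<rho>(1)
    proof (cases rule: T_coneE)
      case (1 \<sigma>)
      have "\<tau> \<noteq> {}" using zero_mem[OF polesD(2)[OF 2(1)]] by blast
      then show ?thesis using up_not_graph \<rho>(2) 1(2) 2(2) by simp
    next
      case (2 \<delta>)
      then have sub: "\<tau> \<subseteq> \<delta>" using \<rho>(2) \<open>\<kappa> = up_cone f \<tau>\<close> up_subset by simp
      obtain \<tau>' where \<tau>': "\<tau>' \<in> poles" "\<delta> \<subseteq> \<tau>'" using div_cone_below_pole[OF 2(1)] .
      then have "\<tau> = \<tau>'" using pole_maximal[OF \<open>\<tau> \<in> poles\<close>] sub by blast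
      then show ?thesis using sub \<tau>'(2) 2(2) \<open>\<kappa> = up_cone f \<tau>\<close> by simp
    qed
    then show ?thesis using up_mem_T[OF polesD(3)[OF 2(1)]] 2(2) unfolding facets_def by simp
  qed
qed

lemma facets_D: "facets D = poles"
proof (intro equalityI subsetI)
  fix \<delta> assume d: "\<delta> \<in> facets D"
  then have "\<delta> \<in> div_cones X f" using facets_subset D_cones by blast
  then obtain \<tau> where \<tau>: "\<tau> \<in> poles" "\<delta> \<subseteq> \<tau>" by (rule div_cone_below_pole)
  then have "\<tau> = \<delta>" using facets_maximal[OF d] polesD(3) D_cones by blast
  then show "\<delta> \<in> poles" using \<tau>(1) by simp
next
  fix \<tau> assume \<tau>: "\<tau> \<in> poles"
  have "\<delta> = \<tau>" if \<delta>: "\<delta> \<in> div_cones X f" "\<tau> \<subseteq> \<delta>" for \<delta>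
  proof -
    obtain \<tau>' where \<tau>': "\<tau>' \<in> poles" "\<delta> \<subseteq> \<tau>'" using div_cone_below_pole[OF \<delta>(1)] .
    then have "\<tau> = \<tau>'" using pole_maximal[OF \<tau>] \<delta>(2) by blast
    then show ?thesis using \<delta>(2) \<tau>'(2) by blast
  qed
  then show "\<tau> \<in> facets D" using polesD(3)[OF \<tau>] unfolding facets_def D_cones by simp
qed

section \<open>Linear lifts to the graph and normal vectors of the modification\<close>

definition form :: "'a set \<Rightarrow> 'a \<Rightarrow> real" where
  "form \<sigma> = (SOME l. linear l \<and> l ` (N \<inter> span \<sigma>) \<subseteq> \<int> \<and> (\<forall>x\<in>\<sigma>. f x = l x))"

lemma form: "linear (form \<sigma>)" "form \<sigma> ` (N \<inter> span \<sigma>) \<subseteq> \<int>" "\<And>x. x \<in> \<sigma> \<Longrightarrow> f x = form \<sigma> x"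
  if "\<sigma> \<in> tf_cones X"
proof -
  have "\<forall>\<sigma>\<in>tf_cones X. \<exists>l. linear l \<and> l ` (N \<inter> span \<sigma>) \<subseteq> \<int> \<and> (\<forall>x\<in>\<sigma>. f x = l x)"
    using f unfolding meromorphic_def by (rule conjunct2)
  from someI_ex[OF bspec[OF this that]]
  have "linear (form \<sigma>) \<and> form \<sigma> ` (N \<inter> span \<sigma>) \<subseteq> \<int> \<and> (\<forall>x\<in>\<sigma>. f x = form \<sigma> x)"
    unfolding form_def .
  then show "linear (form \<sigma>)" "form \<sigma> ` (N \<inter> span \<sigma>) \<subseteq> \<int>" "\<And>x. x \<in> \<sigma> \<Longrightarrow> f x = form \<sigma> x" by blast+
qed

text \<open>The graph map of \<open>f\<close> is only piecewise linear. \<open>lift \<sigma>\<close>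
  is a linear map agreeing with it on \<open>\<sigma>\<close>, with left inverse \<open>fst\<close>,
  as \<open>codim1_sum\<close> and \<open>is_normal_vec_sum\<close> require.\<close>

abbreviation "lift \<sigma> x \<equiv> (x, form \<sigma> x)"
abbreviation "ray \<equiv> {(0 :: 'a, t :: real) | t. 0 \<le> t}"

lemma graph_sum: "graph_cone f \<tau> = {lift \<sigma> x + r | x r. x \<in> \<tau> \<and> r \<in> {0}}" if "\<sigma> \<in> tf_cones X" "\<tau> \<subseteq> \<sigma>"
proof -
  have "graph_cone f \<tau> = lift \<sigma> ` \<tau>"
    unfolding graph_cone_def using form(3)[OF that(1)] that(2) by (intro image_cong) auto
  then show ?thesis unfolding image_eq_sum_zero .
qed

lemma up_sum: "up_cone f \<tau> = {lift \<sigma> x + r | x r. x \<in> \<tau> \<and> r \<in> ray}" if "\<sigma> \<in> tf_cones X" "\<tau> \<subseteq> \<sigma>"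
proof (intro equalityI[symmetric] subsetI)
  fix z assume "z \<in> {lift \<sigma> x + r | x r. x \<in> \<tau> \<and> r \<in> ray}"
  then obtain x t where "z = lift \<sigma> x + (0, t)" "x \<in> \<tau>" "0 \<le> t" by blast
  then have "z = (x, f x + t)" "x \<in> \<tau>" "0 \<le> t" using form(3)[OF that(1), of x] that(2) by auto
  then show "z \<in> up_cone f \<tau>" unfolding up_cone_def by blast
next
  fix z assume "z \<in> up_cone f \<tau>"
  then obtain x t where z: "z = (x, f x + t)" "x \<in> \<tau>" "0 \<le> t" unfolding up_cone_def by blast
  then have "z = lift \<sigma> x + (0, t)" using form(3)[OF that(1), of x] that(2) by auto
  then show "z \<in> {lift \<sigma> x + r | x r. x \<in> \<tau> \<and> r \<in> ray}" using z(2,3) by blast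
qed

lemma linear_lift: "\<sigma> \<in> tf_cones X \<Longrightarrow> linear (lift \<sigma>)"
  using form(1) by (rule linear_Pair)

lemma lift_lattice: "\<sigma> \<in> tf_cones X \<Longrightarrow> lift \<sigma> ` (N \<inter> span \<sigma>) \<subseteq> tf_lattice T"
  unfolding T_lattice using form(2) by blast

lemma fst_lattice: "fst ` (tf_lattice T \<inter> W) \<subseteq> N"
  unfolding T_lattice by auto

lemma lift_mem: "\<sigma> \<in> tf_cones X \<Longrightarrow> x \<in> \<sigma> \<Longrightarrow> lift \<sigma> x \<in> graph_cone f \<sigma>"
  using form(3) unfolding mem_graph by simp

lemma span_graph: "\<sigma> \<in> tf_cones X \<Longrightarrow> span (graph_cone f \<sigma>) = lift \<sigma> ` span \<sigma>"
proof -
  assume \<sigma>: "\<sigma> \<in> tf_cones X"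
  have "graph_cone f \<sigma> = lift \<sigma> ` \<sigma>"
    unfolding graph_cone_def using form(3)[OF \<sigma>] by (intro image_cong) auto
  then show ?thesis using linear_span_image[OF linear_lift[OF \<sigma>]] by simp
qed

lemma up_span: "(0, t) \<in> span (up_cone f \<delta>)" "x \<in> span \<delta> \<Longrightarrow> (x, t) \<in> span (up_cone f \<delta>)"
  if \<delta>: "\<delta> \<in> div_cones X f"
proof -
  note c = div_cone[OF \<delta>]
  have 0: "(0, t) \<in> span (up_cone f \<delta>)" for t
  proof -
    have "f 0 = 0" using form(3)[OF c zero_mem[OF c]] form(1)[OF c] by (simp add: linear_0)
    then have "(0, 1) \<in> up_cone f \<delta>" unfolding mem_up using zero_mem[OF c] by simp
    then have "t *\<^sub>R (0, 1) \<in> span (up_cone f \<delta>)" by (intro span_scale span_base)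
    then show ?thesis by simp
  qed
  then show "(0, t) \<in> span (up_cone f \<delta>)" .
  assume x: "x \<in> span \<delta>"
  have "graph_cone f \<delta> \<subseteq> up_cone f \<delta>" using graph_up_subset by blast
  then have "span (graph_cone f \<delta>) \<subseteq> span (up_cone f \<delta>)" by (rule span_mono)
  then have "lift \<delta> x \<in> span (up_cone f \<delta>)" using x unfolding span_graph[OF c] by blast
  then have "lift \<delta> x + (0, t - form \<delta> x) \<in> span (up_cone f \<delta>)" using 0 by (rule span_add)
  then show "(x, t) \<in> span (up_cone f \<delta>)" by simp
qed

lemma span_up: "(x, t) \<in> span (up_cone f \<delta>) \<Longrightarrow> x \<in> span \<delta>"
proof -
  assume "(x, t) \<in> span (up_cone f \<delta>)"
  then have "fst (x, t) \<in> fst ` span (up_cone f \<delta>)" by (rule imageI)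
  then show ?thesis using linear_span_image[OF linear_fst, of "up_cone f \<delta>"] fst_up by simp
qed

lemma zero_one_lattice: "(0, 1) \<in> tf_lattice T"
  unfolding T_lattice using is_lattice_zero[OF tropical_fan_lattice[OF X]] by simp

text \<open>The vertical vector is primitive modulo the graph: a lattice vector
  \<open>(x, s)\<close> of the span exceeds its lift by \<open>s - form \<tau> x\<close>, an integer
  since the form is integral on \<open>N \<inter> span \<tau>\<close>.\<close>

lemma normal_up_graph:
  assumes "\<tau> \<in> poles"
  shows "is_normal_vec (tf_lattice T) (up_cone f \<tau>) (graph_cone f \<tau>) (0, 1)"
proof (rule is_normal_vec_ray)
  note c = polesD(2)[OF assms] and d = polesD(3)[OF assms]
  have f0: "form \<tau> 0 = 0" "f 0 = 0" using form(3)[OF c zero_mem[OF c]] form(1)[OF c] by (simp_all add: linear_0)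
  show "is_lattice (tf_lattice T)" by (rule tropical_fan_lattice[OF T])
  show "(0, 1) \<in> tf_lattice T" by (rule zero_one_lattice)
  show "(0, 1) \<in> up_cone f \<tau>" unfolding mem_up using zero_mem[OF c] f0 by simp
  show "(0, 1) \<notin> span (graph_cone f \<tau>)" unfolding span_graph[OF c] using f0 by auto
  show "graph_cone f \<tau> \<subseteq> span (up_cone f \<tau>)" using graph_up_subset span_superset by blast
  show "\<exists>k::int. z - of_int k *\<^sub>R (0, 1) \<in> span (graph_cone f \<tau>)"
    if z: "z \<in> tf_lattice T" "z \<in> span (up_cone f \<tau>)" for z
  proof -
    obtain x s where xs: "z = (x, s)" by (cases z)
    have x: "x \<in> N" "s \<in> \<int>" using z(1) unfolding xs T_lattice by auto
    have xsp: "x \<in> span \<tau>" using z(2) unfolding xs by (rule span_up)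
    then have "form \<tau> x \<in> \<int>" using form(2)[OF c] x(1) by blast
    then have "s - form \<tau> x \<in> \<int>" using x(2) by (rule Ints_diff[rotated])
    then obtain k :: int where k: "s - form \<tau> x = of_int k" by (rule Ints_cases)
    then have "z - of_int k *\<^sub>R (0, 1) = lift \<tau> x" unfolding xs by (simp add: algebra_simps)
    then show ?thesis unfolding span_graph[OF c] using xsp by blast
  qed
qed

lemma wall_graph:
  assumes \<tau>: "\<tau> \<in> walls X"
  shows "graph_cone f \<tau> \<in> walls T"
proof -
  have \<tau>c: "\<tau> \<in> tf_cones X" using \<tau> by (rule walls_subset)
  obtain F where F: "F \<in> facets X" "\<tau> \<subseteq> F" using facet_above[OF X \<tau>c] by blast
  note Fc = facets_subset[OF F(1)]
  have "codim1 \<tau> F" using wall_iff_codim1[OF X F(1) \<tau>c F(2)] \<tau> by blast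
  then have "codim1 (graph_cone f \<tau>) (graph_cone f F)"
    using codim1_sum[where \<iota> = "lift F" and p = fst and \<sigma> = F and \<tau> = \<tau> and R = "{0}", OF graph_sum[OF Fc order_refl] graph_sum[OF Fc F(2)] linear_lift[OF Fc] linear_fst]
      F(2) zero_mem[OF \<tau>c] by simp
  moreover have "graph_cone f F \<in> facets T" unfolding facets_T using F(1) by blast
  ultimately show ?thesis
    using wall_iff_codim1[OF T _ graph_mem_T[OF \<tau>c]] graph_subset F(2) by blast
qed

lemma normal_graph:
  assumes "\<tau> \<in> walls X" "\<sigma> \<in> wall_facets X \<tau>" "is_normal_vec N \<sigma> \<tau> n"
  shows "is_normal_vec (tf_lattice T) (graph_cone f \<sigma>) (graph_cone f \<tau>) (lift \<sigma> n)"
proof -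
  note s = wall_facetsD(2,3)[OF assms(2)]
  have p0: "fst r = 0" if "r \<in> {0 :: 'a \<times> real}" for r using that by simp
  show ?thesis
    by (rule is_normal_vec_sum[where \<iota> = "lift \<sigma>" and p = fst and \<sigma> = \<sigma> and \<tau> = \<tau> and R = "{0}",
          OF graph_sum[OF s(1) order_refl] graph_sum[OF s] linear_lift[OF s(1)] linear_fst fst_conv p0 s(2)
            zero_mem[OF walls_subset[OF assms(1)]] singletonI assms(3) tropical_fan_lattice[OF T] fst_lattice
            lift_lattice[OF s(1)]])
qed

text \<open>The right-hand side involves \<open>a\<close> but neither \<open>\<delta>\<close> nor
  \<open>k\<close>, so all upper cones over \<open>a\<close> see the same slope.\<close>

lemma vertical_slope:
  assumes "a \<in> \<delta>" "linear k" "\<And>z. z \<in> up_cone f \<delta> \<Longrightarrow> g z = k z"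
  shows "k (0, 1) = g (a, f a + 1) - g (a, f a)"
proof -
  have "(0, 1) = (a, f a + 1) - (a, f a)" by simp
  then have "k (0, 1) = k (a, f a + 1) - k (a, f a)" using linear_diff[OF assms(2)] by metis
  then show ?thesis using assms(1,3) mem_up by simp
qed

text \<open>Around the graph of a wall \<open>\<tau>\<close> lie the graphs of the facets around
  \<open>\<tau>\<close> and, if \<open>\<tau>\<close> is a pole, one upper cone with normal vector
  \<open>(0, 1)\<close>. The comparison form \<open>?L\<close> extends \<open>k \<tau>\<close> with
  vertical slope \<open>c\<close>, so that upper cone contributes nothing and the rest is the sum
  for \<open>h\<close> on \<open>X\<close>.\<close>

lemma near_graph:
  assumes a: "a \<in> support X" and near: "div_faithful_near X a"
  shows "div_faithful_near T (a, f a)"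
  unfolding div_faithful_near_def
proof (intro allI impI)
  fix g assume g: "\<forall>\<kappa>\<in>tf_cones T. (a, f a) \<in> \<kappa> \<longrightarrow> integral_linear_on (tf_lattice T) \<kappa> g"
    and bal: "\<forall>\<kappa>\<in>walls T. (a, f a) \<in> \<kappa> \<longrightarrow> balanced_at T g \<kappa>"
  define S where "S = {\<kappa> \<in> tf_cones T. (a, f a) \<in> \<kappa>}"
  have gS: "integral_linear_on (tf_lattice T) \<kappa> g" if "\<kappa> \<in> S" for \<kappa>
    using g that unfolding S_def by blast
  obtain l where l: "\<And>\<kappa>. \<kappa> \<in> S \<Longrightarrow> linear (l \<kappa>)" "\<And>\<kappa>. \<kappa> \<in> S \<Longrightarrow> l \<kappa> ` (tf_lattice T \<inter> span \<kappa>) \<subseteq> \<int>"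
    "\<And>\<kappa> z. \<kappa> \<in> S \<Longrightarrow> z \<in> \<kappa> \<Longrightarrow> g z = l \<kappa> z"
    using integral_linear_forms[OF gS] by metis
  have Sg: "graph_cone f \<sigma> \<in> S" if "\<sigma> \<in> tf_cones X" "a \<in> \<sigma>" for \<sigma>
    unfolding S_def using graph_mem_T[OF that(1)] that(2) by (simp add: mem_graph)
  have Su: "up_cone f \<delta> \<in> S" if "\<delta> \<in> div_cones X f" "a \<in> \<delta>" for \<delta>
    unfolding S_def using up_mem_T[OF that(1)] that(2) mem_up[of a "f a"] by simp
  \<comment> \<open>the slope of \<open>g\<close> in the vertical direction, if that is seen at all from \<open>a\<close>\<close>
  define c where "c = (if \<exists>\<delta>\<in>div_cones X f. a \<in> \<delta> then g (a, f a + 1) - g (a, f a) else 0)"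
  have c: "l (up_cone f \<delta>) (0, 1) = c" if \<delta>: "\<delta> \<in> div_cones X f" "a \<in> \<delta>" for \<delta>
  proof -
    have "l (up_cone f \<delta>) (0, 1) = g (a, f a + 1) - g (a, f a)"
      by (rule vertical_slope[OF \<delta>(2) l(1,3)[OF Su[OF \<delta>]]])
    then show ?thesis unfolding c_def using \<delta> by auto
  qed
  have c_int: "c \<in> \<int>"
  proof (cases "\<exists>\<delta>\<in>div_cones X f. a \<in> \<delta>")
    case True
    then obtain \<delta> where \<delta>: "\<delta> \<in> div_cones X f" "a \<in> \<delta>" by blast
    have "(0, 1) \<in> tf_lattice T \<inter> span (up_cone f \<delta>)" using up_span(1)[OF \<delta>(1)] zero_one_lattice by blast
    then have "l (up_cone f \<delta>) (0, 1) \<in> \<int>" using l(2)[OF Su[OF \<delta>]] by blast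
    then show ?thesis using c[OF \<delta>] by simp
  next
    case False
    then show ?thesis unfolding c_def by simp
  qed
  define h where "h = (\<lambda>x. g (x, f x) - c * f x)"
  define k where "k = (\<lambda>\<sigma> x. l (graph_cone f \<sigma>) (lift \<sigma> x) - c * form \<sigma> x)"
  have k_lin: "linear (k \<sigma>)" if "\<sigma> \<in> tf_cones X" "a \<in> \<sigma>" for \<sigma>
  proof -
    have "linear (\<lambda>x. l (graph_cone f \<sigma>) (lift \<sigma> x))"
      using linear_compose[OF linear_lift[OF that(1)] l(1)[OF Sg[OF that]]] by (simp add: o_def)
    then show ?thesis unfolding k_def by (intro linear_compose_sub linear_cmult form(1) that(1))
  qed
  have hk: "h x = k \<sigma> x" if "\<sigma> \<in> tf_cones X" "a \<in> \<sigma>" "x \<in> \<sigma>" for \<sigma> x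
    unfolding h_def k_def using l(3)[OF Sg[OF that(1,2)] lift_mem[OF that(1,3)]] form(3)[OF that(1,3)] by simp
  have "integral_linear_on N \<sigma> h" if \<sigma>: "\<sigma> \<in> tf_cones X" "a \<in> \<sigma>" for \<sigma>
    unfolding integral_linear_on_def
  proof (intro exI conjI ballI)
    show "linear (k \<sigma>)" by (rule k_lin[OF \<sigma>])
    show "k \<sigma> ` (N \<inter> span \<sigma>) \<subseteq> \<int>"
    proof
      fix y assume "y \<in> k \<sigma> ` (N \<inter> span \<sigma>)"
      then obtain x where x: "x \<in> N \<inter> span \<sigma>" "y = k \<sigma> x" by blast
      have "lift \<sigma> x \<in> tf_lattice T \<inter> span (graph_cone f \<sigma>)"
        using x(1) lift_lattice[OF \<sigma>(1)] unfolding span_graph[OF \<sigma>(1)] by blast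
      then have "l (graph_cone f \<sigma>) (lift \<sigma> x) \<in> \<int>" using l(2)[OF Sg[OF \<sigma>]] by blast
      moreover have "form \<sigma> x \<in> \<int>" using form(2)[OF \<sigma>(1)] x(1) by blast
      ultimately show "y \<in> \<int>" unfolding x(2) k_def using c_int by (intro Ints_diff Ints_mult)
    qed
  qed (rule hk[OF \<sigma>])
  moreover have "balanced_at X h \<tau>" if \<tau>: "\<tau> \<in> walls X" "a \<in> \<tau>" for \<tau>
  proof -
    have \<tau>c: "\<tau> \<in> tf_cones X" using \<tau> walls_subset by blast
    have W: "\<sigma> \<in> tf_cones X" "a \<in> \<sigma>" if "\<sigma> \<in> wall_facets X \<tau>" for \<sigma> using wall_facetsD[OF that] \<tau>(2) by auto
    have graph_W: "graph_cone f ` wall_facets X \<tau> \<subseteq> wall_facets T (graph_cone f \<tau>)"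
      unfolding wall_facets_def facets_T using graph_subset by blast
    \<comment> \<open>Such a facet is an upper cone over a pole containing \<open>\<tau>\<close>;
      all walls have the same dimension, so the pole is \<open>\<tau>\<close> itself.\<close>
    have other: "\<tau> \<in> poles \<and> \<rho> = up_cone f \<tau>"
      if \<rho>: "\<rho> \<in> wall_facets T (graph_cone f \<tau>)" "\<rho> \<notin> graph_cone f ` wall_facets X \<tau>" for \<rho>
    proof -
      have sub: "graph_cone f \<tau> \<subseteq> \<rho>" using wall_facetsD(3)[OF \<rho>(1)] .
      have "\<rho> \<notin> graph_cone f ` facets X"
      proof
        assume "\<rho> \<in> graph_cone f ` facets X"
        then obtain F where F: "F \<in> facets X" "\<rho> = graph_cone f F" by blast
        then have "\<tau> \<subseteq> F" using sub graph_subset by simp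
        then have "F \<in> wall_facets X \<tau>" using F(1) unfolding wall_facets_def by simp
        then show False using \<rho>(2) F(2) by blast
      qed
      then have "\<rho> \<in> up_cone f ` poles" using wall_facetsD(1)[OF \<rho>(1)] unfolding facets_T by blast
      then obtain \<tau>' where \<tau>': "\<tau>' \<in> poles" "\<rho> = up_cone f \<tau>'" by blast
      have "\<tau> = \<tau>'"
      proof (rule tropical_fan_eq_if_dim[OF X polesD(2)[OF \<tau>'(1)] \<tau>c])
        show "\<tau> \<subseteq> \<tau>'" using sub \<tau>'(2) graph_up_subset by simp
        show "dim \<tau>' \<le> dim \<tau>" using \<tau>(1) polesD(1)[OF \<tau>'(1)] unfolding walls_def by simp
      qed
      then show ?thesis using \<tau>' by simp
    qed
    have \<kappa>S: "\<kappa> \<in> S" if "\<kappa> \<in> wall_facets T (graph_cone f \<tau>)" for \<kappa>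
      using wall_facetsD(2,3)[OF that] Sg[OF \<tau>c \<tau>(2)] unfolding S_def by blast
    obtain n where n: "\<And>\<sigma>. \<sigma> \<in> wall_facets X \<tau> \<Longrightarrow> is_normal_vec N \<sigma> \<tau> (n \<sigma>)"
      using wall_normals[OF X \<tau>(1)] by blast
    let ?L = "\<lambda>z. k \<tau> (fst z) + c * snd z"
    show ?thesis
    proof (rule balanced_at_pullback[OF X \<tau>(1) T, of g "graph_cone f \<tau>" "graph_cone f" 1 n "\<lambda>\<sigma>. lift \<sigma> (n \<sigma>)"
          "\<lambda>_. (0, 1)" l ?L k h "k \<tau>"])
      show "balanced_at T g (graph_cone f \<tau>)" using bal wall_graph[OF \<tau>(1)] \<tau>(2) mem_graph by blast
      show "inj_on (graph_cone f) (wall_facets X \<tau>)" using inj_graph inj_on_subset by blast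
      show "tf_orient T (graph_cone f \<sigma>) = 1 * tf_orient X \<sigma>" for \<sigma> by (simp add: orient_graph)
      show "is_normal_vec (tf_lattice T) (graph_cone f \<sigma>) (graph_cone f \<tau>) (lift \<sigma> (n \<sigma>))"
        if "\<sigma> \<in> wall_facets X \<tau>" for \<sigma> by (rule normal_graph[OF \<tau>(1) that n[OF that]])
      show "is_normal_vec (tf_lattice T) \<rho> (graph_cone f \<tau>) (0, 1) \<and> l \<rho> (0, 1) = ?L (0, 1)"
        if "\<rho> \<in> wall_facets T (graph_cone f \<tau>)" "\<rho> \<notin> graph_cone f ` wall_facets X \<tau>" for \<rho>
      proof -
        have p: "\<tau> \<in> poles" "\<rho> = up_cone f \<tau>" using other[OF that] by blast+
        then show ?thesis
          using normal_up_graph[OF p(1)] c[OF polesD(3)[OF p(1)] \<tau>(2)] linear_0[OF k_lin[OF \<tau>c \<tau>(2)]] by simp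
      qed
      show "linear ?L" by (rule linear_affine_coord[OF k_lin[OF \<tau>c \<tau>(2)]])
      show "g z = ?L z" if z: "z \<in> graph_cone f \<tau>" for z
      proof -
        obtain x where x: "z = (x, f x)" "x \<in> \<tau>" using z unfolding graph_cone_def by blast
        then show ?thesis using hk[OF \<tau>c \<tau>(2) x(2)] unfolding h_def by simp
      qed
      show "l (graph_cone f \<sigma>) (lift \<sigma> (n \<sigma>)) - ?L (lift \<sigma> (n \<sigma>)) = k \<sigma> (n \<sigma>) - k \<tau> (n \<sigma>)"
        if "\<sigma> \<in> wall_facets X \<tau>" for \<sigma> unfolding k_def by simp
      show "linear (k \<sigma>)" if "\<sigma> \<in> wall_facets X \<tau>" for \<sigma> by (rule k_lin[OF W[OF that]])
      show "h x = k \<sigma> x" if "\<sigma> \<in> wall_facets X \<tau>" "x \<in> \<sigma>" for \<sigma> x by (rule hk[OF W[OF that(1)] that(2)])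
      show "linear (k \<tau>)" by (rule k_lin[OF \<tau>c \<tau>(2)])
      show "h x = k \<tau> x" if "x \<in> \<tau>" for x by (rule hk[OF \<tau>c \<tau>(2) that])
      show "linear (l \<rho>)" if "\<rho> \<in> wall_facets T (graph_cone f \<tau>)" for \<rho> by (rule l(1)[OF \<kappa>S[OF that]])
      show "g z = l \<rho> z" if "\<rho> \<in> wall_facets T (graph_cone f \<tau>)" "z \<in> \<rho>" for \<rho> z by (rule l(3)[OF \<kappa>S[OF that(1)] that(2)])
      show "graph_cone f ` wall_facets X \<tau> \<subseteq> wall_facets T (graph_cone f \<tau>)" by (rule graph_W)
      show "is_normal_vec N \<sigma> \<tau> (n \<sigma>)" if "\<sigma> \<in> wall_facets X \<tau>" for \<sigma> by (rule n[OF that])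
    qed simp
  qed
  ultimately obtain m where m: "linear m" "\<forall>\<sigma>\<in>tf_cones X. a \<in> \<sigma> \<longrightarrow> (\<forall>x\<in>\<sigma>. h x = m x)"
    using near unfolding div_faithful_near_def by blast
  let ?m = "\<lambda>z. m (fst z) + c * snd z"
  have gm: "g (x, f x) = m x + c * f x" if "\<sigma> \<in> tf_cones X" "a \<in> \<sigma>" "x \<in> \<sigma>" for \<sigma> x
  proof -
    have "h x = m x" using m(2) that by blast
    then show ?thesis unfolding h_def by simp
  qed
  have "g z = ?m z" if \<kappa>: "\<kappa> \<in> tf_cones T" "(a, f a) \<in> \<kappa>" "z \<in> \<kappa>" for \<kappa> z
    using \<kappa>(1)
  proof (cases rule: T_coneE)
    case (1 \<sigma>)
    then have "a \<in> \<sigma>" using \<kappa>(2) mem_graph by blast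
    obtain x where x: "z = (x, f x)" "x \<in> \<sigma>" using \<kappa>(3) unfolding 1(2) graph_cone_def by blast
    show ?thesis unfolding x(1) using gm[OF 1(1) \<open>a \<in> \<sigma>\<close> x(2)] by simp
  next
    case (2 \<delta>)
    then have \<delta>: "a \<in> \<delta>" using \<kappa>(2) mem_up by blast
    obtain x t where x: "z = (x, f x + t)" "x \<in> \<delta>" "0 \<le> t" using \<kappa>(3) unfolding 2(2) up_cone_def by blast
    have "(x, f x) \<in> up_cone f \<delta>" unfolding mem_up using x(2) by simp
    have "z = (x, f x) + t *\<^sub>R (0, 1)" unfolding x(1) by simp
    then have "l \<kappa> z = l \<kappa> (x, f x) + t * l \<kappa> (0, 1)"
      using l(1)[OF Su[OF 2(1) \<delta>]] unfolding 2(2) by (simp only: linear_add linear_scale real_scaleR_def)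
    then have "g z = g (x, f x) + t * c"
      using l(3)[OF Su[OF 2(1) \<delta>]] \<kappa>(3) \<open>(x, f x) \<in> up_cone f \<delta>\<close> c[OF 2(1) \<delta>] unfolding 2(2) by simp
    then show ?thesis unfolding x(1) using gm[OF div_cone[OF 2(1)] \<delta> x(2)] by (simp add: algebra_simps)
  qed
  then show "\<exists>m. linear m \<and> (\<forall>\<kappa>\<in>tf_cones T. (a, f a) \<in> \<kappa> \<longrightarrow> (\<forall>z\<in>\<kappa>. g z = m z))"
    by (intro exI[of _ ?m] conjI linear_affine_coord[OF m(1)] ballI impI)
qed

lemma near_up:
  assumes D: "tropical_fan D" and a: "a \<in> support D" and near: "div_faithful_near D a" and s: "f a < s"
  shows "div_faithful_near T (a, s)"
  unfolding div_faithful_near_def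
proof (intro allI impI)
  fix g assume g: "\<forall>\<kappa>\<in>tf_cones T. (a, s) \<in> \<kappa> \<longrightarrow> integral_linear_on (tf_lattice T) \<kappa> g"
    and bal: "\<forall>\<kappa>\<in>walls T. (a, s) \<in> \<kappa> \<longrightarrow> balanced_at T g \<kappa>"
  define S where "S = {\<kappa> \<in> tf_cones T. (a, s) \<in> \<kappa>}"
  have gS: "integral_linear_on (tf_lattice T) \<kappa> g" if "\<kappa> \<in> S" for \<kappa>
    using g that unfolding S_def by blast
  obtain l where l: "\<And>\<kappa>. \<kappa> \<in> S \<Longrightarrow> linear (l \<kappa>)" "\<And>\<kappa>. \<kappa> \<in> S \<Longrightarrow> l \<kappa> ` (tf_lattice T \<inter> span \<kappa>) \<subseteq> \<int>"
    "\<And>\<kappa> z. \<kappa> \<in> S \<Longrightarrow> z \<in> \<kappa> \<Longrightarrow> g z = l \<kappa> z"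
    using integral_linear_forms[OF gS] by metis
  have Su: "up_cone f \<delta> \<in> S" if "\<delta> \<in> div_cones X f" "a \<in> \<delta>" for \<delta>
    unfolding S_def using up_mem_T[OF that(1)] that(2) s mem_up[of a s] by simp
  define c where "c = g (a, f a + 1) - g (a, f a)"
  have c: "l (up_cone f \<delta>) (0, 1) = c" if \<delta>: "\<delta> \<in> div_cones X f" "a \<in> \<delta>" for \<delta>
  proof -
    have "l (up_cone f \<delta>) (0, 1) = g (a, f a + 1) - g (a, f a)"
      by (rule vertical_slope[OF \<delta>(2) l(1,3)[OF Su[OF \<delta>]]])
    then show ?thesis unfolding c_def by simp
  qed
  have split: "l (up_cone f \<delta>) (x, t) = l (up_cone f \<delta>) (x, 0) + c * t" if \<delta>: "\<delta> \<in> div_cones X f" "a \<in> \<delta>" for \<delta> x t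
  proof -
    have "(x, t) = (x, 0) + t *\<^sub>R (0 :: 'a, 1 :: real)" by simp
    then have "l (up_cone f \<delta>) (x, t) = l (up_cone f \<delta>) (x, 0) + t * l (up_cone f \<delta>) (0, 1)"
      using l(1)[OF Su[OF \<delta>]] by (simp only: linear_add linear_scale real_scaleR_def)
    then show ?thesis using c[OF \<delta>] by simp
  qed
  define h where "h = (\<lambda>x. g (x, f x) - c * f x)"
  \<comment> \<open>The form at height \<open>0\<close>, where the upper cone itself may have no
    points; by \<open>split\<close> it still equals \<open>h\<close> on
    \<open>\<delta>\<close>.\<close>
  define k where "k = (\<lambda>\<delta> x. l (up_cone f \<delta>) (x, 0))"
  have k_lin: "linear (k \<delta>)" if \<delta>: "\<delta> \<in> div_cones X f" "a \<in> \<delta>" for \<delta>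
  proof -
    have "linear (\<lambda>x :: 'a. (x, 0 :: real))" by (rule linearI) simp_all
    from linear_compose[OF this l(1)[OF Su[OF \<delta>]]] show ?thesis unfolding k_def by (simp add: o_def)
  qed
  have hk: "h x = k \<delta> x" if "\<delta> \<in> div_cones X f" "a \<in> \<delta>" "x \<in> \<delta>" for \<delta> x
  proof -
    have "(x, f x) \<in> up_cone f \<delta>" unfolding mem_up using that(3) by simp
    then have "g (x, f x) = l (up_cone f \<delta>) (x, f x)" by (rule l(3)[OF Su[OF that(1,2)]])
    then show ?thesis unfolding h_def k_def using split[OF that(1,2), of x "f x"] by linarith
  qed
  have "integral_linear_on (tf_lattice D) \<delta> h" if \<delta>: "\<delta> \<in> tf_cones D" "a \<in> \<delta>" for \<delta>
    unfolding integral_linear_on_def D_lattice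
  proof (intro exI conjI ballI)
    have \<delta>d: "\<delta> \<in> div_cones X f" using \<delta>(1) D_cones by simp
    show "linear (k \<delta>)" by (rule k_lin[OF \<delta>d \<delta>(2)])
    show "k \<delta> ` (N \<inter> span \<delta>) \<subseteq> \<int>"
    proof
      fix y assume "y \<in> k \<delta> ` (N \<inter> span \<delta>)"
      then obtain x where x: "x \<in> N" "x \<in> span \<delta>" "y = k \<delta> x" by blast
      have "(x, 0) \<in> tf_lattice T \<inter> span (up_cone f \<delta>)"
        using x(1) up_span(2)[OF \<delta>d x(2)] unfolding T_lattice by simp
      then show "y \<in> \<int>" unfolding x(3) k_def using l(2)[OF Su[OF \<delta>d \<delta>(2)]] by blast
    qed
    show "h x = k \<delta> x" if "x \<in> \<delta>" for x by (rule hk[OF \<delta>d \<delta>(2) that])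
  qed
  moreover have "balanced_at D h \<tau>" if \<tau>: "\<tau> \<in> walls D" "a \<in> \<tau>" for \<tau>
  proof -
    have \<tau>D: "\<tau> \<in> tf_cones D" using walls_subset[OF \<tau>(1)] .
    then have \<tau>d: "\<tau> \<in> div_cones X f" using D_cones by simp
    have W: "\<sigma> \<in> div_cones X f" "a \<in> \<sigma>" "\<sigma> \<in> poles" if "\<sigma> \<in> wall_facets D \<tau>" for \<sigma>
      using wall_facetsD[OF that] \<tau>(2) D_cones facets_D by auto
    have WT: "wall_facets T (up_cone f \<tau>) = up_cone f ` wall_facets D \<tau>"
    proof (intro equalityI subsetI)
      fix \<kappa> assume k: "\<kappa> \<in> wall_facets T (up_cone f \<tau>)"
      have "\<kappa> \<notin> graph_cone f ` facets X"
        using wall_facetsD(3)[OF k] up_not_graph[of \<tau>] \<tau>(2) by blast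
      then obtain \<delta> where \<delta>: "\<delta> \<in> poles" "\<kappa> = up_cone f \<delta>" using wall_facetsD(1)[OF k] unfolding facets_T by blast
      then have "\<tau> \<subseteq> \<delta>" using wall_facetsD(3)[OF k] up_subset by simp
      then show "\<kappa> \<in> up_cone f ` wall_facets D \<tau>" using \<delta> unfolding wall_facets_def facets_D by blast
    next
      fix \<kappa> assume "\<kappa> \<in> up_cone f ` wall_facets D \<tau>"
      then obtain \<delta> where "\<delta> \<in> poles" "\<tau> \<subseteq> \<delta>" "\<kappa> = up_cone f \<delta>" unfolding wall_facets_def facets_D by blast
      then show "\<kappa> \<in> wall_facets T (up_cone f \<tau>)" unfolding wall_facets_def facets_T using up_subset by simp
    qed
    have ray0: "(0 :: 'a \<times> real) \<in> ray" by (simp add: zero_prod_def)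
    have ray_fst: "fst r = 0" if "r \<in> ray" for r using that by auto
    have "up_cone f \<tau> \<in> walls T"
    proof -
      obtain F where F: "F \<in> facets D" "\<tau> \<subseteq> F" using facet_above[OF D \<tau>D] by blast
      then have Fp: "F \<in> poles" using facets_D by simp
      note Fc = polesD(2)[OF Fp]
      have "codim1 \<tau> F" using wall_iff_codim1[OF D F(1) \<tau>D F(2)] \<tau>(1) by blast
      then have "codim1 (up_cone f \<tau>) (up_cone f F)"
        using codim1_sum[where \<iota> = "lift F" and p = fst and \<sigma> = F and \<tau> = \<tau> and R = ray, OF up_sum[OF Fc order_refl] up_sum[OF Fc F(2)] linear_lift[OF Fc] linear_fst _ ray_fst F(2)
            zero_mem[OF div_cone[OF \<tau>d]] ray0] by simp
      moreover have "up_cone f F \<in> facets T" unfolding facets_T using Fp by blast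
      ultimately show ?thesis
        using wall_iff_codim1[OF T _ up_mem_T[OF \<tau>d]] up_subset F(2) by blast
    qed
    moreover have aup: "(a, s) \<in> up_cone f \<tau>" unfolding mem_up using \<tau>(2) s by simp
    ultimately have bal\<tau>: "balanced_at T g (up_cone f \<tau>)" using bal by blast
    have \<kappa>S: "\<kappa> \<in> S" if "\<kappa> \<in> wall_facets T (up_cone f \<tau>)" for \<kappa>
      using wall_facetsD(2,3)[OF that] aup unfolding S_def by blast
    obtain n where n: "\<And>\<sigma>. \<sigma> \<in> wall_facets D \<tau> \<Longrightarrow> is_normal_vec (tf_lattice D) \<sigma> \<tau> (n \<sigma>)"
      using wall_normals[OF D \<tau>(1)] by blast
    let ?L = "\<lambda>z. k \<tau> (fst z) + c * snd z"
    show ?thesis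
    proof (rule balanced_at_pullback[OF D \<tau>(1) T, of g "up_cone f \<tau>" "up_cone f" 1 n "\<lambda>\<sigma>. lift \<sigma> (n \<sigma>)"
          "\<lambda>_. (0, 1)" l ?L k h "k \<tau>"])
      show "balanced_at T g (up_cone f \<tau>)" by (rule bal\<tau>)
      show "inj_on (up_cone f) (wall_facets D \<tau>)" using inj_up inj_on_subset by blast
      show "tf_orient T (up_cone f \<sigma>) = 1 * tf_orient D \<sigma>" if "\<sigma> \<in> wall_facets D \<tau>" for \<sigma>
        using orient_up[OF W(1)[OF that]] D_orient by simp
      show "is_normal_vec (tf_lattice T) (up_cone f \<sigma>) (up_cone f \<tau>) (lift \<sigma> (n \<sigma>))"
        if \<sigma>: "\<sigma> \<in> wall_facets D \<tau>" for \<sigma>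
      proof -
        note s = div_cone[OF W(1)[OF \<sigma>]] wall_facetsD(3)[OF \<sigma>]
        show ?thesis
          by (rule is_normal_vec_sum[where \<iota> = "lift \<sigma>" and p = fst and \<sigma> = \<sigma> and \<tau> = \<tau> and R = ray,
                OF up_sum[OF s(1) order_refl] up_sum[OF s] linear_lift[OF s(1)] linear_fst fst_conv ray_fst s(2)
                  zero_mem[OF div_cone[OF \<tau>d]] ray0 n[OF \<sigma>, unfolded D_lattice] tropical_fan_lattice[OF T] fst_lattice
                  lift_lattice[OF s(1)]])
      qed
      show "linear ?L" by (rule linear_affine_coord[OF k_lin[OF \<tau>d \<tau>(2)]])
      show "g z = ?L z" if z: "z \<in> up_cone f \<tau>" for z
      proof -
        have "g z = l (up_cone f \<tau>) (fst z, snd z)" using l(3)[OF Su[OF \<tau>d \<tau>(2)] z] by simp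
        then show ?thesis unfolding k_def using split[OF \<tau>d \<tau>(2), of "fst z" "snd z"] by simp
      qed
      show "l (up_cone f \<sigma>) (lift \<sigma> (n \<sigma>)) - ?L (lift \<sigma> (n \<sigma>)) = k \<sigma> (n \<sigma>) - k \<tau> (n \<sigma>)"
        if "\<sigma> \<in> wall_facets D \<tau>" for \<sigma> unfolding k_def using split[OF W(1,2)[OF that], of "n \<sigma>" "form \<sigma> (n \<sigma>)"] by simp
      show "linear (k \<sigma>)" if "\<sigma> \<in> wall_facets D \<tau>" for \<sigma> by (rule k_lin[OF W(1,2)[OF that]])
      show "h x = k \<sigma> x" if "\<sigma> \<in> wall_facets D \<tau>" "x \<in> \<sigma>" for \<sigma> x by (rule hk[OF W(1,2)[OF that(1)] that(2)])
      show "linear (k \<tau>)" by (rule k_lin[OF \<tau>d \<tau>(2)])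
      show "h x = k \<tau> x" if "x \<in> \<tau>" for x by (rule hk[OF \<tau>d \<tau>(2) that])
      show "linear (l \<rho>)" if "\<rho> \<in> wall_facets T (up_cone f \<tau>)" for \<rho> by (rule l(1)[OF \<kappa>S[OF that]])
      show "g z = l \<rho> z" if "\<rho> \<in> wall_facets T (up_cone f \<tau>)" "z \<in> \<rho>" for \<rho> z by (rule l(3)[OF \<kappa>S[OF that(1)] that(2)])
      show "is_normal_vec (tf_lattice D) \<sigma> \<tau> (n \<sigma>)" if "\<sigma> \<in> wall_facets D \<tau>" for \<sigma> by (rule n[OF that])
    qed (use WT in simp_all)
  qed
  ultimately obtain m where m: "linear m" "\<forall>\<delta>\<in>tf_cones D. a \<in> \<delta> \<longrightarrow> (\<forall>x\<in>\<delta>. h x = m x)"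
    using near unfolding div_faithful_near_def by blast
  let ?m = "\<lambda>z. m (fst z) + c * snd z"
  have "g z = ?m z" if \<kappa>: "\<kappa> \<in> tf_cones T" "(a, s) \<in> \<kappa>" "z \<in> \<kappa>" for \<kappa> z
    using \<kappa>(1)
  proof (cases rule: T_coneE)
    case (1 \<sigma>)
    then show ?thesis using \<kappa>(2) mem_graph s by simp
  next
    case (2 \<delta>)
    then have \<delta>: "a \<in> \<delta>" using \<kappa>(2) mem_up by blast
    obtain x t where x: "z = (x, t)" "x \<in> \<delta>" using \<kappa>(3) unfolding 2(2) up_cone_def by blast
    have "g z = l (up_cone f \<delta>) (x, t)" using l(3)[OF Su[OF 2(1) \<delta>]] \<kappa>(3) unfolding 2(2) x(1) by blast
    also have "\<dots> = k \<delta> x + c * t" unfolding k_def by (rule split[OF 2(1) \<delta>])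
    also have "k \<delta> x = m x" using hk[OF 2(1) \<delta> x(2)] m(2) 2(1) \<delta> x(2) D_cones by simp
    finally show ?thesis unfolding x(1) by simp
  qed
  then show "\<exists>m. linear m \<and> (\<forall>\<kappa>\<in>tf_cones T. (a, s) \<in> \<kappa> \<longrightarrow> (\<forall>z\<in>\<kappa>. g z = m z))"
    by (intro exI[of _ ?m] conjI linear_affine_coord[OF m(1)] ballI impI)
qed

lemma div_faithful_modification:
  assumes df: "div_faithful X" and D: "div_trivial X f \<or> (tropical_fan D \<and> div_faithful D)"
  shows "div_faithful T"
  unfolding div_faithful_iff_near[OF T]
proof
  fix p assume "p \<in> support T"
  then obtain \<kappa> where \<kappa>: "\<kappa> \<in> tf_cones T" "p \<in> \<kappa>" unfolding support_def by blast
  obtain a s where p: "p = (a, s)" by (cases p)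
  have graph: "div_faithful_near T (a, f a)" if "\<sigma> \<in> tf_cones X" "a \<in> \<sigma>" for \<sigma>
  proof -
    have "a \<in> support X" unfolding support_def using that by blast
    then show ?thesis using near_graph df unfolding div_faithful_iff_near[OF X] by blast
  qed
  from \<kappa>(1) show "div_faithful_near T p"
  proof (cases rule: T_coneE)
    case (1 \<sigma>)
    then show ?thesis using \<kappa>(2) graph[OF 1(1)] unfolding p by (simp add: mem_graph)
  next
    case (2 \<delta>)
    then have a: "a \<in> \<delta>" "f a \<le> s" using \<kappa>(2) unfolding p by (simp_all add: mem_up)
    show ?thesis
    proof (cases "s = f a")
      case True
      then show ?thesis using graph[OF div_cone[OF 2(1)] a(1)] unfolding p by simp
    next
      case False
      have "\<not> div_trivial X f"
        using 2(1) unfolding div_trivial_def div_cones_def by blast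
      then have D: "tropical_fan D" "div_faithful D" using D by blast+
      have "a \<in> support D" unfolding support_def D_cones using 2(1) a(1) by blast
      then show ?thesis
        using near_up[OF D(1)] D(2) False a(2) unfolding div_faithful_iff_near[OF D(1)] p by simp
    qed
  qed
qed

end

section \<open>Subdivisions\<close>

lemma rational_cone_halfspaces:
  fixes \<sigma> :: "'a::real_vector set"
  assumes "rational_cone N \<sigma>"
  shows "\<exists>H. finite H \<and> (\<forall>h\<in>H. linear (h :: 'a \<Rightarrow> real)) \<and>
    (\<forall>x. x \<in> \<sigma> \<longleftrightarrow> x \<in> span \<sigma> \<and> (\<forall>h\<in>H. 0 \<le> h x))"
proof -
  obtain F where F: "finite F" "\<sigma> = convex_cone hull F" "span \<sigma> = span F"
    using rational_coneE[OF assms] by metis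
  obtain H where H: "finite H" "\<forall>h\<in>H. linear (h :: 'a \<Rightarrow> real)" "convex_cone hull F = {x \<in> span F. \<forall>h\<in>H. 0 \<le> h x}"
    using convex_cone_hull_halfspaces[OF F(1)] by (elim exE conjE)
  have "x \<in> \<sigma> \<longleftrightarrow> x \<in> span \<sigma> \<and> (\<forall>h\<in>H. 0 \<le> h x)" for x unfolding F(3) unfolding F(2) H(3) by simp
  then show ?thesis using H(1,2) by (intro exI[of _ H] conjI allI)
qed

text \<open>Closedness of a cone along one line, obtained from half-spaces instead of a norm. If
  \<open>p\<close> is in the span, a form negative at \<open>p\<close> stays negative for a while;
  otherwise the ray from \<open>p\<close> meets the span at most once.\<close>

lemma rational_cone_avoid:
  fixes p x :: "'a::real_vector"
  assumes "rational_cone N \<sigma>" "p \<notin> \<sigma>"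
  shows "\<exists>e>0. \<forall>s. 0 < s \<and> s \<le> e \<longrightarrow> p + s *\<^sub>R x \<notin> \<sigma>"
proof (cases "p \<in> span \<sigma>")
  case True
  obtain H where lin: "\<forall>h\<in>H. linear (h :: 'a \<Rightarrow> real)"
    and mem: "\<forall>y. y \<in> \<sigma> \<longleftrightarrow> y \<in> span \<sigma> \<and> (\<forall>h\<in>H. 0 \<le> h y)"
    using rational_cone_halfspaces[OF assms(1)] by (elim exE conjE)
  have "\<exists>h\<in>H. h p < 0" using assms(2) True mem[rule_format, of p] by (auto simp: not_le)
  then obtain h where h: "h \<in> H" "h p < 0" by blast
  \<comment> \<open>Chosen so that \<open>s * \<bar>h x\<bar> < - h p\<close> for
    \<open>0 < s \<le> e\<close>; the added \<open>1\<close> allows \<open>h x = 0\<close>.\<close>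
  define e where "e = - h p / (\<bar>h x\<bar> + 1)"
  have "e > 0" unfolding e_def using h(2) by (intro divide_pos_pos) auto
  moreover have "p + s *\<^sub>R x \<notin> \<sigma>" if s: "0 < s" "s \<le> e" for s
  proof
    assume "p + s *\<^sub>R x \<in> \<sigma>"
    then have "0 \<le> h (p + s *\<^sub>R x)" using mem[rule_format, of "p + s *\<^sub>R x"] h(1) by simp
    then have "0 \<le> h p + s * h x" using bspec[OF lin h(1)] by (simp add: linear_add linear_scale)
    also have "s * h x \<le> s * \<bar>h x\<bar>" using s(1) by (intro mult_left_mono) auto
    also have "\<dots> < s * (\<bar>h x\<bar> + 1)" using s(1) by simp
    also have "\<dots> \<le> e * (\<bar>h x\<bar> + 1)" using s(2) by (intro mult_right_mono) auto
    also have "\<dots> = - h p" unfolding e_def by (simp add: add_nonneg_pos less_imp_neq[symmetric])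
    finally show False by simp
  qed
  ultimately show ?thesis by blast
next
  case False
  have uniq: "s = t" if "p + s *\<^sub>R x \<in> span \<sigma>" "p + t *\<^sub>R x \<in> span \<sigma>" for s t
  proof (rule ccontr)
    assume "s \<noteq> t"
    have "(p + s *\<^sub>R x) - (p + t *\<^sub>R x) \<in> span \<sigma>" using that by (rule span_diff)
    then have "(s - t) *\<^sub>R x \<in> span \<sigma>" by (simp add: algebra_simps)
    then have "(1 / (s - t)) *\<^sub>R ((s - t) *\<^sub>R x) \<in> span \<sigma>" by (rule span_scale)
    then have "x \<in> span \<sigma>" using \<open>s \<noteq> t\<close> by simp
    then have "(p + s *\<^sub>R x) - s *\<^sub>R x \<in> span \<sigma>" using that(1) by (intro span_diff span_scale)
    then show False using False by simp
  qed
  show ?thesis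
  proof (cases "\<exists>s>0. p + s *\<^sub>R x \<in> span \<sigma>")
    case True
    then obtain s where s: "s > 0" "p + s *\<^sub>R x \<in> span \<sigma>" by blast
    have "p + t *\<^sub>R x \<notin> \<sigma>" if "0 < t" "t \<le> s / 2" for t
    proof
      assume "p + t *\<^sub>R x \<in> \<sigma>"
      then have "p + t *\<^sub>R x \<in> span \<sigma>" by (rule span_base)
      then have "t = s" using s(2) by (rule uniq)
      then show False using that s(1) by simp
    qed
    then show ?thesis using s(1) by (intro exI[of _ "s / 2"]) simp
  next
    case False
    then have "\<forall>s. 0 < s \<and> s \<le> 1 \<longrightarrow> p + s *\<^sub>R x \<notin> \<sigma>" using span_base by blast
    then show ?thesis by (intro exI[of _ 1]) simp
  qed
qed

text \<open>Every cone missing \<open>p\<close> leaves a gap on the ray from \<open>p\<close>, and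
  finitely many gaps have a positive minimum. The bound \<open>e \<le> 1\<close> keeps the parameter
  in range for covers of the unit segment.\<close>

lemma rational_cones_local:
  fixes p x :: "'a::real_vector"
  assumes "finite C" "\<And>\<sigma>. \<sigma> \<in> C \<Longrightarrow> rational_cone N \<sigma>"
  obtains e where "0 < e" "e \<le> 1" "\<And>s \<sigma>. \<lbrakk>\<sigma> \<in> C; 0 < s; s \<le> e; p + s *\<^sub>R x \<in> \<sigma>\<rbrakk> \<Longrightarrow> p \<in> \<sigma>"
proof -
  have "\<exists>e>0. \<forall>\<sigma>\<in>C. \<forall>s. 0 < s \<and> s \<le> e \<longrightarrow> p + s *\<^sub>R x \<in> \<sigma> \<longrightarrow> p \<in> \<sigma>"
    using assms
  proof (induction C rule: finite_induct)
    case empty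
    then show ?case by (intro exI[of _ 1]) simp
  next
    case (insert \<sigma> C)
    then obtain e where e: "e > 0" "\<forall>\<sigma>\<in>C. \<forall>s. 0 < s \<and> s \<le> e \<longrightarrow> p + s *\<^sub>R x \<in> \<sigma> \<longrightarrow> p \<in> \<sigma>"
      by blast
    obtain e' where e': "e' > 0" "\<forall>s. 0 < s \<and> s \<le> e' \<longrightarrow> p + s *\<^sub>R x \<in> \<sigma> \<longrightarrow> p \<in> \<sigma>"
    proof (cases "p \<in> \<sigma>")
      case True
      then show ?thesis using that[of 1] by simp
    next
      case False
      have "rational_cone N \<sigma>" by (rule insert.prems) simp
      then show ?thesis using rational_cone_avoid[OF _ False] that by blast
    qed
    show ?case using e e' by (intro exI[of _ "min e e'"]) auto
  qed
  then obtain e where "e > 0" "\<forall>\<sigma>\<in>C. \<forall>s. 0 < s \<and> s \<le> e \<longrightarrow> p + s *\<^sub>R x \<in> \<sigma> \<longrightarrow> p \<in> \<sigma>" by blast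
  then show ?thesis by (intro that[of "min e 1"]) auto
qed

lemma convex_cone_segment:
  assumes "convex_cone C" "p \<in> C" "p + e *\<^sub>R x \<in> C" "0 \<le> s" "s \<le> e"
  shows "p + s *\<^sub>R x \<in> C"
proof (cases "e = 0")
  case True
  then have "s = 0" using assms(4,5) by simp
  then show ?thesis using assms(2) by simp
next
  case False
  then have e: "e > 0" using assms(4,5) by simp
  have "(1 - s / e) *\<^sub>R p + (s / e) *\<^sub>R (p + e *\<^sub>R x) \<in> C"
    using e assms(4,5)
    by (intro convex_cone_add[OF assms(1)] convex_cone_scaleR[OF assms(1) _ assms(2)] convex_cone_scaleR[OF assms(1) _ assms(3)]) auto
  moreover have "(1 - s / e) *\<^sub>R p + (s / e) *\<^sub>R (p + e *\<^sub>R x) = p + s *\<^sub>R x"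
    using e by (simp add: algebra_simps)
  ultimately show ?thesis by simp
qed

text \<open>A cone covering the point at a small parameter \<open>e\<close> must contain
  \<open>p\<close> itself, and convexity then gives the segment between.\<close>

lemma rational_cones_initial_segment:
  fixes p x :: "'a::real_vector"
  assumes C: "finite C" "\<And>\<sigma>. \<sigma> \<in> C \<Longrightarrow> rational_cone N \<sigma>"
    and cover: "\<And>s. 0 < s \<Longrightarrow> s \<le> 1 \<Longrightarrow> \<exists>\<sigma>\<in>C. p + s *\<^sub>R x \<in> \<sigma>"
  obtains \<sigma> e where "\<sigma> \<in> C" "0 < e" "p \<in> \<sigma>" "\<And>s. 0 \<le> s \<Longrightarrow> s \<le> e \<Longrightarrow> p + s *\<^sub>R x \<in> \<sigma>"
proof -
  obtain e where e: "0 < e" "e \<le> 1" "\<And>s \<sigma>. \<lbrakk>\<sigma> \<in> C; 0 < s; s \<le> e; p + s *\<^sub>R x \<in> \<sigma>\<rbrakk> \<Longrightarrow> p \<in> \<sigma>"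
    using rational_cones_local[OF C] by blast
  obtain \<sigma> where \<sigma>: "\<sigma> \<in> C" "p + e *\<^sub>R x \<in> \<sigma>" using cover e by blast
  have p: "p \<in> \<sigma>" using e(3)[OF \<sigma>(1) e(1) order_refl \<sigma>(2)] .
  show ?thesis
    using that[OF \<sigma>(1) e(1) p] convex_cone_segment[OF rational_cone_convex[OF C(2)[OF \<sigma>(1)]] p \<sigma>(2)] by blast
qed

text \<open>Connectedness of the unit interval, through the supremum of the parameters up to which
  \<open>\<phi>\<close> vanishes: an affine function vanishing just below that point vanishes also
  beyond it.\<close>

lemma locally_affine_zero:
  fixes \<phi> :: "real \<Rightarrow> real"
  assumes loc: "\<And>t. 0 \<le> t \<Longrightarrow> t \<le> 1 \<Longrightarrow> \<exists>e>0. \<exists>\<alpha> \<beta>. \<forall>s. 0 \<le> s \<and> s \<le> 1 \<and> \<bar>s - t\<bar> \<le> e \<longrightarrow> \<phi> s = \<alpha> + \<beta> * s"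
    and start: "0 < e0" "\<And>s. 0 \<le> s \<Longrightarrow> s \<le> e0 \<Longrightarrow> s \<le> 1 \<Longrightarrow> \<phi> s = 0"
  shows "\<phi> 1 = 0"
proof -
  define A where "A = {t. 0 \<le> t \<and> t \<le> 1 \<and> (\<forall>s. 0 \<le> s \<and> s \<le> t \<longrightarrow> \<phi> s = 0)}"
  have m: "min e0 1 \<in> A" unfolding A_def using start by simp
  have bdd: "bdd_above A" unfolding A_def by (rule bdd_aboveI[of _ 1]) simp
  define T where "T = Sup A"
  have T: "0 < T" "T \<le> 1"
  proof -
    have "min e0 1 \<le> T" unfolding T_def by (rule cSup_upper[OF m bdd])
    then show "0 < T" using start(1) by simp
    have "A \<noteq> {}" using m by blast
    then show "T \<le> 1" unfolding T_def by (rule cSup_least) (simp add: A_def)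
  qed
  have below: "\<phi> s = 0" if s: "0 \<le> s" "s < T" for s
  proof -
    obtain t where "t \<in> A" "s < t" using s(2) less_cSup_iff[OF _ bdd, of s] m unfolding T_def by blast
    then show ?thesis unfolding A_def using s(1) by simp
  qed
  obtain e \<alpha> \<beta> where e: "e > 0" "\<And>s. 0 \<le> s \<Longrightarrow> s \<le> 1 \<Longrightarrow> \<bar>s - T\<bar> \<le> e \<Longrightarrow> \<phi> s = \<alpha> + \<beta> * s"
    using loc[of T] T by auto
  define d where "d = min e (T / 2)"
  have d: "0 < d" "d \<le> e" "d \<le> T / 2" unfolding d_def using e(1) T(1) by auto
  \<comment> \<open>Two distinct parameters below \<open>T\<close> within range of the affine
    formula force \<open>\<alpha>\<close> and \<open>\<beta>\<close> to vanish.\<close>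
  have z: "\<alpha> + \<beta> * (T - d) = 0" "\<alpha> + \<beta> * (T - d / 2) = 0"
    using e(2)[of "T - d"] e(2)[of "T - d / 2"] below[of "T - d"] below[of "T - d / 2"] d T by auto
  have "\<beta> * (d / 2) = (\<alpha> + \<beta> * (T - d / 2)) - (\<alpha> + \<beta> * (T - d))" by (simp add: algebra_simps)
  then have "\<beta> = 0" using z d(1) by simp
  then have "\<alpha> = 0" using z by simp
  have near: "\<phi> s = 0" if "0 \<le> s" "s \<le> 1" "\<bar>s - T\<bar> \<le> e" for s
    using e(2)[OF that] \<open>\<alpha> = 0\<close> \<open>\<beta> = 0\<close> by simp
  have "min (T + e) 1 \<in> A"
    unfolding A_def
  proof (intro CollectI conjI allI impI)
    fix s assume s: "0 \<le> s \<and> s \<le> min (T + e) 1"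
    show "\<phi> s = 0"
    proof (cases "s < T")
      case True
      then show ?thesis using below s by blast
    next
      case False
      then show ?thesis using near[of s] s by auto
    qed
  qed (use T e(1) in auto)
  then have "min (T + e) 1 \<le> T" unfolding T_def by (rule cSup_upper[OF _ bdd])
  then have "T = 1" using e(1) T by auto
  then show ?thesis using near[of 1] e(1) by simp
qed

text \<open>Adding suitable elements of the wall to \<open>x'\<close> and to the multiple of
  \<open>x\<close> makes them equal, so the two facets share a point \<open>z\<close> outside
  \<open>span \<kappa>\<close>. Their intersection then spans \<open>G\<close>, and a face with full
  span is the whole cone.\<close>

lemma same_side_facets_eq:
  assumes X: "tropical_fan X" and \<kappa>: "\<kappa> \<in> walls X" and G: "G \<in> wall_facets X \<kappa>" "G' \<in> wall_facets X \<kappa>"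
    and x: "x \<in> G" "x \<notin> span \<kappa>" "x' \<in> G'" "x' - a *\<^sub>R x \<in> span \<kappa>" "0 < a"
  shows "G = G'"
proof -
  note c = wall_facetsD(2)[OF G(1)] wall_facetsD(2)[OF G(2)]
  have \<kappa>c: "convex_cone \<kappa>" using tropical_fan_convex[OF X walls_subset[OF \<kappa>]] .
  obtain k k' where k: "k \<in> \<kappa>" "k' \<in> \<kappa>" "x' - a *\<^sub>R x = k - k'" using span_convex_cone[OF \<kappa>c x(4)] by blast
  define z where "z = a *\<^sub>R x + k"
  have z': "z = x' + k'" unfolding z_def using k(3) by (simp add: algebra_simps)
  have "z \<in> G" unfolding z_def
    using convex_cone_add[OF tropical_fan_convex[OF X c(1)] convex_cone_scaleR[OF tropical_fan_convex[OF X c(1)] _ x(1)]]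
      x(5) k(1) wall_facetsD(3)[OF G(1)] by auto
  moreover have "z \<in> G'" unfolding z'
    using convex_cone_add[OF tropical_fan_convex[OF X c(2)] x(3)] k(2) wall_facetsD(3)[OF G(2)] by blast
  ultimately have z: "z \<in> G \<inter> G'" by blast
  have "z \<notin> span \<kappa>"
  proof
    assume "z \<in> span \<kappa>"
    then have "z - k \<in> span \<kappa>" using span_base[OF k(1)] by (rule span_diff)
    then have "(1 / a) *\<^sub>R (z - k) \<in> span \<kappa>" by (rule span_scale)
    then show False using x(2,5) unfolding z_def by simp
  qed
  then have "span G = span (insert z \<kappa>)"
    using codim1_span[OF wall_codim1(1)[OF X \<kappa> G(1)]] z span_base by blast
  also have "\<dots> \<subseteq> span (G \<inter> G')"
    using z wall_facetsD(3)[OF G(1)] wall_facetsD(3)[OF G(2)] by (intro span_mono) blast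
  finally have "G \<subseteq> span (G \<inter> G')" using span_superset by blast
  then have "G \<inter> G' = G"
    using cone_face_eq_if_span[OF tropical_fan_convex[OF X c(1)] tropical_fan_Int[OF X c]] by blast
  then show ?thesis using facets_maximal[OF wall_facetsD(1)[OF G(1)] c(2)] by blast
qed

section \<open>Subdivisions of a fan\<close>

locale fan_subdivision =
  fixes X X' :: "'a::real_vector tfan"
  assumes X: "tropical_fan X" and X': "tropical_fan X'" and lattice: "tf_lattice X' = tf_lattice X"
    and finer: "\<And>\<kappa>. \<kappa> \<in> tf_cones X' \<Longrightarrow> \<exists>\<sigma>\<in>tf_cones X. \<kappa> \<subseteq> \<sigma>"
    and cover: "\<And>\<sigma> x. \<sigma> \<in> tf_cones X \<Longrightarrow> x \<in> \<sigma> \<Longrightarrow> \<exists>\<kappa>\<in>tf_cones X'. x \<in> \<kappa> \<and> \<kappa> \<subseteq> \<sigma>"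
begin

abbreviation "N \<equiv> tf_lattice X"

lemma initial_segment:
  assumes "\<sigma> \<in> tf_cones X" "\<And>s. 0 < s \<Longrightarrow> s \<le> 1 \<Longrightarrow> p + s *\<^sub>R x \<in> \<sigma>"
  obtains \<kappa> e where "\<kappa> \<in> tf_cones X'" "\<kappa> \<subseteq> \<sigma>" "0 < e" "p \<in> \<kappa>" "\<And>s. 0 \<le> s \<Longrightarrow> s \<le> e \<Longrightarrow> p + s *\<^sub>R x \<in> \<kappa>"
proof -
  let ?C = "{\<kappa> \<in> tf_cones X'. \<kappa> \<subseteq> \<sigma>}"
  have fin: "finite ?C" using tropical_fan_finite[OF X'] by simp
  have rc: "rational_cone N \<kappa>" if "\<kappa> \<in> ?C" for \<kappa>
    using tropical_fan_cone[OF X'] that lattice by auto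
  have cov: "\<exists>\<kappa>\<in>?C. p + s *\<^sub>R x \<in> \<kappa>" if "0 < s" "s \<le> 1" for s
    using cover[OF assms(1) assms(2)[OF that]] by blast
  show ?thesis
    by (rule rational_cones_initial_segment[OF fin rc cov]) (use that in blast)+
qed

text \<open>From \<open>p\<close> the segment in a generic direction \<open>x\<close> of
  \<open>\<sigma>\<close> starts inside one fine cone, whose span then contains \<open>x\<close>;
  genericity of \<open>x\<close> makes this span all of \<open>span \<sigma>\<close>.\<close>

lemma subcone:
  assumes \<sigma>: "\<sigma> \<in> tf_cones X" "p \<in> \<sigma>"
  obtains \<kappa> where "\<kappa> \<in> tf_cones X'" "\<kappa> \<subseteq> \<sigma>" "p \<in> \<kappa>" "span \<kappa> = span \<sigma>"
proof -
  define \<W> where "\<W> = span ` {\<kappa> \<in> tf_cones X'. \<not> \<sigma> \<subseteq> span \<kappa>}"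
  have "finite \<W>" using tropical_fan_finite[OF X'] unfolding \<W>_def by simp
  moreover have "subspace W" "\<not> \<sigma> \<subseteq> W" if "W \<in> \<W>" for W using that unfolding \<W>_def by auto
  ultimately obtain x where x: "x \<in> \<sigma>" "\<And>W. W \<in> \<W> \<Longrightarrow> x \<notin> W"
    using generic_point[OF tropical_fan_convex[OF X \<sigma>(1)], of \<W>] by metis
  note c = tropical_fan_convex[OF X \<sigma>(1)]
  have "p + s *\<^sub>R x \<in> \<sigma>" if "0 < s" "s \<le> 1" for s
    using that \<sigma>(2) x(1) by (intro convex_cone_add[OF c] convex_cone_scaleR[OF c]) auto
  then obtain \<kappa> e where \<kappa>: "\<kappa> \<in> tf_cones X'" "\<kappa> \<subseteq> \<sigma>" "0 < e" "p \<in> \<kappa>" "\<And>s. 0 \<le> s \<Longrightarrow> s \<le> e \<Longrightarrow> p + s *\<^sub>R x \<in> \<kappa>"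
    using initial_segment[OF \<sigma>(1)] by blast
  have "(p + e *\<^sub>R x) - p \<in> span \<kappa>" using \<kappa>(5)[of e] \<kappa>(3,4) by (intro span_diff span_base) auto
  then have "(1 / e) *\<^sub>R ((p + e *\<^sub>R x) - p) \<in> span \<kappa>" by (rule span_scale)
  then have "x \<in> span \<kappa>" using \<kappa>(3) by simp
  then have "\<sigma> \<subseteq> span \<kappa>" using x(2)[of "span \<kappa>"] \<kappa>(1) unfolding \<W>_def by blast
  then have "span \<kappa> = span \<sigma>" using \<kappa>(2) by (simp add: span_eq span_superset[THEN subsetD] subset_iff)
  then show ?thesis using that \<kappa> by blast
qed

lemma facet_around:
  assumes "\<kappa> \<in> tf_cones X'"
  obtains F where "F \<in> facets X" "\<kappa> \<subseteq> F"
proof -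
  obtain \<sigma> where "\<sigma> \<in> tf_cones X" "\<kappa> \<subseteq> \<sigma>" using finer[OF assms] by blast
  then show ?thesis using facet_above[OF X] that by (metis order_trans)
qed

lemma fan_dim_eq: "fan_dim X' = fan_dim X"
proof -
  obtain \<sigma> where "\<sigma> \<in> tf_cones X" using tropical_fan_nonempty[OF X] by blast
  then obtain F where F: "F \<in> facets X" using facet_above[OF X] by metis
  note Fc = facets_subset[OF F]
  obtain \<kappa> where \<kappa>: "\<kappa> \<in> tf_cones X'" "span \<kappa> = span F" using subcone[OF Fc tropical_fan_zero[OF X Fc]] by metis
  obtain F' where F': "F' \<in> facets X'" "\<kappa> \<subseteq> F'" using facet_above[OF X' \<kappa>(1)] by blast
  obtain G where G: "G \<in> facets X" "F' \<subseteq> G" using facet_around[OF facets_subset[OF F'(1)]] .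
  have "dim \<kappa> = dim F" using \<kappa>(2) by (rule span_eq_dim)
  moreover have "dim \<kappa> \<le> dim F'"
    using tropical_fan_dim_mono[OF X' facets_subset[OF F'(1)]] F'(2) span_superset by blast
  moreover have "dim F' \<le> dim G"
    using tropical_fan_dim_mono[OF X facets_subset[OF G(1)]] G(2) span_superset by blast
  ultimately show ?thesis using tropical_fan_dim[OF X F] tropical_fan_dim[OF X G(1)] tropical_fan_dim[OF X' F'(1)] by simp
qed

lemma subfacet_span:
  assumes "F \<in> facets X" "F' \<in> facets X'" "F' \<subseteq> F"
  shows "span F' = span F"
proof (rule tropical_fan_span_eq_if_dim[OF X facets_subset[OF assms(1)]])
  show "F' \<subseteq> span F" using assms(3) span_superset by (rule subset_trans)
  show "dim F \<le> dim F'" using tropical_fan_dim[OF X assms(1)] tropical_fan_dim[OF X' assms(2)] fan_dim_eq by simp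
qed

lemma subfacetI:
  assumes "F \<in> facets X" "\<kappa> \<in> tf_cones X'" "span \<kappa> = span F"
  shows "\<kappa> \<in> facets X'"
proof -
  have "dim \<kappa> = fan_dim X'"
    using span_eq_dim[OF assms(3)] tropical_fan_dim[OF X assms(1)] fan_dim_eq by simp
  then show ?thesis unfolding k_cones_fan_dim[OF X', symmetric] k_cones_def using assms(2) by simp
qed

text \<open>\<open>F'\<close> spans the same space as \<open>F\<close>, so the face
  \<open>F \<inter> G\<close> of \<open>F\<close> has full span and equals \<open>F\<close>;
  maximality of \<open>F\<close> then gives equality.\<close>

lemma facet_around_unique:
  assumes "F' \<in> facets X'" "F \<in> facets X" "G \<in> facets X" "F' \<subseteq> F" "F' \<subseteq> G"
  shows "F = G"
proof -
  note c = facets_subset[OF assms(2)] facets_subset[OF assms(3)]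
  have "span F \<subseteq> span (F \<inter> G)"
    unfolding subfacet_span[OF assms(2,1,4), symmetric] using assms(4,5) by (intro span_mono) blast
  then have "F \<inter> G = F"
    using cone_face_eq_if_span[OF tropical_fan_convex[OF X c(1)] tropical_fan_Int[OF X c]] span_superset by blast
  then show ?thesis using facets_maximal[OF assms(2) c(2)] by blast
qed

lemma subwall_span:
  assumes "\<tau> \<in> walls X" "\<kappa> \<in> walls X'" "\<kappa> \<subseteq> \<tau>"
  shows "span \<kappa> = span \<tau>"
proof (rule tropical_fan_span_eq_if_dim[OF X walls_subset[OF assms(1)]])
  show "\<kappa> \<subseteq> span \<tau>" using assms(3) span_superset by blast
  show "dim \<tau> \<le> dim \<kappa>" using assms(1,2) fan_dim_eq unfolding walls_def by simp
qed

definition around :: "'a set \<Rightarrow> 'a set" where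
  "around F' = (SOME F. F \<in> facets X \<and> F' \<subseteq> F)"

lemma around: "F' \<in> tf_cones X' \<Longrightarrow> around F' \<in> facets X" "F' \<in> tf_cones X' \<Longrightarrow> F' \<subseteq> around F'"
proof -
  assume "F' \<in> tf_cones X'"
  then have "\<exists>F. F \<in> facets X \<and> F' \<subseteq> F" using facet_around by metis
  from someI_ex[OF this] show "around F' \<in> facets X" "F' \<subseteq> around F'" unfolding around_def by blast+
qed

text \<open>Two fine facets at \<open>\<kappa>\<close> inside one coarse facet lie on the same side
  of the common span, since \<open>\<tau>\<close> is a face of that coarse facet; hence they are
  equal. Conversely each coarse facet at \<open>\<tau>\<close> contains a full-dimensional fine cone
  through a generic point of \<open>\<kappa>\<close>, and this cone contains
  \<open>\<kappa>\<close>.\<close>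

lemma around_wall:
  assumes "\<tau> \<in> walls X" "\<kappa> \<in> walls X'" "\<kappa> \<subseteq> \<tau>"
  shows "bij_betw around (wall_facets X' \<kappa>) (wall_facets X \<tau>)"
proof -
  note \<tau>c = walls_subset[OF assms(1)] and \<kappa>c = walls_subset[OF assms(2)]
  note sp = subwall_span[OF assms]
  have in_wall: "around G \<in> wall_facets X \<tau>" if G: "G \<in> wall_facets X' \<kappa>" for G
  proof -
    note a = around[OF wall_facetsD(2)[OF G]]
    have "\<kappa> \<subseteq> \<tau> \<inter> around G" using assms(3) wall_facetsD(3)[OF G] a(2) by blast
    then have "span \<tau> \<subseteq> span (\<tau> \<inter> around G)" unfolding sp[symmetric] by (rule span_mono)
    then have "\<tau> \<inter> around G = \<tau>"
      using cone_face_eq_if_span[OF tropical_fan_convex[OF X \<tau>c] tropical_fan_Int[OF X \<tau>c facets_subset[OF a(1)]]]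
        span_superset by blast
    then show ?thesis using a(1) unfolding wall_facets_def by blast
  qed
  have inj: "G = G'" if G: "G \<in> wall_facets X' \<kappa>" "G' \<in> wall_facets X' \<kappa>" "around G = around G'" for G G'
  proof -
    define F where "F = around G"
    have F: "F \<in> wall_facets X \<tau>" "G \<subseteq> F" "G' \<subseteq> F"
      unfolding F_def using in_wall[OF G(1)] around(2)[OF wall_facetsD(2)[OF G(1)]] around(2)[OF wall_facetsD(2)[OF G(2)]] G(3) by auto
    have cdG: "codim1 \<kappa> G" "codim1 \<kappa> G'" using wall_codim1(1)[OF X' assms(2)] G(1,2) by blast+
    obtain x where x: "x \<in> G" "x \<notin> span \<kappa>" using cdG(1) unfolding codim1_def by blast
    obtain x' where x': "x' \<in> G'" "x' \<notin> span \<kappa>" using cdG(2) unfolding codim1_def by blast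
    have spans: "span G = span F"
      using subfacet_span[OF wall_facetsD(1)[OF F(1)] wall_facetsD(1)[OF G(1)] F(2)] .
    have "x' \<in> span G" unfolding spans using x'(1) F(3) span_base by blast
    then obtain a where a: "x' - a *\<^sub>R x \<in> span \<kappa>" using codim1_decomp[OF cdG(1) span_base[OF x(1)] x(2)] by blast
    have "0 \<le> a"
      using cone_face_same_side[OF tropical_fan_convex[OF X wall_facetsD(2)[OF F(1)]]
          tropical_fan_subset_face[OF X wall_facetsD(2)[OF F(1)] \<tau>c wall_facetsD(3)[OF F(1)]], of x x' a]
        x x' a F(2,3) sp by blast
    moreover have "a \<noteq> 0" using a x'(2) by auto
    ultimately show ?thesis using same_side_facets_eq[OF X' assms(2) G(1,2) x x'(1) a] by simp
  qed
  have surj: "\<exists>G\<in>wall_facets X' \<kappa>. F = around G" if F: "F \<in> wall_facets X \<tau>" for F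
  proof -
    obtain q where q: "q \<in> \<kappa>" "\<And>\<zeta>. \<zeta> \<in> tf_cones X' \<Longrightarrow> q \<in> \<zeta> \<longleftrightarrow> \<kappa> \<subseteq> \<zeta>"
      using fan_generic_point[OF X' \<kappa>c] by blast
    have "q \<in> F" using q(1) assms(3) wall_facetsD(3)[OF F] by blast
    then obtain G where G: "G \<in> tf_cones X'" "G \<subseteq> F" "q \<in> G" "span G = span F"
      using subcone[OF wall_facetsD(2)[OF F]] by blast
    have Gf: "G \<in> facets X'" using subfacetI[OF wall_facetsD(1)[OF F] G(1,4)] .
    have "\<kappa> \<subseteq> G" using q(2)[OF G(1)] G(3) by blast
    moreover have "around G = F"
      using facet_around_unique[OF Gf around(1)[OF G(1)] wall_facetsD(1)[OF F] around(2)[OF G(1)] G(2)] .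
    ultimately show ?thesis using Gf unfolding wall_facets_def by blast
  qed
  show ?thesis
    unfolding bij_betw_def inj_on_def using in_wall inj surj by blast
qed

lemma subwall_normal:
  assumes \<tau>: "\<tau> \<in> walls X" "\<kappa> \<in> walls X'" "\<kappa> \<subseteq> \<tau>" and G: "G \<in> wall_facets X' \<kappa>"
    and n: "is_normal_vec (tf_lattice X') G \<kappa> n"
  shows "is_normal_vec N (around G) \<tau> n"
proof -
  note a = around[OF wall_facetsD(2)[OF G]]
  have sp: "span \<kappa> = span \<tau>" "span G = span (around G)"
    using subwall_span[OF \<tau>] subfacet_span[OF a(1) wall_facetsD(1)[OF G] a(2)] by blast+
  show ?thesis using n a(2) unfolding is_normal_vec_def lattice sp by blast
qed

lemma subwall_ex:
  assumes "\<tau> \<in> walls X" "p \<in> \<tau>"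
  obtains \<kappa> where "\<kappa> \<in> walls X'" "\<kappa> \<subseteq> \<tau>" "p \<in> \<kappa>"
proof -
  obtain \<kappa> where \<kappa>: "\<kappa> \<in> tf_cones X'" "\<kappa> \<subseteq> \<tau>" "p \<in> \<kappa>" "span \<kappa> = span \<tau>"
    using subcone[OF walls_subset[OF assms(1)] assms(2)] .
  have "dim \<kappa> = dim \<tau>" using \<kappa>(4) by (rule span_eq_dim)
  then have "\<kappa> \<in> walls X'" using \<kappa>(1) assms(1) fan_dim_eq unfolding walls_def by simp
  then show ?thesis using that \<kappa> by blast
qed

lemma support_eq: "support X' = support X"
  unfolding support_def using finer cover by blast

end

section \<open>The local condition under subdivision\<close>

locale weighted_subdivision = fan_subdivision +
  assumes orient: "\<And>F F'. F \<in> facets X \<Longrightarrow> F' \<in> facets X' \<Longrightarrow> F' \<subseteq> F \<Longrightarrow> tf_orient X' F' = tf_orient X F"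
begin

lemma orient_around: "F' \<in> facets X' \<Longrightarrow> tf_orient X' F' = tf_orient X (around F')"
  by (rule orient[OF around(1) _ around(2)]) (simp_all add: facets_subset)

text \<open>A fine wall either has all its facets inside one coarse facet, where the function is a
  single form and balancing is automatic, or lies in a coarse wall of the same dimension, whose
  balancing is the same equation by \<open>around_wall\<close>.\<close>

lemma near_coarse:
  assumes near: "div_faithful_near X' p"
  shows "div_faithful_near X p"
  unfolding div_faithful_near_def
proof (intro allI impI)
  fix g assume g: "\<forall>\<sigma>\<in>tf_cones X. p \<in> \<sigma> \<longrightarrow> integral_linear_on N \<sigma> g"
    and bal: "\<forall>\<tau>\<in>walls X. p \<in> \<tau> \<longrightarrow> balanced_at X g \<tau>"
  define S where "S = {\<sigma> \<in> tf_cones X. p \<in> \<sigma>}"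
  have gS: "integral_linear_on N \<sigma> g" if "\<sigma> \<in> S" for \<sigma> using g that unfolding S_def by blast
  obtain l where l: "\<And>\<sigma>. \<sigma> \<in> S \<Longrightarrow> linear (l \<sigma>)" "\<And>\<sigma>. \<sigma> \<in> S \<Longrightarrow> l \<sigma> ` (N \<inter> span \<sigma>) \<subseteq> \<int>"
    "\<And>\<sigma> x. \<sigma> \<in> S \<Longrightarrow> x \<in> \<sigma> \<Longrightarrow> g x = l \<sigma> x"
    using integral_linear_forms[OF gS] by metis
  have a: "around \<kappa> \<in> facets X" "\<kappa> \<subseteq> around \<kappa>" "around \<kappa> \<in> S" if "\<kappa> \<in> tf_cones X'" "p \<in> \<kappa>" for \<kappa>
    using around[OF that(1)] facets_subset that(2) unfolding S_def by auto
  have "integral_linear_on (tf_lattice X') \<kappa> g" if \<kappa>: "\<kappa> \<in> tf_cones X'" "p \<in> \<kappa>" for \<kappa>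
    unfolding integral_linear_on_def lattice
  proof (intro exI conjI ballI)
    note a = a[OF \<kappa>]
    show "linear (l (around \<kappa>))" by (rule l(1)[OF a(3)])
    have "span \<kappa> \<subseteq> span (around \<kappa>)" using a(2) by (rule span_mono)
    then show "l (around \<kappa>) ` (N \<inter> span \<kappa>) \<subseteq> \<int>" using l(2)[OF a(3)] by blast
    show "g x = l (around \<kappa>) x" if "x \<in> \<kappa>" for x using l(3)[OF a(3)] a(2) that by blast
  qed
  moreover have "balanced_at X' g \<kappa>" if \<kappa>: "\<kappa> \<in> walls X'" "p \<in> \<kappa>" for \<kappa>
  proof -
    note \<kappa>c = walls_subset[OF \<kappa>(1)]
    obtain n where n: "\<And>G. G \<in> wall_facets X' \<kappa> \<Longrightarrow> is_normal_vec (tf_lattice X') G \<kappa> (n G)"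
      using wall_normals[OF X' \<kappa>(1)] by blast
    have W: "G \<in> tf_cones X'" "p \<in> G" if "G \<in> wall_facets X' \<kappa>" for G using wall_facetsD(2,3)[OF that] \<kappa>(2) by auto
    show ?thesis
    proof (cases "\<exists>F\<in>facets X. \<forall>G\<in>wall_facets X' \<kappa>. G \<subseteq> F")
      case True
      then obtain F where F: "F \<in> facets X" "\<And>G. G \<in> wall_facets X' \<kappa> \<Longrightarrow> G \<subseteq> F" by blast
      obtain G0 where "G0 \<in> facets X'" "\<kappa> \<subseteq> G0" using facet_above[OF X' \<kappa>c] .
      then have G0: "G0 \<in> wall_facets X' \<kappa>" unfolding wall_facets_def by blast
      have \<kappa>F: "\<kappa> \<subseteq> F" using wall_facetsD(3)[OF G0] F(2)[OF G0] by blast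
      then have FS: "F \<in> S" unfolding S_def using facets_subset[OF F(1)] \<kappa>(2) by blast
      show ?thesis
      proof (rule balanced_atI[OF X' \<kappa>(1), where n = n and l = "\<lambda>_. l F" and L = "l F"])
        show "g x = l F x" if "G \<in> wall_facets X' \<kappa>" "x \<in> G" for G x using l(3)[OF FS] F(2) that by blast
        show "g x = l F x" if "x \<in> \<kappa>" for x using l(3)[OF FS] \<kappa>F that by blast
      qed (use n l(1)[OF FS] in simp_all)
    next
      case False
      obtain G1 where "G1 \<in> facets X'" "\<kappa> \<subseteq> G1" using facet_above[OF X' \<kappa>c] .
      then have G1: "G1 \<in> wall_facets X' \<kappa>" unfolding wall_facets_def by blast
      note a1 = a[OF W[OF G1]]
      obtain G2 where G2: "G2 \<in> wall_facets X' \<kappa>" "\<not> G2 \<subseteq> around G1" using False a1(1) by blast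
      note a2 = a[OF W[OF G2(1)]]
      \<comment> \<open>A proper face of a coarse facet that still contains the fine wall
        \<open>\<kappa>\<close> can only have codimension one.\<close>
      define \<tau> where "\<tau> = around G1 \<inter> around G2"
      have \<tau>c: "\<tau> \<in> tf_cones X"
        unfolding \<tau>_def using tropical_fan_Int_cone[OF X facets_subset[OF a1(1)] facets_subset[OF a2(1)]] .
      have \<kappa>\<tau>: "\<kappa> \<subseteq> \<tau>" unfolding \<tau>_def using wall_facetsD(3)[OF G1] wall_facetsD(3)[OF G2(1)] a1(2) a2(2) by blast
      have "\<tau> \<noteq> around G1"
      proof
        assume "\<tau> = around G1"
        then have "around G2 = around G1"
          unfolding \<tau>_def using facets_maximal[OF a1(1) facets_subset[OF a2(1)]] by blast
        then show False using G2(2) a2(2) by simp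
      qed
      then have "\<not> dim (around G1) \<le> dim \<tau>"
        using tropical_fan_eq_if_dim[OF X facets_subset[OF a1(1)] \<tau>c] unfolding \<tau>_def by blast
      moreover have "dim \<kappa> \<le> dim \<tau>"
        using tropical_fan_dim_mono[OF X \<tau>c] \<kappa>\<tau> span_superset by blast
      ultimately have "dim \<tau> + 1 = fan_dim X"
        using tropical_fan_dim[OF X a1(1)] \<kappa>(1) fan_dim_eq unfolding walls_def by simp
      then have \<tau>: "\<tau> \<in> walls X" using \<tau>c unfolding walls_def by simp
      have \<tau>S: "\<tau> \<in> S" unfolding S_def using \<tau>c \<kappa>\<tau> \<kappa>(2) by blast
      have bij: "bij_betw around (wall_facets X' \<kappa>) (wall_facets X \<tau>)" by (rule around_wall[OF \<tau> \<kappa>(1) \<kappa>\<tau>])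
      have FS: "F \<in> S" if "F \<in> wall_facets X \<tau>" for F
        using wall_facetsD(2,3)[OF that] \<tau>S unfolding S_def by blast
      show ?thesis
      proof (rule balanced_at_pullback[OF X' \<kappa>(1) X, of g \<tau> around 1 n n "\<lambda>_. 0" l "l \<tau>" "\<lambda>G. l (around G)" g "l \<tau>"])
        show "balanced_at X g \<tau>" using bal \<tau> \<tau>S unfolding S_def by blast
        show "inj_on around (wall_facets X' \<kappa>)" using bij unfolding bij_betw_def by blast
        show "around ` wall_facets X' \<kappa> \<subseteq> wall_facets X \<tau>" using bij unfolding bij_betw_def by blast
        show "tf_orient X (around G) = 1 * tf_orient X' G" if "G \<in> wall_facets X' \<kappa>" for G
          using orient_around[OF wall_facetsD(1)[OF that]] by simp
        show "is_normal_vec (tf_lattice X') G \<kappa> (n G)" if "G \<in> wall_facets X' \<kappa>" for G by (rule n[OF that])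
        show "is_normal_vec N (around G) \<tau> (n G)" if "G \<in> wall_facets X' \<kappa>" for G
          by (rule subwall_normal[OF \<tau> \<kappa>(1) \<kappa>\<tau> that n[OF that]])
        show "is_normal_vec N \<rho> \<tau> 0 \<and> l \<rho> 0 = l \<tau> 0"
          if "\<rho> \<in> wall_facets X \<tau>" "\<rho> \<notin> around ` wall_facets X' \<kappa>" for \<rho>
          using that bij unfolding bij_betw_def by blast
        show "linear (l (around G))" if "G \<in> wall_facets X' \<kappa>" for G by (rule l(1)[OF a(3)[OF W[OF that]]])
        show "g x = l (around G) x" if "G \<in> wall_facets X' \<kappa>" "x \<in> G" for G x
          using l(3)[OF a(3)[OF W[OF that(1)]]] a(2)[OF W[OF that(1)]] that(2) by blast
        show "linear (l \<tau>)" "linear (l \<tau>)" by (rule l(1)[OF \<tau>S])+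
        show "g x = l \<tau> x" if "x \<in> \<kappa>" for x using l(3)[OF \<tau>S] \<kappa>\<tau> that by blast
        show "g x = l \<tau> x" if "x \<in> \<tau>" for x by (rule l(3)[OF \<tau>S that])
        show "linear (l F)" if "F \<in> wall_facets X \<tau>" for F by (rule l(1)[OF FS[OF that]])
        show "g x = l F x" if "F \<in> wall_facets X \<tau>" "x \<in> F" for F x by (rule l(3)[OF FS[OF that(1)] that(2)])
      qed simp_all
    qed
  qed
  ultimately obtain m where m: "linear m" "\<forall>\<kappa>\<in>tf_cones X'. p \<in> \<kappa> \<longrightarrow> (\<forall>x\<in>\<kappa>. g x = m x)"
    using near unfolding div_faithful_near_def by blast
  have "g x = m x" if \<sigma>: "\<sigma> \<in> tf_cones X" "p \<in> \<sigma>" "x \<in> \<sigma>" for \<sigma> x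
  proof -
    have \<sigma>S: "\<sigma> \<in> S" unfolding S_def using \<sigma> by blast
    \<comment> \<open>The form \<open>m\<close> is known on the fine cones through \<open>p\<close>
      only; one of them spans \<open>\<sigma>\<close>, and linearity carries the equality
      over.\<close>
    obtain \<kappa> where \<kappa>: "\<kappa> \<in> tf_cones X'" "\<kappa> \<subseteq> \<sigma>" "p \<in> \<kappa>" "span \<kappa> = span \<sigma>" using subcone[OF \<sigma>(1,2)] .
    have "l \<sigma> y = m y" if "y \<in> \<kappa>" for y using l(3)[OF \<sigma>S, of y] m(2) \<kappa> that by auto
    then have "l \<sigma> x = m x"
      using linear_eq_on_span[OF l(1)[OF \<sigma>S] m(1), of \<kappa> x] \<kappa>(4) span_base[OF \<sigma>(3)] by simp
    then show ?thesis using l(3)[OF \<sigma>S \<sigma>(3)] by simp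
  qed
  then show "\<exists>m. linear m \<and> (\<forall>\<sigma>\<in>tf_cones X. p \<in> \<sigma> \<longrightarrow> (\<forall>x\<in>\<sigma>. g x = m x))"
    using m(1) by (intro exI[of _ m] conjI ballI impI)
qed

text \<open>Distinct facets at the wall inside \<open>F\<close> lie on opposite sides of it, so
  there are at most two. Taking the form of \<open>G1\<close> as comparison form in the balancing
  leaves one term, and its nonzero weight forces the two forms to agree on a normal vector; on
  \<open>\<kappa>\<close> both equal \<open>f\<close>.\<close>

lemma forms_agree_across_wall:
  assumes \<kappa>: "\<kappa> \<in> walls X'" and F: "F \<in> facets X" "\<And>G. G \<in> wall_facets X' \<kappa> \<Longrightarrow> G \<subseteq> F"
    and bal: "balanced_at X' f \<kappa>"
    and l: "\<And>G. G \<in> wall_facets X' \<kappa> \<Longrightarrow> linear (l G)" "\<And>G x. G \<in> wall_facets X' \<kappa> \<Longrightarrow> x \<in> G \<Longrightarrow> f x = l G x"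
    and G: "G1 \<in> wall_facets X' \<kappa>" "G2 \<in> wall_facets X' \<kappa>" and x: "x \<in> span F"
  shows "l G1 x = l G2 x"
proof (cases "G1 = G2")
  case False
  let ?S = "wall_facets X' \<kappa>"
  have sp: "span G = span F" if "G \<in> ?S" for G
    using subfacet_span[OF F(1) wall_facetsD(1)[OF that] F(2)[OF that]] .
  obtain n where n: "\<And>G. G \<in> ?S \<Longrightarrow> is_normal_vec (tf_lattice X') G \<kappa> (n G)"
    using wall_normals[OF X' \<kappa>] by blast
  have n_notin: "n G \<notin> span \<kappa>" if "G \<in> ?S" for G by (rule wall_normal_notin[OF X' \<kappa> that n[OF that]])
  have n_span: "n G \<in> span G'" if "G \<in> ?S" "G' \<in> ?S" for G G'
    using n[OF that(1)] sp[OF that(1)] sp[OF that(2)] unfolding is_normal_vec_def by blast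
  have dec: "\<exists>a. a \<noteq> 0 \<and> n G' - a *\<^sub>R n G \<in> span \<kappa> \<and> (0 < a \<longrightarrow> G = G')" if GG: "G \<in> ?S" "G' \<in> ?S" for G G'
  proof -
    obtain a where a: "n G' - a *\<^sub>R n G \<in> span \<kappa>"
      using codim1_decomp[OF wall_codim1(1)[OF X' \<kappa> GG(1)] n_span[OF GG(1,1)] n_notin[OF GG(1)] n_span[OF GG(2,1)]] .
    obtain y z where y: "y \<in> G" "z \<in> span \<kappa>" "n G = y + z" using n[OF GG(1)] unfolding is_normal_vec_def by blast
    obtain y' z' where y': "y' \<in> G'" "z' \<in> span \<kappa>" "n G' = y' + z'" using n[OF GG(2)] unfolding is_normal_vec_def by blast
    have "y \<notin> span \<kappa>" using n_notin[OF GG(1)] span_add[OF _ y(2)] y(3) by metis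
    moreover have "y' - a *\<^sub>R y \<in> span \<kappa>"
    proof -
      have "(n G' - a *\<^sub>R n G) - z' + a *\<^sub>R z \<in> span \<kappa>"
        by (rule span_add[OF span_diff[OF a y'(2)] span_scale[OF y(2)]])
      moreover have "(n G' - a *\<^sub>R n G) - z' + a *\<^sub>R z = y' - a *\<^sub>R y" unfolding y(3) y'(3) by (simp add: algebra_simps)
      ultimately show ?thesis by simp
    qed
    ultimately have "0 < a \<Longrightarrow> G = G'" using same_side_facets_eq[OF X' \<kappa> GG y(1) _ y'(1)] by blast
    moreover have "a \<noteq> 0" using a n_notin[OF GG(2)] by auto
    ultimately show ?thesis using a by blast
  qed
  obtain a where a: "a < 0" "n G2 - a *\<^sub>R n G1 \<in> span \<kappa>" using dec[OF G] False by (metis less_linear)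
  \<comment> \<open>A third facet would be opposite to both, although \<open>G1\<close> and
    \<open>G2\<close> are opposite to each other: the coefficients \<open>b\<close> and
    \<open>c * a\<close> have opposite signs yet must coincide.\<close>
  have two: "G = G1 \<or> G = G2" if GS: "G \<in> ?S" for G
  proof (rule ccontr)
    assume ne: "\<not> (G = G1 \<or> G = G2)"
    obtain b where b: "b < 0" "n G - b *\<^sub>R n G1 \<in> span \<kappa>" using dec[OF G(1) GS] ne by (metis less_linear)
    obtain c where c: "c < 0" "n G - c *\<^sub>R n G2 \<in> span \<kappa>" using dec[OF G(2) GS] ne by (metis less_linear)
    have "(n G - c *\<^sub>R n G2) + c *\<^sub>R (n G2 - a *\<^sub>R n G1) - (n G - b *\<^sub>R n G1) \<in> span \<kappa>"
      by (rule span_diff[OF span_add[OF c(2) span_scale[OF a(2)]] b(2)])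
    moreover have "(n G - c *\<^sub>R n G2) + c *\<^sub>R (n G2 - a *\<^sub>R n G1) - (n G - b *\<^sub>R n G1) = (b - c * a) *\<^sub>R n G1"
      by (simp add: algebra_simps)
    ultimately have "(b - c * a) *\<^sub>R n G1 \<in> span \<kappa>" by simp
    then have "(1 / (b - c * a)) *\<^sub>R ((b - c * a) *\<^sub>R n G1) \<in> span \<kappa>" by (rule span_scale)
    moreover have "b - c * a < 0" using a(1) b(1) c(1) by (simp add: mult_neg_neg add_neg_neg less_trans)
    ultimately show False using n_notin[OF G(1)] by simp
  qed
  then have S: "?S = {G1, G2}" using G by blast
  have \<kappa>G: "\<kappa> \<subseteq> G1" "\<kappa> \<subseteq> G2" using wall_facetsD(3) G by blast+
  have "(\<Sum>G\<in>?S. of_int (tf_orient X' G) * (l G (n G) - l G1 (n G))) = 0"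
    by (rule balanced_atD[OF bal n l l(1)[OF G(1)]]) (use l(2)[OF G(1)] \<kappa>G in blast)+
  then have "of_int (tf_orient X' G2) * (l G2 (n G2) - l G1 (n G2)) = 0" unfolding S using False by simp
  then have eq: "l G1 (n G2) = l G2 (n G2)" using tropical_fan_orient[OF X' wall_facetsD(1)[OF G(2)]] by simp
  have "l G1 y = l G2 y" if "y \<in> insert (n G2) \<kappa>" for y
  proof (cases "y = n G2")
    case False
    then have "y \<in> G1" "y \<in> G2" using that \<kappa>G by blast+
    then show ?thesis using l(2)[OF G(1)] l(2)[OF G(2)] by metis
  qed (simp add: eq)
  moreover have "x \<in> span (insert (n G2) \<kappa>)"
    using codim1_span[OF wall_codim1(1)[OF X' \<kappa> G(2)] n_span[OF G(2,2)] n_notin[OF G(2)]] x sp[OF G(2)] by simp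
  ultimately show ?thesis using linear_eq_on_span[OF l(1)[OF G(1)] l(1)[OF G(2)]] by blast
qed simp

text \<open>
  Two points of the facet \<open>F\<close>, one of them generic, are joined by a segment which meets the
  subdivision of \<open>F\<close> in cones of codimension at most one, and the forms agree across these.
\<close>

lemma tangent_linear:
  assumes S_def: "S = {\<kappa> \<in> tf_cones X'. p \<in> \<kappa>}"
    and l: "\<And>\<kappa>. \<kappa> \<in> S \<Longrightarrow> linear (l \<kappa>)" "\<And>\<kappa> x. \<kappa> \<in> S \<Longrightarrow> x \<in> \<kappa> \<Longrightarrow> f x = l \<kappa> x"
    and bal: "\<And>\<kappa>. \<kappa> \<in> walls X' \<Longrightarrow> p \<in> \<kappa> \<Longrightarrow> balanced_at X' f \<kappa>"
    and F: "F \<in> facets X" "p \<in> F" and F': "F' \<in> facets X'" "F' \<subseteq> F" "p \<in> F'"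
    and y: "y \<in> F" and \<kappa>: "\<kappa> \<in> S" "0 < e" "p + e *\<^sub>R y \<in> \<kappa>"
  shows "l \<kappa> y = l F' y"
proof -
  note Fc = facets_subset[OF F(1)] and F'c = facets_subset[OF F'(1)]
  note Fcone = tropical_fan_convex[OF X Fc] and F'cone = tropical_fan_convex[OF X' F'c]
  have value_eq: "l \<kappa> x = l \<kappa>' x" if "\<kappa> \<in> S" "\<kappa>' \<in> S" "0 < e" "p + e *\<^sub>R x \<in> \<kappa>" "0 < e'" "p + e' *\<^sub>R x \<in> \<kappa>'" for \<kappa> \<kappa>' x e e'
  proof -
    define d where "d = min e e'"
    have d: "0 < d" "d \<le> e" "d \<le> e'" unfolding d_def using that(3,5) by auto
    have \<kappa>: "\<kappa> \<in> tf_cones X'" "p \<in> \<kappa>" "\<kappa>' \<in> tf_cones X'" "p \<in> \<kappa>'" using that(1,2) unfolding S_def by auto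
    have "p + d *\<^sub>R x \<in> \<kappa>" "p + d *\<^sub>R x \<in> \<kappa>'"
      using convex_cone_segment[OF tropical_fan_convex[OF X' \<kappa>(1)] \<kappa>(2) that(4)]
        convex_cone_segment[OF tropical_fan_convex[OF X' \<kappa>(3)] \<kappa>(4) that(6)] d by simp_all
    then have "l \<kappa> (p + d *\<^sub>R x) = l \<kappa>' (p + d *\<^sub>R x)" "l \<kappa> p = l \<kappa>' p"
      using l(2)[OF that(1)] l(2)[OF that(2)] \<kappa>(2,4) by metis+
    then have "d * l \<kappa> x = d * l \<kappa>' x"
      using l(1)[OF that(1)] l(1)[OF that(2)] by (simp add: linear_add linear_scale)
    then show ?thesis using d(1) by simp
  qed
  \<comment> \<open>The directional derivative of \<open>f\<close> at \<open>p\<close>: it is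
    computed by any fine cone through \<open>p\<close> that contains a short step from
    \<open>p\<close> in direction \<open>x\<close>, and \<open>value_eq\<close> makes the choice
    irrelevant.\<close>
  define ft where "ft = (\<lambda>x. l (SOME \<kappa>. \<kappa> \<in> S \<and> (\<exists>e>0. p + e *\<^sub>R x \<in> \<kappa>)) x)"
  have ft: "ft x = l \<kappa> x" if "\<kappa> \<in> S" "0 < e" "p + e *\<^sub>R x \<in> \<kappa>" for \<kappa> x e
  proof -
    define \<kappa>' where "\<kappa>' = (SOME \<kappa>. \<kappa> \<in> S \<and> (\<exists>e>0. p + e *\<^sub>R x \<in> \<kappa>))"
    have "\<kappa>' \<in> S \<and> (\<exists>e>0. p + e *\<^sub>R x \<in> \<kappa>')" unfolding \<kappa>'_def by (rule someI[of _ \<kappa>]) (use that in blast)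
    then obtain e' where "\<kappa>' \<in> S" "0 < e'" "p + e' *\<^sub>R x \<in> \<kappa>'" by blast
    then show ?thesis unfolding ft_def \<kappa>'_def[symmetric] using value_eq[of \<kappa>' \<kappa> e' x e] that by blast
  qed
  have F'S: "F' \<in> S" unfolding S_def using F'c F'(3) by blast
  \<comment> \<open>The first family keeps the segment from \<open>q\<close> to \<open>y\<close>, as
    seen from \<open>p\<close>, off fine cones of codimension two or more before it reaches
    \<open>y\<close>; the second keeps it off the proper faces of \<open>F\<close>, so that no other
    coarse facet is met.\<close>
  define \<W> where "\<W> = (\<lambda>\<mu>. span (insert y \<mu>)) ` {\<mu> \<in> tf_cones X'. dim \<mu> + 1 < fan_dim X}
    \<union> span ` {\<phi> \<in> tf_cones X. \<phi> \<subseteq> F \<and> \<phi> \<noteq> F}"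
  have spF: "span F' = span F" by (rule subfacet_span[OF F(1) F'(1,2)])
  have dimF': "dim F' = fan_dim X" using tropical_fan_dim[OF X' F'(1)] fan_dim_eq by simp
  have proper: "\<not> F' \<subseteq> W" if "W \<in> \<W>" for W
  proof
    assume sub: "F' \<subseteq> W"
    from that consider \<mu> where "\<mu> \<in> tf_cones X'" "dim \<mu> + 1 < fan_dim X" "W = span (insert y \<mu>)"
      | \<phi> where "\<phi> \<in> tf_cones X" "\<phi> \<subseteq> F" "\<phi> \<noteq> F" "W = span \<phi>"
      unfolding \<W>_def by blast
    then show False
    proof cases
      case (1 \<mu>)
      obtain E where E: "finite E" "\<mu> \<subseteq> span E" using tropical_fan_finite_span[OF X' 1(1)] .
      obtain B where B: "finite B" "span B = span \<mu>" "card B = dim \<mu>" using finite_basis_of[OF E] by metis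
      have "insert y \<mu> \<subseteq> span (insert y B)"
        using B(2) span_superset[of \<mu>] span_mono[of B "insert y B"] span_base[of y "insert y B"] by auto
      then have "span (insert y \<mu>) \<subseteq> span (insert y B)" by (simp add: span_minimal)
      then have "dim F' \<le> card (insert y B)" using sub B(1) unfolding 1(3) by (intro dim_le_card) auto
      also have "\<dots> \<le> dim \<mu> + 1" using B(1,3) by (simp add: card_insert_if)
      finally show False using 1(2) dimF' by simp
    next
      case (2 \<phi>)
      have "span F' \<subseteq> span \<phi>" using sub unfolding 2(4) by (simp add: span_minimal)
      then have "F \<subseteq> span \<phi>" unfolding spF using span_superset by blast
      then show False using tropical_fan_eq_if_span[OF X Fc 2(1,2)] 2(3) by blast
    qed
  qed
  have "finite \<W>" unfolding \<W>_def using tropical_fan_finite[OF X] tropical_fan_finite[OF X'] by simp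
  moreover have "subspace W" if "W \<in> \<W>" for W using that unfolding \<W>_def by auto
  ultimately obtain q where q: "q \<in> F'" "\<And>W. W \<in> \<W> \<Longrightarrow> q \<notin> W"
    using generic_point[OF F'cone, of \<W>] proper by metis
  have qF: "q \<in> F" using q(1) F'(2) by blast
  define \<gamma> where "\<gamma> = (\<lambda>s. q + s *\<^sub>R (y - q))"
  have \<gamma>_conv: "\<gamma> s = (1 - s) *\<^sub>R q + s *\<^sub>R y" for s unfolding \<gamma>_def by (simp add: algebra_simps)
  have \<gamma>F: "\<gamma> s \<in> F" if "0 \<le> s" "s \<le> 1" for s
    unfolding \<gamma>_conv using that qF y by (intro convex_cone_add[OF Fcone] convex_cone_scaleR[OF Fcone]) auto
  have \<gamma>_diff: "\<gamma> (s + r * (t - s)) = \<gamma> s + r *\<^sub>R (\<gamma> t - \<gamma> s)" for r s t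
    unfolding \<gamma>_def by (simp add: algebra_simps)
  \<comment> \<open>near \<open>\<gamma> s\<close>, in the direction of \<open>\<gamma> t\<close>, the tangent function is given by a single cone\<close>
  have one_sided: "\<exists>\<kappa> d. \<kappa> \<in> S \<and> z \<in> \<kappa> \<and> 0 < d \<and> (\<forall>r. 0 \<le> r \<and> r \<le> d \<longrightarrow> p + e *\<^sub>R \<gamma> (s + r * (t - s)) \<in> \<kappa>)"
    if s: "0 \<le> s" "s \<le> 1" and t: "0 \<le> t" "t \<le> 1" and e: "0 < e" and z: "z = p + e *\<^sub>R \<gamma> s"
      and loc: "\<And>\<kappa>. \<kappa> \<in> tf_cones X' \<Longrightarrow> z \<in> \<kappa> \<Longrightarrow> p \<in> \<kappa>" for s t e z
  proof -
    have eq: "z + r *\<^sub>R (e *\<^sub>R (\<gamma> t - \<gamma> s)) = p + e *\<^sub>R \<gamma> (s + r * (t - s))" for r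
      unfolding z \<gamma>_diff by (simp add: algebra_simps)
    have "z + r *\<^sub>R (e *\<^sub>R (\<gamma> t - \<gamma> s)) \<in> F" if "0 < r" "r \<le> 1" for r
    proof -
      have "s + r * (t - s) = (1 - r) * s + r * t" by (simp add: algebra_simps)
      moreover have "0 \<le> (1 - r) * s + r * t" using that s t by (intro add_nonneg_nonneg mult_nonneg_nonneg) auto
      moreover have "(1 - r) * s + r * t \<le> (1 - r) * 1 + r * 1" using that s t by (intro add_mono mult_left_mono) auto
      ultimately have "\<gamma> (s + r * (t - s)) \<in> F" using \<gamma>F by simp
      then show ?thesis unfolding eq using e F(2) by (intro convex_cone_add[OF Fcone] convex_cone_scaleR[OF Fcone]) auto
    qed
    then obtain \<kappa> d where \<kappa>: "\<kappa> \<in> tf_cones X'" "0 < d" "z \<in> \<kappa>"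
      "\<And>r. 0 \<le> r \<Longrightarrow> r \<le> d \<Longrightarrow> z + r *\<^sub>R (e *\<^sub>R (\<gamma> t - \<gamma> s)) \<in> \<kappa>"
      using initial_segment[OF Fc] by metis
    then show ?thesis using loc unfolding eq S_def by blast
  qed
  \<comment> \<open>A step so short that every fine cone containing its end passes through
    \<open>p\<close>, where \<open>f\<close> is controlled.\<close>
  have small: "\<exists>e>0. \<forall>\<kappa>\<in>tf_cones X'. p + e *\<^sub>R x \<in> \<kappa> \<longrightarrow> p \<in> \<kappa>" for x
    using rational_cones_local[OF tropical_fan_finite[OF X'] tropical_fan_cone[OF X'], of p x] by (metis order_refl)
  \<comment> \<open>At a parameter \<open>s < 1\<close> all fine facets at \<open>z\<close> lie in
    \<open>F\<close> and the smallest cone there, \<open>\<mu>\<close>, is a facet or a wall. The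
    forms of all facets at \<open>z\<close> therefore agree, so any of them computes
    \<open>ft\<close> near \<open>s\<close>.\<close>
  have crossing: "ft x = l G x" if s: "0 \<le> s" "s < 1" and e: "0 < e" and z: "z = p + e *\<^sub>R \<gamma> s"
      and loc: "\<And>\<kappa>. \<kappa> \<in> tf_cones X' \<Longrightarrow> z \<in> \<kappa> \<Longrightarrow> p \<in> \<kappa>"
      and G: "G \<in> facets X'" "z \<in> G" and \<kappa>: "\<kappa> \<in> S" "z \<in> \<kappa>" "p + e *\<^sub>R x \<in> \<kappa>" and x: "x \<in> F"
    for s e z G \<kappa> x
  proof -
    have zF: "z \<in> F" unfolding z using e F(2) \<gamma>F[of s] s by (intro convex_cone_add[OF Fcone] convex_cone_scaleR[OF Fcone]) auto
    then have "z \<in> support X'" unfolding support_eq unfolding support_def using Fc by blast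
    then obtain \<mu> where \<mu>: "\<mu> \<in> tf_cones X'" "\<And>\<zeta>. \<zeta> \<in> tf_cones X' \<Longrightarrow> z \<in> \<zeta> \<longleftrightarrow> \<mu> \<subseteq> \<zeta>"
      using fan_minimal_cone[OF X'] by blast
    have z\<mu>: "z \<in> \<mu>" using \<mu> by blast
    have p\<mu>: "p \<in> \<mu>" using loc[OF \<mu>(1) z\<mu>] .
    have only: "H = F" if H: "H \<in> facets X" "\<mu> \<subseteq> H" for H
    proof -
      note Hc = facets_subset[OF H(1)]
      have face: "cone_face (F \<inter> H) F" by (rule tropical_fan_Int[OF X Fc Hc])
      have parts: "(e * (1 - s)) *\<^sub>R q \<in> F" "p + (e * s) *\<^sub>R y \<in> F"
        using e s qF y F(2) by (intro convex_cone_add[OF Fcone] convex_cone_scaleR[OF Fcone]; simp)+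
      have "(e * (1 - s)) *\<^sub>R q + (p + (e * s) *\<^sub>R y) = z" unfolding z \<gamma>_conv by (simp add: algebra_simps)
      then have "(e * (1 - s)) *\<^sub>R q \<in> F \<inter> H" using cone_faceD[OF Fcone face parts] zF z\<mu> H(2) by auto
      then have "(1 / (e * (1 - s))) *\<^sub>R ((e * (1 - s)) *\<^sub>R q) \<in> span (F \<inter> H)" by (intro span_scale span_base)
      then have "q \<in> span (F \<inter> H)" using e s by simp
      then have "F \<inter> H = F"
        using q(2)[of "span (F \<inter> H)"] tropical_fan_Int_cone[OF X Fc Hc] unfolding \<W>_def by blast
      then show ?thesis using facets_maximal[OF F(1) Hc] by blast
    qed
    have inF: "G' \<subseteq> F" if "G' \<in> facets X'" "z \<in> G'" for G'
    proof -
      note G'c = facets_subset[OF that(1)]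
      have "\<mu> \<subseteq> G'" using \<mu>(2)[OF G'c] that(2) by blast
      then have "around G' = F" using only around[OF G'c] by blast
      then show ?thesis using around(2)[OF G'c] by simp
    qed
    have "\<not> dim \<mu> + 1 < fan_dim X"
    proof
      assume d: "dim \<mu> + 1 < fan_dim X"
      then have W: "q \<notin> span (insert y \<mu>)" using q(2) \<mu>(1) unfolding \<W>_def by blast
      have "z - p - (e * s) *\<^sub>R y \<in> span (insert y \<mu>)" using z\<mu> p\<mu> by (intro span_diff span_scale span_base) auto
      moreover have "z - p - (e * s) *\<^sub>R y = (e * (1 - s)) *\<^sub>R q" unfolding z \<gamma>_conv by (simp add: algebra_simps)
      ultimately have "(e * (1 - s)) *\<^sub>R q \<in> span (insert y \<mu>)" by simp
      then have "(1 / (e * (1 - s))) *\<^sub>R ((e * (1 - s)) *\<^sub>R q) \<in> span (insert y \<mu>)" by (rule span_scale)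
      then show False using W e s by simp
    qed
    then have codim: "\<mu> \<in> walls X' \<or> dim \<mu> \<ge> fan_dim X'" unfolding walls_def using \<mu>(1) fan_dim_eq by auto
    obtain K where K: "K \<in> facets X'" "\<kappa> \<subseteq> K" using facet_above[OF X'] \<kappa>(1) unfolding S_def by blast
    have zK: "z \<in> K" using K(2) \<kappa>(2) by blast
    have KS: "K \<in> S" "G \<in> S" unfolding S_def using facets_subset[OF K(1)] facets_subset[OF G(1)] loc zK G(2) by blast+
    have \<mu>KG: "\<mu> \<subseteq> K" "\<mu> \<subseteq> G" using \<mu>(2) facets_subset K(1) G(1) zK G(2) by blast+
    have "l K x = l G x"
    proof (cases "\<mu> \<in> walls X'")
      case True
      show ?thesis
      proof (rule forms_agree_across_wall[OF True F(1) _ bal[OF True p\<mu>]])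
        have m: "z \<in> H" "H \<in> S" if "H \<in> wall_facets X' \<mu>" for H
          using wall_facetsD(2,3)[OF that] z\<mu> p\<mu> unfolding S_def by blast+
        show "H \<subseteq> F" if "H \<in> wall_facets X' \<mu>" for H using inF[OF wall_facetsD(1)[OF that] m(1)[OF that]] .
        show "linear (l H)" if "H \<in> wall_facets X' \<mu>" for H using l(1)[OF m(2)[OF that]] .
        show "f w = l H w" if "H \<in> wall_facets X' \<mu>" "w \<in> H" for H w using l(2)[OF m(2)[OF that(1)] that(2)] .
        show "K \<in> wall_facets X' \<mu>" "G \<in> wall_facets X' \<mu>" unfolding wall_facets_def using K(1) G(1) \<mu>KG by blast+
        show "x \<in> span F" using x by (rule span_base)
      qed
    next
      case False
      then have d: "dim \<mu> \<ge> fan_dim X'" using codim by blast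
      have "\<mu> = K" "\<mu> = G"
        using tropical_fan_eq_if_dim[OF X' facets_subset[OF K(1)] \<mu>(1) \<mu>KG(1)]
          tropical_fan_eq_if_dim[OF X' facets_subset[OF G(1)] \<mu>(1) \<mu>KG(2)]
          tropical_fan_dim[OF X' K(1)] tropical_fan_dim[OF X' G(1)] d by simp_all
      then show ?thesis by simp
    qed
    moreover have "ft x = l K x" using ft[OF KS(1) e] K(2) \<kappa>(3) by blast
    ultimately show ?thesis by simp
  qed
  define \<phi> where "\<phi> = (\<lambda>s. ft (\<gamma> s) - l F' (\<gamma> s))"
  have affine: "\<exists>\<alpha> \<beta>. \<forall>s. l \<kappa> (\<gamma> s) - l F' (\<gamma> s) = \<alpha> + \<beta> * s" if "\<kappa> \<in> S" for \<kappa>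
  proof (intro exI allI)
    fix s show "l \<kappa> (\<gamma> s) - l F' (\<gamma> s) = (l \<kappa> q - l F' q) + (l \<kappa> (y - q) - l F' (y - q)) * s"
      unfolding \<gamma>_def linear_add[OF l(1)[OF that]] linear_add[OF l(1)[OF F'S]]
        linear_scale[OF l(1)[OF that]] linear_scale[OF l(1)[OF F'S]] real_scaleR_def
      by (simp add: algebra_simps)
  qed
  have reach: "\<exists>r. s' = s + r * (t - s) \<and> 0 \<le> r \<and> r \<le> d"
    if "s \<noteq> t" "(s \<le> s' \<and> s < t) \<or> (s' \<le> s \<and> t < s)" "\<bar>s' - s\<bar> \<le> d * \<bar>t - s\<bar>" for s t s' d :: real
  proof (intro exI conjI)
    show "s' = s + ((s' - s) / (t - s)) * (t - s)" using that(1) by simp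
    show "0 \<le> (s' - s) / (t - s)" using that(2) by (auto simp: zero_le_divide_iff)
    have "\<bar>(s' - s) / (t - s)\<bar> \<le> d" using that(1,3) unfolding abs_divide by (simp add: pos_divide_le_eq)
    then show "(s' - s) / (t - s) \<le> d" by (rule abs_le_D1)
  qed
  have two_sided: "\<exists>d>0. \<forall>s'. 0 \<le> s' \<and> s' \<le> 1 \<and> \<bar>s' - s\<bar> \<le> d \<longrightarrow> ft (\<gamma> s') = l G (\<gamma> s')"
    if s: "0 \<le> s" "s < 1" and e: "0 < e" and z: "z = p + e *\<^sub>R \<gamma> s"
      and loc: "\<And>\<kappa>. \<kappa> \<in> tf_cones X' \<Longrightarrow> z \<in> \<kappa> \<Longrightarrow> p \<in> \<kappa>" and G: "G \<in> facets X'" "z \<in> G" for s e z G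
  proof -
    have s1: "s \<le> 1" using s(2) by simp
    obtain \<kappa>1 d1 where 1: "\<kappa>1 \<in> S" "z \<in> \<kappa>1" "0 < d1" "\<forall>r. 0 \<le> r \<and> r \<le> d1 \<longrightarrow> p + e *\<^sub>R \<gamma> (s + r * (1 - s)) \<in> \<kappa>1"
      using one_sided[OF s(1) s1 _ _ e z loc, of 1] by auto
    obtain \<kappa>0 d0 where 0: "\<kappa>0 \<in> S" "z \<in> \<kappa>0" "0 < d0" "\<forall>r. 0 \<le> r \<and> r \<le> d0 \<longrightarrow> p + e *\<^sub>R \<gamma> (s + r * (0 - s)) \<in> \<kappa>0"
      using one_sided[OF s(1) s1 _ _ e z loc, of 0] by auto
    \<comment> \<open>The radii \<open>d1\<close> and \<open>d0\<close>, measured in steps towards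
      \<open>1\<close> and \<open>0\<close>, become distances in \<open>s\<close>; at
      \<open>s = 0\<close> there is nothing on the left, and \<open>1\<close> stands for no
      restriction.\<close>
    define d where "d = min (d1 * (1 - s)) (if s = 0 then 1 else d0 * s)"
    have "0 < d" unfolding d_def using 1(3) 0(3) s by auto
    moreover have "ft (\<gamma> s') = l G (\<gamma> s')" if s': "0 \<le> s'" "s' \<le> 1" "\<bar>s' - s\<bar> \<le> d" for s'
    proof (cases "s \<le> s'")
      case True
      have "\<bar>s' - s\<bar> \<le> d1 * \<bar>1 - s\<bar>" using s'(3) s(2) unfolding d_def by simp
      then obtain r where r: "s' = s + r * (1 - s)" "0 \<le> r" "r \<le> d1"
        using reach[of s 1 s' d1] True s(2) by auto
      then have "p + e *\<^sub>R \<gamma> s' \<in> \<kappa>1" using 1(4) by blast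
      then show ?thesis using crossing[OF s e z loc G 1(1,2) _ \<gamma>F[OF s'(1,2)]] by blast
    next
      case False
      then have s0: "0 < s" using s'(1) by simp
      then have "\<bar>s' - s\<bar> \<le> d0 * \<bar>0 - s\<bar>" using s'(3) unfolding d_def by simp
      then obtain r where r: "s' = s + r * (0 - s)" "0 \<le> r" "r \<le> d0"
        using reach[of s 0 s' d0] False s0 by auto
      then have "p + e *\<^sub>R \<gamma> s' \<in> \<kappa>0" using 0(4) by blast
      then show ?thesis using crossing[OF s e z loc G 0(1,2) _ \<gamma>F[OF s'(1,2)]] by blast
    qed
    ultimately show ?thesis by blast
  qed
  have "\<exists>d>0. \<forall>s'. 0 \<le> s' \<and> s' \<le> 1 \<and> \<bar>s' - 0\<bar> \<le> d \<longrightarrow> ft (\<gamma> s') = l F' (\<gamma> s')"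
  proof -
    obtain e where e: "0 < e" "\<forall>\<kappa>\<in>tf_cones X'. p + e *\<^sub>R \<gamma> 0 \<in> \<kappa> \<longrightarrow> p \<in> \<kappa>" using small by blast
    define z where z: "z = p + e *\<^sub>R \<gamma> 0"
    have loc: "\<And>\<kappa>. \<kappa> \<in> tf_cones X' \<Longrightarrow> z \<in> \<kappa> \<Longrightarrow> p \<in> \<kappa>" using e(2) unfolding z by blast
    have "z \<in> F'" unfolding z \<gamma>_def using e(1) F'(3) q(1)
      by (simp add: convex_cone_add[OF F'cone] convex_cone_scaleR[OF F'cone])
    then show ?thesis by (intro two_sided[OF _ _ e(1) z loc F'(1)]) simp_all
  qed
  then obtain d where d: "0 < d" "\<forall>s'. 0 \<le> s' \<and> s' \<le> 1 \<and> \<bar>s' - 0\<bar> \<le> d \<longrightarrow> ft (\<gamma> s') = l F' (\<gamma> s')" by blast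
  have "\<phi> 1 = 0"
  proof (rule locally_affine_zero[OF _ d(1)])
    fix t :: real assume t: "0 \<le> t" "t \<le> 1"
    obtain e where e: "0 < e" "\<forall>\<kappa>\<in>tf_cones X'. p + e *\<^sub>R \<gamma> t \<in> \<kappa> \<longrightarrow> p \<in> \<kappa>" using small by blast
    define z where z: "z = p + e *\<^sub>R \<gamma> t"
    have loc: "\<And>\<kappa>. \<kappa> \<in> tf_cones X' \<Longrightarrow> z \<in> \<kappa> \<Longrightarrow> p \<in> \<kappa>" using e(2) unfolding z by blast
    show "\<exists>d>0. \<exists>\<alpha> \<beta>. \<forall>s. 0 \<le> s \<and> s \<le> 1 \<and> \<bar>s - t\<bar> \<le> d \<longrightarrow> \<phi> s = \<alpha> + \<beta> * s"
    proof (cases "t = 1")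
      \<comment> \<open>The end point \<open>y\<close> may be special, but only parameters
        \<open>s \<le> 1\<close> matter there, and a single cone covers them near
        \<open>1\<close>.\<close>
      case True
      obtain \<kappa>0 d0 where 0: "\<kappa>0 \<in> S" "0 < d0" "\<forall>r. 0 \<le> r \<and> r \<le> d0 \<longrightarrow> p + e *\<^sub>R \<gamma> (t + r * (0 - t)) \<in> \<kappa>0"
        using one_sided[OF t _ _ e(1) z loc, of 0] by auto
      obtain \<alpha> \<beta> where ab: "\<forall>s. l \<kappa>0 (\<gamma> s) - l F' (\<gamma> s) = \<alpha> + \<beta> * s" using affine[OF 0(1)] by blast
      have "\<phi> s = \<alpha> + \<beta> * s" if s: "0 \<le> s" "s \<le> 1" "\<bar>s - t\<bar> \<le> d0" for s
      proof -
        have "\<bar>s - t\<bar> \<le> d0 * \<bar>0 - t\<bar>" using s(3) True by simp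
        then obtain r where r: "s = t + r * (0 - t)" "0 \<le> r" "r \<le> d0" using reach[of t 0 s d0] s True by auto
        then have "p + e *\<^sub>R \<gamma> s \<in> \<kappa>0" using 0(3) by blast
        then have "ft (\<gamma> s) = l \<kappa>0 (\<gamma> s)" by (rule ft[OF 0(1) e(1)])
        then show ?thesis unfolding \<phi>_def using ab by simp
      qed
      then show ?thesis using 0(2) by blast
    next
      case False
      then have t1: "t < 1" using t by simp
      have "z \<in> F" unfolding z using e(1) F(2) \<gamma>F[OF t] by (intro convex_cone_add[OF Fcone] convex_cone_scaleR[OF Fcone]) auto
      then obtain \<kappa> where \<kappa>: "\<kappa> \<in> tf_cones X'" "z \<in> \<kappa>" using cover[OF Fc] by blast
      obtain G where G: "G \<in> facets X'" "\<kappa> \<subseteq> G" using facet_above[OF X' \<kappa>(1)] .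
      have zG: "z \<in> G" using G(2) \<kappa>(2) by blast
      have GS: "G \<in> S" unfolding S_def using loc[OF facets_subset[OF G(1)] zG] facets_subset[OF G(1)] by blast
      obtain \<alpha> \<beta> where ab: "\<forall>s. l G (\<gamma> s) - l F' (\<gamma> s) = \<alpha> + \<beta> * s" using affine[OF GS] by blast
      obtain d where d: "d > 0" "\<forall>s'. 0 \<le> s' \<and> s' \<le> 1 \<and> \<bar>s' - t\<bar> \<le> d \<longrightarrow> ft (\<gamma> s') = l G (\<gamma> s')"
        using two_sided[OF t(1) t1 e(1) z loc G(1) zG] by blast
      then show ?thesis unfolding \<phi>_def using ab by (intro exI[of _ d] conjI exI[of _ \<alpha>] exI[of _ \<beta>]) simp_all
    qed
  next
    show "\<phi> s = 0" if "0 \<le> s" "s \<le> d" "s \<le> 1" for s unfolding \<phi>_def using d(2) that by simp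
  qed
  then have "ft y = l F' y" unfolding \<phi>_def \<gamma>_def by simp
  moreover have "ft y = l \<kappa> y" by (rule ft[OF \<kappa>])
  ultimately show ?thesis by simp
qed

lemma near_fine:
  assumes near: "div_faithful_near X p"
  shows "div_faithful_near X' p"
  unfolding div_faithful_near_def
proof (intro allI impI)
  fix f assume f: "\<forall>\<kappa>\<in>tf_cones X'. p \<in> \<kappa> \<longrightarrow> integral_linear_on (tf_lattice X') \<kappa> f"
    and bal: "\<forall>\<kappa>\<in>walls X'. p \<in> \<kappa> \<longrightarrow> balanced_at X' f \<kappa>"
  define S where "S = {\<kappa> \<in> tf_cones X'. p \<in> \<kappa>}"
  have fS: "integral_linear_on N \<kappa> f" if "\<kappa> \<in> S" for \<kappa> using f that unfolding S_def lattice by blast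
  obtain l where l: "\<And>\<kappa>. \<kappa> \<in> S \<Longrightarrow> linear (l \<kappa>)" "\<And>\<kappa>. \<kappa> \<in> S \<Longrightarrow> l \<kappa> ` (N \<inter> span \<kappa>) \<subseteq> \<int>"
    "\<And>\<kappa> x. \<kappa> \<in> S \<Longrightarrow> x \<in> \<kappa> \<Longrightarrow> f x = l \<kappa> x"
    using integral_linear_forms[OF fS] by metis
  \<comment> \<open>the derivative of \<open>f\<close> at \<open>p\<close>, which extends \<open>f\<close> to the cones of \<open>X\<close> around \<open>p\<close>\<close>
  define g where "g = (\<lambda>x. l (SOME \<kappa>. \<kappa> \<in> S \<and> (\<exists>e>0. p + e *\<^sub>R x \<in> \<kappa>)) x)"
  have g: "g y = l F' y" if F: "F \<in> facets X" "p \<in> F" and F': "F' \<in> facets X'" "F' \<subseteq> F" "p \<in> F'" and y: "y \<in> F"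
    for F F' y
  proof -
    note Fcone = tropical_fan_convex[OF X facets_subset[OF F(1)]]
    have "p + s *\<^sub>R y \<in> F" if "0 < s" "s \<le> 1" for s
      using that F(2) y by (intro convex_cone_add[OF Fcone] convex_cone_scaleR[OF Fcone]) auto
    then obtain \<kappa> e where "\<kappa> \<in> tf_cones X'" "0 < e" "p \<in> \<kappa>" "\<And>s. 0 \<le> s \<Longrightarrow> s \<le> e \<Longrightarrow> p + s *\<^sub>R y \<in> \<kappa>"
      using initial_segment[OF facets_subset[OF F(1)]] by metis
    then have ex: "\<kappa> \<in> S \<and> (\<exists>e>0. p + e *\<^sub>R y \<in> \<kappa>)"
      unfolding S_def by (metis (no_types, lifting) less_imp_le mem_Collect_eq order_refl)
    define \<kappa>' where "\<kappa>' = (SOME \<kappa>. \<kappa> \<in> S \<and> (\<exists>e>0. p + e *\<^sub>R y \<in> \<kappa>))"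
    have "\<kappa>' \<in> S \<and> (\<exists>e>0. p + e *\<^sub>R y \<in> \<kappa>')" unfolding \<kappa>'_def by (rule someI[of _ \<kappa>]) (rule ex)
    then obtain e' where "\<kappa>' \<in> S" "0 < e'" "p + e' *\<^sub>R y \<in> \<kappa>'" by blast
    then show ?thesis
      unfolding g_def \<kappa>'_def[symmetric]
      by (intro tangent_linear[OF S_def l(1,3) bal[rule_format] F F' y])
  qed
  have inside: "\<exists>F'. F' \<in> facets X' \<and> F' \<subseteq> F \<and> p \<in> F' \<and> F' \<in> S" if F: "F \<in> facets X" "p \<in> F" for F
  proof -
    obtain F' where F': "F' \<in> tf_cones X'" "F' \<subseteq> F" "p \<in> F'" "span F' = span F"
      using subcone[OF facets_subset[OF F(1)] F(2)] .
    then show ?thesis using subfacetI[OF F(1) F'(1,4)] unfolding S_def by blast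
  qed
  have "integral_linear_on N \<sigma> g" if \<sigma>: "\<sigma> \<in> tf_cones X" "p \<in> \<sigma>" for \<sigma>
  proof -
    obtain F where F: "F \<in> facets X" "\<sigma> \<subseteq> F" using facet_above[OF X \<sigma>(1)] .
    then have pF: "p \<in> F" using \<sigma>(2) by blast
    obtain F' where F': "F' \<in> facets X'" "F' \<subseteq> F" "p \<in> F'" "F' \<in> S" using inside[OF F(1) pF] by blast
    have "span \<sigma> \<subseteq> span F'" unfolding subfacet_span[OF F(1) F'(1,2)] using F(2) by (rule span_mono)
    then have "l F' ` (N \<inter> span \<sigma>) \<subseteq> \<int>" using l(2)[OF F'(4)] by blast
    moreover have "g y = l F' y" if "y \<in> \<sigma>" for y using g[OF F(1) pF F'(1,2,3)] F(2) that by blast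
    ultimately show ?thesis unfolding integral_linear_on_def using l(1)[OF F'(4)] by blast
  qed
  moreover have "balanced_at X g \<tau>" if \<tau>: "\<tau> \<in> walls X" "p \<in> \<tau>" for \<tau>
  proof -
    \<comment> \<open>Balancing is borrowed from one fine wall in \<open>\<tau>\<close> through
      \<open>p\<close>: each coarse facet at \<open>\<tau>\<close> contains exactly one fine facet
      at \<open>\<kappa>\<close>, and on all of the coarse one \<open>g\<close> is the form of the
      fine one.\<close>
    obtain \<kappa> where \<kappa>: "\<kappa> \<in> walls X'" "\<kappa> \<subseteq> \<tau>" "p \<in> \<kappa>" using subwall_ex[OF \<tau>] .
    let ?W = "wall_facets X \<tau>" and ?W' = "wall_facets X' \<kappa>"
    have bij: "bij_betw around ?W' ?W" by (rule around_wall[OF \<tau>(1) \<kappa>(1,2)])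
    define J where "J = inv_into ?W' around"
    have bijJ: "bij_betw J ?W ?W'" unfolding J_def by (rule bij_betw_inv_into[OF bij])
    have J: "J F \<in> ?W'" "around (J F) = F" if "F \<in> ?W" for F
      using bijJ bij_betw_inv_into_right[OF bij that] that unfolding J_def bij_betw_def by blast+
    obtain n where n: "\<And>G. G \<in> ?W' \<Longrightarrow> is_normal_vec (tf_lattice X') G \<kappa> (n G)"
      using wall_normals[OF X' \<kappa>(1)] by blast
    have WS: "G \<in> S" if "G \<in> ?W'" for G using wall_facetsD(2,3)[OF that] \<kappa>(3) unfolding S_def by blast
    have gJ: "g x = l (J F) x" if "F \<in> ?W" "x \<in> F" for F x
    proof (rule g[OF wall_facetsD(1)[OF that(1)] _ _ _ _ that(2)])
      show "p \<in> F" using wall_facetsD(3)[OF that(1)] \<tau>(2) by blast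
      show "J F \<in> facets X'" by (rule wall_facetsD(1)[OF J(1)[OF that(1)]])
      show "J F \<subseteq> F" using around(2)[OF wall_facetsD(2)[OF J(1)[OF that(1)]]] J(2)[OF that(1)] by simp
      show "p \<in> J F" using WS[OF J(1)[OF that(1)]] unfolding S_def by blast
    qed
    obtain F0 where "F0 \<in> facets X" "\<tau> \<subseteq> F0" using facet_above[OF X walls_subset[OF \<tau>(1)]] .
    then have F0: "F0 \<in> ?W" unfolding wall_facets_def by blast
    note JF0 = J(1)[OF F0]
    show ?thesis
    proof (rule balanced_at_pullback[OF X \<tau>(1) X', of f \<kappa> J 1 "\<lambda>F. n (J F)" "\<lambda>F. n (J F)" "\<lambda>_. 0" l "l (J F0)"
          "\<lambda>F. l (J F)" g "l (J F0)"])
      show "balanced_at X' f \<kappa>" using bal \<kappa>(1,3) by blast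
      show "inj_on J ?W" "J ` ?W \<subseteq> ?W'" using bijJ unfolding bij_betw_def by blast+
      show "tf_orient X' (J F) = 1 * tf_orient X F" if "F \<in> ?W" for F
        using orient_around[OF wall_facetsD(1)[OF J(1)[OF that]]] J(2)[OF that] by simp
      show "is_normal_vec N F \<tau> (n (J F))" if "F \<in> ?W" for F
        using subwall_normal[OF \<tau>(1) \<kappa>(1,2) J(1)[OF that] n[OF J(1)[OF that]]] J(2)[OF that] by simp
      show "is_normal_vec (tf_lattice X') (J F) \<kappa> (n (J F))" if "F \<in> ?W" for F by (rule n[OF J(1)[OF that]])
      show "is_normal_vec (tf_lattice X') \<rho> \<kappa> 0 \<and> l \<rho> 0 = l (J F0) 0" if "\<rho> \<in> ?W'" "\<rho> \<notin> J ` ?W" for \<rho>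
        using that bijJ unfolding bij_betw_def by blast
      show "linear (l (J F))" if "F \<in> ?W" for F by (rule l(1)[OF WS[OF J(1)[OF that]]])
      show "g x = l (J F) x" if "F \<in> ?W" "x \<in> F" for F x by (rule gJ[OF that])
      show "linear (l (J F0))" "linear (l (J F0))" by (rule l(1)[OF WS[OF JF0]])+
      show "g x = l (J F0) x" if "x \<in> \<tau>" for x using gJ[OF F0] wall_facetsD(3)[OF F0] that by blast
      show "linear (l \<rho>)" if "\<rho> \<in> ?W'" for \<rho> by (rule l(1)[OF WS[OF that]])
      show "f x = l \<rho> x" if "\<rho> \<in> ?W'" "x \<in> \<rho>" for \<rho> x by (rule l(3)[OF WS[OF that(1)] that(2)])
      show "f x = l (J F0) x" if "x \<in> \<kappa>" for x using l(3)[OF WS[OF JF0]] wall_facetsD(3)[OF JF0] that by blast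
    qed simp_all
  qed
  ultimately obtain m where m: "linear m" "\<forall>\<sigma>\<in>tf_cones X. p \<in> \<sigma> \<longrightarrow> (\<forall>x\<in>\<sigma>. g x = m x)"
    using near unfolding div_faithful_near_def by blast
  have "f x = m x" if \<kappa>: "\<kappa> \<in> tf_cones X'" "p \<in> \<kappa>" "x \<in> \<kappa>" for \<kappa> x
  proof -
    obtain F' where F': "F' \<in> facets X'" "\<kappa> \<subseteq> F'" using facet_above[OF X' \<kappa>(1)] .
    have pF': "p \<in> F'" "x \<in> F'" using F'(2) \<kappa>(2,3) by blast+
    then have F'S: "F' \<in> S" unfolding S_def using facets_subset[OF F'(1)] by blast
    note a = around[OF facets_subset[OF F'(1)]]
    have pa: "p \<in> around F'" "x \<in> around F'" using a(2) pF' by blast+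
    have "f x = l F' x" by (rule l(3)[OF F'S pF'(2)])
    also have "\<dots> = g x" using g[OF a(1) pa(1) F'(1) a(2) pF'(1) pa(2)] by simp
    also have "\<dots> = m x" using m(2) facets_subset[OF a(1)] pa by blast
    finally show ?thesis .
  qed
  then show "\<exists>m. linear m \<and> (\<forall>\<kappa>\<in>tf_cones X'. p \<in> \<kappa> \<longrightarrow> (\<forall>x\<in>\<kappa>. f x = m x))"
    using m(1) by (intro exI[of _ m] conjI ballI impI)
qed

end

lemma div_faithful_subdivision:
  fixes X X' :: "'a::real_normed_vector tfan"
  assumes "weighted_subdivision X X'"
  shows "div_faithful X' \<longleftrightarrow> div_faithful X"
proof -
  interpret weighted_subdivision X X' by (rule assms)
  show ?thesis
    unfolding div_faithful_iff_near[OF X] div_faithful_iff_near[OF X'] support_eq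
    using near_coarse near_fine by blast
qed

section \<open>Blow-ups\<close>

text \<open>Subtract the largest multiple of \<open>v\<close> that stays in the cone. The point
  reached lies on a bounding hyperplane \<open>h0 = 0\<close> with \<open>h0 v > 0\<close>, whose
  face does not contain \<open>v\<close>; such a form exists because \<open>- v\<close> is not in
  the strongly convex cone.\<close>

lemma rational_cone_shoot_ray:
  fixes x v :: "'a::real_vector"
  assumes \<eta>: "rational_cone N \<eta>" and x: "x \<in> \<eta>" and v: "v \<in> \<eta>" "v \<noteq> 0"
  obtains \<tau> w t where "cone_face \<tau> \<eta>" "v \<notin> \<tau>" "w \<in> \<tau>" "0 \<le> t" "x = w + t *\<^sub>R v"
proof -
  obtain H where H: "finite H" "\<forall>h\<in>H. linear (h :: 'a \<Rightarrow> real)"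
    and mem: "\<forall>y. y \<in> \<eta> \<longleftrightarrow> y \<in> span \<eta> \<and> (\<forall>h\<in>H. 0 \<le> h y)"
    using rational_cone_halfspaces[OF \<eta>] by (elim exE conjE)
  have pos: "0 \<le> h y" if "h \<in> H" "y \<in> \<eta>" for h y using mem that by simp
  have lin: "linear h" if "h \<in> H" for h using H(2) that by (rule bspec)
  have "\<exists>h\<in>H. 0 < h v"
  proof (rule ccontr)
    assume "\<not> (\<exists>h\<in>H. 0 < h v)"
    then have "0 \<le> h (- v)" if "h \<in> H" for h
      using that linear_neg[OF lin[OF that]] by (simp add: not_less)
    moreover have "- v \<in> span \<eta>" using v(1) by (simp add: span_base span_neg)
    ultimately have "- v \<in> \<eta>" using mem by simp
    then show False using \<eta> v unfolding rational_cone_def by blast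
  qed
  then have ne: "{h \<in> H. 0 < h v} \<noteq> {}" by blast
  define q where "q = (\<lambda>h :: 'a \<Rightarrow> real. h x / h v)"
  have fin: "finite (q ` {h \<in> H. 0 < h v})" using H(1) by simp
  \<comment> \<open>Only forms positive at \<open>v\<close> bound the multiple; the others vanish at
    \<open>v\<close> and stay constant along it.\<close>
  define t where "t = Min (q ` {h \<in> H. 0 < h v})"
  have "t \<in> q ` {h \<in> H. 0 < h v}" unfolding t_def using Min_in[OF fin] ne by blast
  then obtain h0 where h0: "h0 \<in> H" "0 < h0 v" "t = h0 x / h0 v" unfolding q_def by blast
  have t_le: "t \<le> h x / h v" if "h \<in> H" "0 < h v" for h
  proof -
    have "q h \<in> q ` {h \<in> H. 0 < h v}" using that by blast
    from Min_le[OF fin this] show ?thesis unfolding t_def q_def .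
  qed
  have t0: "0 \<le> t" unfolding h0(3) using pos[OF h0(1) x] h0(2) by simp
  define w where "w = x - t *\<^sub>R v"
  have hw: "h w = h x - t * h v" if "h \<in> H" for h
    unfolding w_def using lin[OF that] by (simp add: linear_diff linear_scale)
  have "0 \<le> h w" if h: "h \<in> H" for h
  proof (cases "0 < h v")
    case True
    then show ?thesis unfolding hw[OF h] using t_le[OF h True] by (simp add: pos_le_divide_eq)
  next
    case False
    then have "h v = 0" using pos[OF h v(1)] by simp
    then show ?thesis unfolding hw[OF h] using pos[OF h x] by simp
  qed
  moreover have "w \<in> span \<eta>" unfolding w_def using x v(1) by (intro span_diff[OF span_base span_scale[OF span_base]])
  ultimately have w\<eta>: "w \<in> \<eta>" using mem by simp
  have h0w: "h0 w = 0" unfolding hw[OF h0(1)] using h0(2,3) by simp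
  note c = rational_cone_convex[OF \<eta>]
  define \<tau> where "\<tau> = {y \<in> \<eta>. h0 y = 0}"
  note lin0 = lin[OF h0(1)]
  have "convex_cone \<tau>"
  proof (rule convex_cone_iff[THEN iffD2], intro conjI ballI allI impI)
    show "0 \<in> \<tau>" unfolding \<tau>_def using convex_cone_contains_0[OF c] linear_0[OF lin0] by simp
    show "a + b \<in> \<tau>" if "a \<in> \<tau>" "b \<in> \<tau>" for a b
      using that convex_cone_add[OF c] linear_add[OF lin0] unfolding \<tau>_def by simp
    show "r *\<^sub>R a \<in> \<tau>" if "a \<in> \<tau>" "0 \<le> r" for a r
      using that convex_cone_scaleR[OF c] linear_scale[OF lin0] unfolding \<tau>_def by simp
  qed
  then have "cone_face \<tau> \<eta>"
  proof (rule cone_faceI[OF c])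
    fix a b assume "a \<in> \<eta>" "b \<in> \<eta>" "a + b \<in> \<tau>"
    then show "a \<in> \<tau>" unfolding \<tau>_def using pos[OF h0(1), of a] pos[OF h0(1), of b] linear_add[OF lin0, of a b] by simp
  qed (simp add: \<tau>_def)
  moreover have "v \<notin> \<tau>" "w \<in> \<tau>" unfolding \<tau>_def using h0(2) w\<eta> h0w by simp_all
  moreover have "x = w + t *\<^sub>R v" unfolding w_def by simp
  ultimately show ?thesis using that t0 by blast
qed

text \<open>Shooting against \<open>v\<close> from a point of a cone containing
  \<open>\<sigma>\<close> ends in a face that misses \<open>v\<close>, hence does not contain
  \<open>\<sigma>\<close>, so the added cones cover. A facet of the blow-up lies in just one facet
  of \<open>X\<close>, which makes the weight in \<open>blow_up\<close> well defined.\<close>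

lemma blow_up_subdivision:
  fixes X :: "'a::real_normed_vector tfan"
  assumes X: "tropical_fan X" and \<sigma>: "\<sigma> \<in> tf_cones X" and \<rho>: "rational_ray_in (tf_lattice X) \<sigma> \<rho>"
    and X': "tropical_fan (blow_up X \<sigma> \<rho>)"
  shows "weighted_subdivision X (blow_up X \<sigma> \<rho>)"
proof -
  let ?X' = "blow_up X \<sigma> \<rho>"
  obtain v where v: "v \<noteq> 0" "v \<in> \<sigma>" "\<rho> = {t *\<^sub>R v | t. 0 \<le> t}"
    using \<rho> unfolding rational_ray_in_def rel_interior_def by blast
  have cones: "tf_cones ?X' = {\<eta> \<in> tf_cones X. \<not> \<sigma> \<subseteq> \<eta>} \<union>
     {{x + y | x y. x \<in> \<tau> \<and> y \<in> \<rho>} | \<tau>. \<exists>\<eta>\<in>tf_cones X. \<sigma> \<subseteq> \<eta> \<and> cone_face \<tau> \<eta> \<and> \<not> \<sigma> \<subseteq> \<tau>}"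
    unfolding blow_up_def by simp
  have join: "{x + y | x y. x \<in> \<tau> \<and> y \<in> \<rho>} \<subseteq> \<eta>" if \<eta>: "\<eta> \<in> tf_cones X" "\<sigma> \<subseteq> \<eta>" "cone_face \<tau> \<eta>" for \<tau> \<eta>
  proof
    note c = tropical_fan_convex[OF X \<eta>(1)]
    fix z assume "z \<in> {x + y | x y. x \<in> \<tau> \<and> y \<in> \<rho>}"
    then obtain x t where z: "z = x + t *\<^sub>R v" "x \<in> \<tau>" "0 \<le> t" unfolding v(3) by blast
    have "x \<in> \<eta>" "v \<in> \<eta>" using z(2) cone_face_subset[OF \<eta>(3)] v(2) \<eta>(2) by blast+
    then show "z \<in> \<eta>" unfolding z(1) using z(3) by (intro convex_cone_add[OF c] convex_cone_scaleR[OF c])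
  qed
  interpret fan_subdivision X ?X'
  proof
    show "tropical_fan X" "tropical_fan ?X'" by (fact X, fact X')
    show "tf_lattice ?X' = tf_lattice X" unfolding blow_up_def by simp
    show "\<exists>\<eta>\<in>tf_cones X. \<kappa> \<subseteq> \<eta>" if "\<kappa> \<in> tf_cones ?X'" for \<kappa>
      using that join unfolding cones by blast
    show "\<exists>\<kappa>\<in>tf_cones ?X'. x \<in> \<kappa> \<and> \<kappa> \<subseteq> \<eta>" if \<eta>: "\<eta> \<in> tf_cones X" "x \<in> \<eta>" for \<eta> x
    proof (cases "\<sigma> \<subseteq> \<eta>")
      case False
      then show ?thesis using \<eta> unfolding cones by blast
    next
      case True
      then have "v \<in> \<eta>" using v(2) by blast
      then obtain \<tau> w t where \<tau>: "cone_face \<tau> \<eta>" "v \<notin> \<tau>" "w \<in> \<tau>" "0 \<le> t" "x = w + t *\<^sub>R v"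
        using rational_cone_shoot_ray[OF tropical_fan_cone[OF X \<eta>(1)] \<eta>(2) _ v(1)] by blast
      let ?\<kappa> = "{x + y | x y. x \<in> \<tau> \<and> y \<in> \<rho>}"
      have "t *\<^sub>R v \<in> \<rho>" unfolding v(3) using \<tau>(4) by blast
      then have "x \<in> ?\<kappa>" using \<tau>(3,5) by blast
      moreover have "?\<kappa> \<in> tf_cones ?X'"
        unfolding cones using \<eta>(1) True \<tau>(1,2) v(2) by blast
      moreover have "?\<kappa> \<subseteq> \<eta>" by (rule join[OF \<eta>(1) True \<tau>(1)])
      ultimately show ?thesis by (intro bexI[where x = "?\<kappa>"] conjI)
    qed
  qed
  show ?thesis
  proof
    fix F F' assume F: "F \<in> facets X" "F' \<in> facets ?X'" "F' \<subseteq> F"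
    have "(THE \<eta>. \<eta> \<in> facets X \<and> F' \<subseteq> \<eta>) = F"
    proof (rule the_equality)
      show "F \<in> facets X \<and> F' \<subseteq> F" using F(1,3) by (rule conjI)
      show "\<eta> = F" if "\<eta> \<in> facets X \<and> F' \<subseteq> \<eta>" for \<eta>
        by (rule facet_around_unique[OF F(2) conjunct1[OF that] F(1) conjunct2[OF that] F(3)])
    qed
    then show "tf_orient ?X' F' = tf_orient X F" unfolding blow_up_def by simp
  qed
qed

section \<open>Tropical stability\<close>

text \<open>Invariance under isomorphism moves the property from the copy in the class to the fan
  itself, so membership splits into a tropical part and div-faithfulness, and every clause of
  stability concerns the given fans directly.\<close>

lemma in_class_div_faithful:
  fixes X :: "'b::real_normed_vector tfan"
  shows "X \<in>\<^sub>T {Y \<in> {Y. tropical_fan Y}. div_faithful Y} \<longleftrightarrow> X \<in>\<^sub>T {Y. tropical_fan Y} \<and> div_faithful X"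
proof -
  have "div_faithful Y \<longleftrightarrow> div_faithful X" if "tropical_fan X" "tropical_fan Y" "Y \<cong>\<^sub>T X" for Y :: "ambient tfan"
    by (rule div_faithful_tfan_iso[OF that(2,1,3)])
  then show ?thesis unfolding in_class_def by blast
qed

lemma tfan_iso_refl: "X \<cong>\<^sub>T X" for X :: "'a::real_vector tfan"
  unfolding tfan_iso_def by (intro exI[of _ "\<lambda>x. x"] conjI) (simp_all add: linear_ident bij_betw_def)

theorem theorem1p5:
  shows "T_stable_property div_faithful"
  unfolding T_stable_property_def T_stable_property_in_def T_stable_def in_class_div_faithful
proof (intro conjI ballI allI impI)
  let ?C = "{Y :: ambient tfan. tropical_fan Y}" and ?S = "{Y \<in> {Y :: ambient tfan. tropical_fan Y}. div_faithful Y}"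
  show "tfan_class ?C" unfolding tfan_class_def by blast
  show "tfan_class ?S" unfolding tfan_class_def using div_faithful_tfan_iso by blast
  show "?S \<subseteq> ?C" by blast
  show "prod_fan X Y \<in>\<^sub>T ?C" if "prod_fan X Y \<in>\<^sub>T ?C" for X Y :: "ambient tfan" by (rule that)
  show "div_faithful (prod_fan X Y)" if "X \<in> ?S" "Y \<in> ?S" "prod_fan X Y \<in>\<^sub>T ?C" for X Y
    using that div_faithful_prod unfolding in_class_def by blast
  show "trop_mod X f \<in>\<^sub>T ?C"
    if "meromorphic X f \<and> (div_trivial X f \<or> div_fan X f \<in>\<^sub>T ?C \<and> div_faithful (div_fan X f)) \<and> trop_mod X f \<in>\<^sub>T ?C"
    for X :: "ambient tfan" and f
    using that by blast
  show "div_faithful (trop_mod X f)"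
    if XS: "X \<in> ?S" and fS: "meromorphic X f \<and> (div_trivial X f \<or> div_fan X f \<in>\<^sub>T ?C \<and> div_faithful (div_fan X f)) \<and> trop_mod X f \<in>\<^sub>T ?C"
    for X f
  proof -
    interpret fan_modification X f 
    proof
      show "tropical_fan X" using XS by blast
      show "meromorphic X f" using fS by (rule conjunct1)
      show "tropical_fan (trop_mod X f)" using fS unfolding in_class_def by (elim conjE)
    qed
    show ?thesis
    proof (rule div_faithful_modification)
      show "div_faithful X" using XS by blast
      show "div_trivial X f \<or> (tropical_fan D \<and> div_faithful D)" using fS unfolding in_class_def by blast
    qed
  qed
  fix X :: "ambient tfan" and \<sigma> \<rho>
  assume X: "X \<in> ?C" and \<sigma>: "\<sigma> \<in> tf_cones X"
    and h: "rational_ray_in (tf_lattice X) \<sigma> \<rho> \<and> (star_fan X \<sigma> \<in>\<^sub>T ?C \<and> div_faithful (star_fan X \<sigma>)) \<and> blow_up X \<sigma> \<rho> \<in>\<^sub>T ?C"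
  have "tropical_fan (blow_up X \<sigma> \<rho>)" using h unfolding in_class_def by blast
  then have "div_faithful (blow_up X \<sigma> \<rho>) \<longleftrightarrow> div_faithful X"
    using div_faithful_subdivision[OF blow_up_subdivision] X \<sigma> h by blast
  moreover have "X \<in>\<^sub>T ?C" unfolding in_class_def using X tfan_iso_refl by blast
  ultimately show "X \<in>\<^sub>T ?C \<and> div_faithful X \<longleftrightarrow> blow_up X \<sigma> \<rho> \<in>\<^sub>T ?C \<and> div_faithful (blow_up X \<sigma> \<rho>)" using h by blast
qed

end
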